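(* Let $(R,\mathfrak m,k)$ be a commutative noetherian complete Cohen-Macaulay local ring with canonical module $\omega$. Let $\mathcal F=\{M_i\}_{i\in I}$ be an infinite set of pairwise non-isomorphic indecomposable maximal Cohen-Macaulay $R$-modules of bounded $\underline{\mathsf h}$-length. Then there exists an infinite subset $I'$ of $I$ such that for any $i\in I'$ there is a non-zero $R$-homomorphism $f_i:M_i\to k$ such that for any $j\in I'$ with $j\neq i$, any composition map $M_j\to M_i\xrightarrow{f_i}k$ (with $M_j\to M_i$ an arbitrary $R$-homomorphism) is zero.
   Context: A finitely generated $R$-module is maximal Cohen-Macaulay (MCM) if it is zero or every system of parameters of $R$ is regular on it. Fix a right minimal MCM-approximation $\alpha:G\to k$, i.e. $G$ is MCM, $\mathrm{Hom}_R(L,\alpha)$ is surjective for all MCM $L$, and any $g:G\to G$ with $\alpha g=\alpha$ is an isomorphism. Let $\underline{\mathrm{Hom}}_R(M,N)$ be $\mathrm{Hom}_R(M,N)$ modulo the submodule of homomorphisms factoring through projective modules. Put $\underline{\mathsf h}(M)=\underline{\mathrm{Hom}}_R(M,M\oplus G)$; the $\underline{\mathsf h}$-length of $M$ is $\ell_R(\underline{\mathsf h}(M))$. A class of MCM modules is of bounded $\underline{\mathsf h}$-length if there is an integer $b$ with $\ell_R(\underline{\mathsf h}(X))<b$ for all $X$ in the class. *)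

theory Defs
  imports "HOL-Algebra.Algebra" "HOL-Library.Extended_Nat"
begin

text \<open>
  A module is a record \<open>('a, 'b) module\<close> satisfying the locale predicate \<open>module R M\<close>. The record
  fields \<open>mult\<close> and \<open>one\<close>, inherited from \<open>ring\<close>, play no role for modules and are left
  \<open>undefined\<close> in the constructions below.

  HOL cannot quantify over modules on all carrier types at once, so the quantifiers over all
  (maximal Cohen-Macaulay, projective, injective, test) modules range over modules
  whose elements have the following type. It is large enough for these purposes:
  every quotient of a free module \<open>R\<^sup>n\<close>, i.e. every finitely generated module, has a copy there, and
  over a noetherian local ring so has every term of the minimal injective resolution of a finitely
  generated module, whose cardinality is at most \<open>max |R| \<aleph>\<^sub>0\<close>.
\<close>

type_synonym 'a elt = "(nat \<Rightarrow> 'a) set"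


subsection \<open>Modules and homomorphisms\<close>

text \<open>Homomorphisms are extensional, so that equality of functions is equality of homomorphisms.\<close>

definition mod_hom ::
    "('a, 'r) ring_scheme \<Rightarrow> ('a, 'b) module \<Rightarrow> ('a, 'c) module \<Rightarrow> ('b \<Rightarrow> 'c) set" where
  "mod_hom R M N =
     {f \<in> carrier M \<rightarrow>\<^sub>E carrier N.
        (\<forall>x\<in>carrier M. \<forall>y\<in>carrier M. f (x \<oplus>\<^bsub>M\<^esub> y) = f x \<oplus>\<^bsub>N\<^esub> f y) \<and>
        (\<forall>r\<in>carrier R. \<forall>x\<in>carrier M. f (r \<odot>\<^bsub>M\<^esub> x) = r \<odot>\<^bsub>N\<^esub> f x)}"

definition zero_hom :: "('a, 'b) module \<Rightarrow> ('a, 'c) module \<Rightarrow> 'b \<Rightarrow> 'c" where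
  "zero_hom M N = (\<lambda>x\<in>carrier M. \<zero>\<^bsub>N\<^esub>)"

definition mod_iso ::
    "('a, 'r) ring_scheme \<Rightarrow> ('a, 'b) module \<Rightarrow> ('a, 'c) module \<Rightarrow> bool" where
  "mod_iso R M N \<longleftrightarrow> (\<exists>f\<in>mod_hom R M N. bij_betw f (carrier M) (carrier N))"

definition hom_module ::
    "('a, 'r) ring_scheme \<Rightarrow> ('a, 'b) module \<Rightarrow> ('a, 'c) module \<Rightarrow> ('a, 'b \<Rightarrow> 'c) module" where
  "hom_module R M N =
     \<lparr>carrier = mod_hom R M N, monoid.mult = undefined, one = undefined,
      ring.zero = zero_hom M N,
      add = (\<lambda>f g. \<lambda>x\<in>carrier M. f x \<oplus>\<^bsub>N\<^esub> g x),
      smult = (\<lambda>r f. \<lambda>x\<in>carrier M. r \<odot>\<^bsub>N\<^esub> f x)\<rparr>"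

definition self_module :: "('a, 'r) ring_scheme \<Rightarrow> ('a, 'a) module" where
  "self_module R =
     \<lparr>carrier = carrier R, monoid.mult = monoid.mult R, one = one R, ring.zero = ring.zero R, add = add R,
      smult = monoid.mult R\<rparr>"

definition direct_sum_module ::
    "('a, 'b) module \<Rightarrow> ('a, 'c) module \<Rightarrow> ('a, 'b \<times> 'c) module" where
  "direct_sum_module M N =
     \<lparr>carrier = carrier M \<times> carrier N, monoid.mult = undefined, one = undefined,
      ring.zero = (\<zero>\<^bsub>M\<^esub>, \<zero>\<^bsub>N\<^esub>),
      add = (\<lambda>(x, y) (x', y'). (x \<oplus>\<^bsub>M\<^esub> x', y \<oplus>\<^bsub>N\<^esub> y')),
      smult = (\<lambda>r (x, y). (r \<odot>\<^bsub>M\<^esub> x, r \<odot>\<^bsub>N\<^esub> y))\<rparr>"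

text \<open>For a coset \<open>C = H +> x\<close> the set \<open>r C\<close> is in general properly contained in the coset of
  \<open>r x\<close>, whence the summand \<open>H\<close> in the scalar multiplication.\<close>

definition quot_module :: "('a, 'b) module \<Rightarrow> 'b set \<Rightarrow> ('a, 'b set) module" where
  "quot_module M H =
     \<lparr>carrier = a_rcosets\<^bsub>M\<^esub> H, monoid.mult = undefined, one = undefined,
      ring.zero = H, add = set_add M,
      smult = (\<lambda>r C. H <+>\<^bsub>M\<^esub> ((\<lambda>x. r \<odot>\<^bsub>M\<^esub> x) ` C))\<rparr>"

definition residue_module :: "('a, 'r) ring_scheme \<Rightarrow> 'a set \<Rightarrow> ('a, 'a set) module" where
  "residue_module R \<mm> = quot_module (self_module R) \<mm>"

definition mod_span :: "('a, 'r) ring_scheme \<Rightarrow> ('a, 'b) module \<Rightarrow> 'b set \<Rightarrow> 'b set" where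
  "mod_span R M S = \<Inter>{H. submodule H R M \<and> S \<subseteq> H}"

definition fin_gen_module :: "('a, 'r) ring_scheme \<Rightarrow> ('a, 'b) module \<Rightarrow> bool" where
  "fin_gen_module R M \<longleftrightarrow>
     module R M \<and> (\<exists>S. finite S \<and> S \<subseteq> carrier M \<and> mod_span R M S = carrier M)"

definition is_zero_module :: "('a, 'b) module \<Rightarrow> bool" where
  "is_zero_module M \<longleftrightarrow> carrier M = {\<zero>\<^bsub>M\<^esub>}"

definition indecomposable_module :: "('a, 'r) ring_scheme \<Rightarrow> ('a, 'b) module \<Rightarrow> bool" where
  "indecomposable_module R M \<longleftrightarrow>
     module R M \<and> \<not> is_zero_module M \<and>
     (\<forall>A B. submodule A R M \<and> submodule B R M \<and>
        A \<inter> B = {\<zero>\<^bsub>M\<^esub>} \<and> A <+>\<^bsub>M\<^esub> B = carrier M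
        \<longrightarrow> A = {\<zero>\<^bsub>M\<^esub>} \<or> B = {\<zero>\<^bsub>M\<^esub>})"

definition module_length :: "('a, 'r) ring_scheme \<Rightarrow> ('a, 'b) module \<Rightarrow> enat" where
  "module_length R M =
     Sup {enat n | n. \<exists>H. (\<forall>i\<le>n. submodule (H i) R M) \<and> (\<forall>i<n. H i \<subset> H (Suc i))}"


subsection \<open>Local rings and maximal Cohen-Macaulay modules\<close>

definition local_ring :: "('a, 'r) ring_scheme \<Rightarrow> 'a set \<Rightarrow> bool" where
  "local_ring R \<mm> \<longleftrightarrow> cring R \<and> {I. maximalideal I R} = {\<mm>}"

text \<open>The natural map from \<open>R\<close> to the inverse limit of the rings \<open>R / \<mm>\<^sup>n\<close> is bijective. The
  transition map sends a coset of \<open>\<mm>\<^sup>n\<^sup>+\<^sup>1\<close> to the coset of \<open>\<mm>\<^sup>n\<close> that contains it.\<close>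

definition adic_complete :: "('a, 'r) ring_scheme \<Rightarrow> 'a set \<Rightarrow> bool" where
  "adic_complete R \<mm> \<longleftrightarrow>
     bij_betw (\<lambda>r (n::nat). (\<mm> [^]\<^bsub>ideals_set R\<^esub> n) +>\<^bsub>R\<^esub> r) (carrier R)
       {c. \<forall>n. c n \<in> carrier (R Quot (\<mm> [^]\<^bsub>ideals_set R\<^esub> n)) \<and> c (Suc n) \<subseteq> c n}"

definition krull_dim :: "('a, 'r) ring_scheme \<Rightarrow> enat" where
  "krull_dim R =
     Sup {enat n | n. \<exists>P. (\<forall>i\<le>n. primeideal (P i) R) \<and> (\<forall>i<n. P i \<subset> P (Suc i))}"

definition system_of_parameters :: "('a, 'r) ring_scheme \<Rightarrow> 'a set \<Rightarrow> 'a list \<Rightarrow> bool" where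
  "system_of_parameters R \<mm> xs \<longleftrightarrow>
     set xs \<subseteq> \<mm> \<and> enat (length xs) = krull_dim R \<and>
     (\<forall>a\<in>\<mm>. \<exists>n::nat. a [^]\<^bsub>R\<^esub> n \<in> Idl\<^bsub>R\<^esub> (set xs))"

definition ideal_times_module ::
    "('a, 'r) ring_scheme \<Rightarrow> 'a set \<Rightarrow> ('a, 'b) module \<Rightarrow> 'b set" where
  "ideal_times_module R I M = mod_span R M {a \<odot>\<^bsub>M\<^esub> x | a x. a \<in> I \<and> x \<in> carrier M}"

definition regular_sequence ::
    "('a, 'r) ring_scheme \<Rightarrow> ('a, 'b) module \<Rightarrow> 'a list \<Rightarrow> bool" where
  "regular_sequence R M xs \<longleftrightarrow>
     set xs \<subseteq> carrier R \<and>
     (\<forall>i<length xs. \<forall>y\<in>carrier M.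
        xs ! i \<odot>\<^bsub>M\<^esub> y \<in> ideal_times_module R (Idl\<^bsub>R\<^esub> (set (take i xs))) M
        \<longrightarrow> y \<in> ideal_times_module R (Idl\<^bsub>R\<^esub> (set (take i xs))) M) \<and>
     ideal_times_module R (Idl\<^bsub>R\<^esub> (set xs)) M \<noteq> carrier M"

definition MCM :: "('a, 'r) ring_scheme \<Rightarrow> 'a set \<Rightarrow> ('a, 'b) module \<Rightarrow> bool" where
  "MCM R \<mm> M \<longleftrightarrow>
     fin_gen_module R M \<and>
     (is_zero_module M \<or> (\<forall>xs. system_of_parameters R \<mm> xs \<longrightarrow> regular_sequence R M xs))"

definition cohen_macaulay_local_ring :: "('a, 'r) ring_scheme \<Rightarrow> 'a set \<Rightarrow> bool" where
  "cohen_macaulay_local_ring R \<mm> \<longleftrightarrow>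
     local_ring R \<mm> \<and> noetherian_ring R \<and> MCM R \<mm> (self_module R)"


subsection \<open>Injective resolutions and canonical modules\<close>

definition injective_module :: "('a, 'r) ring_scheme \<Rightarrow> ('a, 'a elt) module \<Rightarrow> bool" where
  "injective_module R E \<longleftrightarrow>
     module R E \<and>
     (\<forall>(A :: ('a, 'a elt) module) (B :: ('a, 'a elt) module). module R A \<longrightarrow> module R B \<longrightarrow>
        (\<forall>g\<in>mod_hom R A B. inj_on g (carrier A) \<longrightarrow>
          (\<forall>f\<in>mod_hom R A E. \<exists>h\<in>mod_hom R B E. compose (carrier A) h g = f)))"

definition injective_resolution ::
    "('a, 'r) ring_scheme \<Rightarrow> ('a, 'b) module \<Rightarrow> (nat \<Rightarrow> ('a, 'a elt) module) \<Rightarrow>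
     (nat \<Rightarrow> 'a elt \<Rightarrow> 'a elt) \<Rightarrow> ('b \<Rightarrow> 'a elt) \<Rightarrow> bool" where
  "injective_resolution R N E d \<epsilon> \<longleftrightarrow>
     (\<forall>n. injective_module R (E n)) \<and>
     \<epsilon> \<in> mod_hom R N (E 0) \<and> (\<forall>n. d n \<in> mod_hom R (E n) (E (Suc n))) \<and>
     inj_on \<epsilon> (carrier N) \<and>
     \<epsilon> ` carrier N = {x \<in> carrier (E 0). d 0 x = \<zero>\<^bsub>E 1\<^esub>} \<and>
     (\<forall>n. d n ` carrier (E n) =
        {x \<in> carrier (E (Suc n)). d (Suc n) x = \<zero>\<^bsub>E (Suc (Suc n))\<^esub>})"

definition finite_injective_dimension ::
    "('a, 'r) ring_scheme \<Rightarrow> ('a, 'b) module \<Rightarrow> bool" where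
  "finite_injective_dimension R N \<longleftrightarrow>
     (\<exists>E d \<epsilon>. injective_resolution R N E d \<epsilon> \<and> (\<exists>n. \<forall>i>n. is_zero_module (E i)))"

text \<open>The \<open>n\<close>-th cohomology of the complex of the modules \<open>Hom(K, E i)\<close>, i.e. \<open>Ext\<^sup>n(K, N)\<close> if
  \<open>(E, d)\<close> is an injective resolution of \<open>N\<close>.\<close>

definition ext_module ::
    "('a, 'r) ring_scheme \<Rightarrow> ('a, 'c) module \<Rightarrow> (nat \<Rightarrow> ('a, 'a elt) module) \<Rightarrow>
     (nat \<Rightarrow> 'a elt \<Rightarrow> 'a elt) \<Rightarrow> nat \<Rightarrow> ('a, ('c \<Rightarrow> 'a elt) set) module" where
  "ext_module R K E d n =
     quot_module
       ((hom_module R K (E n))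
          \<lparr>carrier := {f \<in> mod_hom R K (E n).
             compose (carrier K) (d n) f = zero_hom K (E (Suc n))}\<rparr>)
       (case n of
          0 \<Rightarrow> {zero_hom K (E 0)}
        | Suc j \<Rightarrow> (\<lambda>f. compose (carrier K) (d j) f) ` mod_hom R K (E j))"

text \<open>A canonical module is a maximal Cohen-Macaulay module of finite injective dimension and of
  type one, where the type is the \<open>k\<close>-dimension of \<open>Ext\<^sup>t(k, N)\<close> for \<open>t = depth N = dim R\<close>.\<close>

definition type_one :: "('a, 'r) ring_scheme \<Rightarrow> 'a set \<Rightarrow> ('a, 'b) module \<Rightarrow> bool" where
  "type_one R \<mm> N \<longleftrightarrow>
     (\<exists>t E d \<epsilon>. krull_dim R = enat t \<and> injective_resolution R N E d \<epsilon> \<and>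
        mod_iso R (ext_module R (residue_module R \<mm>) E d t) (residue_module R \<mm>))"

definition canonical_module :: "('a, 'r) ring_scheme \<Rightarrow> 'a set \<Rightarrow> ('a, 'b) module \<Rightarrow> bool" where
  "canonical_module R \<mm> \<omega> \<longleftrightarrow>
     MCM R \<mm> \<omega> \<and> type_one R \<mm> \<omega> \<and> finite_injective_dimension R \<omega>"


subsection \<open>Stable homomorphisms and approximations\<close>

definition projective_module :: "('a, 'r) ring_scheme \<Rightarrow> ('a, 'a elt) module \<Rightarrow> bool" where
  "projective_module R P \<longleftrightarrow>
     module R P \<and>
     (\<forall>(A :: ('a, 'a elt) module) (B :: ('a, 'a elt) module). module R A \<longrightarrow> module R B \<longrightarrow>
        (\<forall>g\<in>mod_hom R A B. g ` carrier A = carrier B \<longrightarrow>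
          (\<forall>f\<in>mod_hom R P B. \<exists>h\<in>mod_hom R P A. compose (carrier P) g h = f)))"

definition projective_homs ::
    "('a, 'r) ring_scheme \<Rightarrow> ('a, 'b) module \<Rightarrow> ('a, 'c) module \<Rightarrow> ('b \<Rightarrow> 'c) set" where
  "projective_homs R M N =
     {f \<in> mod_hom R M N.
        \<exists>P. projective_module R P \<and>
          (\<exists>g\<in>mod_hom R M P. \<exists>h\<in>mod_hom R P N. f = compose (carrier M) h g)}"

definition stable_hom ::
    "('a, 'r) ring_scheme \<Rightarrow> ('a, 'b) module \<Rightarrow> ('a, 'c) module \<Rightarrow> ('a, ('b \<Rightarrow> 'c) set) module"
  where
  "stable_hom R M N = quot_module (hom_module R M N) (projective_homs R M N)"

definition right_minimal_MCM_approximation ::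
    "('a, 'r) ring_scheme \<Rightarrow> 'a set \<Rightarrow> ('a, 'g) module \<Rightarrow> ('a, 'b) module \<Rightarrow> ('g \<Rightarrow> 'b) \<Rightarrow> bool"
  where
  "right_minimal_MCM_approximation R \<mm> G N \<alpha> \<longleftrightarrow>
     MCM R \<mm> G \<and> \<alpha> \<in> mod_hom R G N \<and>
     (\<forall>L :: ('a, 'a elt) module. MCM R \<mm> L \<longrightarrow>
        (\<forall>\<beta>\<in>mod_hom R L N. \<exists>\<gamma>\<in>mod_hom R L G. compose (carrier L) \<alpha> \<gamma> = \<beta>)) \<and>
     (\<forall>g\<in>mod_hom R G G. compose (carrier G) \<alpha> g = \<alpha> \<longrightarrow> bij_betw g (carrier G) (carrier G))"

definition h_length ::
    "('a, 'r) ring_scheme \<Rightarrow> ('a, 'g) module \<Rightarrow> ('a, 'b) module \<Rightarrow> enat" where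
  "h_length R G M = module_length R (stable_hom R M (direct_sum_module M G))"

end

theory Submission
  imports Defs
begin

text \<open>
  Discard the at most one \<open>M\<^sub>i\<close> isomorphic to \<open>R\<close>. As \<open>Hom(M\<^sub>i, G) \<rightarrow> Hom(M\<^sub>i, k)\<close> is onto and kills
  everything that factors through projectives, a bound on the \<open>h\<close>-lengths bounds the numbers of
  generators of the \<open>M\<^sub>i\<close>; it also yields \<open>b\<close> with \<open>\<mm>\<^sup>b\<close> killing all stable endomorphism modules.

  Choose a system of parameters \<open>x\<close> inside \<open>\<mm>\<^sup>b\<close>. Multiplication by a member of \<open>x\<close> on \<open>M\<^sub>i\<close> factors
  through a free module, and \<open>x\<^sup>2\<close> is regular on \<open>M\<^sub>j\<close>, whence every homomorphism
  \<open>M\<^sub>i / x\<^sup>2 M\<^sub>i \<rightarrow> M\<^sub>j / x\<^sup>2 M\<^sub>j\<close> lifts modulo \<open>x\<close> to \<open>M\<^sub>i \<rightarrow> M\<^sub>j\<close>. Since idempotents lift over the complete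
  ring \<open>R\<close>, the \<open>M\<^sub>i / x\<^sup>2 M\<^sub>i\<close> are indecomposable, and a homomorphism that is bijective modulo \<open>x\<^sup>2\<close> is an
  isomorphism. Their lengths are bounded by some \<open>B\<close>, so the argument of Harada and Sai shows that a composite
  of \<open>2\<^sup>B - 1\<close> non-isomorphisms has image in \<open>\<mm> M\<^sub>i\<close>.

  Now remove from the index set \<open>J\<close> all \<open>i\<close> that admit a functional \<open>f\<^sub>i\<close> relative to \<open>J\<close>, and repeat. An
  index that survives \<open>n\<close> rounds is the target of a composite of \<open>n\<close> non-isomorphisms with non-zero
  image in \<open>k\<close>. So nothing survives \<open>2\<^sup>B - 1\<close> rounds, and one of the removed sets is infinite.
\<close>

subsection \<open>Homomorphisms\<close>

text \<open>Harada and Sai need modules of bounded finite length, which the M_i themselves need not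
  be; hence the passage to M_i / x^2 M_i. Lifting back works because multiplication by x on M
  factors through some R^n, and a map from R^n to N / x^2 N lifts to N generator by generator. The
  lift represents x times the given map; dividing it by x costs one factor x, which is why the
  reduction uses squares. The outcome is controlled only modulo \<mm> N, but idempotents over a
  complete ring and surjectivity (Nakayama's lemma) see no more than residues modulo \<mm>.

  The modules isomorphic to R go because they have functionals with unit values: for them, maps that
  factor through projectives need not die in k.

  The bound B comes from the layers \<mm>^i M / \<mm>^(i+1) M below an exponent n with \<mm>^n
  inside the ideal generated by the squares: generators of \<mm>^i times generators of M.

  Quotients appear mostly as congruences of representatives, and lengths as the existence or absence
  of strict chains, so that no composition series are compared. Projectivity and approximations are
  tested on modules of one fixed element type only; finitely generated modules are copied
  there.\<close>

lemma mod_hom_closed: "f \<in> mod_hom R M N \<Longrightarrow> x \<in> carrier M \<Longrightarrow> f x \<in> carrier N"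
  by (auto simp: mod_hom_def)

lemma mod_hom_add:
  "f \<in> mod_hom R M N \<Longrightarrow> x \<in> carrier M \<Longrightarrow> y \<in> carrier M \<Longrightarrow> f (x \<oplus>\<^bsub>M\<^esub> y) = f x \<oplus>\<^bsub>N\<^esub> f y"
  by (auto simp: mod_hom_def)

lemma mod_hom_smult:
  "f \<in> mod_hom R M N \<Longrightarrow> r \<in> carrier R \<Longrightarrow> x \<in> carrier M \<Longrightarrow> f (r \<odot>\<^bsub>M\<^esub> x) = r \<odot>\<^bsub>N\<^esub> f x"
  by (auto simp: mod_hom_def)

lemma mod_homI:
  assumes "f \<in> extensional (carrier M)" "\<And>x. x \<in> carrier M \<Longrightarrow> f x \<in> carrier N"
    "\<And>x y. x \<in> carrier M \<Longrightarrow> y \<in> carrier M \<Longrightarrow> f (x \<oplus>\<^bsub>M\<^esub> y) = f x \<oplus>\<^bsub>N\<^esub> f y"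
    "\<And>r x. r \<in> carrier R \<Longrightarrow> x \<in> carrier M \<Longrightarrow> f (r \<odot>\<^bsub>M\<^esub> x) = r \<odot>\<^bsub>N\<^esub> f x"
  shows "f \<in> mod_hom R M N"
  using assms by (auto simp: mod_hom_def PiE_def)

lemma mod_hom_restrictI:
  assumes "module R M" "\<And>x. x \<in> carrier M \<Longrightarrow> f x \<in> carrier N"
    "\<And>x y. x \<in> carrier M \<Longrightarrow> y \<in> carrier M \<Longrightarrow> f (x \<oplus>\<^bsub>M\<^esub> y) = f x \<oplus>\<^bsub>N\<^esub> f y"
    "\<And>r x. r \<in> carrier R \<Longrightarrow> x \<in> carrier M \<Longrightarrow> f (r \<odot>\<^bsub>M\<^esub> x) = r \<odot>\<^bsub>N\<^esub> f x"
  shows "restrict f (carrier M) \<in> mod_hom R M N"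
proof -
  interpret module R M by fact
  show ?thesis using assms by (auto intro!: mod_homI)
qed

lemma mod_hom_eqI:
  "f \<in> mod_hom R M N \<Longrightarrow> g \<in> mod_hom R M N \<Longrightarrow> (\<And>x. x \<in> carrier M \<Longrightarrow> f x = g x) \<Longrightarrow> f = g"
  unfolding mod_hom_def by (auto intro: PiE_ext)

lemma mod_hom_compose:
  assumes "module R M" "f \<in> mod_hom R M N" "g \<in> mod_hom R N K"
  shows "compose (carrier M) g f \<in> mod_hom R M K"
  unfolding compose_def
  by (rule mod_hom_restrictI) (use assms in \<open>auto simp: mod_hom_closed mod_hom_add mod_hom_smult\<close>)

lemma mod_hom_zero:
  assumes "module R M" "module R N" "f \<in> mod_hom R M N"
  shows "f \<zero>\<^bsub>M\<^esub> = \<zero>\<^bsub>N\<^esub>"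
proof -
  interpret M: module R M by fact
  interpret N: module R N by fact
  have "f (\<zero>\<^bsub>R\<^esub> \<odot>\<^bsub>M\<^esub> \<zero>\<^bsub>M\<^esub>) = \<zero>\<^bsub>R\<^esub> \<odot>\<^bsub>N\<^esub> f \<zero>\<^bsub>M\<^esub>"
    by (rule mod_hom_smult[OF assms(3)]) auto
  then show ?thesis using mod_hom_closed[OF assms(3)] by simp
qed

lemma mod_hom_a_inv:
  assumes "module R M" "module R N" "f \<in> mod_hom R M N" "x \<in> carrier M"
  shows "f (\<ominus>\<^bsub>M\<^esub> x) = \<ominus>\<^bsub>N\<^esub> f x"
proof -
  interpret M: module R M by fact
  interpret N: module R N by fact
  have "f (\<ominus>\<^bsub>M\<^esub> x) \<oplus>\<^bsub>N\<^esub> f x = \<zero>\<^bsub>N\<^esub>"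
    using assms mod_hom_add[OF assms(3), of "\<ominus>\<^bsub>M\<^esub> x" x] mod_hom_zero[OF assms(1-3)]
    by (simp add: M.M.l_neg)
  then show ?thesis
    using mod_hom_closed[OF assms(3)] assms by (simp add: N.M.minus_equality)
qed

lemma mod_hom_minus:
  assumes "module R M" "module R N" "f \<in> mod_hom R M N" "x \<in> carrier M" "y \<in> carrier M"
  shows "f (x \<ominus>\<^bsub>M\<^esub> y) = f x \<ominus>\<^bsub>N\<^esub> f y"
proof -
  interpret M: module R M by fact
  interpret N: module R N by fact
  show ?thesis
    using assms by (simp add: a_minus_def mod_hom_add mod_hom_a_inv)
qed

lemma mod_hom_zero_hom:
  assumes "module R M" "module R N"
  shows "zero_hom M N \<in> mod_hom R M N"
proof -
  interpret M: module R M by fact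
  interpret N: module R N by fact
  show ?thesis unfolding zero_hom_def by (rule mod_hom_restrictI) (use assms in auto)
qed

lemma mod_hom_id: "module R M \<Longrightarrow> restrict (\<lambda>x. x) (carrier M) \<in> mod_hom R M M"
  by (rule mod_hom_restrictI) auto

lemma mod_hom_lin:
  assumes "module R M" "module R N" "f \<in> mod_hom R M N" "g \<in> mod_hom R M N"
  shows "(\<lambda>x\<in>carrier M. f x \<oplus>\<^bsub>N\<^esub> g x) \<in> mod_hom R M N"
proof -
  interpret M: module R M by fact
  interpret N: module R N by fact
  note c = mod_hom_closed[OF assms(3)] mod_hom_closed[OF assms(4)]
  show ?thesis
    by (rule mod_hom_restrictI)
      (use assms c in \<open>auto simp: mod_hom_add mod_hom_smult N.smult_r_distr N.M.a_ac\<close>)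
qed

lemma mod_hom_scale:
  assumes "module R M" "module R N" "f \<in> mod_hom R M N" "r \<in> carrier R"
  shows "(\<lambda>x\<in>carrier M. r \<odot>\<^bsub>N\<^esub> f x) \<in> mod_hom R M N"
proof -
  interpret M: module R M by fact
  interpret N: module R N by fact
  note c = mod_hom_closed[OF assms(3)]
  show ?thesis
    by (rule mod_hom_restrictI)
      (use assms c in \<open>auto simp: mod_hom_add mod_hom_smult N.smult_r_distr N.smult_assoc1[symmetric] M.R.m_comm\<close>)
qed

lemma iso_inverse:
  assumes "module R M" "module R N" "f \<in> mod_hom R M N" "bij_betw f (carrier M) (carrier N)"
  shows "\<exists>g\<in>mod_hom R N M. (\<forall>x\<in>carrier M. g (f x) = x) \<and> (\<forall>y\<in>carrier N. f (g y) = y)"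
proof -
  interpret M: module R M by fact
  interpret N: module R N by fact
  let ?g = "inv_into (carrier M) f"
  have gc: "?g y \<in> carrier M" if "y \<in> carrier N" for y
    using assms(4) that by (metis bij_betw_def inv_into_into)
  have fg: "f (?g y) = y" if "y \<in> carrier N" for y
    using assms(4) that by (auto simp: bij_betw_def f_inv_into_f)
  have gf: "?g (f x) = x" if "x \<in> carrier M" for x
    using assms(4) that by (auto simp: bij_betw_def)
  have "restrict ?g (carrier N) \<in> mod_hom R N M"
  proof (rule mod_hom_restrictI[OF assms(2)])
    fix x y assume xy: "x \<in> carrier N" "y \<in> carrier N"
    have "f (?g x \<oplus>\<^bsub>M\<^esub> ?g y) = x \<oplus>\<^bsub>N\<^esub> y" using xy by (simp add: mod_hom_add[OF assms(3)] gc fg)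
    then show "?g (x \<oplus>\<^bsub>N\<^esub> y) = ?g x \<oplus>\<^bsub>M\<^esub> ?g y" by (metis gc gf M.add.m_closed xy)
  next
    fix r x assume xy: "r \<in> carrier R" "x \<in> carrier N"
    have "f (r \<odot>\<^bsub>M\<^esub> ?g x) = r \<odot>\<^bsub>N\<^esub> x" using xy by (simp add: mod_hom_smult[OF assms(3)] gc fg)
    then show "?g (r \<odot>\<^bsub>N\<^esub> x) = r \<odot>\<^bsub>M\<^esub> ?g x" by (metis gc gf M.smult_closed xy)
  qed (simp add: gc)
  then show ?thesis using gf fg mod_hom_closed[OF assms(3)]
    by (intro bexI[of _ "restrict ?g (carrier N)"]) auto
qed

lemma mod_iso_sym:
  assumes "module R M" "module R N" "mod_iso R M N"
  shows "mod_iso R N M"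
proof -
  obtain f where f: "f \<in> mod_hom R M N" "bij_betw f (carrier M) (carrier N)"
    using assms(3) by (auto simp: mod_iso_def)
  obtain g where g: "g \<in> mod_hom R N M" "\<forall>x\<in>carrier M. g (f x) = x" "\<forall>y\<in>carrier N. f (g y) = y"
    using iso_inverse[OF assms(1,2) f] by (elim bexE conjE)
  have "bij_betw g (carrier N) (carrier M)"
    by (rule bij_betw_byWitness[where f' = f]) (use f g mod_hom_closed in auto)
  then show ?thesis using g(1) unfolding mod_iso_def by blast
qed

lemma mod_iso_trans:
  assumes "module R M" "mod_iso R M N" "mod_iso R N K"
  shows "mod_iso R M K"
proof -
  obtain f g where f: "f \<in> mod_hom R M N" "bij_betw f (carrier M) (carrier N)"
    and g: "g \<in> mod_hom R N K" "bij_betw g (carrier N) (carrier K)"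
    using assms(2,3) by (auto simp: mod_iso_def)
  have "bij_betw (compose (carrier M) g f) (carrier M) (carrier K)"
    by (rule bij_betw_compose[OF f(2) g(2)])
  then show ?thesis using mod_hom_compose[OF assms(1) f(1) g(1)] by (auto simp: mod_iso_def)
qed

subsection \<open>Submodules and congruences\<close>

text \<open>Quotients are mostly handled through congruent representatives instead of cosets.
  Membership in the carrier is part of the relation, so that for a submodule \<open>H\<close> it is
  an equivalence relation exactly on \<open>carrier M\<close>.\<close>

definition mod_cong :: "('a, 'b) module \<Rightarrow> 'b set \<Rightarrow> 'b \<Rightarrow> 'b \<Rightarrow> bool" where
  "mod_cong M H x y \<longleftrightarrow> x \<in> carrier M \<and> y \<in> carrier M \<and> x \<ominus>\<^bsub>M\<^esub> y \<in> H"

text \<open>\<open>ideal_times_module\<close> covers only D = M, whereas Nakayama's lemma, Krull's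
  intersection theorem and completeness involve products with smaller \<open>D\<close>.\<close>

definition ideal_times :: "('a, 'r) ring_scheme \<Rightarrow> 'a set \<Rightarrow> ('a, 'b) module \<Rightarrow> 'b set \<Rightarrow> 'b set" where
  "ideal_times R J M D = mod_span R M {a \<odot>\<^bsub>M\<^esub> x | a x. a \<in> J \<and> x \<in> D}"

lemma ideal_times_module_eq: "ideal_times_module R J M = ideal_times R J M (carrier M)"
  by (simp add: ideal_times_module_def ideal_times_def)

locale rmodule = module R M for R :: "('a, 'r) ring_scheme" (structure) and M :: "('a, 'b) module"
begin

lemma neg_zero [simp]: "\<ominus>\<^bsub>M\<^esub> \<zero>\<^bsub>M\<^esub> = \<zero>\<^bsub>M\<^esub>"
  by (rule M.minus_equality) auto

lemma sub_carrier: "submodule H R M \<Longrightarrow> x \<in> H \<Longrightarrow> x \<in> carrier M"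
  using submoduleE(1) by blast

lemma sub_zero: "submodule H R M \<Longrightarrow> \<zero>\<^bsub>M\<^esub> \<in> H"
  using submodule.axioms(1) subgroup.one_closed by fastforce

lemma sub_add: "submodule H R M \<Longrightarrow> x \<in> H \<Longrightarrow> y \<in> H \<Longrightarrow> x \<oplus>\<^bsub>M\<^esub> y \<in> H"
  using submoduleE(5) by blast

lemma sub_neg: "submodule H R M \<Longrightarrow> x \<in> H \<Longrightarrow> \<ominus>\<^bsub>M\<^esub> x \<in> H"
  using submoduleE(3) by blast

lemma sub_minus: "submodule H R M \<Longrightarrow> x \<in> H \<Longrightarrow> y \<in> H \<Longrightarrow> x \<ominus>\<^bsub>M\<^esub> y \<in> H"
  by (simp add: a_minus_def sub_add sub_neg)

lemma sub_smult: "submodule H R M \<Longrightarrow> r \<in> carrier R \<Longrightarrow> x \<in> H \<Longrightarrow> r \<odot>\<^bsub>M\<^esub> x \<in> H"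
  using submoduleE(4) by blast

lemma subI:
  assumes "H \<subseteq> carrier M" "\<zero>\<^bsub>M\<^esub> \<in> H" "\<And>x y. x \<in> H \<Longrightarrow> y \<in> H \<Longrightarrow> x \<oplus>\<^bsub>M\<^esub> y \<in> H"
    "\<And>r x. r \<in> carrier R \<Longrightarrow> x \<in> H \<Longrightarrow> r \<odot>\<^bsub>M\<^esub> x \<in> H"
  shows "submodule H R M"
proof (rule submoduleI)
  fix x assume x: "x \<in> H"
  then have "x \<in> carrier M" using assms(1) by auto
  then have "\<ominus>\<^bsub>M\<^esub> x = (\<ominus> \<one>) \<odot>\<^bsub>M\<^esub> x" by (simp add: smult_l_minus)
  then show "\<ominus>\<^bsub>M\<^esub> x \<in> H" using assms(4)[OF _ x, of "\<ominus> \<one>"] by simp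
qed (use assms in auto)

lemma sub_zero_module: "submodule {\<zero>\<^bsub>M\<^esub>} R M"
  by (rule subI) auto

lemma sub_Int: "submodule A R M \<Longrightarrow> submodule B R M \<Longrightarrow> submodule (A \<inter> B) R M"
  by (rule subI) (auto intro: sub_carrier sub_zero sub_add sub_smult)

lemma sub_INT: "(\<And>i. i \<in> I \<Longrightarrow> submodule (A i) R M) \<Longrightarrow> I \<noteq> {} \<Longrightarrow> submodule (\<Inter>i\<in>I. A i) R M"
  by (rule subI) (auto intro: sub_carrier sub_zero sub_add sub_smult)

lemma set_add_mem: "x \<in> A <+>\<^bsub>M\<^esub> B \<longleftrightarrow> (\<exists>a\<in>A. \<exists>b\<in>B. x = a \<oplus>\<^bsub>M\<^esub> b)"
  by (auto simp: set_add_def')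

lemma set_addI: "a \<in> A \<Longrightarrow> b \<in> B \<Longrightarrow> a \<oplus>\<^bsub>M\<^esub> b \<in> A <+>\<^bsub>M\<^esub> B"
  by (auto simp: set_add_mem)

lemma sub_set_add:
  assumes "submodule A R M" "submodule B R M"
  shows "submodule (A <+>\<^bsub>M\<^esub> B) R M"
proof (rule subI)
  show "A <+>\<^bsub>M\<^esub> B \<subseteq> carrier M"
    using assms sub_carrier by (auto simp: set_add_mem)
  show "\<zero>\<^bsub>M\<^esub> \<in> A <+>\<^bsub>M\<^esub> B" using set_addI[OF assms[THEN sub_zero]] by simp
next
  fix x y assume "x \<in> A <+>\<^bsub>M\<^esub> B" "y \<in> A <+>\<^bsub>M\<^esub> B"
  then obtain a b c d where *: "a \<in> A" "b \<in> B" "x = a \<oplus>\<^bsub>M\<^esub> b" "c \<in> A" "d \<in> B" "y = c \<oplus>\<^bsub>M\<^esub> d"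
    by (auto simp: set_add_mem)
  then have "x \<oplus>\<^bsub>M\<^esub> y = (a \<oplus>\<^bsub>M\<^esub> c) \<oplus>\<^bsub>M\<^esub> (b \<oplus>\<^bsub>M\<^esub> d)"
    using assms[THEN sub_carrier] by (simp add: M.a_ac)
  then show "x \<oplus>\<^bsub>M\<^esub> y \<in> A <+>\<^bsub>M\<^esub> B" using * assms by (auto intro: set_addI sub_add)
next
  fix r x assume "r \<in> carrier R" "x \<in> A <+>\<^bsub>M\<^esub> B"
  then show "r \<odot>\<^bsub>M\<^esub> x \<in> A <+>\<^bsub>M\<^esub> B"
    using assms[THEN sub_carrier] assms[THEN sub_smult]
    by (auto simp: set_add_mem smult_r_distr) blast
qed

lemma set_add_upper:
  assumes "submodule A R M" "submodule B R M"
  shows "A \<subseteq> A <+>\<^bsub>M\<^esub> B" "B \<subseteq> A <+>\<^bsub>M\<^esub> B"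
proof -
  show "A \<subseteq> A <+>\<^bsub>M\<^esub> B"
    using assms set_addI[OF _ sub_zero[OF assms(2)], of _ A] sub_carrier[OF assms(1)] by fastforce
  show "B \<subseteq> A <+>\<^bsub>M\<^esub> B"
    using assms set_addI[OF sub_zero[OF assms(1)], of _ B] sub_carrier[OF assms(2)] by fastforce
qed

lemma set_add_least:
  assumes "submodule H R M" "A \<subseteq> H" "B \<subseteq> H"
  shows "A <+>\<^bsub>M\<^esub> B \<subseteq> H"
  using assms(2,3) sub_add[OF assms(1)] unfolding set_add_mem subset_iff by metis

lemma span_mem: "x \<in> S \<Longrightarrow> x \<in> mod_span R M S"
  by (auto simp: mod_span_def)

lemma span_least: "submodule H R M \<Longrightarrow> S \<subseteq> H \<Longrightarrow> mod_span R M S \<subseteq> H"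
  by (auto simp: mod_span_def)

lemma span_sub: "S \<subseteq> carrier M \<Longrightarrow> submodule (mod_span R M S) R M"
proof -
  assume "S \<subseteq> carrier M"
  then have "submodule (\<Inter>H\<in>{H. submodule H R M \<and> S \<subseteq> H}. H) R M"
    using carrier_is_submodule by (intro sub_INT) auto
  then show ?thesis by (simp add: mod_span_def)
qed

lemma span_mono: "S \<subseteq> T \<Longrightarrow> mod_span R M S \<subseteq> mod_span R M T"
  by (auto simp: mod_span_def)

lemma span_empty: "mod_span R M {} = {\<zero>\<^bsub>M\<^esub>}"
  using span_least[OF sub_zero_module, of "{}"] sub_zero[OF span_sub, of "{}"] by auto

lemma cyclic_sub: "g \<in> carrier M \<Longrightarrow> submodule {r \<odot>\<^bsub>M\<^esub> g | r. r \<in> carrier R} R M"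
proof (rule subI)
  assume g: "g \<in> carrier M"
  show "\<zero>\<^bsub>M\<^esub> \<in> {r \<odot>\<^bsub>M\<^esub> g | r. r \<in> carrier R}"
    using smult_l_null[OF g] R.zero_closed by (metis (mono_tags, lifting) mem_Collect_eq)
  fix x y assume "x \<in> {r \<odot>\<^bsub>M\<^esub> g | r. r \<in> carrier R}" "y \<in> {r \<odot>\<^bsub>M\<^esub> g | r. r \<in> carrier R}"
  then show "x \<oplus>\<^bsub>M\<^esub> y \<in> {r \<odot>\<^bsub>M\<^esub> g | r. r \<in> carrier R}"
    using g by (auto simp: smult_l_distr[symmetric])
next
  assume g: "g \<in> carrier M"
  fix s x assume "s \<in> carrier R" "x \<in> {r \<odot>\<^bsub>M\<^esub> g | r. r \<in> carrier R}"
  then show "s \<odot>\<^bsub>M\<^esub> x \<in> {r \<odot>\<^bsub>M\<^esub> g | r. r \<in> carrier R}"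
    using g by (auto simp: smult_assoc1[symmetric])
qed auto

lemma adjoin_mem:
  "x \<in> H <+>\<^bsub>M\<^esub> {r \<odot>\<^bsub>M\<^esub> g | r. r \<in> carrier R} \<longleftrightarrow> (\<exists>h\<in>H. \<exists>r\<in>carrier R. x = h \<oplus>\<^bsub>M\<^esub> r \<odot>\<^bsub>M\<^esub> g)"
  unfolding set_add_mem by blast

lemma adjoin:
  assumes "submodule H R M" "g \<in> carrier M"
  shows "submodule (H <+>\<^bsub>M\<^esub> {r \<odot>\<^bsub>M\<^esub> g | r. r \<in> carrier R}) R M"
    and "H \<subseteq> H <+>\<^bsub>M\<^esub> {r \<odot>\<^bsub>M\<^esub> g | r. r \<in> carrier R}"
    and "g \<in> H <+>\<^bsub>M\<^esub> {r \<odot>\<^bsub>M\<^esub> g | r. r \<in> carrier R}"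
proof -
  note c = cyclic_sub[OF assms(2)]
  show "submodule (H <+>\<^bsub>M\<^esub> {r \<odot>\<^bsub>M\<^esub> g | r. r \<in> carrier R}) R M"
    "H \<subseteq> H <+>\<^bsub>M\<^esub> {r \<odot>\<^bsub>M\<^esub> g | r. r \<in> carrier R}"
    using sub_set_add[OF assms(1) c] set_add_upper[OF assms(1) c] by auto
  have "\<one> \<odot>\<^bsub>M\<^esub> g \<in> {r \<odot>\<^bsub>M\<^esub> g | r. r \<in> carrier R}" by blast
  then show "g \<in> H <+>\<^bsub>M\<^esub> {r \<odot>\<^bsub>M\<^esub> g | r. r \<in> carrier R}"
    using set_add_upper(2)[OF assms(1) c] assms(2) by auto
qed

lemma span_insert:
  assumes "S \<subseteq> carrier M" "g \<in> carrier M"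
  shows "mod_span R M (insert g S) = mod_span R M S <+>\<^bsub>M\<^esub> {r \<odot>\<^bsub>M\<^esub> g | r. r \<in> carrier R}"
proof
  note a = adjoin[OF span_sub[OF assms(1)] assms(2)]
  show "mod_span R M (insert g S) \<subseteq> mod_span R M S <+>\<^bsub>M\<^esub> {r \<odot>\<^bsub>M\<^esub> g | r. r \<in> carrier R}"
    by (rule span_least[OF a(1)]) (use a span_mem in blast)
  show "mod_span R M S <+>\<^bsub>M\<^esub> {r \<odot>\<^bsub>M\<^esub> g | r. r \<in> carrier R} \<subseteq> mod_span R M (insert g S)"
  proof (rule set_add_least[OF span_sub])
    show "mod_span R M S \<subseteq> mod_span R M (insert g S)" by (rule span_mono) auto
    show "{r \<odot>\<^bsub>M\<^esub> g |r. r \<in> carrier R} \<subseteq> mod_span R M (insert g S)"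
      using sub_smult[OF span_sub, of "insert g S"] span_mem[of g "insert g S"] assms by auto
  qed (use assms in auto)
qed

lemma times_sub: "J \<subseteq> carrier R \<Longrightarrow> D \<subseteq> carrier M \<Longrightarrow> submodule (ideal_times R J M D) R M"
  unfolding ideal_times_def by (rule span_sub) auto

lemma times_mem: "a \<in> J \<Longrightarrow> x \<in> D \<Longrightarrow> a \<odot>\<^bsub>M\<^esub> x \<in> ideal_times R J M D"
  unfolding ideal_times_def by (rule span_mem) auto

lemma times_least:
  "submodule H R M \<Longrightarrow> (\<And>a x. a \<in> J \<Longrightarrow> x \<in> D \<Longrightarrow> a \<odot>\<^bsub>M\<^esub> x \<in> H) \<Longrightarrow> ideal_times R J M D \<subseteq> H"
  unfolding ideal_times_def by (rule span_least) auto

lemma times_mono: "J \<subseteq> J' \<Longrightarrow> D \<subseteq> D' \<Longrightarrow> ideal_times R J M D \<subseteq> ideal_times R J' M D'"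
  unfolding ideal_times_def by (rule span_mono) auto

lemma times_subset: "J \<subseteq> carrier R \<Longrightarrow> submodule D R M \<Longrightarrow> ideal_times R J M D \<subseteq> D"
  by (rule times_least) (auto intro: sub_smult)

lemma cong_refl: "submodule H R M \<Longrightarrow> x \<in> carrier M \<Longrightarrow> mod_cong M H x x"
  by (simp add: mod_cong_def sub_zero a_minus_def M.r_neg)

lemma cong_sym: "submodule H R M \<Longrightarrow> mod_cong M H x y \<Longrightarrow> mod_cong M H y x"
  using sub_neg[of H "x \<ominus>\<^bsub>M\<^esub> y"]
  by (auto simp: mod_cong_def a_minus_def M.minus_add M.a_comm)

lemma cong_trans:
  assumes "submodule H R M" "mod_cong M H x y" "mod_cong M H y z"
  shows "mod_cong M H x z"
proof -
  have c: "x \<in> carrier M" "y \<in> carrier M" "z \<in> carrier M" using assms by (auto simp: mod_cong_def)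
  have "x \<ominus>\<^bsub>M\<^esub> z = (x \<ominus>\<^bsub>M\<^esub> y) \<oplus>\<^bsub>M\<^esub> (y \<ominus>\<^bsub>M\<^esub> z)"
    using c by (simp add: a_minus_def M.a_assoc M.r_neg1)
  then show ?thesis using assms sub_add by (auto simp: mod_cong_def)
qed

lemma cong_add:
  assumes "submodule H R M" "mod_cong M H x y" "mod_cong M H x' y'"
  shows "mod_cong M H (x \<oplus>\<^bsub>M\<^esub> x') (y \<oplus>\<^bsub>M\<^esub> y')"
proof -
  have c: "x \<in> carrier M" "y \<in> carrier M" "x' \<in> carrier M" "y' \<in> carrier M"
    using assms by (auto simp: mod_cong_def)
  have "(x \<oplus>\<^bsub>M\<^esub> x') \<ominus>\<^bsub>M\<^esub> (y \<oplus>\<^bsub>M\<^esub> y') = (x \<ominus>\<^bsub>M\<^esub> y) \<oplus>\<^bsub>M\<^esub> (x' \<ominus>\<^bsub>M\<^esub> y')"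
    using c by (simp add: a_minus_def M.minus_add M.a_ac)
  then show ?thesis using assms sub_add c by (auto simp: mod_cong_def)
qed

lemma cong_smult:
  assumes "submodule H R M" "mod_cong M H x y" "r \<in> carrier R"
  shows "mod_cong M H (r \<odot>\<^bsub>M\<^esub> x) (r \<odot>\<^bsub>M\<^esub> y)"
proof -
  have c: "x \<in> carrier M" "y \<in> carrier M" using assms by (auto simp: mod_cong_def)
  have "r \<odot>\<^bsub>M\<^esub> x \<ominus>\<^bsub>M\<^esub> r \<odot>\<^bsub>M\<^esub> y = r \<odot>\<^bsub>M\<^esub> (x \<ominus>\<^bsub>M\<^esub> y)"
    using c assms by (simp add: a_minus_def smult_r_distr smult_r_minus)
  then show ?thesis using assms sub_smult c by (auto simp: mod_cong_def)
qed

lemma cong_mono: "mod_cong M H x y \<Longrightarrow> H \<subseteq> H' \<Longrightarrow> mod_cong M H' x y"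
  by (auto simp: mod_cong_def)

lemma cong_mem_iff:
  assumes "submodule H R M" "mod_cong M H x y"
  shows "x \<in> H \<longleftrightarrow> y \<in> H"
proof -
  have c: "x \<in> carrier M" "y \<in> carrier M" using assms by (auto simp: mod_cong_def)
  have e: "x = (x \<ominus>\<^bsub>M\<^esub> y) \<oplus>\<^bsub>M\<^esub> y" "y = x \<ominus>\<^bsub>M\<^esub> (x \<ominus>\<^bsub>M\<^esub> y)"
    using c by (simp_all add: a_minus_def M.a_assoc M.l_neg M.minus_add M.r_neg2)
  show ?thesis
    using e sub_add[OF assms(1), of "x \<ominus>\<^bsub>M\<^esub> y" y] sub_minus[OF assms(1), of x "x \<ominus>\<^bsub>M\<^esub> y"] assms(2)
    by (auto simp: mod_cong_def)
qed

lemma cong_zero_iff: "submodule H R M \<Longrightarrow> mod_cong M H x \<zero>\<^bsub>M\<^esub> \<longleftrightarrow> x \<in> H"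
  using sub_carrier[of H x] by (auto simp: mod_cong_def a_minus_def)

lemma congI_add:
  assumes "submodule H R M" "y \<in> carrier M" "h \<in> H" "x = y \<oplus>\<^bsub>M\<^esub> h"
  shows "mod_cong M H x y"
proof -
  have "x \<ominus>\<^bsub>M\<^esub> y = h" using assms sub_carrier[OF assms(1,3)]
    by (simp add: a_minus_def M.a_assoc M.r_neg M.r_neg1 M.a_comm[of y])
  then show ?thesis using assms sub_carrier[OF assms(1,3)] by (auto simp: mod_cong_def)
qed

lemma congE_add:
  assumes "mod_cong M H x y" obtains h where "h \<in> H" "x = y \<oplus>\<^bsub>M\<^esub> h"
proof
  show "x \<ominus>\<^bsub>M\<^esub> y \<in> H" using assms by (auto simp: mod_cong_def)
  show "x = y \<oplus>\<^bsub>M\<^esub> (x \<ominus>\<^bsub>M\<^esub> y)"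
    using assms by (simp add: mod_cong_def a_minus_def M.a_comm[of x] M.r_neg1 M.r_neg2 M.a_assoc[symmetric] M.r_neg)
qed

end

lemma rmoduleI: "module R M \<Longrightarrow> rmodule R M"
  by (simp add: rmodule_def)

lemma sub_vimage:
  assumes "module R M" "module R N" "f \<in> mod_hom R M N" "submodule H R N"
  shows "submodule {x \<in> carrier M. f x \<in> H} R M"
proof -
  interpret M: rmodule R M using assms(1) by (rule rmoduleI)
  interpret N: rmodule R N using assms(2) by (rule rmoduleI)
  show ?thesis
    by (rule M.subI)
      (use assms in \<open>auto simp: mod_hom_zero mod_hom_add mod_hom_smult intro: N.sub_zero N.sub_add N.sub_smult\<close>)
qed

lemma sub_image:
  assumes "module R M" "module R N" "f \<in> mod_hom R M N" "submodule H R M"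
  shows "submodule (f ` H) R N"
proof -
  interpret M: rmodule R M using assms(1) by (rule rmoduleI)
  interpret N: rmodule R N using assms(2) by (rule rmoduleI)
  note c = M.sub_carrier[OF assms(4)]
  show ?thesis
  proof (rule N.subI)
    show "f ` H \<subseteq> carrier N" using c assms by (auto simp: mod_hom_closed)
    show "\<zero>\<^bsub>N\<^esub> \<in> f ` H" using mod_hom_zero[OF assms(1-3)] M.sub_zero[OF assms(4)] by (metis image_eqI)
  next
    fix x y assume "x \<in> f ` H" "y \<in> f ` H"
    then show "x \<oplus>\<^bsub>N\<^esub> y \<in> f ` H"
      using mod_hom_add[OF assms(3), symmetric] c M.sub_add[OF assms(4)] by auto
  next
    fix r x assume "r \<in> carrier R" "x \<in> f ` H"
    then show "r \<odot>\<^bsub>N\<^esub> x \<in> f ` H"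
      using mod_hom_smult[OF assms(3), symmetric] c M.sub_smult[OF assms(4)] by auto
  qed
qed

lemma mod_hom_ideal_times:
  assumes "module R M" "module R N" "f \<in> mod_hom R M N" "J \<subseteq> carrier R"
    "\<And>x. x \<in> D \<Longrightarrow> f x \<in> D'" "D \<subseteq> carrier M" "D' \<subseteq> carrier N" "x \<in> ideal_times R J M D"
  shows "f x \<in> ideal_times R J N D'"
proof -
  interpret M: rmodule R M using assms(1) by (rule rmoduleI)
  interpret N: rmodule R N using assms(2) by (rule rmoduleI)
  have s: "submodule {x \<in> carrier M. f x \<in> ideal_times R J N D'} R M"
    by (rule sub_vimage[OF assms(1-3) N.times_sub[OF assms(4,7)]])
  have "ideal_times R J M D \<subseteq> {x \<in> carrier M. f x \<in> ideal_times R J N D'}"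
  proof (rule M.times_least[OF s])
    fix a x assume ax: "a \<in> J" "x \<in> D"
    then have "a \<in> carrier R" "x \<in> carrier M" using assms by auto
    then show "a \<odot>\<^bsub>M\<^esub> x \<in> {x \<in> carrier M. f x \<in> ideal_times R J N D'}"
      using ax assms(5) mod_hom_smult[OF assms(3)] N.times_mem by auto
  qed
  then show ?thesis using assms by auto
qed

lemma mod_hom_cong:
  assumes "module R M" "module R N" "f \<in> mod_hom R M N" "mod_cong M H x y" "\<And>h. h \<in> H \<Longrightarrow> f h \<in> H'"
  shows "mod_cong N H' (f x) (f y)"
  using assms(4,5) mod_hom_minus[OF assms(1-3), of x y, symmetric] mod_hom_closed[OF assms(3)]
  by (simp add: mod_cong_def)

subsection \<open>Noetherian local rings\<close>

locale noeth_local = cring R + noetherian_ring R for R :: "('a, 'r) ring_scheme" (structure) +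
  fixes \<mm> :: "'a set"
  assumes local: "{I. maximalideal I R} = {\<mm>}"
begin

text \<open>In a noetherian ring the union of a nonempty chain of ideals is a member of the chain,
  so Zorn's lemma applies to every nonempty family. All noetherian inductions on ideals below start
  from here.\<close>

lemma ideal_max:
  assumes "\<And>J. J \<in> \<C> \<Longrightarrow> ideal J R" "\<C> \<noteq> {}"
  obtains J where "J \<in> \<C>" "\<And>K. K \<in> \<C> \<Longrightarrow> J \<subseteq> K \<Longrightarrow> K = J"
proof -
  have "\<exists>M\<in>\<C>. \<forall>K\<in>\<C>. M \<subseteq> K \<longrightarrow> K = M"
  proof (rule subset_Zorn_nonempty[OF assms(2)])
    fix K assume K: "K \<noteq> {}" "subset.chain \<C> K"
    then have "\<Union>K \<in> K"
      using assms(1) by (intro ideal_chain_is_trivial) (auto simp: pred_on.chain_def)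
    then show "\<Union>K \<in> \<C>" using K by (auto simp: pred_on.chain_def)
  qed
  then show thesis using that by blast
qed

lemma idl_carrier: "ideal J R \<Longrightarrow> x \<in> J \<Longrightarrow> x \<in> carrier R"
  using ideal.Icarr by metis

lemma idl_add: "ideal J R \<Longrightarrow> x \<in> J \<Longrightarrow> y \<in> J \<Longrightarrow> x \<oplus> y \<in> J"
  by (simp add: additive_subgroup.a_closed ideal_def)

lemma idl_zero: "ideal J R \<Longrightarrow> \<zero> \<in> J"
  by (simp add: additive_subgroup.zero_closed ideal_def)

lemma idl_mult: "ideal J R \<Longrightarrow> x \<in> J \<Longrightarrow> r \<in> carrier R \<Longrightarrow> r \<otimes> x \<in> J"
  using ideal.I_l_closed by metis

lemma idl_mult': "ideal J R \<Longrightarrow> x \<in> J \<Longrightarrow> r \<in> carrier R \<Longrightarrow> x \<otimes> r \<in> J"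
  using ideal.I_r_closed by metis

lemma idl_neg: "ideal J R \<Longrightarrow> x \<in> J \<Longrightarrow> \<ominus> x \<in> J"
  by (simp add: additive_subgroup.a_inv_closed ideal_def)

lemma idl_minus: "ideal J R \<Longrightarrow> x \<in> J \<Longrightarrow> y \<in> J \<Longrightarrow> x \<ominus> y \<in> J"
  by (simp add: a_minus_def idl_add idl_neg)

lemma idlI:
  assumes "J \<subseteq> carrier R" "\<zero> \<in> J" "\<And>x y. x \<in> J \<Longrightarrow> y \<in> J \<Longrightarrow> x \<oplus> y \<in> J"
    "\<And>r x. r \<in> carrier R \<Longrightarrow> x \<in> J \<Longrightarrow> r \<otimes> x \<in> J"
  shows "ideal J R"
proof (rule idealI[OF ring_axioms])
  show "subgroup J (add_monoid R)"
  proof (rule add.subgroupI)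
    fix x assume x: "x \<in> J"
    then have "\<ominus> x = (\<ominus> \<one>) \<otimes> x" using assms(1) by (auto simp: l_minus)
    then show "\<ominus> x \<in> J" using assms(4)[OF _ x, of "\<ominus> \<one>"] by simp
  qed (use assms in auto)
next
  fix a x assume "a \<in> J" "x \<in> carrier R"
  then show "x \<otimes> a \<in> J" "a \<otimes> x \<in> J"
    using assms(4)[of x a] assms(1) m_comm[of a x] by auto
qed

lemma m_maximal: "maximalideal \<mm> R"
  using local by auto

lemma m_ideal: "ideal \<mm> R"
  using m_maximal by (rule maximalideal.axioms(1))

lemma m_carrier: "x \<in> \<mm> \<Longrightarrow> x \<in> carrier R"
  using idl_carrier[OF m_ideal] .

lemma m_prime: "primeideal \<mm> R"
  using maximalideal_prime[OF m_maximal] .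

lemma one_notin_m: "\<one> \<notin> \<mm>"
  using ideal.one_imp_carrier[OF m_ideal] maximalideal.I_notcarr[OF m_maximal] by auto

text \<open>A maximal element among the proper ideals over \<open>J\<close> is a maximal ideal,
  hence \<mm>.\<close>

lemma proper_subset_m:
  assumes "ideal J R" "J \<noteq> carrier R"
  shows "J \<subseteq> \<mm>"
proof -
  let ?C = "{K. ideal K R \<and> J \<subseteq> K \<and> K \<noteq> carrier R}"
  obtain K where K: "K \<in> ?C" "\<And>L. L \<in> ?C \<Longrightarrow> K \<subseteq> L \<Longrightarrow> L = K"
    by (rule ideal_max[of ?C]) (use assms in auto)
  have "maximalideal K R"
  proof (rule maximalidealI)
    fix L assume "ideal L R" "K \<subseteq> L" "L \<subseteq> carrier R"
    then show "L = K \<or> L = carrier R" using K by blast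
  qed (use K in auto)
  then have "K = \<mm>" using local by auto
  then show ?thesis using K by auto
qed

lemma unit_of_notin_m:
  assumes "x \<in> carrier R" "x \<notin> \<mm>"
  obtains y where "y \<in> carrier R" "y \<otimes> x = \<one>"
proof -
  have "PIdl x = carrier R"
    using proper_subset_m[OF cgenideal_ideal[OF assms(1)]] cgenideal_self[OF assms(1)] assms(2) by auto
  then have "\<one> \<in> PIdl x" by simp
  then obtain y where "y \<in> carrier R" "\<one> = y \<otimes> x" by (auto simp: cgenideal_def)
  then show thesis using that by auto
qed

lemma one_minus_unit:
  assumes "a \<in> \<mm>"
  obtains y where "y \<in> carrier R" "y \<otimes> (\<one> \<ominus> a) = \<one>"
proof (rule unit_of_notin_m[of "\<one> \<ominus> a"])
  show "\<one> \<ominus> a \<in> carrier R" using m_carrier[OF assms] by simp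
  show "\<one> \<ominus> a \<notin> \<mm>"
  proof
    assume "\<one> \<ominus> a \<in> \<mm>"
    from idl_add[OF m_ideal this assms] have "\<one> \<in> \<mm>"
      using m_carrier[OF assms] by (simp add: a_minus_def a_assoc l_neg)
    then show False using one_notin_m by simp
  qed
qed

section \<open>Powers of the maximal ideal\<close>

definition mpow :: "nat \<Rightarrow> 'a set" where "mpow n = \<mm> [^]\<^bsub>ideals_set R\<^esub> n"

lemma mpow_0: "mpow 0 = carrier R"
  by (simp add: mpow_def ideals_set_def)

lemma ideals_monoid: "monoid (ideals_set R)"
  using ideals_set_is_comm_monoid comm_monoid.axioms(1) by blast

lemma m_in_ideals_set: "\<mm> \<in> carrier (ideals_set R)"
  by (simp add: ideals_set_def m_ideal)

lemma mpow_ideal: "ideal (mpow n) R"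
  using monoid.nat_pow_closed[OF ideals_monoid m_in_ideals_set, of n]
  by (simp add: mpow_def ideals_set_def)

lemma mpow_add: "mpow (k + l) = ideal_prod R (mpow k) (mpow l)"
  using monoid.nat_pow_mult[OF ideals_monoid m_in_ideals_set, of k l]
  by (simp add: mpow_def) (simp add: ideals_set_def)

lemma mpow_1: "mpow (Suc 0) = \<mm>"
  using monoid.nat_pow_eone[OF ideals_monoid m_in_ideals_set] by (simp add: mpow_def)

lemma mpow_carrier: "x \<in> mpow n \<Longrightarrow> x \<in> carrier R"
  using idl_carrier[OF mpow_ideal] .

lemma mpow_subset: "mpow n \<subseteq> carrier R"
  using mpow_carrier by auto

lemma mpow_mult: "a \<in> mpow k \<Longrightarrow> b \<in> mpow l \<Longrightarrow> a \<otimes> b \<in> mpow (k + l)"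
  unfolding mpow_add by (rule ideal_prod.prod)

lemma mpow_least:
  assumes "ideal J R" "\<And>a b. a \<in> mpow k \<Longrightarrow> b \<in> mpow l \<Longrightarrow> a \<otimes> b \<in> J"
  shows "mpow (k + l) \<subseteq> J"
proof
  fix x assume "x \<in> mpow (k + l)"
  then show "x \<in> J" unfolding mpow_add
    by (induct rule: ideal_prod.induct) (auto intro: assms idl_add)
qed

lemma mpow_antimono: "k \<le> l \<Longrightarrow> mpow l \<subseteq> mpow k"
proof -
  assume "k \<le> l"
  then obtain j where "l = k + j" using le_Suc_ex by blast
  moreover have "mpow (k + j) \<subseteq> mpow k"
    by (rule mpow_least) (auto intro: mpow_ideal idl_mult' mpow_carrier)
  ultimately show ?thesis by simp
qed

lemma mpow_Suc_m: "0 < n \<Longrightarrow> mpow n \<subseteq> \<mm>"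
  using mpow_antimono[of "Suc 0" n] by (simp add: mpow_1)

lemma pow_mpow: "a \<in> \<mm> \<Longrightarrow> a [^] n \<in> mpow n"
proof (induct n)
  case (Suc n)
  then show ?case using mpow_mult[of "a [^] n" n a "Suc 0"] by (simp add: mpow_1)
qed (simp add: mpow_0)

section \<open>Prime ideals over a given ideal\<close>

lemma idl_adjoin:
  assumes "ideal J R" "a \<in> carrier R"
  shows "ideal (J <+>\<^bsub>R\<^esub> PIdl a) R" "J \<subseteq> J <+>\<^bsub>R\<^esub> PIdl a" "a \<in> J <+>\<^bsub>R\<^esub> PIdl a"
    "x \<in> J <+>\<^bsub>R\<^esub> PIdl a \<longleftrightarrow> (\<exists>j\<in>J. \<exists>r\<in>carrier R. x = j \<oplus> r \<otimes> a)"
proof -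
  show "ideal (J <+>\<^bsub>R\<^esub> PIdl a) R" by (rule add_ideals[OF assms(1) cgenideal_ideal[OF assms(2)]])
  show m: "x \<in> J <+>\<^bsub>R\<^esub> PIdl a \<longleftrightarrow> (\<exists>j\<in>J. \<exists>r\<in>carrier R. x = j \<oplus> r \<otimes> a)" for x
    by (auto simp: set_add_def' cgenideal_def)
  show "J \<subseteq> J <+>\<^bsub>R\<^esub> PIdl a"
  proof
    fix j assume "j \<in> J"
    then show "j \<in> J <+>\<^bsub>R\<^esub> PIdl a" unfolding m
      by (intro bexI[of _ j] bexI[of _ \<zero>]) (use assms idl_carrier in auto)
  qed
  show "a \<in> J <+>\<^bsub>R\<^esub> PIdl a" unfolding m
    by (intro bexI[of _ \<zero>] bexI[of _ \<one>]) (use assms idl_zero in auto)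
qed

text \<open>Each of the products in (J + a R) (J + b R) \<subseteq> J + a b R falls into J. This is
  what makes ideals that are maximal with a suitable property prime.\<close>

lemma adjoin_mult_in:
  assumes J: "ideal J R" and "a \<in> carrier R" "b \<in> carrier R" "a \<otimes> b \<in> J"
    and "x \<in> J <+>\<^bsub>R\<^esub> PIdl a" "y \<in> J <+>\<^bsub>R\<^esub> PIdl b"
  shows "x \<otimes> y \<in> J"
proof -
  obtain i r where x: "i \<in> J" "r \<in> carrier R" "x = i \<oplus> r \<otimes> a"
    using assms idl_adjoin(4)[OF J] by auto
  obtain j s where y: "j \<in> J" "s \<in> carrier R" "y = j \<oplus> s \<otimes> b"
    using assms idl_adjoin(4)[OF J] by auto
  have c: "i \<in> carrier R" "j \<in> carrier R" using x y J idl_carrier by auto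
  have "x \<otimes> y = i \<otimes> y \<oplus> ((r \<otimes> a) \<otimes> j \<oplus> (r \<otimes> s) \<otimes> (a \<otimes> b))"
    using x y c assms by (simp add: l_distr r_distr m_ac a_ac)
  moreover have "y \<in> carrier R" using y c assms by simp
  then have "i \<otimes> y \<in> J" by (rule idl_mult'[OF J x(1)])
  moreover have "(r \<otimes> a) \<otimes> j \<in> J" using x assms by (intro idl_mult[OF J y(1)]) auto
  moreover have "(r \<otimes> s) \<otimes> (a \<otimes> b) \<in> J" using x y assms by (simp add: idl_mult[OF J])
  ultimately show ?thesis by (simp add: idl_add[OF J])
qed

text \<open>An ideal \<open>K\<close> maximal among those over \<open>T\<close> that contain no
  power of \<mm> is prime: if a b \<in> K but a, b \<notin> K, then K + a R and K + b R contain
  powers of \<mm>, and the product of these powers lies in K. So K would be \<mm>, which contains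
  its own first power.\<close>

lemma prime_radical:
  assumes T: "ideal T R" and P: "\<And>P. primeideal P R \<Longrightarrow> T \<subseteq> P \<Longrightarrow> P = \<mm>"
  shows "\<exists>k. mpow k \<subseteq> T"
proof (rule ccontr)
  assume no: "\<nexists>k. mpow k \<subseteq> T"
  let ?C = "{K. ideal K R \<and> T \<subseteq> K \<and> (\<forall>k. \<not> mpow k \<subseteq> K)}"
  obtain K where K: "K \<in> ?C" "\<And>L. L \<in> ?C \<Longrightarrow> K \<subseteq> L \<Longrightarrow> L = K"
    by (rule ideal_max[of ?C]) (use T no in auto)
  have "primeideal K R"
  proof (rule primeidealI)
    show "cring R" by (rule is_cring)
    show "carrier R \<noteq> K" using K(1) mpow_0 by auto
    fix a b assume ab: "a \<in> carrier R" "b \<in> carrier R" "a \<otimes> b \<in> K"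
    show "a \<in> K \<or> b \<in> K"
    proof (rule ccontr)
      assume n: "\<not> (a \<in> K \<or> b \<in> K)"
      have "\<exists>k. mpow k \<subseteq> K <+>\<^bsub>R\<^esub> PIdl c" if c: "c \<in> carrier R" "c \<notin> K" for c
      proof (rule ccontr)
        assume "\<nexists>k. mpow k \<subseteq> K <+>\<^bsub>R\<^esub> PIdl c"
        then have "K <+>\<^bsub>R\<^esub> PIdl c \<in> ?C" using K(1) idl_adjoin[of K c] c by auto
        then have "K <+>\<^bsub>R\<^esub> PIdl c = K" using K(2) idl_adjoin(2)[of K c] K(1) c by auto
        then show False using idl_adjoin(3)[of K c] K(1) c by auto
      qed
      then obtain k l where "mpow k \<subseteq> K <+>\<^bsub>R\<^esub> PIdl a" "mpow l \<subseteq> K <+>\<^bsub>R\<^esub> PIdl b" using n ab by meson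
      then have "mpow (k + l) \<subseteq> K"
        using K(1) ab by (intro mpow_least) (auto intro: adjoin_mult_in)
      then show False using K(1) by auto
    qed
  qed (use K(1) in auto)
  then have "K = \<mm>" using P K(1) by auto
  then show False using K(1) mpow_1 by auto
qed

lemma prime_pow:
  assumes "primeideal P R" "a \<in> carrier R" "a [^] (n::nat) \<in> P"
  shows "a \<in> P"
  using assms(3)
proof (induct n)
  case 0
  then show ?case
    using ideal.one_imp_carrier[OF primeideal.axioms(1)[OF assms(1)]] primeideal.I_notcarr[OF assms(1)] by auto
next
  case (Suc n)
  then show ?case using primeideal.I_prime[OF assms(1), of "a [^] n" a] assms(2) by auto
qed

lemma prime_neq: "primeideal P R \<Longrightarrow> \<one> \<notin> P"
  using ideal.one_imp_carrier[OF primeideal.axioms(1)] primeideal.I_notcarr by metis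

lemma prime_subset_m: "primeideal P R \<Longrightarrow> P \<subseteq> \<mm>"
  using proper_subset_m primeideal.axioms(1) primeideal.I_notcarr by metis

text \<open>A prime over \<open>T\<close> contains a power of every a \<in> \<mm>, hence a itself,
  hence \<mm>.\<close>

lemma pow_radical:
  assumes T: "ideal T R" and "\<And>a. a \<in> \<mm> \<Longrightarrow> \<exists>n::nat. a [^] n \<in> T"
  shows "\<exists>k. mpow k \<subseteq> T"
proof (rule prime_radical[OF T])
  fix P assume P: "primeideal P R" "T \<subseteq> P"
  have "\<mm> \<subseteq> P" using assms(2) P prime_pow m_carrier by blast
  then show "P = \<mm>" using prime_subset_m[OF P(1)] by auto
qed

text \<open>A maximal counterexample \<open>K\<close> is neither the unit ideal (covered by the
  empty set) nor prime (covered by itself). So a b \<in> K for some a, b \<notin> K, and the covers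
  of K + a R and K + b R together cover \<open>K\<close>. Such a set \<open>S\<close> contains all
  minimal primes over \<open>T\<close>.\<close>

lemma finite_minimal_primes:
  assumes "ideal T R"
  shows "\<exists>S. finite S \<and> (\<forall>P\<in>S. primeideal P R \<and> T \<subseteq> P) \<and> (\<forall>P. primeideal P R \<longrightarrow> T \<subseteq> P \<longrightarrow> (\<exists>Q\<in>S. Q \<subseteq> P))"
proof (rule ccontr)
  define cov where "cov = (\<lambda>K S. finite S \<and> (\<forall>P\<in>S. primeideal P R \<and> K \<subseteq> P) \<and>
    (\<forall>P. primeideal P R \<longrightarrow> K \<subseteq> P \<longrightarrow> (\<exists>Q\<in>S. Q \<subseteq> P)))"
  assume "\<not> (\<exists>S. finite S \<and> (\<forall>P\<in>S. primeideal P R \<and> T \<subseteq> P) \<and>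
    (\<forall>P. primeideal P R \<longrightarrow> T \<subseteq> P \<longrightarrow> (\<exists>Q\<in>S. Q \<subseteq> P)))"
  then have no: "\<nexists>S. cov T S" by (simp add: cov_def)
  let ?C = "{K. ideal K R \<and> (\<nexists>S. cov K S)}"
  obtain K where K: "K \<in> ?C" "\<And>L. L \<in> ?C \<Longrightarrow> K \<subseteq> L \<Longrightarrow> L = K"
    by (rule ideal_max[of ?C]) (use assms no in auto)
  have iK: "ideal K R" and bad: "\<And>S. \<not> cov K S" using K(1) by auto
  have ne: "carrier R \<noteq> K"
  proof
    assume e: "carrier R = K"
    have "\<not> K \<subseteq> P" if "primeideal P R" for P
      using prime_neq[OF that(1)] e one_closed by (metis subsetD)
    then have "cov K {}" by (simp add: cov_def)
    then show False using bad by simp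
  qed
  have "\<not> primeideal K R"
  proof
    assume "primeideal K R"
    then have "cov K {K}" by (auto simp: cov_def)
    then show False using bad by simp
  qed
  then have "\<not> (\<forall>a b. a \<in> carrier R \<longrightarrow> b \<in> carrier R \<longrightarrow> a \<otimes> b \<in> K \<longrightarrow> a \<in> K \<or> b \<in> K)"
    using primeidealI[OF iK is_cring ne] by metis
  then obtain a b where ab: "a \<in> carrier R" "b \<in> carrier R" "a \<otimes> b \<in> K" "a \<notin> K" "b \<notin> K"
    by auto
  have g: "\<exists>S. cov (K <+>\<^bsub>R\<^esub> PIdl c) S" if c: "c \<in> carrier R" "c \<notin> K" for c
  proof (rule ccontr)
    assume "\<nexists>S. cov (K <+>\<^bsub>R\<^esub> PIdl c) S"
    then have "K <+>\<^bsub>R\<^esub> PIdl c \<in> ?C" using idl_adjoin(1)[OF iK c(1)] by simp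
    from K(2)[OF this idl_adjoin(2)[OF iK c(1)]] have "K <+>\<^bsub>R\<^esub> PIdl c = K" .
    then show False using idl_adjoin(3)[OF iK c(1)] c by auto
  qed
  obtain S where S: "cov (K <+>\<^bsub>R\<^esub> PIdl a) S" using g[OF ab(1,4)] by auto
  obtain S' where S': "cov (K <+>\<^bsub>R\<^esub> PIdl b) S'" using g[OF ab(2,5)] by auto
  have "\<exists>Q\<in>S \<union> S'. Q \<subseteq> P" if P: "primeideal P R" "K \<subseteq> P" for P
  proof -
    have iP: "ideal P R" by (rule primeideal.axioms(1)[OF P(1)])
    have *: "K <+>\<^bsub>R\<^esub> PIdl c \<subseteq> P" if c: "c \<in> carrier R" "c \<in> P" for c
    proof
      fix x assume "x \<in> K <+>\<^bsub>R\<^esub> PIdl c"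
      then obtain j r where "j \<in> K" "r \<in> carrier R" "x = j \<oplus> r \<otimes> c"
        using idl_adjoin(4)[OF iK c(1)] by auto
      then show "x \<in> P" using P(2) idl_add[OF iP _ idl_mult[OF iP c(2)]] by auto
    qed
    have "a \<in> P \<or> b \<in> P" using primeideal.I_prime[OF P(1) ab(1,2)] ab(3) P(2) by auto
    then show ?thesis
    proof
      assume "a \<in> P"
      then show ?thesis using *[OF ab(1)] S P(1) unfolding cov_def by (metis UnI1)
    next
      assume "b \<in> P"
      then show ?thesis using *[OF ab(2)] S' P(1) unfolding cov_def by (metis UnI2)
    qed
  qed
  moreover have "primeideal P R \<and> K \<subseteq> P" if "P \<in> S \<union> S'" for P
    using that S S' idl_adjoin(2)[OF iK ab(1)] idl_adjoin(2)[OF iK ab(2)]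
    unfolding cov_def by (meson UnE order_trans)
  ultimately have "cov K (S \<union> S')"
    using S S' unfolding cov_def by (metis finite_Un)
  then show False using bad by simp
qed

lemma prime_avoidance:
  assumes "finite S" "\<And>P. P \<in> S \<Longrightarrow> primeideal P R \<and> \<not> J \<subseteq> P" "ideal J R"
  shows "\<exists>x\<in>J. \<forall>P\<in>S. x \<notin> P"
  using assms(1,2)
proof (induct "card S" arbitrary: S rule: less_induct)
  case less
  show ?case
  proof (cases "S = {}")
    case True
    then show ?thesis using idl_zero[OF assms(3)] by auto
  next
    case False
    then obtain P where P: "P \<in> S" by auto
    have iQ: "ideal Q R" if "Q \<in> S" for Q using less(3)[OF that] primeideal.axioms(1) by blast
    have c: "card (S - {Q}) < card S" if "Q \<in> S" for Q using card_Diff1_less[OF less(2) that] .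
    show ?thesis
    proof (cases "\<exists>Q\<in>S. Q \<noteq> P \<and> Q \<subseteq> P")
      \<comment> \<open>A prime contained in another member may be dropped: what avoids P also
        avoids Q.\<close>
      case True
      then obtain Q where Q: "Q \<in> S" "Q \<noteq> P" "Q \<subseteq> P" by auto
      obtain x where x: "x \<in> J" "\<forall>P\<in>S - {Q}. x \<notin> P"
        using less(1)[OF c[OF Q(1)]] less(2,3) by auto
      then have "x \<notin> Q" using Q P by auto
      then show ?thesis using x by blast
    next
      case False
      obtain x where x: "x \<in> J" "\<forall>Q\<in>S - {P}. x \<notin> Q"
        using less(1)[OF c[OF P]] less(2,3) by auto
      obtain j where j: "j \<in> J" "j \<notin> P" using less(3)[OF P] by blast
      \<comment> \<open>A product of elements of the other primes, none of them in P. If x happens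
        to lie in P, then x + j y leaves P because j y does, and stays outside the other primes
        because y lies in them.\<close>
      have "\<exists>y\<in>carrier R. y \<notin> P \<and> (\<forall>Q\<in>U. y \<in> Q)" if "finite U" "U \<subseteq> S - {P}" for U
        using that
      proof (induct U)
        case empty
        then show ?case using prime_neq less(3)[OF P] by (intro bexI[of _ \<one>]) auto
      next
        case (insert Q U)
        then obtain y where y: "y \<in> carrier R" "y \<notin> P" "\<forall>Q\<in>U. y \<in> Q" by auto
        have QS: "Q \<in> S" "Q \<noteq> P" using insert by auto
        then obtain z where z: "z \<in> Q" "z \<notin> P" using False by auto
        have zc: "z \<in> carrier R" using z(1) idl_carrier[OF iQ[OF QS(1)]] by simp
        have "y \<otimes> z \<notin> P" using primeideal.I_prime[of P R y z] less(3)[OF P] y z zc by auto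
        moreover have "y \<otimes> z \<in> Q'" if "Q' \<in> U" for Q'
          using idl_mult'[of Q' y z] iQ[of Q'] that y zc insert(4) by auto
        moreover have "y \<otimes> z \<in> Q" by (rule idl_mult[OF iQ[OF QS(1)] z(1) y(1)])
        ultimately show ?case using y zc by (intro bexI[of _ "y \<otimes> z"]) auto
      qed
      then obtain y where y: "y \<in> carrier R" "y \<notin> P" "\<forall>Q\<in>S - {P}. y \<in> Q"
        using less(2) by (metis finite_Diff order_refl)
      have jc: "j \<in> carrier R" and xc: "x \<in> carrier R" using j x idl_carrier[OF assms(3)] by auto
      show ?thesis
      proof (cases "x \<in> P")
        case True
        have n: "j \<otimes> y \<notin> P" using primeideal.I_prime[of P R j y] less(3)[OF P] y j jc by auto
        have "x \<oplus> j \<otimes> y \<notin> P"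
        proof
          assume "x \<oplus> j \<otimes> y \<in> P"
          then have "(x \<oplus> j \<otimes> y) \<ominus> x \<in> P" using True idl_minus[OF iQ[OF P]] by blast
          moreover have "(x \<oplus> j \<otimes> y) \<ominus> x = j \<otimes> y"
            using xc jc y by (simp add: a_minus_def a_comm[of x] a_assoc r_neg)
          ultimately show False using n by simp
        qed
        moreover have "x \<oplus> j \<otimes> y \<notin> Q" if Q: "Q \<in> S" "Q \<noteq> P" for Q
        proof
          assume a: "x \<oplus> j \<otimes> y \<in> Q"
          have "j \<otimes> y \<in> Q" using y Q jc idl_mult[OF iQ[OF Q(1)]] by blast
          then have "(x \<oplus> j \<otimes> y) \<ominus> j \<otimes> y \<in> Q" using a idl_minus[OF iQ[OF Q(1)]] by blast
          moreover have "(x \<oplus> j \<otimes> y) \<ominus> j \<otimes> y = x"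
            using xc jc y by (simp add: a_minus_def a_assoc r_neg)
          ultimately show False using x Q by auto
        qed
        moreover have "x \<oplus> j \<otimes> y \<in> J"
          using x j y by (auto intro!: idl_add[OF assms(3)] idl_mult'[OF assms(3)])
        ultimately show ?thesis by blast
      next
        case False
        then show ?thesis using x by blast
      qed
    qed
  qed
qed

end

context rmodule
begin

lemma scale_hom: "a \<in> carrier R \<Longrightarrow> (\<lambda>y\<in>carrier M. a \<odot>\<^bsub>M\<^esub> y) \<in> mod_hom R M M"
  using mod_hom_scale[OF module_axioms module_axioms mod_hom_id[OF module_axioms]]
  by (simp add: restrict_def cong: if_cong)

lemma sub_smult_vimage:
  assumes "submodule H R M" "a \<in> carrier R"
  shows "submodule {y \<in> carrier M. a \<odot>\<^bsub>M\<^esub> y \<in> H} R M"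
proof -
  have "{y \<in> carrier M. a \<odot>\<^bsub>M\<^esub> y \<in> H} = {y \<in> carrier M. (\<lambda>y\<in>carrier M. a \<odot>\<^bsub>M\<^esub> y) y \<in> H}" by auto
  then show ?thesis
    using sub_vimage[OF module_axioms module_axioms scale_hom[OF assms(2)] assms(1)] by simp
qed

end

subsection \<open>Quotient modules\<close>

context rmodule
begin

lemma rcos_eq:
  assumes "submodule H R M" "x \<in> carrier M"
  shows "H +>\<^bsub>M\<^esub> x = {y. mod_cong M H y x}"
proof -
  have "y \<in> H +>\<^bsub>M\<^esub> x \<longleftrightarrow> mod_cong M H y x" for y
  proof
    assume "y \<in> H +>\<^bsub>M\<^esub> x"
    then obtain h where "h \<in> H" "y = h \<oplus>\<^bsub>M\<^esub> x" by (auto simp: a_r_coset_def')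
    then show "mod_cong M H y x"
      using assms sub_carrier[OF assms(1)] by (intro congI_add[of H x h]) (auto simp: M.a_comm)
  next
    assume a: "mod_cong M H y x"
    then obtain h where "h \<in> H" "y = x \<oplus>\<^bsub>M\<^esub> h" by (rule congE_add)
    then show "y \<in> H +>\<^bsub>M\<^esub> x"
      using assms sub_carrier[OF assms(1)] by (auto simp: a_r_coset_def' M.a_comm)
  qed
  then show ?thesis by auto
qed

lemma rcos_eq_iff:
  assumes "submodule H R M" "x \<in> carrier M" "y \<in> carrier M"
  shows "H +>\<^bsub>M\<^esub> x = H +>\<^bsub>M\<^esub> y \<longleftrightarrow> mod_cong M H x y"
  unfolding rcos_eq[OF assms(1,2)] rcos_eq[OF assms(1,3)] set_eq_iff mem_Collect_eq
  using assms cong_refl cong_trans cong_sym by metis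

lemma quot_carrier: "carrier (quot_module M H) = {H +>\<^bsub>M\<^esub> x | x. x \<in> carrier M}"
  by (auto simp: quot_module_def A_RCOSETS_def' a_r_coset_def')

lemma rcos_zero: "submodule H R M \<Longrightarrow> H +>\<^bsub>M\<^esub> \<zero>\<^bsub>M\<^esub> = H"
  by (simp add: rcos_eq cong_zero_iff)

lemma quot_zero: "submodule H R M \<Longrightarrow> \<zero>\<^bsub>quot_module M H\<^esub> = H +>\<^bsub>M\<^esub> \<zero>\<^bsub>M\<^esub>"
  by (simp add: quot_module_def rcos_zero)

lemma quot_add:
  assumes "submodule H R M" "x \<in> carrier M" "y \<in> carrier M"
  shows "(H +>\<^bsub>M\<^esub> x) \<oplus>\<^bsub>quot_module M H\<^esub> (H +>\<^bsub>M\<^esub> y) = H +>\<^bsub>M\<^esub> (x \<oplus>\<^bsub>M\<^esub> y)"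
proof -
  have "abelian_subgroup H M"
    using submodule.axioms(1)[OF assms(1)]
    by (intro abelian_subgroupI3 additive_subgroupI) (auto intro: M.abelian_group_axioms)
  then show ?thesis using abelian_subgroup.a_rcos_sum[of H M x y] assms by (simp add: quot_module_def)
qed

lemma quot_smult:
  assumes "submodule H R M" "x \<in> carrier M" "r \<in> carrier R"
  shows "r \<odot>\<^bsub>quot_module M H\<^esub> (H +>\<^bsub>M\<^esub> x) = H +>\<^bsub>M\<^esub> (r \<odot>\<^bsub>M\<^esub> x)"
proof -
  have "y \<in> H <+>\<^bsub>M\<^esub> ((\<lambda>x. r \<odot>\<^bsub>M\<^esub> x) ` (H +>\<^bsub>M\<^esub> x)) \<longleftrightarrow> mod_cong M H y (r \<odot>\<^bsub>M\<^esub> x)" for y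
  proof
    assume "y \<in> H <+>\<^bsub>M\<^esub> ((\<lambda>x. r \<odot>\<^bsub>M\<^esub> x) ` (H +>\<^bsub>M\<^esub> x))"
    then obtain h z where hz: "h \<in> H" "mod_cong M H z x" "y = h \<oplus>\<^bsub>M\<^esub> r \<odot>\<^bsub>M\<^esub> z"
      using rcos_eq[OF assms(1,2)] by (auto simp: set_add_mem)
    have "mod_cong M H h \<zero>\<^bsub>M\<^esub>" using hz assms by (simp add: cong_zero_iff)
    from cong_add[OF assms(1) this cong_smult[OF assms(1) hz(2) assms(3)]]
    show "mod_cong M H y (r \<odot>\<^bsub>M\<^esub> x)" using hz assms by simp
  next
    assume "mod_cong M H y (r \<odot>\<^bsub>M\<^esub> x)"
    then obtain h where "h \<in> H" "y = r \<odot>\<^bsub>M\<^esub> x \<oplus>\<^bsub>M\<^esub> h" by (rule congE_add)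
    moreover have "x \<in> H +>\<^bsub>M\<^esub> x" using assms cong_refl by (simp add: rcos_eq)
    ultimately show "y \<in> H <+>\<^bsub>M\<^esub> ((\<lambda>x. r \<odot>\<^bsub>M\<^esub> x) ` (H +>\<^bsub>M\<^esub> x))"
      using assms sub_carrier[OF assms(1)] by (auto simp: set_add_mem M.a_comm)
  qed
  then show ?thesis using assms by (auto simp: quot_module_def rcos_eq)
qed

lemma quot_cases:
  assumes "u \<in> carrier (quot_module M H)"
  obtains x where "x \<in> carrier M" "u = H +>\<^bsub>M\<^esub> x"
  using assms by (auto simp: quot_carrier)

lemma quot_in: "x \<in> carrier M \<Longrightarrow> H +>\<^bsub>M\<^esub> x \<in> carrier (quot_module M H)"
  by (auto simp: quot_carrier)

lemma quot_module:
  assumes H: "submodule H R M"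
  shows "module R (quot_module M H)"
proof (rule moduleI)
  note s = quot_add[OF H] quot_smult[OF H] quot_zero[OF H] quot_in
  show "cring R" by (rule R.is_cring)
  show "abelian_group (quot_module M H)"
  proof (rule abelian_groupI)
    fix u assume "u \<in> carrier (quot_module M H)"
    then obtain x where x: "x \<in> carrier M" "u = H +>\<^bsub>M\<^esub> x" by (rule quot_cases)
    then have "(H +>\<^bsub>M\<^esub> (\<ominus>\<^bsub>M\<^esub> x)) \<oplus>\<^bsub>quot_module M H\<^esub> u = \<zero>\<^bsub>quot_module M H\<^esub>"
      by (simp add: s M.l_neg)
    then show "\<exists>y\<in>carrier (quot_module M H). y \<oplus>\<^bsub>quot_module M H\<^esub> u = \<zero>\<^bsub>quot_module M H\<^esub>"
      using x quot_in by blast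
  qed (auto elim!: quot_cases simp: s M.a_ac)
qed (auto elim!: quot_cases simp: quot_add[OF H] quot_smult[OF H] quot_in smult_l_distr smult_r_distr smult_assoc1)

lemma quot_proj:
  assumes H: "submodule H R M"
  shows "(\<lambda>x\<in>carrier M. H +>\<^bsub>M\<^esub> x) \<in> mod_hom R M (quot_module M H)"
  by (rule mod_hom_restrictI) (auto simp: quot_add[OF H] quot_smult[OF H] quot_in module_axioms)

lemma quot_zero_iff:
  assumes H: "submodule H R M" "x \<in> carrier M"
  shows "H +>\<^bsub>M\<^esub> x = \<zero>\<^bsub>quot_module M H\<^esub> \<longleftrightarrow> x \<in> H"
  using assms by (simp add: quot_zero rcos_eq_iff cong_zero_iff)

text \<open>Images of the chain stay strict because all its members contain \<open>P\<close>. It is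
  used contrapositively: a bound on the length of a stable Hom module excludes long strict chains in
  Hom above the maps that factor through projectives.\<close>

lemma quot_chain:
  assumes P: "submodule P R M"
    and H: "\<And>i. i \<le> n \<Longrightarrow> submodule (H i) R M \<and> P \<subseteq> H i" "\<And>i. i < n \<Longrightarrow> H i \<subset> H (Suc i)"
  shows "enat n \<le> module_length R (quot_module M P)"
proof -
  interpret Q: rmodule R "quot_module M P" by (rule rmoduleI[OF quot_module[OF P]])
  define \<pi> where "\<pi> = (\<lambda>x\<in>carrier M. P +>\<^bsub>M\<^esub> x)"
  have \<pi>: "\<pi> \<in> mod_hom R M (quot_module M P)" unfolding \<pi>_def by (rule quot_proj[OF P])
  have 1: "submodule (\<pi> ` H i) R (quot_module M P)" if "i \<le> n" for i
    by (rule sub_image[OF module_axioms quot_module[OF P] \<pi>]) (use H that in auto)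
  have 2: "\<pi> ` H i \<subset> \<pi> ` H (Suc i)" if i: "i < n" for i
  proof -
    have si: "submodule (H i) R M" "P \<subseteq> H i" and sS: "submodule (H (Suc i)) R M"
      using H(1)[of i] H(1)[of "Suc i"] i by auto
    obtain x where x: "x \<in> H (Suc i)" "x \<notin> H i" using H(2)[OF i] by auto
    have xc: "x \<in> carrier M" using x sub_carrier[OF sS] by auto
    have "\<pi> x \<notin> \<pi> ` H i"
    proof
      assume "\<pi> x \<in> \<pi> ` H i"
      then obtain y where y: "y \<in> H i" "\<pi> x = \<pi> y" by auto
      have yc: "y \<in> carrier M" using y sub_carrier[OF si(1)] by auto
      then have "mod_cong M P x y" using y xc rcos_eq_iff[OF P xc yc] by (simp add: \<pi>_def)
      then have "mod_cong M (H i) x y" using si(2) by (rule cong_mono)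
      then show False using cong_mem_iff[OF si(1)] x y by blast
    qed
    then show ?thesis using H(2)[OF i] x by blast
  qed
  show ?thesis unfolding module_length_def
  proof (rule Sup_upper, rule CollectI, intro exI conjI)
    show "\<forall>i\<le>n. submodule (\<pi> ` H i) R (quot_module M P)" using 1 by blast
    show "\<forall>i<n. \<pi> ` H i \<subset> \<pi> ` H (Suc i)" using 2 by blast
  qed simp
qed

end

subsection \<open>Finitely generated modules\<close>

context noeth_local
begin

text \<open>The \<mm>-adic filtration. \<open>filt M 0\<close> is all of M, since the zeroth power
  of \<mm> is R.\<close>

definition filt :: "('a, 'b) module \<Rightarrow> nat \<Rightarrow> 'b set" where
  "filt M n = ideal_times R (mpow n) M (carrier M)"

end

locale local_module = noeth_local R \<mm> + rmodule R M
  for R :: "('a, 'r) ring_scheme" (structure) and \<mm> and M :: "('a, 'b) module"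
begin

lemma filt_sub: "submodule (filt M n) R M"
  unfolding filt_def by (rule times_sub[OF mpow_subset]) simp

lemma filt_mem: "a \<in> mpow n \<Longrightarrow> x \<in> carrier M \<Longrightarrow> a \<odot>\<^bsub>M\<^esub> x \<in> filt M n"
  unfolding filt_def by (rule times_mem)

lemma filt_carrier: "x \<in> filt M n \<Longrightarrow> x \<in> carrier M"
  using sub_carrier[OF filt_sub] .

lemma filt_0: "filt M 0 = carrier M"
proof
  show "carrier M \<subseteq> filt M 0"
  proof
    fix x assume x: "x \<in> carrier M"
    then have "\<one> \<odot>\<^bsub>M\<^esub> x \<in> filt M 0" by (intro filt_mem) (auto simp: mpow_0)
    then show "x \<in> filt M 0" using x by simp
  qed
qed (use filt_carrier in auto)

lemma filt_antimono: "k \<le> l \<Longrightarrow> filt M l \<subseteq> filt M k"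
  unfolding filt_def by (rule times_mono[OF mpow_antimono]) auto

lemma filt_smult:
  assumes "a \<in> mpow k" "x \<in> filt M l"
  shows "a \<odot>\<^bsub>M\<^esub> x \<in> filt M (k + l)"
proof -
  have "submodule {x \<in> carrier M. a \<odot>\<^bsub>M\<^esub> x \<in> filt M (k + l)} R M"
    by (rule sub_smult_vimage[OF filt_sub mpow_carrier[OF assms(1)]])
  then have "filt M l \<subseteq> {x \<in> carrier M. a \<odot>\<^bsub>M\<^esub> x \<in> filt M (k + l)}"
    unfolding filt_def[of _ l]
  proof (rule times_least)
    fix b x assume b: "b \<in> mpow l" "x \<in> carrier M"
    have "(a \<otimes> b) \<odot>\<^bsub>M\<^esub> x \<in> filt M (k + l)" by (rule filt_mem[OF mpow_mult[OF assms(1) b(1)] b(2)])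
    then show "b \<odot>\<^bsub>M\<^esub> x \<in> {x \<in> carrier M. a \<odot>\<^bsub>M\<^esub> x \<in> filt M (k + l)}"
      using b mpow_carrier assms(1) by (simp add: smult_assoc1)
  qed
  then show ?thesis using assms(2) by auto
qed

lemma filt_least:
  assumes "submodule H R M" "\<And>a x. a \<in> mpow n \<Longrightarrow> x \<in> carrier M \<Longrightarrow> a \<odot>\<^bsub>M\<^esub> x \<in> H"
  shows "filt M n \<subseteq> H"
  unfolding filt_def by (rule times_least[OF assms])

end

locale fg_local_module = local_module +
  assumes fg: "fin_gen_module R M"
begin

text \<open>Induction on the generators. For a new generator g, the coefficients r such that r g + h
  \<in> H for some h in the old span form an ideal, which is generated by a finite set A. Generators
  of H are lifts of A to H together with generators of the intersection of H with the old
  span.\<close>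

lemma sub_fg_aux:
  assumes "finite T" "T \<subseteq> carrier M"
  shows "\<forall>H. submodule H R M \<longrightarrow> H \<subseteq> mod_span R M T \<longrightarrow> (\<exists>S. finite S \<and> S \<subseteq> H \<and> mod_span R M S = H)"
  using assms
proof (induct T)
  case empty
  show ?case
  proof (intro allI impI)
    fix H assume "submodule H R M" "H \<subseteq> mod_span R M {}"
    then have "H = {\<zero>\<^bsub>M\<^esub>}" using sub_zero span_empty by blast
    then show "\<exists>S. finite S \<and> S \<subseteq> H \<and> mod_span R M S = H" by (intro exI[of _ "{}"]) (simp add: span_empty)
  qed
next
  case (insert g T)
  have gT: "g \<in> carrier M" "T \<subseteq> carrier M" using insert by auto
  note sT = span_sub[OF gT(2)]
  note cT = sub_carrier[OF sT]
  show ?case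
  proof (intro allI impI)
    fix H assume H: "submodule H R M" "H \<subseteq> mod_span R M (insert g T)"
    have Jid: "ideal {r \<in> carrier R. \<exists>h\<in>mod_span R M T. r \<odot>\<^bsub>M\<^esub> g \<oplus>\<^bsub>M\<^esub> h \<in> K} R"
      if K: "submodule K R M" for K
    proof (rule idlI)
      show "\<zero> \<in> {r \<in> carrier R. \<exists>h\<in>mod_span R M T. r \<odot>\<^bsub>M\<^esub> g \<oplus>\<^bsub>M\<^esub> h \<in> K}"
        using gT sub_zero[OF sT] sub_zero[OF K] by (auto intro!: bexI[of _ "\<zero>\<^bsub>M\<^esub>"])
    next
      fix x y assume "x \<in> {r \<in> carrier R. \<exists>h\<in>mod_span R M T. r \<odot>\<^bsub>M\<^esub> g \<oplus>\<^bsub>M\<^esub> h \<in> K}"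
        "y \<in> {r \<in> carrier R. \<exists>h\<in>mod_span R M T. r \<odot>\<^bsub>M\<^esub> g \<oplus>\<^bsub>M\<^esub> h \<in> K}"
      then obtain h h' where h: "x \<in> carrier R" "y \<in> carrier R" "h \<in> mod_span R M T" "h' \<in> mod_span R M T"
        "x \<odot>\<^bsub>M\<^esub> g \<oplus>\<^bsub>M\<^esub> h \<in> K" "y \<odot>\<^bsub>M\<^esub> g \<oplus>\<^bsub>M\<^esub> h' \<in> K" by auto
      have "(x \<oplus> y) \<odot>\<^bsub>M\<^esub> g \<oplus>\<^bsub>M\<^esub> (h \<oplus>\<^bsub>M\<^esub> h') = (x \<odot>\<^bsub>M\<^esub> g \<oplus>\<^bsub>M\<^esub> h) \<oplus>\<^bsub>M\<^esub> (y \<odot>\<^bsub>M\<^esub> g \<oplus>\<^bsub>M\<^esub> h')"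
        using h gT cT by (simp add: smult_l_distr M.a_ac)
      then show "x \<oplus> y \<in> {r \<in> carrier R. \<exists>h\<in>mod_span R M T. r \<odot>\<^bsub>M\<^esub> g \<oplus>\<^bsub>M\<^esub> h \<in> K}"
        using h sub_add[OF K h(5,6)] sub_add[OF sT h(3,4)] by (auto intro!: bexI[of _ "h \<oplus>\<^bsub>M\<^esub> h'"])
    next
      fix r x assume r: "r \<in> carrier R"
        and "x \<in> {r \<in> carrier R. \<exists>h\<in>mod_span R M T. r \<odot>\<^bsub>M\<^esub> g \<oplus>\<^bsub>M\<^esub> h \<in> K}"
      then obtain h where h: "x \<in> carrier R" "h \<in> mod_span R M T" "x \<odot>\<^bsub>M\<^esub> g \<oplus>\<^bsub>M\<^esub> h \<in> K" by auto
      have "(r \<otimes> x) \<odot>\<^bsub>M\<^esub> g \<oplus>\<^bsub>M\<^esub> r \<odot>\<^bsub>M\<^esub> h = r \<odot>\<^bsub>M\<^esub> (x \<odot>\<^bsub>M\<^esub> g \<oplus>\<^bsub>M\<^esub> h)"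
        using h gT cT r by (simp add: smult_r_distr smult_assoc1)
      then show "r \<otimes> x \<in> {r \<in> carrier R. \<exists>h\<in>mod_span R M T. r \<odot>\<^bsub>M\<^esub> g \<oplus>\<^bsub>M\<^esub> h \<in> K}"
        using h r sub_smult[OF K r h(3)] sub_smult[OF sT r h(2)] by (auto intro!: bexI[of _ "r \<odot>\<^bsub>M\<^esub> h"])
    qed auto
    obtain A where A: "A \<subseteq> carrier R" "finite A"
      "{r \<in> carrier R. \<exists>h\<in>mod_span R M T. r \<odot>\<^bsub>M\<^esub> g \<oplus>\<^bsub>M\<^esub> h \<in> H} = Idl A"
      using finetely_gen[OF Jid[OF H(1)]] by blast
    then have "\<forall>a\<in>A. \<exists>h\<in>mod_span R M T. a \<odot>\<^bsub>M\<^esub> g \<oplus>\<^bsub>M\<^esub> h \<in> H"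
      using genideal_self[OF A(1)] by blast
    then obtain \<eta> where \<eta>: "\<And>a. a \<in> A \<Longrightarrow> \<eta> a \<in> mod_span R M T \<and> a \<odot>\<^bsub>M\<^esub> g \<oplus>\<^bsub>M\<^esub> \<eta> a \<in> H" by metis
    define S1 where "S1 = (\<lambda>a. a \<odot>\<^bsub>M\<^esub> g \<oplus>\<^bsub>M\<^esub> \<eta> a) ` A"
    have S1: "finite S1" "S1 \<subseteq> H" using A \<eta> by (auto simp: S1_def)
    obtain S2 where S2: "finite S2" "S2 \<subseteq> H \<inter> mod_span R M T" "mod_span R M S2 = H \<inter> mod_span R M T"
      using insert(3)[OF gT(2)] sub_Int[OF H(1) sT] by (metis Int_lower2)
    have Hc: "H \<subseteq> carrier M" using sub_carrier[OF H(1)] by auto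
    have c12: "S1 \<subseteq> carrier M" "S2 \<subseteq> carrier M" "S1 \<union> S2 \<subseteq> carrier M" using S1 S2 Hc by auto
    note s1 = span_sub[OF c12(1)] and s12 = span_sub[OF c12(3)]
    have l: "mod_span R M S1 \<subseteq> H" by (rule span_least[OF H(1) S1(2)])
    have "mod_span R M (S1 \<union> S2) = H"
    proof
      show "mod_span R M (S1 \<union> S2) \<subseteq> H" by (rule span_least[OF H(1)]) (use S1 S2 in auto)
      show "H \<subseteq> mod_span R M (S1 \<union> S2)"
      proof
        fix x assume x: "x \<in> H"
        then obtain h r where hr: "h \<in> mod_span R M T" "r \<in> carrier R" "x = h \<oplus>\<^bsub>M\<^esub> r \<odot>\<^bsub>M\<^esub> g"
          using H(2) span_insert[OF gT(2,1)] adjoin_mem by blast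
        then have "r \<in> Idl A" using x gT cT by (auto simp: A(3)[symmetric] M.a_comm)
        \<comment> \<open>The coefficient ideal of the span of the lifts already contains A. So some
          combination of the lifts has the same g-coefficient as x, and their difference lies in H
          as well as in the old span.\<close>
        moreover have "Idl A \<subseteq> {r \<in> carrier R. \<exists>h\<in>mod_span R M T. r \<odot>\<^bsub>M\<^esub> g \<oplus>\<^bsub>M\<^esub> h \<in> mod_span R M S1}"
        proof (rule genideal_minimal[OF Jid[OF s1]], rule subsetI)
          fix a assume "a \<in> A"
          then show "a \<in> {r \<in> carrier R. \<exists>h\<in>mod_span R M T. r \<odot>\<^bsub>M\<^esub> g \<oplus>\<^bsub>M\<^esub> h \<in> mod_span R M S1}"
            using A(1) \<eta>[of a] span_mem[of "a \<odot>\<^bsub>M\<^esub> g \<oplus>\<^bsub>M\<^esub> \<eta> a" S1] by (auto simp: S1_def)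
        qed
        ultimately obtain h' where h': "h' \<in> mod_span R M T" "r \<odot>\<^bsub>M\<^esub> g \<oplus>\<^bsub>M\<^esub> h' \<in> mod_span R M S1" by blast
        have c: "h \<in> carrier M" "h' \<in> carrier M" "r \<odot>\<^bsub>M\<^esub> g \<in> carrier M" using hr h' cT gT by auto
        have e: "h \<ominus>\<^bsub>M\<^esub> h' = x \<ominus>\<^bsub>M\<^esub> (r \<odot>\<^bsub>M\<^esub> g \<oplus>\<^bsub>M\<^esub> h')"
          using c hr(3) by (simp add: a_minus_def M.minus_add M.a_assoc M.r_neg1) (simp add: M.a_ac M.r_neg M.r_neg1 M.r_neg2)
        have "x \<ominus>\<^bsub>M\<^esub> (r \<odot>\<^bsub>M\<^esub> g \<oplus>\<^bsub>M\<^esub> h') \<in> H" using x h' l by (intro sub_minus[OF H(1)]) auto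
        then have "h \<ominus>\<^bsub>M\<^esub> h' \<in> mod_span R M S2"
          unfolding S2(3) using e sub_minus[OF sT hr(1) h'(1)] by simp
        then have "h \<ominus>\<^bsub>M\<^esub> h' \<in> mod_span R M (S1 \<union> S2)" using span_mono[of S2 "S1 \<union> S2"] by auto
        moreover have "r \<odot>\<^bsub>M\<^esub> g \<oplus>\<^bsub>M\<^esub> h' \<in> mod_span R M (S1 \<union> S2)" using h' span_mono[of S1 "S1 \<union> S2"] by auto
        ultimately have "(h \<ominus>\<^bsub>M\<^esub> h') \<oplus>\<^bsub>M\<^esub> (r \<odot>\<^bsub>M\<^esub> g \<oplus>\<^bsub>M\<^esub> h') \<in> mod_span R M (S1 \<union> S2)"
          by (rule sub_add[OF s12])
        moreover have "(h \<ominus>\<^bsub>M\<^esub> h') \<oplus>\<^bsub>M\<^esub> (r \<odot>\<^bsub>M\<^esub> g \<oplus>\<^bsub>M\<^esub> h') = x"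
          using c hr(3) by (simp add: a_minus_def M.a_assoc M.a_comm[of _ h'] M.r_neg1 M.r_neg2)
        ultimately show "x \<in> mod_span R M (S1 \<union> S2)" by simp
      qed
    qed
    then show "\<exists>S. finite S \<and> S \<subseteq> H \<and> mod_span R M S = H"
      using S1 S2 by (intro exI[of _ "S1 \<union> S2"]) auto
  qed
qed

lemma sub_fg:
  assumes "submodule H R M"
  obtains S where "finite S" "S \<subseteq> H" "mod_span R M S = H"
proof -
  obtain T where "finite T" "T \<subseteq> carrier M" "mod_span R M T = carrier M"
    using fg by (auto simp: fin_gen_module_def)
  then show thesis using sub_fg_aux[of T] assms sub_carrier that by (metis subsetI)
qed

text \<open>The union of a chain of submodules is finitely generated, so its generators lie in one
  member of the chain, and the union is that member.\<close>

lemma sub_max: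
  assumes "\<And>K. K \<in> \<C> \<Longrightarrow> submodule K R M" "\<C> \<noteq> {}"
  obtains K where "K \<in> \<C>" "\<And>L. L \<in> \<C> \<Longrightarrow> K \<subseteq> L \<Longrightarrow> L = K"
proof -
  have "\<exists>M\<in>\<C>. \<forall>K\<in>\<C>. M \<subseteq> K \<longrightarrow> K = M"
  proof (rule subset_Zorn_nonempty[OF assms(2)])
    fix K assume K: "K \<noteq> {}" "subset.chain \<C> K"
    have KC: "K \<subseteq> \<C>" and tot: "\<And>A B. A \<in> K \<Longrightarrow> B \<in> K \<Longrightarrow> A \<subseteq> B \<or> B \<subseteq> A"
      using K(2) by (auto simp: subset_chain_def)
    have s: "\<And>A. A \<in> K \<Longrightarrow> submodule A R M" using KC assms(1) by auto
    have "submodule (\<Union>K) R M"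
    proof (rule subI)
      show "\<Union>K \<subseteq> carrier M" using s sub_carrier by blast
      show "\<zero>\<^bsub>M\<^esub> \<in> \<Union>K" using s sub_zero K(1) by blast
      fix x y assume "x \<in> \<Union>K" "y \<in> \<Union>K"
      then obtain A where "A \<in> K" "x \<in> A" "y \<in> A" using tot by blast
      then show "x \<oplus>\<^bsub>M\<^esub> y \<in> \<Union>K" using s sub_add by blast
    next
      fix r x assume "r \<in> carrier R" "x \<in> \<Union>K"
      then show "r \<odot>\<^bsub>M\<^esub> x \<in> \<Union>K" using s sub_smult by blast
    qed
    then obtain S where S: "finite S" "S \<subseteq> \<Union>K" "mod_span R M S = \<Union>K" by (rule sub_fg)
    obtain A where A: "A \<in> K" "S \<subseteq> A" using finite_subset_Union_chain[OF S(1,2) K] by blast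
    then have "\<Union>K \<subseteq> A" using span_least[OF s[OF A(1)] A(2)] S(3) by simp
    then have "\<Union>K = A" using A by auto
    then show "\<Union>K \<in> \<C>" using A KC by auto
  qed
  then show thesis using that by blast
qed

text \<open>Common source of \<open>nakayama\<close> and \<open>functional\<close>: modulo a
  \<open>K\<close> that is maximal without containing \<open>D\<close>, every nonzero cyclic
  submodule contains the image of \<open>D\<close>.\<close>

lemma maximal_not_containing:
  assumes "submodule H R M" "\<not> D \<subseteq> H" "submodule D R M"
  obtains K where "submodule K R M" "H \<subseteq> K" "\<not> D \<subseteq> K" "\<And>x. x \<in> carrier M \<Longrightarrow> x \<notin> K \<Longrightarrow>
    D \<subseteq> K <+>\<^bsub>M\<^esub> {r \<odot>\<^bsub>M\<^esub> x | r. r \<in> carrier R}"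
proof -
  let ?C = "{K. submodule K R M \<and> H \<subseteq> K \<and> \<not> D \<subseteq> K}"
  obtain K where K: "K \<in> ?C" "\<And>L. L \<in> ?C \<Longrightarrow> K \<subseteq> L \<Longrightarrow> L = K"
    by (rule sub_max[of ?C]) (use assms in auto)
  have sK: "submodule K R M" using K by auto
  have "D \<subseteq> K <+>\<^bsub>M\<^esub> {r \<odot>\<^bsub>M\<^esub> x | r. r \<in> carrier R}" if x: "x \<in> carrier M" "x \<notin> K" for x
  proof (rule ccontr)
    note a = adjoin[OF sK x(1)]
    assume "\<not> D \<subseteq> K <+>\<^bsub>M\<^esub> {r \<odot>\<^bsub>M\<^esub> x | r. r \<in> carrier R}"
    then have "K <+>\<^bsub>M\<^esub> {r \<odot>\<^bsub>M\<^esub> x | r. r \<in> carrier R} \<in> ?C" using a K(1) by blast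
    then have "K <+>\<^bsub>M\<^esub> {r \<odot>\<^bsub>M\<^esub> x | r. r \<in> carrier R} = K" using K(2) a(2) by blast
    then show False using a(3) x by simp
  qed
  then show thesis using that K by blast
qed

text \<open>Take K over H maximal without containing D. If a x \<notin> K for some a \<in> \<mm> and
  x \<in> D, then x = k + r a x with k \<in> K; as 1 - r a is a unit, x lies in K, a contradiction.
  So \<mm> D, and with it D, lies in K.\<close>

lemma nakayama:
  assumes D: "submodule D R M" and H: "submodule H R M" and le: "D \<subseteq> ideal_times R \<mm> M D <+>\<^bsub>M\<^esub> H"
  shows "D \<subseteq> H"
proof (rule ccontr)
  assume n: "\<not> D \<subseteq> H"
  obtain K where K: "submodule K R M" "H \<subseteq> K" "\<not> D \<subseteq> K" "\<And>x. x \<in> carrier M \<Longrightarrow> x \<notin> K \<Longrightarrow>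
    D \<subseteq> K <+>\<^bsub>M\<^esub> {r \<odot>\<^bsub>M\<^esub> x | r. r \<in> carrier R}" using maximal_not_containing[OF H n D] by blast
  have "ideal_times R \<mm> M D \<subseteq> K"
  proof (rule times_least[OF K(1)], rule ccontr)
    fix a x assume ax: "a \<in> \<mm>" "x \<in> D" "a \<odot>\<^bsub>M\<^esub> x \<notin> K"
    have c: "a \<in> carrier R" "x \<in> carrier M" using ax m_carrier sub_carrier[OF D] by auto
    obtain k r where kr: "k \<in> K" "r \<in> carrier R" "x = k \<oplus>\<^bsub>M\<^esub> r \<odot>\<^bsub>M\<^esub> (a \<odot>\<^bsub>M\<^esub> x)"
      using K(4)[of "a \<odot>\<^bsub>M\<^esub> x"] ax c adjoin_mem by blast
    have kc: "k \<in> carrier M" using kr sub_carrier[OF K(1)] by auto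
    have ra: "r \<otimes> a \<in> \<mm>" using idl_mult[OF m_ideal ax(1) kr(2)] .
    obtain y where y: "y \<in> carrier R" "y \<otimes> (\<one> \<ominus> r \<otimes> a) = \<one>" by (rule one_minus_unit[OF ra])
    have "(\<one> \<ominus> r \<otimes> a) \<odot>\<^bsub>M\<^esub> x = x \<ominus>\<^bsub>M\<^esub> r \<odot>\<^bsub>M\<^esub> (a \<odot>\<^bsub>M\<^esub> x)"
      using c kr by (simp add: a_minus_def smult_l_distr smult_l_minus smult_assoc1)
    also have "\<dots> = (k \<oplus>\<^bsub>M\<^esub> r \<odot>\<^bsub>M\<^esub> (a \<odot>\<^bsub>M\<^esub> x)) \<ominus>\<^bsub>M\<^esub> r \<odot>\<^bsub>M\<^esub> (a \<odot>\<^bsub>M\<^esub> x)"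
      using kr(3) by simp
    also have "\<dots> = k" using c kr(2) kc by (simp add: a_minus_def M.a_assoc M.r_neg)
    finally have "y \<odot>\<^bsub>M\<^esub> ((\<one> \<ominus> r \<otimes> a) \<odot>\<^bsub>M\<^esub> x) = y \<odot>\<^bsub>M\<^esub> k" by simp
    then have "x = y \<odot>\<^bsub>M\<^esub> k" using y c kr by (simp add: smult_assoc1[symmetric])
    then have "x \<in> K" using sub_smult[OF K(1) y(1) kr(1)] by simp
    then show False using sub_smult[OF K(1) c(1)] ax by auto
  qed
  then have "D \<subseteq> K" using set_add_least[OF K(1) _ K(2), of "ideal_times R \<mm> M D"] le by blast
  then show False using K by auto
qed

lemma filt_1: "filt M 1 = ideal_times R \<mm> M (carrier M)"
  by (simp add: filt_def mpow_1)

text \<open>The form used for surjectivity: it suffices to reach every element modulo \<mm>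
  M.\<close>

lemma nakayama_carrier:
  assumes H: "submodule H R M" and le: "\<And>x. x \<in> carrier M \<Longrightarrow> \<exists>h\<in>H. mod_cong M (filt M 1) x h"
  shows "H = carrier M"
proof -
  have "carrier M \<subseteq> ideal_times R \<mm> M (carrier M) <+>\<^bsub>M\<^esub> H"
  proof
    fix x assume "x \<in> carrier M"
    then obtain h where h: "h \<in> H" "mod_cong M (filt M 1) x h" using le by auto
    obtain z where z: "z \<in> filt M 1" "x = h \<oplus>\<^bsub>M\<^esub> z" using h(2) by (rule congE_add)
    then show "x \<in> ideal_times R \<mm> M (carrier M) <+>\<^bsub>M\<^esub> H"
      using h filt_carrier[OF z(1)] sub_carrier[OF H h(1)]
      using set_addI[of z "filt M 1" h H] by (simp add: filt_1[symmetric] M.a_comm)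
  qed
  then have "carrier M \<subseteq> H" by (rule nakayama[OF carrier_is_submodule H])
  then show ?thesis using sub_carrier[OF H] by auto
qed

text \<open>A proof without the Artin-Rees lemma. With D the intersection, choose L over \<mm> D
  maximal with L \<inter> D \<subseteq> \<mm> D. Every a \<in> \<mm> has a power with a^n M
  \<subseteq> L, so \<mm>^k M \<subseteq> L for some k. Then D \<subseteq> L \<inter> D \<subseteq>
  \<mm> D, and D = 0 by Nakayama's lemma.\<close>

lemma krull_intersection: "(\<Inter>n. filt M n) = {\<zero>\<^bsub>M\<^esub>}"
proof -
  define D where "D = (\<Inter>n. filt M n)"
  have D: "submodule D R M" unfolding D_def by (rule sub_INT) (auto intro: filt_sub)
  define mD where "mD = ideal_times R \<mm> M D"
  have mD: "submodule mD R M" unfolding mD_def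
    by (rule times_sub) (use m_carrier sub_carrier[OF D] in auto)
  have mDD: "mD \<subseteq> D" unfolding mD_def by (rule times_subset[OF _ D]) (use m_carrier in auto)
  let ?C = "{K. submodule K R M \<and> mD \<subseteq> K \<and> K \<inter> D \<subseteq> mD}"
  obtain L where L: "L \<in> ?C" "\<And>K. K \<in> ?C \<Longrightarrow> L \<subseteq> K \<Longrightarrow> K = L"
    by (rule sub_max[of ?C]) (use mD in auto)
  have sL: "submodule L R M" "mD \<subseteq> L" "L \<inter> D \<subseteq> mD" using L by auto
  have key: "\<exists>n::nat. \<forall>x\<in>carrier M. (a [^] n) \<odot>\<^bsub>M\<^esub> x \<in> L" if a: "a \<in> \<mm>" for a
  proof -
    have ac: "a \<in> carrier R" using m_carrier[OF a] .
    define Q where "Q = (\<lambda>n::nat. {x \<in> carrier M. (a [^] n) \<odot>\<^bsub>M\<^esub> x \<in> L})"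
    have sQ: "submodule (Q n) R M" for n
      unfolding Q_def by (rule sub_smult_vimage[OF sL(1)]) (use ac in simp)
    obtain n where n: "\<And>k. Q n \<subseteq> Q k \<Longrightarrow> Q k = Q n"
    proof (rule sub_max[of "range Q"])
      fix K assume K: "K \<in> range Q" "\<And>L. L \<in> range Q \<Longrightarrow> K \<subseteq> L \<Longrightarrow> L = K"
      then obtain n where "K = Q n" by auto
      then show thesis using that[of n] K(2) by blast
    qed (use sQ in auto)
    \<comment> \<open>The ascending submodules of all x with a^n x \<in> L become
      stationary.\<close>
    have QS: "Q (Suc n) = Q n"
    proof (rule n, rule subsetI)
      fix x assume "x \<in> Q n"
      then have x: "x \<in> carrier M" "(a [^] n) \<odot>\<^bsub>M\<^esub> x \<in> L" by (auto simp: Q_def)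
      then have "a \<odot>\<^bsub>M\<^esub> ((a [^] n) \<odot>\<^bsub>M\<^esub> x) \<in> L" using ac by (simp add: sub_smult[OF sL(1)])
      then show "x \<in> Q (Suc n)" using x ac by (simp add: Q_def smult_assoc1[symmetric] m_comm)
    qed
    define I where "I = (\<lambda>x\<in>carrier M. (a [^] n) \<odot>\<^bsub>M\<^esub> x) ` carrier M"
    have hI: "(\<lambda>x\<in>carrier M. (a [^] n) \<odot>\<^bsub>M\<^esub> x) \<in> mod_hom R M M"
      by (rule scale_hom) (use ac in simp)
    have sI: "submodule I R M" unfolding I_def
      by (rule sub_image[OF module_axioms module_axioms hI carrier_is_submodule])
    have "L <+>\<^bsub>M\<^esub> I \<in> ?C"
    proof (intro CollectI conjI)
      show "submodule (L <+>\<^bsub>M\<^esub> I) R M" by (rule sub_set_add[OF sL(1) sI])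
      show "mD \<subseteq> L <+>\<^bsub>M\<^esub> I" using set_add_upper[OF sL(1) sI] sL by auto
      show "(L <+>\<^bsub>M\<^esub> I) \<inter> D \<subseteq> mD"
      proof
        \<comment> \<open>Here a z lies in \<mm> D \<subseteq> L, so a^(n+1) y lies in L, and by the
          choice of n so does a^n y.\<close>
        fix z assume "z \<in> (L <+>\<^bsub>M\<^esub> I) \<inter> D"
        then obtain l y where z: "z \<in> D" "l \<in> L" "y \<in> carrier M" "z = l \<oplus>\<^bsub>M\<^esub> (a [^] n) \<odot>\<^bsub>M\<^esub> y"
          by (auto simp: set_add_mem I_def)
        have lc: "l \<in> carrier M" using z sub_carrier[OF sL(1)] by auto
        have az: "a \<odot>\<^bsub>M\<^esub> z \<in> L" using times_mem[OF a z(1)] sL(2) by (auto simp: mD_def)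
        have "a \<odot>\<^bsub>M\<^esub> z \<ominus>\<^bsub>M\<^esub> a \<odot>\<^bsub>M\<^esub> l \<in> L"
          by (rule sub_minus[OF sL(1) az sub_smult[OF sL(1) ac z(2)]])
        moreover have "a \<odot>\<^bsub>M\<^esub> z \<ominus>\<^bsub>M\<^esub> a \<odot>\<^bsub>M\<^esub> l = (a [^] Suc n) \<odot>\<^bsub>M\<^esub> y"
          using z ac lc by (simp add: a_minus_def smult_r_distr smult_assoc1[symmetric] M.a_comm[of "a \<odot>\<^bsub>M\<^esub> l"] M.a_assoc M.r_neg m_comm)
        ultimately have "y \<in> Q (Suc n)" using z by (simp add: Q_def)
        then have "(a [^] n) \<odot>\<^bsub>M\<^esub> y \<in> L" using QS by (auto simp: Q_def)
        then have "z \<in> L" using z sub_add[OF sL(1)] by auto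
        then show "z \<in> mD" using z sL by auto
      qed
    qed
    then have "L <+>\<^bsub>M\<^esub> I = L" using L(2) set_add_upper[OF sL(1) sI] by auto
    then have "I \<subseteq> L" using set_add_upper[OF sL(1) sI] by auto
    then show ?thesis by (auto simp: I_def)
  qed
  let ?T = "{r \<in> carrier R. \<forall>x\<in>carrier M. r \<odot>\<^bsub>M\<^esub> x \<in> L}"
  have "ideal ?T R"
    by (rule idlI) (auto simp: sub_zero[OF sL(1)] sub_add[OF sL(1)] smult_l_distr smult_assoc1 sub_smult[OF sL(1)])
  moreover have "\<exists>n::nat. a [^] n \<in> ?T" if "a \<in> \<mm>" for a
    using key[OF that] m_carrier[OF that] by auto
  ultimately obtain k where "mpow k \<subseteq> ?T" using pow_radical by blast
  then have "filt M k \<subseteq> L" by (intro filt_least[OF sL(1)]) auto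
  then have "D \<subseteq> L" unfolding D_def by auto
  then have "D \<subseteq> mD" using sL by auto
  then have "D \<subseteq> mD <+>\<^bsub>M\<^esub> {\<zero>\<^bsub>M\<^esub>}" using set_add_upper[OF mD sub_zero_module] by auto
  then have "D \<subseteq> {\<zero>\<^bsub>M\<^esub>}" using nakayama[OF D sub_zero_module] by (simp add: mD_def)
  then show ?thesis using sub_zero[OF D] by (auto simp: D_def)
qed

lemma filt_zeroI: "(\<And>n. x \<in> filt M n) \<Longrightarrow> x = \<zero>\<^bsub>M\<^esub>"
  using krull_intersection by auto

end

section \<open>The ring as a module, its residue field, and its completeness\<close>

lemma self_module_module:
  assumes "cring R"
  shows "module R (self_module R)"
proof -
  interpret cring R by fact
  show ?thesis
    by (rule moduleI) (auto simp: self_module_def is_cring l_distr r_distr m_assoc a_ac l_neg r_neg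
        intro!: abelian_groupI bexI[of _ "\<ominus>\<^bsub>R\<^esub> _"])
qed

context noeth_local
begin

lemma self_simps [simp]:
  "carrier (self_module R) = carrier R" "\<zero>\<^bsub>self_module R\<^esub> = \<zero>"
  "x \<oplus>\<^bsub>self_module R\<^esub> y = x \<oplus> y" "r \<odot>\<^bsub>self_module R\<^esub> x = r \<otimes> x"
  by (simp_all add: self_module_def)

lemma self_a_inv [simp]: "\<ominus>\<^bsub>self_module R\<^esub> x = \<ominus> x"
  by (simp add: a_inv_def m_inv_def self_module_def)

lemma self_minus [simp]: "x \<ominus>\<^bsub>self_module R\<^esub> y = x \<ominus> y"
  by (simp add: a_minus_def)

lemma self_coset [simp]: "J +>\<^bsub>self_module R\<^esub> x = J +> x"
  by (simp add: a_r_coset_def r_coset_def self_module_def)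

lemma self_module: "module R (self_module R)"
  by (rule self_module_module[OF is_cring])

lemma self_submodule: "ideal J R \<Longrightarrow> submodule J R (self_module R)"
proof -
  interpret S: rmodule R "self_module R" by (rule rmoduleI[OF self_module])
  assume "ideal J R"
  then show ?thesis
    by (intro S.subI) (auto simp: idl_zero idl_add idl_mult idl_carrier)
qed

lemma self_submodule_iff: "submodule J R (self_module R) \<longleftrightarrow> ideal J R"
proof -
  interpret S: rmodule R "self_module R" by (rule rmoduleI[OF self_module])
  have "ideal J R" if "submodule J R (self_module R)"
    using S.sub_carrier[OF that] S.sub_zero[OF that] S.sub_add[OF that] S.sub_smult[OF that]
    by (intro idlI) auto
  then show ?thesis using self_submodule by auto
qed

lemma self_local: "local_module R \<mm> (self_module R)"
  by (intro local_module.intro rmoduleI self_module noeth_local_axioms)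

lemma self_fg: "fg_local_module R \<mm> (self_module R)"
proof -
  interpret S: local_module R \<mm> "self_module R" by (rule self_local)
  have "mod_span R (self_module R) {\<one>} = carrier (self_module R)"
  proof
    show "mod_span R (self_module R) {\<one>} \<subseteq> carrier (self_module R)"
      by (rule S.span_least[OF S.carrier_is_submodule]) auto
    show "carrier (self_module R) \<subseteq> mod_span R (self_module R) {\<one>}"
    proof
      fix x assume "x \<in> carrier (self_module R)"
      then show "x \<in> mod_span R (self_module R) {\<one>}"
        using S.sub_smult[OF S.span_sub _ S.span_mem, of "{\<one>}" x \<one>] by simp
    qed
  qed
  then have "fin_gen_module R (self_module R)"
    unfolding fin_gen_module_def using self_module
    by (intro conjI exI[of _ "{\<one>}"]) auto
  then show ?thesis by (intro fg_local_module.intro self_local fg_local_module_axioms.intro)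
qed

lemma m_sub_self: "submodule \<mm> R (self_module R)"
  by (rule self_submodule[OF m_ideal])

lemma residue_module: "module R (residue_module R \<mm>)"
proof -
  interpret S: local_module R \<mm> "self_module R" by (rule self_local)
  show ?thesis unfolding residue_module_def by (rule S.quot_module[OF m_sub_self])
qed

lemma residue_simps:
  assumes "x \<in> carrier R" "y \<in> carrier R"
  shows "\<mm> +> x \<in> carrier (residue_module R \<mm>)"
    "\<mm> +> x = \<zero>\<^bsub>residue_module R \<mm>\<^esub> \<longleftrightarrow> x \<in> \<mm>"
    "\<mm> +> x = \<mm> +> y \<longleftrightarrow> x \<ominus> y \<in> \<mm>"
    "(\<mm> +> x) \<oplus>\<^bsub>residue_module R \<mm>\<^esub> (\<mm> +> y) = \<mm> +> (x \<oplus> y)"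
    "x \<odot>\<^bsub>residue_module R \<mm>\<^esub> (\<mm> +> y) = \<mm> +> (x \<otimes> y)"
proof -
  interpret S: local_module R \<mm> "self_module R" by (rule self_local)
  note s = S.quot_in[of x \<mm>] S.quot_zero_iff[OF m_sub_self, of x] S.rcos_eq_iff[OF m_sub_self, of x y]
    S.quot_add[OF m_sub_self, of x y] S.quot_smult[OF m_sub_self, of y x]
  show "\<mm> +> x \<in> carrier (residue_module R \<mm>)"
    "\<mm> +> x = \<zero>\<^bsub>residue_module R \<mm>\<^esub> \<longleftrightarrow> x \<in> \<mm>"
    "\<mm> +> x = \<mm> +> y \<longleftrightarrow> x \<ominus> y \<in> \<mm>"
    "(\<mm> +> x) \<oplus>\<^bsub>residue_module R \<mm>\<^esub> (\<mm> +> y) = \<mm> +> (x \<oplus> y)"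
    "x \<odot>\<^bsub>residue_module R \<mm>\<^esub> (\<mm> +> y) = \<mm> +> (x \<otimes> y)"
    using s assms by (simp_all add: residue_module_def mod_cong_def)
qed

lemma residue_kill:
  assumes "a \<in> \<mm>" "u \<in> carrier (residue_module R \<mm>)"
  shows "a \<odot>\<^bsub>residue_module R \<mm>\<^esub> u = \<zero>\<^bsub>residue_module R \<mm>\<^esub>"
proof -
  interpret S: local_module R \<mm> "self_module R" by (rule self_local)
  obtain x where x: "x \<in> carrier R" "u = \<mm> +> x"
    using assms(2) S.quot_cases[of u \<mm>] by (auto simp: residue_module_def)
  then show ?thesis
    using residue_simps(5)[of a x] residue_simps(2)[of "a \<otimes> x"] assms(1) m_carrier idl_mult'[OF m_ideal]
    by auto
qed

lemma self_rcos:
  assumes "ideal J R" "x \<in> carrier R"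
  shows "J +> x = {y \<in> carrier R. y \<ominus> x \<in> J}"
proof -
  interpret S: local_module R \<mm> "self_module R" by (rule self_local)
  show ?thesis using S.rcos_eq[OF self_submodule[OF assms(1)], of x] assms(2)
    by (auto simp: mod_cong_def)
qed

text \<open>The cosets of the c n form a point of the inverse limit, to which the surjectivity in
  \<open>adic_complete\<close> applies.\<close>

lemma complete_limit:
  assumes "adic_complete R \<mm>" and c: "\<And>n. c n \<in> carrier R" "\<And>n. c (Suc n) \<ominus> c n \<in> mpow n"
  shows "\<exists>r\<in>carrier R. \<forall>n. r \<ominus> c n \<in> mpow n"
proof -
  define C where "C = (\<lambda>n. mpow n +> c n)"
  have "C n \<in> carrier (R Quot (mpow n)) \<and> C (Suc n) \<subseteq> C n" for n
  proof
    show "C n \<in> carrier (R Quot (mpow n))"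
      using c(1) by (auto simp: C_def FactRing_def A_RCOSETS_def' a_r_coset_def')
    show "C (Suc n) \<subseteq> C n"
    proof
      fix y assume "y \<in> C (Suc n)"
      then have y: "y \<in> carrier R" "y \<ominus> c (Suc n) \<in> mpow (Suc n)"
        using self_rcos[OF mpow_ideal c(1)] by (auto simp: C_def)
      have "y \<ominus> c n = (y \<ominus> c (Suc n)) \<oplus> (c (Suc n) \<ominus> c n)"
        using y c(1) by (simp add: a_minus_def a_assoc r_neg1)
      moreover have "y \<ominus> c (Suc n) \<in> mpow n" using y mpow_antimono[of n "Suc n"] by auto
      ultimately have "y \<ominus> c n \<in> mpow n" using c(2) idl_add[OF mpow_ideal] by simp
      then show "y \<in> C n" using y self_rcos[OF mpow_ideal c(1)] by (auto simp: C_def)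
    qed
  qed
  then have "C \<in> {c. \<forall>n. c n \<in> carrier (R Quot (\<mm> [^]\<^bsub>ideals_set R\<^esub> n)) \<and> c (Suc n) \<subseteq> c n}"
    by (simp add: mpow_def)
  then obtain r where r: "r \<in> carrier R" "C = (\<lambda>n. mpow n +> r)"
    using assms(1) unfolding adic_complete_def bij_betw_def mpow_def by (metis (lifting) imageE)
  have "r \<ominus> c n \<in> mpow n" for n
  proof -
    have "r \<in> mpow n +> r" using self_rcos[OF mpow_ideal r(1)] r(1) idl_zero[OF mpow_ideal]
      by (simp add: a_minus_def r_neg)
    also have "mpow n +> r = mpow n +> c n" using r(2) by (metis C_def)
    finally show ?thesis using self_rcos[OF mpow_ideal c(1)] by auto
  qed
  then show ?thesis using r(1) by blast
qed

lemma complete_series: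
  assumes "adic_complete R \<mm>" and a: "\<And>n. a n \<in> mpow n"
  shows "\<exists>c r. r \<in> carrier R \<and> c 0 = \<zero> \<and>
    (\<forall>n. c n \<in> carrier R \<and> c (Suc n) = c n \<oplus> a n \<and> r \<ominus> c n \<in> mpow n)"
proof -
  define c where "c = rec_nat \<zero> (\<lambda>n x. x \<oplus> a n)"
  have c0: "c 0 = \<zero>" "\<And>n. c (Suc n) = c n \<oplus> a n" by (simp_all add: c_def)
  have cc: "c n \<in> carrier R" for n
    by (induct n) (simp_all add: c0 mpow_carrier[OF a])
  have d: "c (Suc n) \<ominus> c n \<in> mpow n" for n
    using cc mpow_carrier[OF a] a by (simp add: c0 a_minus_def a_comm[of "c n"] a_assoc r_neg)
  obtain r where r: "r \<in> carrier R" "\<forall>n. r \<ominus> c n \<in> mpow n"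
    using complete_limit[OF assms(1) cc d] by auto
  show ?thesis by (intro exI[of _ c] exI[of _ r]) (use r cc c0 in auto)
qed

end

context fg_local_module
begin

text \<open>Modulo a \<open>K\<close> over \<open>T\<close> that is maximal without containing R x,
  every nonzero class y has x as a multiple, with a unit coefficient because \<mm> M \<subseteq> K.
  So M / K is the line through x, and the coefficient of x modulo \<mm> is the functional.\<close>

lemma functional:
  assumes T: "submodule T R M" "filt M 1 \<subseteq> T" and x: "x \<in> carrier M" "x \<notin> T"
  obtains f where "f \<in> mod_hom R M (residue_module R \<mm>)" "\<And>t. t \<in> T \<Longrightarrow> f t = \<zero>\<^bsub>residue_module R \<mm>\<^esub>"
    "f x \<noteq> \<zero>\<^bsub>residue_module R \<mm>\<^esub>"
proof -
  have sx: "{x} \<subseteq> carrier M" using x by auto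
  have "\<not> mod_span R M {x} \<subseteq> T" using x span_mem[of x "{x}"] by auto
  then obtain K where K: "submodule K R M" "T \<subseteq> K" "\<not> mod_span R M {x} \<subseteq> K" "\<And>y. y \<in> carrier M \<Longrightarrow> y \<notin> K \<Longrightarrow>
    mod_span R M {x} \<subseteq> K <+>\<^bsub>M\<^esub> {r \<odot>\<^bsub>M\<^esub> y | r. r \<in> carrier R}"
    using maximal_not_containing[OF T(1) _ span_sub[OF sx]] by blast
  have xK: "x \<notin> K" using K(3) span_least[OF K(1), of "{x}"] by auto
  have mK: "a \<odot>\<^bsub>M\<^esub> y \<in> K" if "a \<in> \<mm>" "y \<in> carrier M" for a y
    using filt_mem[of a 1 y] that T(2) K(2) by (auto simp: mpow_1)
  have key: "r \<in> \<mm>" if r: "r \<in> carrier R" "r \<odot>\<^bsub>M\<^esub> x \<in> K" for r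
  proof (rule ccontr)
    assume "r \<notin> \<mm>"
    then obtain u where u: "u \<in> carrier R" "u \<otimes> r = \<one>" using unit_of_notin_m[OF r(1)] by metis
    have "u \<odot>\<^bsub>M\<^esub> (r \<odot>\<^bsub>M\<^esub> x) \<in> K" by (rule sub_smult[OF K(1) u(1) r(2)])
    then show False using u r x xK by (simp add: smult_assoc1[symmetric])
  qed
  have ex: "\<exists>r\<in>carrier R. mod_cong M K y (r \<odot>\<^bsub>M\<^esub> x)" if y: "y \<in> carrier M" for y
  proof (cases "y \<in> K")
    case True
    then show ?thesis using x by (intro bexI[of _ \<zero>]) (simp_all add: cong_zero_iff[OF K(1)])
  next
    case False
    then obtain k r where kr: "k \<in> K" "r \<in> carrier R" "x = k \<oplus>\<^bsub>M\<^esub> r \<odot>\<^bsub>M\<^esub> y"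
      using K(4)[OF y] adjoin_mem span_mem[of x "{x}"] by blast
    have "r \<notin> \<mm>" using mK[OF _ y] sub_add[OF K(1) kr(1)] kr(3) xK by auto
    then obtain u where u: "u \<in> carrier R" "u \<otimes> r = \<one>" using unit_of_notin_m[OF kr(2)] by metis
    have kc: "k \<in> carrier M" using sub_carrier[OF K(1) kr(1)] .
    have "mod_cong M K x (r \<odot>\<^bsub>M\<^esub> y)"
      by (rule congI_add[OF K(1) _ kr(1)]) (use kr kc y in \<open>auto simp: M.a_comm\<close>)
    from cong_smult[OF K(1) this u(1)]
    have "mod_cong M K (u \<odot>\<^bsub>M\<^esub> x) y" using u y kr(2) by (simp add: smult_assoc1[symmetric])
    then show ?thesis using u cong_sym[OF K(1)] by blast
  qed
  then obtain \<rho> where \<rho>: "\<And>y. y \<in> carrier M \<Longrightarrow> \<rho> y \<in> carrier R \<and> mod_cong M K y (\<rho> y \<odot>\<^bsub>M\<^esub> x)"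
    by metis
  have uniq: "r \<ominus> s \<in> \<mm>" if rs: "r \<in> carrier R" "s \<in> carrier R" "mod_cong M K y (r \<odot>\<^bsub>M\<^esub> x)" "mod_cong M K y (s \<odot>\<^bsub>M\<^esub> x)" for r s y
  proof (rule key)
    have "mod_cong M K (r \<odot>\<^bsub>M\<^esub> x) (s \<odot>\<^bsub>M\<^esub> x)" using cong_trans[OF K(1) cong_sym[OF K(1) rs(3)] rs(4)] .
    then show "(r \<ominus> s) \<odot>\<^bsub>M\<^esub> x \<in> K"
      using rs x by (simp add: mod_cong_def a_minus_def smult_l_distr smult_l_minus)
  qed (use rs in auto)
  define f where "f = (\<lambda>y\<in>carrier M. \<mm> +> \<rho> y)"
  have feq: "f y = \<mm> +> r" if "y \<in> carrier M" "r \<in> carrier R" "mod_cong M K y (r \<odot>\<^bsub>M\<^esub> x)" for y r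
    using that \<rho>[OF that(1)] uniq[of "\<rho> y" r y] residue_simps(3) by (simp add: f_def)
  have fh: "f \<in> mod_hom R M (residue_module R \<mm>)"
    unfolding f_def
  proof (rule mod_hom_restrictI[OF module_axioms])
    fix y z assume yz: "y \<in> carrier M" "z \<in> carrier M"
    have "f (y \<oplus>\<^bsub>M\<^esub> z) = \<mm> +> (\<rho> y \<oplus> \<rho> z)"
      using \<rho>[OF yz(1)] \<rho>[OF yz(2)] yz x cong_add[OF K(1), of y _ z]
      by (intro feq) (auto simp: smult_l_distr)
    then show "\<mm> +> \<rho> (y \<oplus>\<^bsub>M\<^esub> z) = (\<mm> +> \<rho> y) \<oplus>\<^bsub>residue_module R \<mm>\<^esub> (\<mm> +> \<rho> z)"
      using yz \<rho> by (simp add: f_def residue_simps)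
  next
    fix r y assume ry: "r \<in> carrier R" "y \<in> carrier M"
    have "f (r \<odot>\<^bsub>M\<^esub> y) = \<mm> +> (r \<otimes> \<rho> y)"
      using \<rho>[OF ry(2)] ry x cong_smult[OF K(1), of y _ r]
      by (intro feq) (auto simp: smult_assoc1)
    then show "\<mm> +> \<rho> (r \<odot>\<^bsub>M\<^esub> y) = r \<odot>\<^bsub>residue_module R \<mm>\<^esub> (\<mm> +> \<rho> y)"
      using ry \<rho> by (simp add: f_def residue_simps)
  qed (use \<rho> residue_simps in auto)
  show thesis
  proof (rule that[OF fh])
    fix t assume "t \<in> T"
    then have t: "t \<in> carrier M" "t \<in> K" using sub_carrier[OF T(1)] K by auto
    then have "f t = \<mm> +> \<zero>" using x by (intro feq) (simp_all add: cong_zero_iff[OF K(1)])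
    then show "f t = \<zero>\<^bsub>residue_module R \<mm>\<^esub>" using residue_simps(2)[of \<zero> \<zero>] idl_zero[OF m_ideal] by simp
  next
    have "f x = \<mm> +> \<one>" using x cong_refl[OF K(1)] by (intro feq) simp_all
    then show "f x \<noteq> \<zero>\<^bsub>residue_module R \<mm>\<^esub>" using residue_simps(2)[of \<one> \<one>] one_notin_m by simp
  qed
qed

text \<open>Krull's intersection theorem as separatedness: identities between limits are checked
  modulo every \<mm>^n M.\<close>

lemma filt_eqI:
  assumes "\<And>n. mod_cong M (filt M n) x y"
  shows "x = y"
proof -
  have c: "x \<in> carrier M" "y \<in> carrier M" using assms by (auto simp: mod_cong_def)
  have "x \<ominus>\<^bsub>M\<^esub> y = \<zero>\<^bsub>M\<^esub>" using assms by (intro filt_zeroI) (auto simp: mod_cong_def)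
  then have "mod_cong M {\<zero>\<^bsub>M\<^esub>} x y" using c by (simp add: mod_cong_def)
  then show ?thesis using c by (elim congE_add) simp
qed

lemma hom_filt:
  assumes "f \<in> mod_hom R M M" "x \<in> filt M n"
  shows "f x \<in> filt M n"
  unfolding filt_def
  by (rule mod_hom_ideal_times[OF module_axioms module_axioms assms(1) mpow_subset
        mod_hom_closed[OF assms(1)] order_refl order_refl assms(2)[unfolded filt_def]])

end

locale complete_module = fg_local_module +
  assumes complete: "adic_complete R \<mm>"
begin

text \<open>Completeness of finitely generated modules over a complete ring. The span of T carries
  the filtration by \<mm>^n times that span, not by its intersections with \<mm>^n M; so adjoining g
  adds exactly \<mm>^n g, and the induction on T requires no comparison of topologies.\<close>

lemma limit_aux:
  assumes "finite T" "T \<subseteq> carrier M"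
    "\<And>n::nat. mod_cong M (ideal_times R (mpow n) M (mod_span R M T)) (y (Suc n)) (y n)"
  shows "\<exists>l. \<forall>n. mod_cong M (ideal_times R (mpow n) M (mod_span R M T)) l (y n)"
  using assms
proof (induct T arbitrary: y)
  case empty
  have e: "ideal_times R (mpow n) M (mod_span R M {}) = {\<zero>\<^bsub>M\<^esub>}" for n
  proof
    show "ideal_times R (mpow n) M (mod_span R M {}) \<subseteq> {\<zero>\<^bsub>M\<^esub>}"
      by (rule times_least[OF sub_zero_module]) (auto simp: span_empty mpow_carrier)
    show "{\<zero>\<^bsub>M\<^esub>} \<subseteq> ideal_times R (mpow n) M (mod_span R M {})"
      using sub_zero[OF times_sub[OF mpow_subset]] by (auto simp: span_empty)
  qed
  have yc: "y n \<in> carrier M" for n using empty(2)[of n] by (auto simp: mod_cong_def)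
  have "mod_cong M {\<zero>\<^bsub>M\<^esub>} (y 0) (y n)" for n
  proof (induct n)
    case 0
    show ?case by (rule cong_refl[OF sub_zero_module yc])
  next
    case (Suc n)
    have "mod_cong M {\<zero>\<^bsub>M\<^esub>} (y n) (y (Suc n))"
      using cong_sym[OF sub_zero_module] empty(2)[of n] by (simp only: e)
    then show ?case by (rule cong_trans[OF sub_zero_module Suc])
  qed
  then show ?case by (auto simp: e)
next
  case (insert g T)
  have gT: "g \<in> carrier M" "T \<subseteq> carrier M" using insert by auto
  note sT = span_sub[OF gT(2)]
  let ?F = "\<lambda>n. ideal_times R (mpow n) M (mod_span R M T)"
  let ?G = "\<lambda>n. ideal_times R (mpow n) M (mod_span R M (insert g T))"
  have sF: "submodule (?F n) R M" for n by (rule times_sub[OF mpow_subset]) (use sub_carrier[OF sT] in auto)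
  have sG: "submodule (?G n) R M" for n by (rule times_sub[OF mpow_subset]) (use sub_carrier[OF span_sub[OF insert(4)]] in auto)
  have FG: "?F n \<subseteq> ?G n" for n by (rule times_mono) (auto intro: span_mono[THEN subsetD])
  have gG: "a \<odot>\<^bsub>M\<^esub> g \<in> ?G n" if "a \<in> mpow n" for a n by (rule times_mem[OF that span_mem]) simp
  have yc: "y n \<in> carrier M" for n using insert(5)[of n] by (auto simp: mod_cong_def)
  have "\<exists>u\<in>?F n. \<exists>a\<in>mpow n. z = u \<oplus>\<^bsub>M\<^esub> a \<odot>\<^bsub>M\<^esub> g" if z: "z \<in> ?G n" for z n
  proof -
    have a: "submodule {a \<odot>\<^bsub>M\<^esub> g | a. a \<in> mpow n} R M"
    proof (rule subI)
      show "{a \<odot>\<^bsub>M\<^esub> g | a. a \<in> mpow n} \<subseteq> carrier M" using gT mpow_carrier by auto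
      show "\<zero>\<^bsub>M\<^esub> \<in> {a \<odot>\<^bsub>M\<^esub> g | a. a \<in> mpow n}" using smult_l_null[OF gT(1), symmetric] idl_zero[OF mpow_ideal] by blast
    next
      fix p q assume "p \<in> {a \<odot>\<^bsub>M\<^esub> g | a. a \<in> mpow n}" "q \<in> {a \<odot>\<^bsub>M\<^esub> g | a. a \<in> mpow n}"
      then obtain a b where "a \<in> mpow n" "b \<in> mpow n" "p = a \<odot>\<^bsub>M\<^esub> g" "q = b \<odot>\<^bsub>M\<^esub> g" by auto
      then show "p \<oplus>\<^bsub>M\<^esub> q \<in> {a \<odot>\<^bsub>M\<^esub> g | a. a \<in> mpow n}"
        using gT idl_add[OF mpow_ideal, of a n b] mpow_carrier[of _ n]
        by (auto simp: smult_l_distr intro!: exI[of _ "a \<oplus> b"])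
    next
      fix r p assume r: "r \<in> carrier R" "p \<in> {a \<odot>\<^bsub>M\<^esub> g | a. a \<in> mpow n}"
      then obtain a where "a \<in> mpow n" "p = a \<odot>\<^bsub>M\<^esub> g" by auto
      then show "r \<odot>\<^bsub>M\<^esub> p \<in> {a \<odot>\<^bsub>M\<^esub> g | a. a \<in> mpow n}"
        using gT r idl_mult[OF mpow_ideal, of a n r] mpow_carrier[of _ n]
        by (auto simp: smult_assoc1 intro!: exI[of _ "r \<otimes> a"])
    qed
    have "?G n \<subseteq> ?F n <+>\<^bsub>M\<^esub> {a \<odot>\<^bsub>M\<^esub> g | a. a \<in> mpow n}"
    proof (rule times_least[OF sub_set_add[OF sF a]])
      fix a x assume ax: "a \<in> mpow n" "x \<in> mod_span R M (insert g T)"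
      then obtain h r where hr: "h \<in> mod_span R M T" "r \<in> carrier R" "x = h \<oplus>\<^bsub>M\<^esub> r \<odot>\<^bsub>M\<^esub> g"
        using span_insert[OF gT(2,1)] adjoin_mem by blast
      have "a \<odot>\<^bsub>M\<^esub> x = a \<odot>\<^bsub>M\<^esub> h \<oplus>\<^bsub>M\<^esub> (a \<otimes> r) \<odot>\<^bsub>M\<^esub> g"
        using hr mpow_carrier[OF ax(1)] gT sub_carrier[OF sT hr(1)] by (simp add: smult_r_distr smult_assoc1)
      moreover have "a \<odot>\<^bsub>M\<^esub> h \<in> ?F n" by (rule times_mem[OF ax(1) hr(1)])
      moreover have "a \<otimes> r \<in> mpow n" by (rule idl_mult'[OF mpow_ideal ax(1) hr(2)])
      ultimately show "a \<odot>\<^bsub>M\<^esub> x \<in> ?F n <+>\<^bsub>M\<^esub> {a \<odot>\<^bsub>M\<^esub> g | a. a \<in> mpow n}"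
        by (auto simp: set_add_mem)
    qed
    then show ?thesis using z unfolding subset_iff set_add_mem by blast
  qed
  then have "\<exists>u a. u \<in> ?F n \<and> a \<in> mpow n \<and> y (Suc n) \<ominus>\<^bsub>M\<^esub> y n = u \<oplus>\<^bsub>M\<^esub> a \<odot>\<^bsub>M\<^esub> g" for n
    using insert(5)[of n] unfolding mod_cong_def by blast
  \<comment> \<open>The increments of y are split into a part from the old span and a multiple of g.
    The coefficients of g sum to some r in R, the other parts converge to some l by induction, and
    the limit is l + r g.\<close>
  then have "\<exists>u a. \<forall>n. u n \<in> ?F n \<and> a n \<in> mpow n \<and> y (Suc n) \<ominus>\<^bsub>M\<^esub> y n = u n \<oplus>\<^bsub>M\<^esub> a n \<odot>\<^bsub>M\<^esub> g"
    by (subst choice_iff[symmetric], subst choice_iff[symmetric]) blast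
  then obtain u a where ua: "\<And>n. u n \<in> ?F n" "\<And>n. a n \<in> mpow n"
    "\<And>n. y (Suc n) \<ominus>\<^bsub>M\<^esub> y n = u n \<oplus>\<^bsub>M\<^esub> a n \<odot>\<^bsub>M\<^esub> g" by blast
  have uc: "u n \<in> carrier M" for n by (rule sub_carrier[OF sF ua(1)])
  have ac: "a n \<in> carrier R" for n by (rule mpow_carrier[OF ua(2)])
  obtain c r where c: "r \<in> carrier R" "\<And>n. c n \<in> carrier R" "c 0 = \<zero>" "\<And>n. c (Suc n) = c n \<oplus> a n"
    "\<And>n. r \<ominus> c n \<in> mpow n" using complete_series[OF complete ua(2)] by auto
  define z where "z = rec_nat (y 0) (\<lambda>n x. x \<oplus>\<^bsub>M\<^esub> u n)"
  have z0: "z 0 = y 0" "\<And>n. z (Suc n) = z n \<oplus>\<^bsub>M\<^esub> u n" by (simp_all add: z_def)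
  have zc: "z n \<in> carrier M" for n by (induct n) (simp_all add: z0 yc uc)
  have yz: "y n = z n \<oplus>\<^bsub>M\<^esub> c n \<odot>\<^bsub>M\<^esub> g" for n
  proof (induct n)
    case 0
    then show ?case using gT yc by (simp add: z0 c)
  next
    case (Suc n)
    have "y (Suc n) = (y (Suc n) \<ominus>\<^bsub>M\<^esub> y n) \<oplus>\<^bsub>M\<^esub> y n" using yc by (simp add: a_minus_def M.a_assoc M.l_neg)
    also have "\<dots> = (u n \<oplus>\<^bsub>M\<^esub> a n \<odot>\<^bsub>M\<^esub> g) \<oplus>\<^bsub>M\<^esub> (z n \<oplus>\<^bsub>M\<^esub> c n \<odot>\<^bsub>M\<^esub> g)" unfolding ua(3) by (simp only: Suc)
    also have "\<dots> = z (Suc n) \<oplus>\<^bsub>M\<^esub> c (Suc n) \<odot>\<^bsub>M\<^esub> g"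
      using uc zc ac c gT by (simp add: z0 c(4) smult_l_distr M.a_ac)
    finally show ?case .
  qed
  have "mod_cong M (?F n) (z (Suc n)) (z n)" for n
    by (rule congI_add[OF sF zc ua(1) z0(2)])
  then have "\<exists>l. \<forall>n. mod_cong M (?F n) l (z n)" by (rule insert(3)[OF gT(2)])
  then obtain l where l: "\<And>n. mod_cong M (?F n) l (z n)" by auto
  have "mod_cong M (?G n) (l \<oplus>\<^bsub>M\<^esub> r \<odot>\<^bsub>M\<^esub> g) (y n)" for n
  proof -
    have "r \<odot>\<^bsub>M\<^esub> g \<ominus>\<^bsub>M\<^esub> c n \<odot>\<^bsub>M\<^esub> g = (r \<ominus> c n) \<odot>\<^bsub>M\<^esub> g"
      using c(1,2) gT by (simp add: a_minus_def smult_l_distr smult_l_minus)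
    then have "mod_cong M (?G n) (r \<odot>\<^bsub>M\<^esub> g) (c n \<odot>\<^bsub>M\<^esub> g)"
      using c(1,2,5) gT gG by (simp add: mod_cong_def)
    then show ?thesis unfolding yz by (rule cong_add[OF sG cong_mono[OF l FG]])
  qed
  then show ?case by blast
qed

lemma limit:
  assumes "\<And>n. mod_cong M (filt M n) (y (Suc n)) (y n)"
  obtains l where "\<And>n. mod_cong M (filt M n) l (y n)"
proof -
  obtain T where "finite T" "T \<subseteq> carrier M" "mod_span R M T = carrier M"
    using fg by (auto simp: fin_gen_module_def)
  then have "\<exists>l. \<forall>n. mod_cong M (filt M n) l (y n)"
    using limit_aux[of T y] assms by (simp add: filt_def)
  then show thesis using that by blast
qed

end

subsection \<open>Lifting idempotents\<close>

context complete_module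
begin

text \<open>Newton's iteration \<open>a \<mapsto> 3a\<^sup>2 - 2a\<^sup>3 = a\<^sup>2 (1 + 2b)\<close> with \<open>b = 1 - a\<close>. Since
  \<open>a\<^sup>2 (1 + 2b) + b\<^sup>2 (1 + 2a) = (a + b)\<^sup>2 = 1\<close>, the new defect is
  \<open>(a b)\<^sup>2 (1 + 2b) (1 + 2a)\<close>.\<close>

lemma idempotent_step:
  assumes a: "a \<in> mod_hom R M M" and n: "n > 0"
    and d: "\<And>x. x \<in> carrier M \<Longrightarrow> a (x \<ominus>\<^bsub>M\<^esub> a x) \<in> filt M n"
  shows "\<exists>a'\<in>mod_hom R M M. (\<forall>x\<in>carrier M. mod_cong M (filt M n) (a' x) (a x)) \<and>
    (\<forall>x\<in>carrier M. a' (x \<ominus>\<^bsub>M\<^esub> a' x) \<in> filt M (Suc n))"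
proof -
  define b where "b = (\<lambda>x\<in>carrier M. x \<ominus>\<^bsub>M\<^esub> a x)"
  note ac [simp] = mod_hom_closed[OF a]
  note aa = mod_hom_add[OF a] and am = mod_hom_minus[OF module_axioms module_axioms a]
  have b: "b \<in> mod_hom R M M" unfolding b_def
  proof (rule mod_hom_restrictI[OF module_axioms])
    fix x y assume "x \<in> carrier M" "y \<in> carrier M"
    then show "x \<oplus>\<^bsub>M\<^esub> y \<ominus>\<^bsub>M\<^esub> a (x \<oplus>\<^bsub>M\<^esub> y) = x \<ominus>\<^bsub>M\<^esub> a x \<oplus>\<^bsub>M\<^esub> (y \<ominus>\<^bsub>M\<^esub> a y)"
      by (simp add: aa a_minus_def M.minus_add M.a_ac)
  next
    fix r x assume "r \<in> carrier R" "x \<in> carrier M"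
    then show "r \<odot>\<^bsub>M\<^esub> x \<ominus>\<^bsub>M\<^esub> a (r \<odot>\<^bsub>M\<^esub> x) = r \<odot>\<^bsub>M\<^esub> (x \<ominus>\<^bsub>M\<^esub> a x)"
      by (simp add: mod_hom_smult[OF a] a_minus_def smult_r_distr smult_r_minus)
  qed simp
  note bc [simp] = mod_hom_closed[OF b]
  note ba = mod_hom_add[OF b]
  have bx: "x \<ominus>\<^bsub>M\<^esub> a x = b x" if "x \<in> carrier M" for x using that by (simp add: b_def)
  have comm: "b (a x) = a (b x)" if "x \<in> carrier M" for x
    using that by (simp add: b_def am)
  have ab1: "a x \<oplus>\<^bsub>M\<^esub> b x = x" if x: "x \<in> carrier M" for x
    using that by (simp add: b_def a_minus_def M.a_comm[of x] M.r_neg1 M.r_neg2)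
  have abf: "a (b x) \<in> filt M n" if "x \<in> carrier M" for x using d[OF that] bx[OF that] by simp
  \<comment> \<open>These two are 1 + 2 b and 1 + 2 a.\<close>
  define g where "g = (\<lambda>x\<in>carrier M. x \<oplus>\<^bsub>M\<^esub> (b x \<oplus>\<^bsub>M\<^esub> b x))"
  define h where "h = (\<lambda>x\<in>carrier M. x \<oplus>\<^bsub>M\<^esub> (a x \<oplus>\<^bsub>M\<^esub> a x))"
  have id: "(\<lambda>x\<in>carrier M. x) \<in> mod_hom R M M" by (rule mod_hom_id[OF module_axioms])
  have g: "g \<in> mod_hom R M M"
    using mod_hom_lin[OF module_axioms module_axioms id mod_hom_lin[OF module_axioms module_axioms b b]]
    unfolding g_def by (simp cong: restrict_cong)
  have h: "h \<in> mod_hom R M M"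
    using mod_hom_lin[OF module_axioms module_axioms id mod_hom_lin[OF module_axioms module_axioms a a]]
    unfolding h_def by (simp cong: restrict_cong)
  note gc [simp] = mod_hom_closed[OF g] and hc [simp] = mod_hom_closed[OF h]
  define a' where "a' = compose (carrier M) a (compose (carrier M) a g)"
  have a': "a' \<in> mod_hom R M M" unfolding a'_def
    by (rule mod_hom_compose[OF module_axioms mod_hom_compose[OF module_axioms g a] a])
  have a'x: "a' x = a (a (g x))" if "x \<in> carrier M" for x
    using that by (simp add: a'_def compose_def)
  have exp: "a' x = a (a x) \<oplus>\<^bsub>M\<^esub> (a (a (b x)) \<oplus>\<^bsub>M\<^esub> a (a (b x)))" if "x \<in> carrier M" for x
    using that by (simp add: a'x g_def aa)
  have exp': "b (b (h x)) = b (b x) \<oplus>\<^bsub>M\<^esub> (a (b (b x)) \<oplus>\<^bsub>M\<^esub> a (b (b x)))" if "x \<in> carrier M" for x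
    using that by (simp add: h_def ba comm)
  have sum1: "a' x \<oplus>\<^bsub>M\<^esub> b (b (h x)) = x" if x: "x \<in> carrier M" for x
  proof -
    have 1: "a x = a (a x) \<oplus>\<^bsub>M\<^esub> a (b x)" using x aa[of "a x" "b x"] ab1[OF x] by simp
    have 2: "b x = a (b x) \<oplus>\<^bsub>M\<^esub> b (b x)" using x ab1[of "b x"] by simp
    have 3: "a (b x) = a (a (b x)) \<oplus>\<^bsub>M\<^esub> a (b (b x))"
      using x aa[of "a (b x)" "b (b x)"] 2 by simp
    have "x = (a (a x) \<oplus>\<^bsub>M\<^esub> a (b x)) \<oplus>\<^bsub>M\<^esub> (a (b x) \<oplus>\<^bsub>M\<^esub> b (b x))"
      using ab1[OF x] 1 2 by simp
    also have "\<dots> = (a (a x) \<oplus>\<^bsub>M\<^esub> (a (a (b x)) \<oplus>\<^bsub>M\<^esub> a (b (b x)))) \<oplus>\<^bsub>M\<^esub> ((a (a (b x)) \<oplus>\<^bsub>M\<^esub> a (b (b x))) \<oplus>\<^bsub>M\<^esub> b (b x))"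
      using 3 by simp
    also have "\<dots> = a' x \<oplus>\<^bsub>M\<^esub> b (b (h x))"
      using x by (simp add: exp exp' M.a_ac)
    finally show ?thesis by simp
  qed
  show ?thesis
  proof (intro bexI[OF _ a'] conjI ballI)
    fix x assume x: "x \<in> carrier M"
    let ?u = "a (a (b x))"
    have uf: "?u \<in> filt M n" by (rule hom_filt[OF a abf[OF x]])
    have u0: "mod_cong M (filt M n) ?u \<zero>\<^bsub>M\<^esub>" using uf by (simp add: cong_zero_iff[OF filt_sub])
    have 1: "mod_cong M (filt M n) (a' x) (a (a x))"
      using cong_add[OF filt_sub cong_refl[OF filt_sub, of "a (a x)"] cong_add[OF filt_sub u0 u0]] x
      by (simp add: exp)
    have "a x = a (a x) \<oplus>\<^bsub>M\<^esub> a (b x)" using x aa[of "a x" "b x"] ab1[OF x] by simp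
    then have "mod_cong M (filt M n) (a x) (a (a x))"
      by (rule congI_add[OF filt_sub _ abf[OF x], rotated]) (use x in simp)
    then show "mod_cong M (filt M n) (a' x) (a x)"
      using cong_trans[OF filt_sub 1] cong_sym[OF filt_sub] by blast
  next
    fix x assume x: "x \<in> carrier M"
    have "x \<ominus>\<^bsub>M\<^esub> a' x = b (b (h x))"
      using sum1[OF x] x mod_hom_closed[OF a' x]
      by (metis M.add.inv_solve_right' M.a_comm M.minus_eq bc hc)
    then have "a' (x \<ominus>\<^bsub>M\<^esub> a' x) = a (a (g (b (b (h x)))))" using x by (simp add: a'x)
    also have "\<dots> = g (a (b (a (b (h x)))))"
    proof -
      have gb: "g (b y) = b (g y)" if "y \<in> carrier M" for y using that by (simp add: g_def ba)
      have ga: "g (a y) = a (g y)" if "y \<in> carrier M" for y using that by (simp add: g_def aa comm)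
      show ?thesis using x by (simp add: gb ga comm)
    qed
    finally have e: "a' (x \<ominus>\<^bsub>M\<^esub> a' x) = g (a (b (a (b (h x)))))" .
    have "y \<in> filt M n \<Longrightarrow> a (b y) \<in> filt M (Suc n)" for y
    proof -
      assume y: "y \<in> filt M n"
      have r: "(\<lambda>x\<in>carrier M. a (b x)) \<in> mod_hom R M M"
        using mod_hom_compose[OF module_axioms b a] by (simp add: compose_def)
      \<comment> \<open>The map a b sends M into \<mm>^n M, hence \<mm>^n M into \<mm>^(2 n) M. As n
        > 0, this lies in \<mm>^(n+1) M; linear convergence is all that the limit requires.\<close>
      have "(\<lambda>x\<in>carrier M. a (b x)) y \<in> filt M (n + n)"
      proof -
        have "y \<in> ideal_times R (mpow n) M (carrier M)" using y by (simp add: filt_def)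
        then have "(\<lambda>x\<in>carrier M. a (b x)) y \<in> ideal_times R (mpow n) M (filt M n)"
          by (rule mod_hom_ideal_times[OF module_axioms module_axioms r mpow_subset, rotated 3])
            (use abf filt_carrier in auto)
        moreover have "ideal_times R (mpow n) M (filt M n) \<subseteq> filt M (n + n)"
          by (rule times_least[OF filt_sub filt_smult])
        ultimately show ?thesis by auto
      qed
      moreover have "filt M (n + n) \<subseteq> filt M (Suc n)" by (rule filt_antimono) (use n in simp)
      ultimately show ?thesis using filt_carrier[OF y] by auto
    qed
    then have "a (b (a (b (h x)))) \<in> filt M (Suc n)" using abf x by simp
    then show "a' (x \<ominus>\<^bsub>M\<^esub> a' x) \<in> filt M (Suc n)" unfolding e by (rule hom_filt[OF g])
  qed
qed

lemma idempotent_lift: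
  assumes \<psi>: "\<psi> \<in> mod_hom R M M" and d: "\<And>x. x \<in> carrier M \<Longrightarrow> \<psi> (x \<ominus>\<^bsub>M\<^esub> \<psi> x) \<in> filt M 1"
  shows "\<exists>e\<in>mod_hom R M M. (\<forall>x\<in>carrier M. e (e x) = e x) \<and> (\<forall>x\<in>carrier M. mod_cong M (filt M 1) (e x) (\<psi> x))"
proof -
  \<comment> \<open>The last clause ties the start of the sequence to \<psi>. The defect is taken
    one index ahead, so that \<open>idempotent_step\<close> is applied with a positive
    exponent.\<close>
  define P where "P = (\<lambda>k a. a \<in> mod_hom R M M \<and> (\<forall>x\<in>carrier M. a (x \<ominus>\<^bsub>M\<^esub> a x) \<in> filt M (Suc k)) \<and>
    (k = 0 \<longrightarrow> a = \<psi>))"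
  have "\<exists>f. \<forall>k. P k (f k) \<and> (\<forall>x\<in>carrier M. mod_cong M (filt M (Suc k)) (f (Suc k) x) (f k x))"
  proof (rule dependent_nat_choice)
    show "\<exists>a. P 0 a" using assms by (auto simp: P_def)
    fix a k assume "P k a"
    then have "a \<in> mod_hom R M M" "\<And>x. x \<in> carrier M \<Longrightarrow> a (x \<ominus>\<^bsub>M\<^esub> a x) \<in> filt M (Suc k)"
      by (auto simp: P_def)
    from idempotent_step[OF this(1) _ this(2)]
    show "\<exists>b. P (Suc k) b \<and> (\<forall>x\<in>carrier M. mod_cong M (filt M (Suc k)) (b x) (a x))"
      by (auto simp: P_def)
  qed
  then obtain f where f: "\<And>k. P k (f k)"
    "\<And>k x. x \<in> carrier M \<Longrightarrow> mod_cong M (filt M (Suc k)) (f (Suc k) x) (f k x)" by blast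
  have fh: "f k \<in> mod_hom R M M" for k using f(1) by (simp add: P_def)
  have fd: "x \<in> carrier M \<Longrightarrow> f k (x \<ominus>\<^bsub>M\<^esub> f k x) \<in> filt M k" for x k
    using f(1)[of k] filt_antimono[of k "Suc k"] by (auto simp: P_def)
  have f0: "f 0 = \<psi>" using f(1)[of 0] by (simp add: P_def)
  have lim: "\<exists>l. \<forall>k. mod_cong M (filt M (Suc k)) l (f k x)" if x: "x \<in> carrier M" for x
  proof -
    \<comment> \<open>\<open>limit\<close> yields a congruence with y n modulo \<mm>^n only.
      Repeating the first term shifts the index, so that the limit agrees with f k modulo
      \<mm>^(k+1); for k = 0 this is the required agreement with \<psi> modulo \<mm> M.\<close>
    define y where "y = (\<lambda>k. case k of 0 \<Rightarrow> f 0 x | Suc k \<Rightarrow> f k x)"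
    have "mod_cong M (filt M k) (y (Suc k)) (y k)" for k
      using f(2)[OF x] cong_refl[OF filt_sub mod_hom_closed[OF fh x]] by (cases k) (auto simp: y_def)
    then obtain l where l: "\<And>k. mod_cong M (filt M k) l (y k)" by (rule limit) blast
    have "mod_cong M (filt M (Suc k)) l (f k x)" for k using l[of "Suc k"] by (simp add: y_def)
    then show ?thesis by blast
  qed
  then obtain e0 where e0: "\<And>x k. x \<in> carrier M \<Longrightarrow> mod_cong M (filt M (Suc k)) (e0 x) (f k x)" by metis
  define e where "e = restrict e0 (carrier M)"
  have ek1: "mod_cong M (filt M (Suc k)) (e x) (f k x)" if "x \<in> carrier M" for x k
    using e0[OF that] that by (simp add: e_def)
  have ek: "mod_cong M (filt M k) (e x) (f k x)" if "x \<in> carrier M" for x k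
    by (rule cong_mono[OF ek1[OF that] filt_antimono]) simp
  have ec: "e x \<in> carrier M" if "x \<in> carrier M" for x using ek[OF that] by (simp add: mod_cong_def)
  have eh: "e \<in> mod_hom R M M"
  proof (rule mod_homI)
    show "e \<in> extensional (carrier M)" by (simp add: e_def)
    fix x y assume xy: "x \<in> carrier M" "y \<in> carrier M"
    show "e (x \<oplus>\<^bsub>M\<^esub> y) = e x \<oplus>\<^bsub>M\<^esub> e y"
    proof (rule filt_eqI)
      fix k
      have "mod_cong M (filt M k) (e x \<oplus>\<^bsub>M\<^esub> e y) (f k (x \<oplus>\<^bsub>M\<^esub> y))"
        using cong_add[OF filt_sub ek[OF xy(1)] ek[OF xy(2)], of k] xy by (simp add: mod_hom_add[OF fh])
      then show "mod_cong M (filt M k) (e (x \<oplus>\<^bsub>M\<^esub> y)) (e x \<oplus>\<^bsub>M\<^esub> e y)"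
        using cong_trans[OF filt_sub ek cong_sym[OF filt_sub]] xy by simp
    qed
  next
    fix r x assume rx: "r \<in> carrier R" "x \<in> carrier M"
    show "e (r \<odot>\<^bsub>M\<^esub> x) = r \<odot>\<^bsub>M\<^esub> e x"
    proof (rule filt_eqI)
      fix k
      have "mod_cong M (filt M k) (r \<odot>\<^bsub>M\<^esub> e x) (f k (r \<odot>\<^bsub>M\<^esub> x))"
        using cong_smult[OF filt_sub ek[OF rx(2)] rx(1), of k] rx by (simp add: mod_hom_smult[OF fh])
      then show "mod_cong M (filt M k) (e (r \<odot>\<^bsub>M\<^esub> x)) (r \<odot>\<^bsub>M\<^esub> e x)"
        using cong_trans[OF filt_sub ek cong_sym[OF filt_sub]] rx by simp
    qed
  qed (rule ec)
  show ?thesis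
  proof (intro bexI[OF _ eh] conjI ballI)
    fix x assume x: "x \<in> carrier M"
    have exc: "e x \<in> carrier M" by (rule ec[OF x])
    show "e (e x) = e x"
    proof (rule filt_eqI)
      fix k
      have fc: "f k x \<in> carrier M" "f k (f k x) \<in> carrier M" using mod_hom_closed[OF fh] x by auto
      have 1: "mod_cong M (filt M k) (f k (e x)) (f k (f k x))"
        by (rule mod_hom_cong[OF module_axioms module_axioms fh ek[OF x] hom_filt[OF fh]])
      have 2: "mod_cong M (filt M k) (f k x) (f k (f k x))"
        using fd[OF x, of k] fc x by (simp add: mod_cong_def mod_hom_minus[OF module_axioms module_axioms fh])
      show "mod_cong M (filt M k) (e (e x)) (e x)"
        by (rule cong_trans[OF filt_sub ek[OF exc] cong_trans[OF filt_sub 1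
              cong_trans[OF filt_sub cong_sym[OF filt_sub 2] cong_sym[OF filt_sub ek[OF x]]]]])
    qed
  next
    fix x assume "x \<in> carrier M"
    then show "mod_cong M (filt M 1) (e x) (\<psi> x)" using ek1[of x 0] f0 by simp
  qed
qed

text \<open>The idempotent e lifting \<psi> splits M into e M and the kernel of e, so e is 0 or the
  identity.\<close>

lemma idempotent_trivial:
  assumes ind: "indecomposable_module R M"
    and \<psi>: "\<psi> \<in> mod_hom R M M" and d: "\<And>x. x \<in> carrier M \<Longrightarrow> \<psi> (x \<ominus>\<^bsub>M\<^esub> \<psi> x) \<in> filt M 1"
  shows "(\<forall>x\<in>carrier M. \<psi> x \<in> filt M 1) \<or> (\<forall>x\<in>carrier M. mod_cong M (filt M 1) (\<psi> x) x)"
proof -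
  obtain e where e: "e \<in> mod_hom R M M" "\<forall>x\<in>carrier M. e (e x) = e x"
    "\<forall>x\<in>carrier M. mod_cong M (filt M 1) (e x) (\<psi> x)"
    using idempotent_lift[OF \<psi> d] by blast
  note ec = mod_hom_closed[OF e(1)]
  let ?A = "e ` carrier M" and ?B = "{x \<in> carrier M. e x \<in> {\<zero>\<^bsub>M\<^esub>}}"
  have sA: "submodule ?A R M" by (rule sub_image[OF module_axioms module_axioms e(1) carrier_is_submodule])
  have sB: "submodule ?B R M" by (rule sub_vimage[OF module_axioms module_axioms e(1) sub_zero_module])
  have xe: "x \<ominus>\<^bsub>M\<^esub> e x \<in> ?B" if "x \<in> carrier M" for x
  proof -
    have "e (x \<ominus>\<^bsub>M\<^esub> e x) = e x \<ominus>\<^bsub>M\<^esub> e (e x)"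
      by (rule mod_hom_minus[OF module_axioms module_axioms e(1) that ec[OF that]])
    then show ?thesis using that e(2) ec by (simp add: a_minus_def M.r_neg)
  qed
  have "?A \<inter> ?B = {\<zero>\<^bsub>M\<^esub>}"
  proof
    show "?A \<inter> ?B \<subseteq> {\<zero>\<^bsub>M\<^esub>}" using e(2) by auto
    show "{\<zero>\<^bsub>M\<^esub>} \<subseteq> ?A \<inter> ?B" using sub_zero[OF sA] sub_zero[OF sB] by auto
  qed
  moreover have "?A <+>\<^bsub>M\<^esub> ?B = carrier M"
  proof
    show "?A <+>\<^bsub>M\<^esub> ?B \<subseteq> carrier M"
      by (rule set_add_least[OF carrier_is_submodule]) (use ec in auto)
    show "carrier M \<subseteq> ?A <+>\<^bsub>M\<^esub> ?B"
    proof
      fix x assume x: "x \<in> carrier M"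
      have "x = e x \<oplus>\<^bsub>M\<^esub> (x \<ominus>\<^bsub>M\<^esub> e x)"
        using x ec by (simp add: a_minus_def M.a_comm[of x] M.r_neg1 M.r_neg2)
      then show "x \<in> ?A <+>\<^bsub>M\<^esub> ?B" using set_addI[OF imageI[OF x] xe[OF x], of e] by simp
    qed
  qed
  ultimately have "?A = {\<zero>\<^bsub>M\<^esub>} \<or> ?B = {\<zero>\<^bsub>M\<^esub>}"
    using ind sA sB unfolding indecomposable_module_def by blast
  then show ?thesis
  proof
    assume "?A = {\<zero>\<^bsub>M\<^esub>}"
    then have "\<psi> x \<in> filt M 1" if "x \<in> carrier M" for x
      using e(3) that cong_sym[OF filt_sub] cong_zero_iff[OF filt_sub] by (metis image_eqI singletonD)
    then show ?thesis by blast
  next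
    assume B: "?B = {\<zero>\<^bsub>M\<^esub>}"
    have "mod_cong M (filt M 1) (\<psi> x) x" if x: "x \<in> carrier M" for x
    proof -
      have "x \<ominus>\<^bsub>M\<^esub> e x = \<zero>\<^bsub>M\<^esub>" using xe[OF x] B by auto
      then have "mod_cong M {\<zero>\<^bsub>M\<^esub>} x (e x)" using x ec by (simp add: mod_cong_def)
      then have "x = e x" using x ec by (elim congE_add) simp
      then show ?thesis using e(3) x cong_sym[OF filt_sub] by metis
    qed
    then show ?thesis by blast
  qed
qed

end

subsection \<open>Homomorphisms of finite rank and lifting modulo a regular sequence\<close>

text \<open>These are the homomorphisms that factor through some R^n, written as finite sums of maps
  x \<mapsto> \<phi>(x) n. In this form no free module has to be mentioned, and lifting such a map
  only means moving the elements n.\<close>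

inductive_set rank_homs ::
    "('a, 'r) ring_scheme \<Rightarrow> ('a, 'b) module \<Rightarrow> ('a, 'c) module \<Rightarrow> ('b \<Rightarrow> 'c) set"
  for R M N where
    zero: "zero_hom M N \<in> rank_homs R M N"
  | step: "f \<in> rank_homs R M N \<Longrightarrow> \<phi> \<in> mod_hom R M (self_module R) \<Longrightarrow> n \<in> carrier N \<Longrightarrow>
      (\<lambda>x\<in>carrier M. \<phi> x \<odot>\<^bsub>N\<^esub> n \<oplus>\<^bsub>N\<^esub> f x) \<in> rank_homs R M N"

text \<open>Here \<open>p\<close> is a choice of representatives for a homomorphism M \<rightarrow>
  N / H. For H = J N this amounts to a homomorphism M / J M \<rightarrow> N / J N.\<close>

definition hom_modulo ::
    "('a, 'r) ring_scheme \<Rightarrow> ('a, 'b) module \<Rightarrow> ('a, 'c) module \<Rightarrow> 'c set \<Rightarrow> ('b \<Rightarrow> 'c) \<Rightarrow> bool" where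
  "hom_modulo R M N H p \<longleftrightarrow>
     (\<forall>x\<in>carrier M. p x \<in> carrier N) \<and>
     (\<forall>x\<in>carrier M. \<forall>y\<in>carrier M. mod_cong N H (p (x \<oplus>\<^bsub>M\<^esub> y)) (p x \<oplus>\<^bsub>N\<^esub> p y)) \<and>
     (\<forall>r\<in>carrier R. \<forall>x\<in>carrier M. mod_cong N H (p (r \<odot>\<^bsub>M\<^esub> x)) (r \<odot>\<^bsub>N\<^esub> p x))"

lemma self_module_hom:
  assumes "\<phi> \<in> mod_hom R M (self_module R)"
  shows "x \<in> carrier M \<Longrightarrow> \<phi> x \<in> carrier R"
    and "x \<in> carrier M \<Longrightarrow> y \<in> carrier M \<Longrightarrow> \<phi> (x \<oplus>\<^bsub>M\<^esub> y) = \<phi> x \<oplus>\<^bsub>R\<^esub> \<phi> y"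
    and "r \<in> carrier R \<Longrightarrow> x \<in> carrier M \<Longrightarrow> \<phi> (r \<odot>\<^bsub>M\<^esub> x) = r \<otimes>\<^bsub>R\<^esub> \<phi> x"
  using mod_hom_closed[OF assms] mod_hom_add[OF assms] mod_hom_smult[OF assms]
  by (simp_all add: self_module_def)

lemma rank_one_hom:
  assumes "module R M" "module R N" "\<phi> \<in> mod_hom R M (self_module R)" "n \<in> carrier N"
  shows "(\<lambda>x\<in>carrier M. \<phi> x \<odot>\<^bsub>N\<^esub> n) \<in> mod_hom R M N"
proof -
  interpret M: module R M by fact
  interpret N: module R N by fact
  show ?thesis
    by (rule mod_hom_restrictI)
      (use assms in \<open>auto simp: self_module_hom[OF assms(3)] N.smult_l_distr N.smult_assoc1\<close>)
qed

lemma rank_homs_hom: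
  assumes "module R M" "module R N" "f \<in> rank_homs R M N"
  shows "f \<in> mod_hom R M N"
  using assms(3)
proof induct
  case zero
  show ?case by (rule mod_hom_zero_hom[OF assms(1,2)])
next
  case (step f \<phi> n)
  show ?case
    using mod_hom_lin[OF assms(1,2) rank_one_hom[OF assms(1,2) step(3,4)] step(2)]
    by (simp add: restrict_def cong: if_cong)
qed

lemma hom_modulo_zero:
  assumes "module R M" "module R N" "submodule H R N" "hom_modulo R M N H p"
  shows "p \<zero>\<^bsub>M\<^esub> \<in> H"
proof -
  interpret M: rmodule R M using assms(1) by (rule rmoduleI)
  interpret N: rmodule R N using assms(2) by (rule rmoduleI)
  have "mod_cong N H (p (\<zero>\<^bsub>R\<^esub> \<odot>\<^bsub>M\<^esub> \<zero>\<^bsub>M\<^esub>)) (\<zero>\<^bsub>R\<^esub> \<odot>\<^bsub>N\<^esub> p \<zero>\<^bsub>M\<^esub>)" and "p \<zero>\<^bsub>M\<^esub> \<in> carrier N"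
    using assms(4) M.M.zero_closed M.R.zero_closed unfolding hom_modulo_def by blast+
  then show ?thesis using N.cong_zero_iff[OF assms(3)] by simp
qed

text \<open>A map from R^n to N / H lifts to N: each term \<phi>(x) n of f is replaced by \<phi>(x)
  p(n).\<close>

lemma rank_homs_lift:
  assumes "module R M" "module R L" "module R N" "submodule H R N"
    and p: "hom_modulo R L N H p" and f: "f \<in> rank_homs R M L"
  shows "\<exists>\<psi>\<in>mod_hom R M N. \<forall>x\<in>carrier M. mod_cong N H (\<psi> x) (p (f x))"
  using f
proof induct
  interpret L: rmodule R L using assms(2) by (rule rmoduleI)
  interpret N: rmodule R N using assms(3) by (rule rmoduleI)
  case zero
  have "mod_cong N H \<zero>\<^bsub>N\<^esub> (p \<zero>\<^bsub>L\<^esub>)"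
    using hom_modulo_zero[OF assms(2-4) p] N.cong_zero_iff[OF assms(4)] N.cong_sym[OF assms(4)] by blast
  then show ?case
    by (intro bexI[OF _ mod_hom_zero_hom[OF assms(1,3)]]) (simp add: zero_hom_def)
next
  interpret L: rmodule R L using assms(2) by (rule rmoduleI)
  interpret N: rmodule R N using assms(3) by (rule rmoduleI)
  case (step f \<phi> n)
  then obtain \<psi> where \<psi>: "\<psi> \<in> mod_hom R M N" "\<forall>x\<in>carrier M. mod_cong N H (\<psi> x) (p (f x))" by auto
  have pn: "p n \<in> carrier N" using p step(4) by (simp add: hom_modulo_def)
  note fh = mod_hom_closed[OF rank_homs_hom[OF assms(1,2) step(1)]]
  let ?\<psi> = "\<lambda>x\<in>carrier M. (\<lambda>x\<in>carrier M. \<phi> x \<odot>\<^bsub>N\<^esub> p n) x \<oplus>\<^bsub>N\<^esub> \<psi> x"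
  have "?\<psi> \<in> mod_hom R M N"
    by (rule mod_hom_lin[OF assms(1,3) rank_one_hom[OF assms(1,3) step(3) pn] \<psi>(1)])
  moreover have "mod_cong N H (?\<psi> x) (p (\<phi> x \<odot>\<^bsub>L\<^esub> n \<oplus>\<^bsub>L\<^esub> f x))" if x: "x \<in> carrier M" for x
  proof -
    have \<phi>x: "\<phi> x \<in> carrier R" by (rule self_module_hom(1)[OF step(3) x])
    have c: "\<phi> x \<odot>\<^bsub>L\<^esub> n \<in> carrier L" "f x \<in> carrier L" using \<phi>x step(4) fh[OF x] by auto
    have 1: "mod_cong N H (p (\<phi> x \<odot>\<^bsub>L\<^esub> n \<oplus>\<^bsub>L\<^esub> f x)) (p (\<phi> x \<odot>\<^bsub>L\<^esub> n) \<oplus>\<^bsub>N\<^esub> p (f x))"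
      using p c unfolding hom_modulo_def by blast
    have 2: "mod_cong N H (p (\<phi> x \<odot>\<^bsub>L\<^esub> n)) (\<phi> x \<odot>\<^bsub>N\<^esub> p n)"
      using p \<phi>x step(4) unfolding hom_modulo_def by blast
    have "mod_cong N H (\<phi> x \<odot>\<^bsub>N\<^esub> p n \<oplus>\<^bsub>N\<^esub> \<psi> x) (p (\<phi> x \<odot>\<^bsub>L\<^esub> n) \<oplus>\<^bsub>N\<^esub> p (f x))"
      by (rule N.cong_add[OF assms(4) N.cong_sym[OF assms(4) 2]]) (use \<psi>(2) x in blast)
    from N.cong_trans[OF assms(4) this N.cong_sym[OF assms(4) 1]] show ?thesis using x by simp
  qed
  ultimately show ?case by (intro bexI[of _ ?\<psi>]) auto
qed

context noeth_local
begin

text \<open>The elements a with a N \<subseteq> H form an ideal, so it suffices to test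
  generators.\<close>

lemma ideal_times_gen:
  assumes "rmodule R N" "submodule H R N" "S \<subseteq> carrier R"
    "\<And>a y. a \<in> S \<Longrightarrow> y \<in> carrier N \<Longrightarrow> a \<odot>\<^bsub>N\<^esub> y \<in> H"
  shows "ideal_times R (Idl S) N (carrier N) \<subseteq> H"
proof -
  interpret N: rmodule R N by fact
  have "ideal {a \<in> carrier R. \<forall>y\<in>carrier N. a \<odot>\<^bsub>N\<^esub> y \<in> H} R"
    by (rule idlI) (auto simp: N.smult_l_distr N.smult_assoc1 N.sub_zero[OF assms(2)] N.sub_add[OF assms(2)] N.sub_smult[OF assms(2)])
  from genideal_minimal[OF this, of S]
  have "Idl S \<subseteq> {a \<in> carrier R. \<forall>y\<in>carrier N. a \<odot>\<^bsub>N\<^esub> y \<in> H}" using assms by auto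
  then show ?thesis by (intro N.times_least[OF assms(2)]) auto
qed

text \<open>Multiplication by \<open>x\<close> on \<open>M\<close> factors through a free module, so \<open>x p\<close> lifts to an honest
  homomorphism; regularity of \<open>x\<close> allows to divide the lift by \<open>x\<close>.\<close>

lemma regular_lift_step:
  assumes M: "local_module R \<mm> M" and N: "local_module R \<mm> N"
    and S: "S \<subseteq> carrier R" and x: "x \<in> \<mm>"
    and xM: "(\<lambda>y\<in>carrier M. x \<odot>\<^bsub>M\<^esub> y) \<in> rank_homs R M M"
    and reg: "\<And>y. y \<in> carrier N \<Longrightarrow> (x [^] (2::nat)) \<odot>\<^bsub>N\<^esub> y \<in> ideal_times R (Idl S) N (carrier N) \<Longrightarrow>
      y \<in> ideal_times R (Idl S) N (carrier N)"
    and p: "hom_modulo R M N (ideal_times R (Idl (insert (x [^] (2::nat)) S)) N (carrier N)) p"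
  shows "\<exists>p'. hom_modulo R M N (ideal_times R (Idl S) N (carrier N)) p' \<and>
    (\<forall>y\<in>carrier M. mod_cong N (filt N 1) (p' y) (p y))"
proof -
  interpret M: local_module R \<mm> M by fact
  interpret N: local_module R \<mm> N by fact
  have xc: "x \<in> carrier R" by (rule m_carrier[OF x])
  let ?x2 = "x [^] (2::nat)"
  have x2: "?x2 \<in> carrier R" "\<And>y. y \<in> carrier N \<Longrightarrow> ?x2 \<odot>\<^bsub>N\<^esub> y = x \<odot>\<^bsub>N\<^esub> (x \<odot>\<^bsub>N\<^esub> y)"
    using xc by (auto simp: numeral_2_eq_2 N.smult_assoc1)
  define Q where "Q = ideal_times R (Idl S) N (carrier N)"
  define Q' where "Q' = ideal_times R (Idl (insert ?x2 S)) N (carrier N)"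
  have iS: "Idl S \<subseteq> carrier R" "Idl (insert ?x2 S) \<subseteq> carrier R"
    using idl_carrier[OF genideal_ideal[OF S]] idl_carrier[OF genideal_ideal[of "insert ?x2 S"]] S x2(1)
    by auto
  have sQ: "submodule Q R N" unfolding Q_def by (rule N.times_sub[OF iS(1)]) simp
  have sQ': "submodule Q' R N" unfolding Q'_def by (rule N.times_sub[OF iS(2)]) simp
  have QQ': "Q \<subseteq> Q'" unfolding Q_def Q'_def
    by (rule N.times_mono[OF subset_Idl_subset]) (use S x2 in auto)
  have sI: "submodule ((\<lambda>y\<in>carrier N. ?x2 \<odot>\<^bsub>N\<^esub> y) ` carrier N) R N"
    by (rule sub_image[OF N.module_axioms N.module_axioms N.scale_hom[OF x2(1)] N.carrier_is_submodule])
  \<comment> \<open>In other words, Q' = Q + x^2 N.\<close>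
  have Q'D: "\<exists>w\<in>Q. \<exists>z\<in>carrier N. u = w \<oplus>\<^bsub>N\<^esub> x \<odot>\<^bsub>N\<^esub> (x \<odot>\<^bsub>N\<^esub> z)" if u: "u \<in> Q'" for u
  proof -
    have "Q' \<subseteq> Q <+>\<^bsub>N\<^esub> ((\<lambda>y\<in>carrier N. ?x2 \<odot>\<^bsub>N\<^esub> y) ` carrier N)"
      unfolding Q'_def
    proof (rule ideal_times_gen[OF N.rmodule_axioms N.sub_set_add[OF sQ sI]])
      fix a y assume a: "a \<in> insert ?x2 S" and y: "y \<in> carrier N"
      from a show "a \<odot>\<^bsub>N\<^esub> y \<in> Q <+>\<^bsub>N\<^esub> ((\<lambda>y\<in>carrier N. ?x2 \<odot>\<^bsub>N\<^esub> y) ` carrier N)"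
      proof
        assume "a = ?x2"
        then have "a \<odot>\<^bsub>N\<^esub> y \<in> (\<lambda>y\<in>carrier N. ?x2 \<odot>\<^bsub>N\<^esub> y) ` carrier N" using y by auto
        then show ?thesis using N.set_add_upper(2)[OF sQ sI] by blast
      next
        assume "a \<in> S"
        then have "a \<odot>\<^bsub>N\<^esub> y \<in> Q" unfolding Q_def
          using genideal_self[OF S] y by (intro N.times_mem) auto
        then show ?thesis using N.set_add_upper(1)[OF sQ sI] by blast
      qed
    qed (use S x2 in auto)
    then have "u \<in> Q <+>\<^bsub>N\<^esub> ((\<lambda>y\<in>carrier N. ?x2 \<odot>\<^bsub>N\<^esub> y) ` carrier N)" using u by (rule subsetD)
    then obtain w z where "w \<in> Q" "z \<in> carrier N" "u = w \<oplus>\<^bsub>N\<^esub> ?x2 \<odot>\<^bsub>N\<^esub> z"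
      unfolding N.set_add_mem by auto
    then show ?thesis using x2(2) by (intro bexI[of _ w] bexI[of _ z]) simp_all
  qed
  \<comment> \<open>If x^2 is regular on N / Q, then so is x.\<close>
  have canc: "mod_cong N Q u v" if uv: "u \<in> carrier N" "v \<in> carrier N" "mod_cong N Q (x \<odot>\<^bsub>N\<^esub> u) (x \<odot>\<^bsub>N\<^esub> v)" for u v
  proof -
    have "mod_cong N Q (x \<odot>\<^bsub>N\<^esub> (x \<odot>\<^bsub>N\<^esub> u)) (x \<odot>\<^bsub>N\<^esub> (x \<odot>\<^bsub>N\<^esub> v))"
      by (rule N.cong_smult[OF sQ uv(3) xc])
    then have "?x2 \<odot>\<^bsub>N\<^esub> (u \<ominus>\<^bsub>N\<^esub> v) \<in> Q"
      using uv xc by (simp add: mod_cong_def x2 a_minus_def N.smult_r_distr N.smult_r_minus)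
    then show ?thesis using reg[of "u \<ominus>\<^bsub>N\<^esub> v"] uv by (auto simp: Q_def mod_cong_def)
  qed
  have p': "hom_modulo R M N Q' p" using p by (simp add: Q'_def)
  obtain \<psi> where \<psi>: "\<psi> \<in> mod_hom R M N" "\<forall>y\<in>carrier M. mod_cong N Q' (\<psi> y) (p ((\<lambda>y\<in>carrier M. x \<odot>\<^bsub>M\<^esub> y) y))"
    using rank_homs_lift[OF M.module_axioms M.module_axioms N.module_axioms sQ' p' xM] by (elim bexE)
  note \<psi>c = mod_hom_closed[OF \<psi>(1)]
  have pc: "p y \<in> carrier N" if "y \<in> carrier M" for y using p' that by (simp add: hom_modulo_def)
  \<comment> \<open>The lift satisfies \<psi>(y) = x p(y) + x^2 z + w = x (p(y) + x z) + w with w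
    \<in> Q. Thanks to the square, division by x alters p(y) only by x z, which lies in \<mm>
    N.\<close>
  have "\<exists>z\<in>carrier N. mod_cong N Q (\<psi> y) (x \<odot>\<^bsub>N\<^esub> (p y \<oplus>\<^bsub>N\<^esub> x \<odot>\<^bsub>N\<^esub> z))" if y: "y \<in> carrier M" for y
  proof -
    have "mod_cong N Q' (\<psi> y) (x \<odot>\<^bsub>N\<^esub> p y)"
    proof (rule N.cong_trans[OF sQ'])
      show "mod_cong N Q' (\<psi> y) (p (x \<odot>\<^bsub>M\<^esub> y))" using \<psi>(2) y by auto
      show "mod_cong N Q' (p (x \<odot>\<^bsub>M\<^esub> y)) (x \<odot>\<^bsub>N\<^esub> p y)" using p' y xc by (auto simp: hom_modulo_def)
    qed
    then obtain u where u: "u \<in> Q'" "\<psi> y = x \<odot>\<^bsub>N\<^esub> p y \<oplus>\<^bsub>N\<^esub> u" by (rule N.congE_add)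
    obtain w z where wz: "w \<in> Q" "z \<in> carrier N" "u = w \<oplus>\<^bsub>N\<^esub> x \<odot>\<^bsub>N\<^esub> (x \<odot>\<^bsub>N\<^esub> z)" using Q'D[OF u(1)] by auto
    have wc: "w \<in> carrier N" by (rule N.sub_carrier[OF sQ wz(1)])
    have "\<psi> y = x \<odot>\<^bsub>N\<^esub> (p y \<oplus>\<^bsub>N\<^esub> x \<odot>\<^bsub>N\<^esub> z) \<oplus>\<^bsub>N\<^esub> w"
      using u wz wc xc pc[OF y] by (simp add: N.smult_r_distr N.M.a_ac)
    then show ?thesis using wz xc pc[OF y] by (intro bexI[OF _ wz(2)] N.congI_add[OF sQ _ wz(1)]) auto
  qed
  then obtain \<zeta> where \<zeta>: "\<And>y. y \<in> carrier M \<Longrightarrow> \<zeta> y \<in> carrier N \<and> mod_cong N Q (\<psi> y) (x \<odot>\<^bsub>N\<^esub> (p y \<oplus>\<^bsub>N\<^esub> x \<odot>\<^bsub>N\<^esub> \<zeta> y))"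
    by metis
  define p1 where "p1 = (\<lambda>y. p y \<oplus>\<^bsub>N\<^esub> x \<odot>\<^bsub>N\<^esub> \<zeta> y)"
  have p1c: "p1 y \<in> carrier N" if "y \<in> carrier M" for y using \<zeta>[OF that] pc[OF that] xc by (simp add: p1_def)
  have p1: "mod_cong N Q (x \<odot>\<^bsub>N\<^esub> p1 y) (\<psi> y)" if "y \<in> carrier M" for y
    using \<zeta>[OF that] N.cong_sym[OF sQ] by (simp add: p1_def)
  have "hom_modulo R M N Q p1"
    unfolding hom_modulo_def
  proof (intro conjI ballI)
    fix y z assume yz: "y \<in> carrier M" "z \<in> carrier M"
    have "mod_cong N Q (x \<odot>\<^bsub>N\<^esub> (p1 y \<oplus>\<^bsub>N\<^esub> p1 z)) (\<psi> (y \<oplus>\<^bsub>M\<^esub> z))"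
      using N.cong_add[OF sQ p1[OF yz(1)] p1[OF yz(2)]] yz p1c xc
      by (simp add: mod_hom_add[OF \<psi>(1)] N.smult_r_distr)
    then show "mod_cong N Q (p1 (y \<oplus>\<^bsub>M\<^esub> z)) (p1 y \<oplus>\<^bsub>N\<^esub> p1 z)"
      using yz p1c by (auto intro!: canc[OF _ _ N.cong_trans[OF sQ p1 N.cong_sym[OF sQ]]])
  next
    fix r y assume ry: "r \<in> carrier R" "y \<in> carrier M"
    have "mod_cong N Q (x \<odot>\<^bsub>N\<^esub> (r \<odot>\<^bsub>N\<^esub> p1 y)) (\<psi> (r \<odot>\<^bsub>M\<^esub> y))"
      using N.cong_smult[OF sQ p1[OF ry(2)] ry(1)] ry p1c xc
      by (simp add: mod_hom_smult[OF \<psi>(1)] N.smult_assoc1[symmetric] m_comm)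
    then show "mod_cong N Q (p1 (r \<odot>\<^bsub>M\<^esub> y)) (r \<odot>\<^bsub>N\<^esub> p1 y)"
      using ry p1c by (auto intro!: canc[OF _ _ N.cong_trans[OF sQ p1 N.cong_sym[OF sQ]]])
  qed (rule p1c)
  moreover have "mod_cong N (filt N 1) (p1 y) (p y)" if y: "y \<in> carrier M" for y
    unfolding p1_def
    by (rule N.congI_add[OF N.filt_sub pc[OF y] N.filt_mem refl]) (use \<zeta>[OF y] x mpow_1 in auto)
  ultimately show ?thesis unfolding Q_def[symmetric] by (intro exI[of _ p1] conjI ballI)
qed

text \<open>The members of \<open>xs\<close> are removed from the end, since regularity is relative
  to the preceding ones. When none is left, congruence is equality and the modified \<open>p\<close>
  is a homomorphism. What is kept throughout is the agreement with the original \<open>p\<close>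
  modulo \<mm> N.\<close>

lemma regular_lift:
  assumes M: "local_module R \<mm> M" and N: "local_module R \<mm> N" and xs: "set xs \<subseteq> \<mm>"
    and xM: "\<And>x. x \<in> set xs \<Longrightarrow> (\<lambda>y\<in>carrier M. x \<odot>\<^bsub>M\<^esub> y) \<in> rank_homs R M M"
    and reg: "regular_sequence R N (map (\<lambda>x. x [^] (2::nat)) xs)"
    and p: "hom_modulo R M N (ideal_times R (Idl (set (map (\<lambda>x. x [^] (2::nat)) xs))) N (carrier N)) p"
  shows "\<exists>\<psi>\<in>mod_hom R M N. \<forall>y\<in>carrier M. mod_cong N (filt N 1) (\<psi> y) (p y)"
proof -
  interpret M: local_module R \<mm> M by fact
  interpret N: local_module R \<mm> N by fact
  let ?ys = "map (\<lambda>x. x [^] (2::nat)) xs"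
  have ys: "set ?ys \<subseteq> carrier R" using xs m_carrier by auto
  let ?Q = "\<lambda>i. ideal_times R (Idl (set (take i ?ys))) N (carrier N)"
  have "\<exists>p'. hom_modulo R M N (?Q (length xs - k)) p' \<and> (\<forall>y\<in>carrier M. mod_cong N (filt N 1) (p' y) (p y))"
    if "k \<le> length xs" for k
    using that
  proof (induct k)
    case 0
    have "p y \<in> carrier N" if "y \<in> carrier M" for y using p that by (simp add: hom_modulo_def)
    then show ?case using p N.cong_refl[OF N.filt_sub] by (intro exI[of _ p]) auto
  next
    case (Suc k)
    define i where "i = length xs - Suc k"
    have i: "length xs - k = Suc i" "i < length xs" using Suc(2) by (auto simp: i_def)
    obtain p1 where p1: "hom_modulo R M N (?Q (Suc i)) p1" "\<forall>y\<in>carrier M. mod_cong N (filt N 1) (p1 y) (p y)"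
      using Suc i by auto
    have "set (take (Suc i) ?ys) = insert (xs ! i [^] (2::nat)) (set (take i ?ys))"
      using i by (simp add: take_Suc_conv_app_nth take_map)
    then have p1': "hom_modulo R M N (ideal_times R (Idl (insert (xs ! i [^] (2::nat)) (set (take i ?ys)))) N (carrier N)) p1"
      using p1(1) by simp
    have xi: "xs ! i \<in> set xs" using i by simp
    have S: "set (take i ?ys) \<subseteq> carrier R" using ys set_take_subset by (rule order_trans[rotated])
    have reg': "y \<in> ?Q i" if "y \<in> carrier N" "(xs ! i [^] (2::nat)) \<odot>\<^bsub>N\<^esub> y \<in> ?Q i" for y
      using reg i that unfolding regular_sequence_def ideal_times_module_eq by auto
    obtain p2 where p2: "hom_modulo R M N (?Q i) p2" "\<forall>y\<in>carrier M. mod_cong N (filt N 1) (p2 y) (p1 y)"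
      using regular_lift_step[OF M N S _ xM[OF xi] reg' p1'] xi xs by blast
    have "\<forall>y\<in>carrier M. mod_cong N (filt N 1) (p2 y) (p y)"
      using p1(2) p2(2) N.cong_trans[OF N.filt_sub] by blast
    then show ?case using p2(1) by (auto simp: i_def)
  qed
  from this[of "length xs"] obtain p0 where
    p0: "hom_modulo R M N (?Q 0) p0" "\<forall>y\<in>carrier M. mod_cong N (filt N 1) (p0 y) (p y)" by auto
  have Q0: "?Q 0 \<subseteq> {\<zero>\<^bsub>N\<^esub>}"
    by (rule ideal_times_gen[OF N.rmodule_axioms N.sub_zero_module]) auto
  have eq: "u = v" if "mod_cong N (?Q 0) u v" for u v
  proof -
    have c: "u \<in> carrier N" "v \<in> carrier N" using that by (auto simp: mod_cong_def)
    have "mod_cong N {\<zero>\<^bsub>N\<^esub>} u v" using that Q0 by (rule N.cong_mono)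
    then show ?thesis using c by (elim N.congE_add) simp
  qed
  have "restrict p0 (carrier M) \<in> mod_hom R M N"
    by (rule mod_hom_restrictI[OF M.module_axioms])
      (use p0(1) eq in \<open>unfold hom_modulo_def, blast\<close>)+
  then show ?thesis using p0(2) by (intro bexI[of _ "restrict p0 (carrier M)"]) auto
qed

end

subsection \<open>Chains of submodules\<close>

text \<open>For A \<subseteq> B it says that B / A has length at least n. Upper bounds on lengths
  are expressed by the absence of such a chain.\<close>

definition sub_chain ::
    "('a, 'r) ring_scheme \<Rightarrow> ('a, 'b) module \<Rightarrow> 'b set \<Rightarrow> nat \<Rightarrow> 'b set \<Rightarrow> bool" where
  "sub_chain R M A n B \<longleftrightarrow>
     (\<exists>H. (\<forall>i\<le>n. submodule (H i) R M \<and> A \<subseteq> H i \<and> H i \<subseteq> B) \<and> (\<forall>i<n. H i \<subset> H (Suc i)))"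

context rmodule
begin

lemma chain_mono: "sub_chain R M A n B \<Longrightarrow> A' \<subseteq> A \<Longrightarrow> B \<subseteq> B' \<Longrightarrow> sub_chain R M A' n B'"
  unfolding sub_chain_def by (meson order_trans)

lemma chain_less: "sub_chain R M A n B \<Longrightarrow> m \<le> n \<Longrightarrow> sub_chain R M A m B"
  unfolding sub_chain_def by (meson order_trans less_le_trans)

lemma chain_0: "submodule B R M \<Longrightarrow> A \<subseteq> B \<Longrightarrow> sub_chain R M A 0 B"
  unfolding sub_chain_def by auto

lemma chain_bottom:
  assumes "sub_chain R M C n B" "submodule A R M" "A \<subset> C"
  shows "sub_chain R M A (Suc n) B"
proof -
  obtain H where H: "\<And>i. i \<le> n \<Longrightarrow> submodule (H i) R M \<and> C \<subseteq> H i \<and> H i \<subseteq> B" "\<And>i. i < n \<Longrightarrow> H i \<subset> H (Suc i)"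
    using assms(1) unfolding sub_chain_def by auto
  have CB: "C \<subseteq> H 0" "H 0 \<subseteq> B" using H(1)[of 0] by auto
  define K where "K = (\<lambda>i. case i of 0 \<Rightarrow> A | Suc i \<Rightarrow> H i)"
  have "submodule (K i) R M \<and> A \<subseteq> K i \<and> K i \<subseteq> B" if "i \<le> Suc n" for i
  proof (cases i)
    case 0
    then show ?thesis using assms CB by (auto simp: K_def)
  next
    case (Suc j)
    then show ?thesis using H(1)[of j] that assms(3) by (auto simp: K_def)
  qed
  moreover have "K i \<subset> K (Suc i)" if "i < Suc n" for i
  proof (cases i)
    case 0
    then show ?thesis using assms(3) CB by (auto simp: K_def)
  next
    case (Suc j)
    then show ?thesis using H(2)[of j] that by (auto simp: K_def)
  qed
  ultimately show ?thesis unfolding sub_chain_def by blast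
qed

lemma chain_top:
  assumes "sub_chain R M A n C" "submodule B R M" "C \<subset> B"
  shows "sub_chain R M A (Suc n) B"
proof -
  obtain H where H: "\<And>i. i \<le> n \<Longrightarrow> submodule (H i) R M \<and> A \<subseteq> H i \<and> H i \<subseteq> C" "\<And>i. i < n \<Longrightarrow> H i \<subset> H (Suc i)"
    using assms(1) unfolding sub_chain_def by auto
  define K where "K = (\<lambda>i. if i \<le> n then H i else B)"
  have "submodule (K i) R M \<and> A \<subseteq> K i \<and> K i \<subseteq> B" for i
    using H(1)[of i] H(1)[of 0] assms(2,3) by (auto simp: K_def)
  moreover have "K i \<subset> K (Suc i)" if "i < Suc n" for i
    using H(1)[of i] H(2)[of i] that assms(3) by (auto simp: K_def)
  ultimately show ?thesis unfolding sub_chain_def by blast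
qed

end

context local_module
begin

text \<open>If \<open>C / B\<close> is zero or simple, then intersecting with \<open>B\<close> shortens a chain in \<open>C\<close> by at most one.\<close>

lemma chain_simple_top:
  assumes B: "submodule B R M" and g: "g \<in> carrier M" "\<And>a. a \<in> \<mm> \<Longrightarrow> a \<odot>\<^bsub>M\<^esub> g \<in> B"
    and A: "A \<subseteq> B" and ch: "sub_chain R M A n (B <+>\<^bsub>M\<^esub> {r \<odot>\<^bsub>M\<^esub> g | r. r \<in> carrier R})"
  shows "sub_chain R M A (n - 1) B"
proof -
  let ?C = "B <+>\<^bsub>M\<^esub> {r \<odot>\<^bsub>M\<^esub> g | r. r \<in> carrier R}"
  obtain H where H: "\<And>i. i \<le> n \<Longrightarrow> submodule (H i) R M \<and> A \<subseteq> H i \<and> H i \<subseteq> ?C" "\<And>i. i < n \<Longrightarrow> H i \<subset> H (Suc i)"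
    using ch unfolding sub_chain_def by auto
  \<comment> \<open>A member of the chain that is not inside B contains some b + r g with r a unit,
    so together with B it spans all of \<open>?C\<close>.\<close>
  have full: "\<exists>h\<in>H i. \<exists>b\<in>B. x = h \<oplus>\<^bsub>M\<^esub> b" if i: "i \<le> n" "\<not> H i \<subseteq> B" and x: "x \<in> ?C" for i x
  proof -
    have sH: "submodule (H i) R M" using H(1)[OF i(1)] by blast
    obtain y where y: "y \<in> H i" "y \<notin> B" using i by auto
    have "y \<in> ?C" using y H(1)[OF i(1)] by blast
    then obtain b r where br: "b \<in> B" "r \<in> carrier R" "y = b \<oplus>\<^bsub>M\<^esub> r \<odot>\<^bsub>M\<^esub> g" unfolding adjoin_mem by blast
    have "r \<notin> \<mm>" using br g(2)[of r] y(2) sub_add[OF B] by auto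
    then obtain u where u: "u \<in> carrier R" "u \<otimes> r = \<one>" using unit_of_notin_m[OF br(2)] by metis
    obtain b' s where bs: "b' \<in> B" "s \<in> carrier R" "x = b' \<oplus>\<^bsub>M\<^esub> s \<odot>\<^bsub>M\<^esub> g" using x unfolding adjoin_mem by blast
    have c: "b \<in> carrier M" "b' \<in> carrier M" using sub_carrier[OF B] br bs by auto
    have su: "s \<otimes> u \<in> carrier R" using u bs by simp
    have "(s \<otimes> u) \<odot>\<^bsub>M\<^esub> y = (s \<otimes> u) \<odot>\<^bsub>M\<^esub> b \<oplus>\<^bsub>M\<^esub> ((s \<otimes> u) \<otimes> r) \<odot>\<^bsub>M\<^esub> g"
      using br c g(1) su by (simp add: smult_r_distr smult_assoc1)
    also have "(s \<otimes> u) \<otimes> r = s" using u bs br(2) by (simp add: m_assoc)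
    finally have e: "(s \<otimes> u) \<odot>\<^bsub>M\<^esub> y = (s \<otimes> u) \<odot>\<^bsub>M\<^esub> b \<oplus>\<^bsub>M\<^esub> s \<odot>\<^bsub>M\<^esub> g" .
    have "x = (s \<otimes> u) \<odot>\<^bsub>M\<^esub> y \<oplus>\<^bsub>M\<^esub> (b' \<ominus>\<^bsub>M\<^esub> (s \<otimes> u) \<odot>\<^bsub>M\<^esub> b)"
      unfolding e bs(3) using c su bs(2) g(1)
      by (simp add: a_minus_def M.a_ac M.r_neg M.r_neg1 M.r_neg2)
    moreover have "(s \<otimes> u) \<odot>\<^bsub>M\<^esub> y \<in> H i" by (rule sub_smult[OF sH su y(1)])
    moreover have "b' \<ominus>\<^bsub>M\<^esub> (s \<otimes> u) \<odot>\<^bsub>M\<^esub> b \<in> B" by (rule sub_minus[OF B bs(1) sub_smult[OF B su br(1)]])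
    ultimately show ?thesis by blast
  qed
  have strict: "H i \<inter> B \<subset> H (Suc i) \<inter> B" if i: "i < n" "\<not> H i \<subseteq> B" for i
  proof -
    obtain x where x: "x \<in> H (Suc i)" "x \<notin> H i" using H(2)[OF i(1)] by auto
    have sH: "submodule (H i) R M" "submodule (H (Suc i)) R M" "H i \<subseteq> H (Suc i)"
      using H(1)[of i] H(1)[of "Suc i"] H(2)[of i] i by auto
    have "x \<in> ?C" using x(1) H(1)[of "Suc i"] i by auto
    then obtain h b where hb: "h \<in> H i" "b \<in> B" "x = h \<oplus>\<^bsub>M\<^esub> b" using full[of i x] i by auto
    have c: "h \<in> carrier M" "b \<in> carrier M" using hb sub_carrier[OF sH(1)] sub_carrier[OF B] by auto
    have "b = x \<ominus>\<^bsub>M\<^esub> h" using hb c by (simp add: a_minus_def M.a_comm[of h] M.a_assoc M.r_neg)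
    then have "b \<in> H (Suc i)" using sub_minus[OF sH(2) x(1)] hb(1) sH(3) by auto
    moreover have "b \<notin> H i" using x(2) hb sub_add[OF sH(1) hb(1)] by auto
    ultimately show ?thesis using hb(2) sH(3) by blast
  qed
  show ?thesis
  proof (cases n)
    case 0
    then show ?thesis using chain_0[OF B A] by simp
  next
    case (Suc m)
    \<comment> \<open>Members inside B are kept; from the first one outside B on, the following
      member is intersected with B. This skips the one step at which intersecting with B may lose
      strictness.\<close>
    define K where "K = (\<lambda>i. if H i \<subseteq> B then H i else H (Suc i) \<inter> B)"
    have "submodule (K i) R M \<and> A \<subseteq> K i \<and> K i \<subseteq> B" if "i \<le> m" for i
      using H(1)[of i] H(1)[of "Suc i"] that Suc A sub_Int[OF _ B] by (auto simp: K_def)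
    moreover have "K i \<subset> K (Suc i)" if i: "i < m" for i
    proof -
      have s: "H i \<subset> H (Suc i)" "H (Suc i) \<subset> H (Suc (Suc i))" using H(2)[of i] H(2)[of "Suc i"] i Suc by auto
      consider "H (Suc i) \<subseteq> B" | "H i \<subseteq> B" "\<not> H (Suc i) \<subseteq> B" | "\<not> H i \<subseteq> B" "\<not> H (Suc i) \<subseteq> B" by blast
      then show ?thesis
      proof cases
        case 1
        then show ?thesis using s by (auto simp: K_def)
      next
        case 2
        then have "H i \<subseteq> H (Suc i) \<inter> B" using s by auto
        also have "\<dots> \<subset> H (Suc (Suc i)) \<inter> B" using strict[of "Suc i"] 2 i Suc by auto
        finally show ?thesis using 2 by (simp add: K_def)
      next
        case 3
        then show ?thesis using strict[of "Suc i"] i Suc by (simp add: K_def)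
      qed
    qed
    ultimately show ?thesis unfolding sub_chain_def using Suc by auto
  qed
qed

text \<open>Modulo B the span of T is generated by \<open>card T\<close> elements killed by \<mm>,
  so its length is at most \<open>card T\<close>; \<open>chain_simple_top\<close> pays for one
  generator at a time.\<close>

lemma chain_span_top:
  assumes "finite T" "T \<subseteq> carrier M" and B: "submodule B R M"
    and "\<And>a g. a \<in> \<mm> \<Longrightarrow> g \<in> T \<Longrightarrow> a \<odot>\<^bsub>M\<^esub> g \<in> B"
    and A: "A \<subseteq> B" and "sub_chain R M A n C" "C \<subseteq> B <+>\<^bsub>M\<^esub> mod_span R M T"
  shows "sub_chain R M A (n - card T) B"
  using assms(1,2,4,6,7)
proof (induct T arbitrary: n C)
  case empty
  have "B <+>\<^bsub>M\<^esub> mod_span R M {} \<subseteq> B"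
    using sub_carrier[OF B] by (auto simp: set_add_mem span_empty)
  then show ?case using chain_mono[OF empty(3) order_refl] empty(4) by auto
next
  case (insert g T)
  have gT: "g \<in> carrier M" "T \<subseteq> carrier M" using insert by auto
  note sT = span_sub[OF gT(2)]
  let ?B = "B <+>\<^bsub>M\<^esub> mod_span R M T"
  have sB: "submodule ?B R M" and BB: "B \<subseteq> ?B"
    using sub_set_add[OF B sT] set_add_upper[OF B sT] by auto
  have "B <+>\<^bsub>M\<^esub> mod_span R M (insert g T) \<subseteq> ?B <+>\<^bsub>M\<^esub> {r \<odot>\<^bsub>M\<^esub> g | r. r \<in> carrier R}"
  proof (rule set_add_least[OF adjoin(1)[OF sB gT(1)]])
    show "B \<subseteq> ?B <+>\<^bsub>M\<^esub> {r \<odot>\<^bsub>M\<^esub> g | r. r \<in> carrier R}" using adjoin(2)[OF sB gT(1)] BB by auto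
    show "mod_span R M (insert g T) \<subseteq> ?B <+>\<^bsub>M\<^esub> {r \<odot>\<^bsub>M\<^esub> g | r. r \<in> carrier R}"
      using adjoin(2,3)[OF sB gT(1)] set_add_upper(2)[OF B sT] span_mem
      by (intro span_least[OF adjoin(1)[OF sB gT(1)]]) blast
  qed
  then have "sub_chain R M A n (?B <+>\<^bsub>M\<^esub> {r \<odot>\<^bsub>M\<^esub> g | r. r \<in> carrier R})"
    using insert(6,7) chain_mono by blast
  then have "sub_chain R M A (n - 1) ?B"
    using insert(5)[of _ g] BB A by (intro chain_simple_top[OF sB gT(1)]) auto
  from insert(3)[OF gT(2) insert(5) this] have "sub_chain R M A (n - 1 - card T) B" by auto
  then show ?case using insert(1,2) by simp
qed

lemma filt_gen:
  assumes "finite T" "T \<subseteq> carrier M" "mod_span R M T = carrier M" "G \<subseteq> carrier R" "mpow i = Idl G"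
  shows "filt M i \<subseteq> mod_span R M {a \<odot>\<^bsub>M\<^esub> g | a g. a \<in> G \<and> g \<in> T}"
proof -
  let ?S = "mod_span R M {a \<odot>\<^bsub>M\<^esub> g | a g. a \<in> G \<and> g \<in> T}"
  have s: "submodule ?S R M" by (rule span_sub) (use assms in auto)
  have "filt M i \<subseteq> ?S"
    unfolding filt_def assms(5)
  proof (rule ideal_times_gen[OF rmodule_axioms s assms(4)])
    fix a y assume a: "a \<in> G" and y: "y \<in> carrier M"
    have ac: "a \<in> carrier R" using a assms by auto
    have "submodule {y \<in> carrier M. a \<odot>\<^bsub>M\<^esub> y \<in> ?S} R M" by (rule sub_smult_vimage[OF s ac])
    then have "mod_span R M T \<subseteq> {y \<in> carrier M. a \<odot>\<^bsub>M\<^esub> y \<in> ?S}"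
    proof (rule span_least, intro subsetI CollectI conjI)
      fix g assume "g \<in> T"
      then show "g \<in> carrier M" "a \<odot>\<^bsub>M\<^esub> g \<in> ?S" using assms(2) a by (auto intro!: span_mem)
    qed
    then show "a \<odot>\<^bsub>M\<^esub> y \<in> ?S" using y assms(3) by auto
  qed
  then show ?thesis .
qed

text \<open>The layer \<mm>^i M / \<mm>^(i+1) M is a k-space spanned by the products of generators
  of \<mm>^i and of M. The resulting bound on the length of M / \<mm>^n M depends on M only through
  the number b, hence is uniform in a family.\<close>

lemma chain_bound:
  assumes T: "finite T" "T \<subseteq> carrier M" "mod_span R M T = carrier M" "card T \<le> b"
    and G: "\<And>i. finite (G i) \<and> G i \<subseteq> carrier R \<and> mpow i = Idl (G i)"
    and ch: "sub_chain R M (filt M n) r (carrier M)"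
  shows "r \<le> (\<Sum>i<n. card (G i) * b)"
proof -
  \<comment> \<open>The excess over the bound for the first k layers survives as a chain inside
    \<mm>^k M. For k = n a positive excess would be a strict chain between equal submodules.\<close>
  have "sub_chain R M (filt M n) (r - (\<Sum>i<k. card (G i) * b)) (filt M k)" if "k \<le> n" for k
    using that
  proof (induct k)
    case 0
    show ?case using ch by (simp only: filt_0 lessThan_0 sum.empty diff_zero)
  next
    case (Suc k)
    define U where "U = {a \<odot>\<^bsub>M\<^esub> g | a g. a \<in> G k \<and> g \<in> T}"
    have Ui: "U = (\<lambda>(a, g). a \<odot>\<^bsub>M\<^esub> g) ` (G k \<times> T)" by (auto simp: U_def)
    have fU: "finite U" unfolding Ui using T G by auto
    have "card U \<le> card (G k \<times> T)" unfolding Ui by (rule card_image_le) (use T G in auto)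
    also have "\<dots> \<le> card (G k) * b" using T(4) by (simp add: card_cartesian_product)
    finally have cU: "card U \<le> card (G k) * b" .
    have Gk: "G k \<subseteq> mpow k" using G[of k] genideal_self by auto
    have Uf: "g \<in> filt M k" if "g \<in> U" for g using that Gk T(2) filt_mem[of _ k] by (auto simp: U_def)
    have "sub_chain R M (filt M n) (r - (\<Sum>i<k. card (G i) * b) - card U) (filt M (Suc k))"
    proof (rule chain_span_top[OF fU _ filt_sub])
      show "U \<subseteq> carrier M" using Uf filt_carrier by auto
      show "a \<odot>\<^bsub>M\<^esub> g \<in> filt M (Suc k)" if "a \<in> \<mm>" "g \<in> U" for a g
        using filt_smult[of a "Suc 0" g k] Uf that mpow_1 by simp
      show "filt M n \<subseteq> filt M (Suc k)" by (rule filt_antimono[OF Suc(2)])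
      show "sub_chain R M (filt M n) (r - (\<Sum>i<k. card (G i) * b)) (filt M k)" using Suc by simp
      have "filt M k \<subseteq> mod_span R M U" unfolding U_def using filt_gen[OF T(1-3), of "G k" k] G by auto
      also have "\<dots> \<subseteq> filt M (Suc k) <+>\<^bsub>M\<^esub> mod_span R M U"
        using Uf filt_carrier by (intro set_add_upper(2)[OF filt_sub span_sub]) auto
      finally show "filt M k \<subseteq> filt M (Suc k) <+>\<^bsub>M\<^esub> mod_span R M U" .
    qed
    then show ?case by (rule chain_less) (use cU in simp)
  qed
  then have c: "sub_chain R M (filt M n) (r - (\<Sum>i<n. card (G i) * b)) (filt M n)" by simp
  show ?thesis
  proof (rule ccontr)
    assume "\<not> ?thesis"
    then have "Suc 0 \<le> r - (\<Sum>i<n. card (G i) * b)" by linarith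
    then have "sub_chain R M (filt M n) (Suc 0) (filt M n)" by (rule chain_less[OF c])
    then obtain H where H: "\<forall>i\<le>Suc 0. submodule (H i) R M \<and> filt M n \<subseteq> H i \<and> H i \<subseteq> filt M n"
      "\<forall>i<Suc 0. H i \<subset> H (Suc i)"
      unfolding sub_chain_def by (elim exE conjE)
    have "H 0 = filt M n" "H (Suc 0) = filt M n" using H(1) by auto
    then show False using H(2)[rule_format, of 0] by simp
  qed
qed

end

subsection \<open>Reduction modulo a regular sequence and the Harada-Sai bound\<close>

locale reduction = noeth_local R \<mm> for R :: "('a, 'r) ring_scheme" (structure) and \<mm> +
  fixes xs :: "'a list"
  assumes xs: "set xs \<subseteq> \<mm>"
begin

definition sq :: "'a list" where "sq = map (\<lambda>x. x [^] (2::nat)) xs"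

text \<open>The argument of Harada and Sai takes place in N / red N.\<close>

definition red :: "('a, 'b) module \<Rightarrow> 'b set" where
  "red N = ideal_times R (Idl (set sq)) N (carrier N)"

text \<open>Collects the hypotheses of \<open>regular_lift\<close> for N both as source and as
  target, together with completeness.\<close>

definition liftable :: "('a, 'b) module \<Rightarrow> bool" where
  "liftable N \<longleftrightarrow> complete_module R \<mm> N \<and>
     (\<forall>x\<in>set xs. (\<lambda>y\<in>carrier N. x \<odot>\<^bsub>N\<^esub> y) \<in> rank_homs R N N) \<and> regular_sequence R N sq"

text \<open>The preimage in N of the image of u(A) in N / red N. Chains between \<open>red N\<close>
  and this submodule measure the length of the image of u after reduction.\<close>

definition red_image :: "('b \<Rightarrow> 'c) \<Rightarrow> 'b set \<Rightarrow> ('a, 'c) module \<Rightarrow> 'c set" where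
  "red_image u A N = u ` A <+>\<^bsub>N\<^esub> red N"

lemma sq_m: "set sq \<subseteq> \<mm>"
proof -
  have "x [^] (2::nat) \<in> \<mm>" if "x \<in> set xs" for x
    using that xs m_carrier idl_mult[OF m_ideal, of x x] by (auto simp: numeral_2_eq_2)
  then show ?thesis by (auto simp: sq_def)
qed

lemma sq_ideal: "ideal (Idl (set sq)) R" "Idl (set sq) \<subseteq> \<mm>" "Idl (set sq) \<subseteq> carrier R"
proof -
  show "Idl (set sq) \<subseteq> \<mm>" by (rule genideal_minimal[OF m_ideal sq_m])
  then show "Idl (set sq) \<subseteq> carrier R" using m_carrier by auto
  show "ideal (Idl (set sq)) R" by (rule genideal_ideal) (use sq_m m_carrier in auto)
qed

lemma liftable_complete: "liftable N \<Longrightarrow> complete_module R \<mm> N"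
  by (simp add: liftable_def)

lemma liftable_module: "liftable N \<Longrightarrow> module R N"
  using liftable_complete complete_module.axioms(1) fg_local_module.axioms(1) local_module.axioms(2)
    rmodule.axioms by blast

lemma liftable_local: "liftable N \<Longrightarrow> local_module R \<mm> N"
  using liftable_complete complete_module.axioms(1) fg_local_module.axioms(1) by blast

lemma red_sub: "module R N \<Longrightarrow> submodule (red N) R N"
  unfolding red_def using rmodule.times_sub[OF rmoduleI sq_ideal(3)] by blast

lemma red_filt: "module R N \<Longrightarrow> red N \<subseteq> filt N 1"
proof -
  assume N: "module R N"
  interpret N: rmodule R N using N by (rule rmoduleI)
  show ?thesis unfolding red_def filt_def by (rule N.times_mono) (use sq_ideal mpow_1 in auto)
qed

lemma red_hom:
  assumes "module R M" "module R N" "f \<in> mod_hom R M N" "x \<in> red M"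
  shows "f x \<in> red N"
  unfolding red_def
  by (rule mod_hom_ideal_times[OF assms(1-3) sq_ideal(3) mod_hom_closed[OF assms(3)] order_refl order_refl
        assms(4)[unfolded red_def]])

lemma lift:
  assumes "liftable M" "liftable N" "hom_modulo R M N (red N) p"
  shows "\<exists>\<psi>\<in>mod_hom R M N. \<forall>y\<in>carrier M. mod_cong N (filt N 1) (\<psi> y) (p y)"
proof (rule regular_lift[OF liftable_local[OF assms(1)] liftable_local[OF assms(2)] xs])
  show "regular_sequence R N (map (\<lambda>x. x [^] (2::nat)) xs)" using assms(2) by (simp add: liftable_def sq_def)
  show "hom_modulo R M N (ideal_times R (Idl set (map (\<lambda>x. x [^] (2::nat)) xs)) N (carrier N)) p"
    using assms(3) by (simp add: red_def sq_def)
qed (use assms(1) in \<open>simp add: liftable_def\<close>)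

text \<open>A and C describe a direct sum decomposition of N / red N. The projection onto A along C
  lifts to an endomorphism of N that is idempotent modulo \<mm> N, hence congruent to 0 or to the
  identity by \<open>idempotent_trivial\<close>. Nakayama's lemma then gives C = N or A = N.\<close>

lemma red_indecomposable:
  assumes L: "liftable N" and ind: "indecomposable_module R N"
    and A: "submodule A R N" "red N \<subseteq> A" and C: "submodule C R N" "red N \<subseteq> C"
    and sum: "\<And>y. y \<in> carrier N \<Longrightarrow> \<exists>a\<in>A. mod_cong N C y a" and int: "A \<inter> C \<subseteq> red N"
  shows "A = red N \<or> (A = carrier N \<and> C = red N)"
proof -
  interpret N: complete_module R \<mm> N by (rule liftable_complete[OF L])
  note mN = N.module_axioms
  have sQ: "submodule (red N) R N" by (rule red_sub[OF mN])
  have cI: "mod_cong N (red N) u v" if "u \<in> A" "v \<in> A" "mod_cong N C u v" for u v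
    using that N.sub_minus[OF A(1)] int by (auto simp: mod_cong_def)
  obtain p where p: "\<And>y. y \<in> carrier N \<Longrightarrow> p y \<in> A \<and> mod_cong N C y (p y)" using sum by metis
  have pc: "p y \<in> carrier N" if "y \<in> carrier N" for y using p[OF that] N.sub_carrier[OF A(1)] by auto
  have pC: "mod_cong N C (p y) y" if "y \<in> carrier N" for y using p[OF that] N.cong_sym[OF C(1)] by auto
  have hm: "hom_modulo R N N (red N) p"
    unfolding hom_modulo_def
  proof (intro conjI ballI)
    fix y z assume yz: "y \<in> carrier N" "z \<in> carrier N"
    have "mod_cong N C (p (y \<oplus>\<^bsub>N\<^esub> z)) (p y \<oplus>\<^bsub>N\<^esub> p z)"
      by (rule N.cong_trans[OF C(1) pC N.cong_sym[OF C(1) N.cong_add[OF C(1) pC pC]]]) (use yz in auto)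
    then show "mod_cong N (red N) (p (y \<oplus>\<^bsub>N\<^esub> z)) (p y \<oplus>\<^bsub>N\<^esub> p z)"
      using p yz N.sub_add[OF A(1)] by (intro cI) auto
  next
    fix r y assume ry: "r \<in> carrier R" "y \<in> carrier N"
    have "mod_cong N C (p (r \<odot>\<^bsub>N\<^esub> y)) (r \<odot>\<^bsub>N\<^esub> p y)"
      by (rule N.cong_trans[OF C(1) pC N.cong_sym[OF C(1) N.cong_smult[OF C(1) pC]]]) (use ry in auto)
    then show "mod_cong N (red N) (p (r \<odot>\<^bsub>N\<^esub> y)) (r \<odot>\<^bsub>N\<^esub> p y)"
      using p ry N.sub_smult[OF A(1)] by (intro cI) auto
  qed (rule pc)
  obtain \<psi> where \<psi>: "\<psi> \<in> mod_hom R N N" "\<And>y. y \<in> carrier N \<Longrightarrow> mod_cong N (filt N 1) (\<psi> y) (p y)"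
    using lift[OF L L hm] by (elim bexE) (metis (full_types))
  note \<psi>c = mod_hom_closed[OF \<psi>(1)]
  \<comment> \<open>Modulo \<mm> N, the maps \<psi> \<psi>, \<psi> p, p p, p and \<psi> agree in
    turn.\<close>
  have d: "\<psi> (y \<ominus>\<^bsub>N\<^esub> \<psi> y) \<in> filt N 1" if y: "y \<in> carrier N" for y
  proof -
    have 1: "mod_cong N (filt N 1) (\<psi> (\<psi> y)) (\<psi> (p y))"
      by (rule mod_hom_cong[OF mN mN \<psi>(1) \<psi>(2)[OF y] N.hom_filt[OF \<psi>(1)]])
    have 2: "mod_cong N (filt N 1) (\<psi> (p y)) (p (p y))" by (rule \<psi>(2)[OF pc[OF y]])
    have 3: "mod_cong N (filt N 1) (p (p y)) (p y)"
      by (rule N.cong_mono[OF cI red_filt[OF mN]]) (use p[OF y] p[OF pc[OF y]] pC[OF pc[OF y]] in auto)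
    have "mod_cong N (filt N 1) (\<psi> y) (\<psi> (\<psi> y))"
      using N.cong_trans[OF N.filt_sub 1 N.cong_trans[OF N.filt_sub 2 N.cong_trans[OF N.filt_sub 3
            N.cong_sym[OF N.filt_sub \<psi>(2)[OF y]]]]] N.cong_sym[OF N.filt_sub] by blast
    then show ?thesis using y \<psi>c by (simp add: mod_cong_def mod_hom_minus[OF mN mN \<psi>(1)])
  qed
  show ?thesis
    using N.idempotent_trivial[OF ind \<psi>(1) d]
  proof
    assume z: "\<forall>x\<in>carrier N. \<psi> x \<in> filt N 1"
    have "C = carrier N"
    proof (rule N.nakayama_carrier[OF C(1)])
      fix y assume y: "y \<in> carrier N"
      have "p y \<in> filt N 1" using N.cong_mem_iff[OF N.filt_sub \<psi>(2)[OF y]] z y by blast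
      moreover obtain c where c: "c \<in> C" "y = p y \<oplus>\<^bsub>N\<^esub> c"
        using p[OF y] by (auto elim: N.congE_add)
      have cc: "c \<in> carrier N" using N.sub_carrier[OF C(1) c(1)] .
      have "y = c \<oplus>\<^bsub>N\<^esub> p y" using c(2) N.M.a_comm[OF pc[OF y] cc] by simp
      ultimately have "mod_cong N (filt N 1) y c" using N.congI_add[OF N.filt_sub cc] by blast
      then show "\<exists>h\<in>C. mod_cong N (filt N 1) y h" using c by blast
    qed
    then have "A \<subseteq> red N" using int N.sub_carrier[OF A(1)] by blast
    then show ?thesis using A(2) by auto
  next
    assume z: "\<forall>x\<in>carrier N. mod_cong N (filt N 1) (\<psi> x) x"
    have AN: "A = carrier N"
    proof (rule N.nakayama_carrier[OF A(1)])
      fix y assume y: "y \<in> carrier N"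
      have "mod_cong N (filt N 1) y (p y)"
        using N.cong_trans[OF N.filt_sub N.cong_sym[OF N.filt_sub] \<psi>(2)[OF y]] z y by blast
      then show "\<exists>h\<in>A. mod_cong N (filt N 1) y h" using p[OF y] by blast
    qed
    then have "C \<subseteq> red N" using int N.sub_carrier[OF C(1)] by blast
    then show ?thesis using AN C(2) by auto
  qed
qed

text \<open>The inverse modulo \<open>red\<close> lifts to some \<psi>. Surjectivity of g is
  Nakayama's lemma. For injectivity, \<theta> = 1 - \<psi> g sends \<mm>^n N into \<mm>^(n+1) N and
  fixes the kernel of g, which therefore lies in every \<mm>^n N.\<close>

lemma red_iso:
  assumes L: "liftable N" and L': "liftable N'" and g: "g \<in> mod_hom R N N'"
    and onto: "\<And>y. y \<in> carrier N' \<Longrightarrow> \<exists>x\<in>carrier N. mod_cong N' (red N') (g x) y"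
    and inj: "\<And>x. x \<in> carrier N \<Longrightarrow> g x \<in> red N' \<Longrightarrow> x \<in> red N"
  shows "bij_betw g (carrier N) (carrier N')"
proof -
  interpret N: complete_module R \<mm> N by (rule liftable_complete[OF L])
  interpret N': complete_module R \<mm> N' by (rule liftable_complete[OF L'])
  note mN = N.module_axioms and mN' = N'.module_axioms
  note gc = mod_hom_closed[OF g]
  have sQ: "submodule (red N) R N" "submodule (red N') R N'" by (rule red_sub[OF mN], rule red_sub[OF mN'])
  have inj': "mod_cong N (red N) u v" if "u \<in> carrier N" "v \<in> carrier N" "mod_cong N' (red N') (g u) (g v)" for u v
    using that inj[of "u \<ominus>\<^bsub>N\<^esub> v"] by (auto simp: mod_cong_def mod_hom_minus[OF mN mN' g])
  obtain p where p: "\<And>y. y \<in> carrier N' \<Longrightarrow> p y \<in> carrier N \<and> mod_cong N' (red N') (g (p y)) y" using onto by metis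
  have hm: "hom_modulo R N' N (red N) p"
    unfolding hom_modulo_def
  proof (intro conjI ballI)
    fix y z assume yz: "y \<in> carrier N'" "z \<in> carrier N'"
    have "mod_cong N' (red N') (g (p (y \<oplus>\<^bsub>N'\<^esub> z))) (g (p y) \<oplus>\<^bsub>N'\<^esub> g (p z))"
      by (rule N'.cong_trans[OF sQ(2) _ N'.cong_sym[OF sQ(2) N'.cong_add[OF sQ(2)]]]) (use p yz in auto)
    then show "mod_cong N (red N) (p (y \<oplus>\<^bsub>N'\<^esub> z)) (p y \<oplus>\<^bsub>N\<^esub> p z)"
      using p yz by (intro inj') (auto simp: mod_hom_add[OF g])
  next
    fix r y assume ry: "r \<in> carrier R" "y \<in> carrier N'"
    have "mod_cong N' (red N') (g (p (r \<odot>\<^bsub>N'\<^esub> y))) (r \<odot>\<^bsub>N'\<^esub> g (p y))"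
      by (rule N'.cong_trans[OF sQ(2) _ N'.cong_sym[OF sQ(2) N'.cong_smult[OF sQ(2)]]]) (use p ry in auto)
    then show "mod_cong N (red N) (p (r \<odot>\<^bsub>N'\<^esub> y)) (r \<odot>\<^bsub>N\<^esub> p y)"
      using p ry by (intro inj') (auto simp: mod_hom_smult[OF g])
  qed (use p in auto)
  obtain \<psi> where \<psi>: "\<psi> \<in> mod_hom R N' N" "\<And>y. y \<in> carrier N' \<Longrightarrow> mod_cong N (filt N 1) (\<psi> y) (p y)"
    using lift[OF L' L hm] by (elim bexE) (metis (full_types))
  note \<psi>c = mod_hom_closed[OF \<psi>(1)]
  have surj: "g ` carrier N = carrier N'"
  proof (rule N'.nakayama_carrier[OF sub_image[OF mN mN' g N.carrier_is_submodule]])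
    fix y assume y: "y \<in> carrier N'"
    then have "mod_cong N' (filt N' 1) y (g (p y))"
      using p[OF y] N'.cong_sym[OF sQ(2)] N'.cong_mono[OF _ red_filt[OF mN']] by blast
    then show "\<exists>h\<in>g ` carrier N. mod_cong N' (filt N' 1) y h" using p[OF y] by blast
  qed
  have pg: "mod_cong N (filt N 1) (\<psi> (g x)) x" if x: "x \<in> carrier N" for x
  proof -
    have "mod_cong N (red N) (p (g x)) x" using p[OF gc[OF x]] x by (intro inj') auto
    then show ?thesis using N.cong_trans[OF N.filt_sub \<psi>(2)[OF gc[OF x]] N.cong_mono[OF _ red_filt[OF mN]]] by blast
  qed
  have ker: "x = \<zero>\<^bsub>N\<^esub>" if x: "x \<in> carrier N" "g x = \<zero>\<^bsub>N'\<^esub>" for x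
  proof -
    define \<theta> where "\<theta> = (\<lambda>y\<in>carrier N. y \<ominus>\<^bsub>N\<^esub> \<psi> (g y))"
    have gp: "compose (carrier N) \<psi> g \<in> mod_hom R N N" by (rule mod_hom_compose[OF mN g \<psi>(1)])
    have \<theta>: "\<theta> \<in> mod_hom R N N"
      unfolding \<theta>_def
    proof (rule mod_hom_restrictI[OF mN])
      fix y z assume "y \<in> carrier N" "z \<in> carrier N"
      then show "y \<oplus>\<^bsub>N\<^esub> z \<ominus>\<^bsub>N\<^esub> \<psi> (g (y \<oplus>\<^bsub>N\<^esub> z)) = y \<ominus>\<^bsub>N\<^esub> \<psi> (g y) \<oplus>\<^bsub>N\<^esub> (z \<ominus>\<^bsub>N\<^esub> \<psi> (g z))"
        using gc \<psi>c by (simp add: mod_hom_add[OF g] mod_hom_add[OF \<psi>(1)] a_minus_def N.M.minus_add N.M.a_ac)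
    next
      fix r y assume "r \<in> carrier R" "y \<in> carrier N"
      then show "r \<odot>\<^bsub>N\<^esub> y \<ominus>\<^bsub>N\<^esub> \<psi> (g (r \<odot>\<^bsub>N\<^esub> y)) = r \<odot>\<^bsub>N\<^esub> (y \<ominus>\<^bsub>N\<^esub> \<psi> (g y))"
        using gc \<psi>c by (simp add: mod_hom_smult[OF g] mod_hom_smult[OF \<psi>(1)] a_minus_def N.smult_r_distr N.smult_r_minus)
    qed (use gc \<psi>c in simp)
    have \<theta>1: "\<theta> y \<in> filt N 1" if "y \<in> carrier N" for y
      using N.cong_sym[OF N.filt_sub pg[OF that]] that by (simp add: \<theta>_def mod_cong_def)
    have step: "\<theta> y \<in> filt N (Suc n)" if y: "y \<in> filt N n" for y n
    proof -
      have "\<theta> y \<in> ideal_times R (mpow n) N (filt N 1)"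
        by (rule mod_hom_ideal_times[OF mN mN \<theta> mpow_subset \<theta>1 order_refl _ y[unfolded filt_def]])
          (use N.filt_carrier in auto)
      moreover have "ideal_times R (mpow n) N (filt N 1) \<subseteq> filt N (n + 1)"
        by (rule N.times_least[OF N.filt_sub N.filt_smult])
      ultimately show ?thesis by auto
    qed
    have \<theta>x: "\<theta> x = x"
      using x mod_hom_zero[OF mN' mN \<psi>(1)] by (simp add: \<theta>_def a_minus_def)
    have "x \<in> filt N n" for n
    proof (induct n)
      case 0
      then show ?case using x by (simp add: N.filt_0)
    next
      case (Suc n)
      then show ?case using step[of x n] \<theta>x by simp
    qed
    then show ?thesis by (rule N.filt_zeroI)
  qed
  have "inj_on g (carrier N)"
  proof (rule inj_onI)
    fix x y assume xy: "x \<in> carrier N" "y \<in> carrier N" "g x = g y"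
    have "g (x \<ominus>\<^bsub>N\<^esub> y) = \<zero>\<^bsub>N'\<^esub>"
      unfolding mod_hom_minus[OF mN mN' g xy(1,2)] using xy gc by (simp add: a_minus_def N'.M.r_neg)
    then have "x \<ominus>\<^bsub>N\<^esub> y = \<zero>\<^bsub>N\<^esub>" using xy by (intro ker) auto
    then have "mod_cong N {\<zero>\<^bsub>N\<^esub>} x y" using xy by (simp add: mod_cong_def)
    then show "x = y" using xy by (elim N.congE_add) simp
  qed
  then show ?thesis using surj by (simp add: bij_betw_def)
qed

lemma red_image_sub:
  assumes "module R M" "module R N" "u \<in> mod_hom R M N" "submodule A R M"
  shows "submodule (red_image u A N) R N" "red N \<subseteq> red_image u A N" "u ` A \<subseteq> red_image u A N"
proof -
  interpret N: rmodule R N using assms(2) by (rule rmoduleI)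
  note s = sub_image[OF assms(1-4)] red_sub[OF assms(2)]
  show "submodule (red_image u A N) R N" "red N \<subseteq> red_image u A N" "u ` A \<subseteq> red_image u A N"
    unfolding red_image_def using N.sub_set_add[OF s] N.set_add_upper[OF s] by auto
qed

text \<open>The chain is pulled back along u and cut down to A. Strictness survives because every
  element of the image is reached from A modulo \<open>red N\<close>, which all members of the chain
  contain.\<close>

lemma red_image_chain:
  assumes M: "module R M" and N: "module R N" and u: "u \<in> mod_hom R M N"
    and A: "submodule A R M" and ch: "sub_chain R N (red N) n (red_image u A N)"
  shows "sub_chain R M ({x \<in> carrier M. u x \<in> red N} \<inter> A) n A"
proof -
  interpret M: rmodule R M using M by (rule rmoduleI)
  interpret N: rmodule R N using N by (rule rmoduleI)
  obtain H where H: "\<forall>i\<le>n. submodule (H i) R N \<and> red N \<subseteq> H i \<and> H i \<subseteq> red_image u A N"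
    "\<forall>i<n. H i \<subset> H (Suc i)" using ch unfolding sub_chain_def by (elim exE conjE)
  define K where "K = (\<lambda>i. {x \<in> carrier M. u x \<in> H i} \<inter> A)"
  have "submodule (K i) R M \<and> {x \<in> carrier M. u x \<in> red N} \<inter> A \<subseteq> K i \<and> K i \<subseteq> A" if "i \<le> n" for i
    using H(1) that M.sub_Int[OF sub_vimage[OF M N u] A] by (auto simp: K_def)
  moreover have "K i \<subset> K (Suc i)" if i: "i < n" for i
  proof -
    have s: "submodule (H i) R N" "submodule (H (Suc i)) R N" "red N \<subseteq> H i" "red N \<subseteq> H (Suc i)"
      "H (Suc i) \<subseteq> red_image u A N" "H i \<subset> H (Suc i)"
      using H i by auto
    obtain y where y: "y \<in> H (Suc i)" "y \<notin> H i" using s(6) by auto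
    obtain a q where aq: "a \<in> A" "q \<in> red N" "y = u a \<oplus>\<^bsub>N\<^esub> q"
      using y s(5) unfolding red_image_def subset_iff N.set_add_mem by blast
    have ac: "a \<in> carrier M" using aq M.sub_carrier[OF A] by auto
    have c: "mod_cong N (red N) y (u a)"
      by (rule N.congI_add[OF red_sub[OF N] mod_hom_closed[OF u ac] aq(2,3)])
    have "u a \<in> H (Suc i)" using N.cong_mem_iff[OF s(2) N.cong_mono[OF c s(4)]] y by blast
    moreover have "u a \<notin> H i" using N.cong_mem_iff[OF s(1) N.cong_mono[OF c s(3)]] y by blast
    ultimately show ?thesis using s(6) aq(1) ac by (auto simp: K_def)
  qed
  ultimately show ?thesis unfolding sub_chain_def by (intro exI[of _ K]) auto
qed

text \<open>Comparing lengths shows that \<open>N / red N\<close> is the direct sum of the image of \<open>A\<close> and the kernel of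
  the map induced by \<open>u\<close>.\<close>

lemma red_split:
  assumes L: "liftable N" and ind: "indecomposable_module R N" and K: "module R K"
    and u: "u \<in> mod_hom R N K" and A: "submodule A R N" "red N \<subseteq> A" and r: "r > 0"
    and ch: "sub_chain R K (red K) r (red_image u A K)"
    and A1: "\<not> sub_chain R N (red N) (Suc r) A"
    and B: "submodule B R K" "u ` carrier N \<subseteq> B" "red K \<subseteq> B" "\<not> sub_chain R K (red K) (Suc r) B"
  shows "A = carrier N \<and> (\<forall>x\<in>carrier N. u x \<in> red K \<longrightarrow> x \<in> red N)"
proof -
  have N: "module R N" by (rule liftable_module[OF L])
  interpret N: rmodule R N using N by (rule rmoduleI)
  interpret K: rmodule R K using K by (rule rmoduleI)
  let ?C = "{x \<in> carrier N. u x \<in> red K}"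
  have sC: "submodule ?C R N" by (rule sub_vimage[OF N K u red_sub[OF K]])
  have QC: "red N \<subseteq> ?C" using red_hom[OF N K u] N.sub_carrier[OF red_sub[OF N]] by auto
  have ch': "sub_chain R N (?C \<inter> A) r A" by (rule red_image_chain[OF N K u A(1) ch])
  \<comment> \<open>If u sent more of A than \<open>red N\<close> into \<open>red K\<close>, the
    pulled back chain could be prolonged downwards, against \<open>A1\<close>.\<close>
  have int: "?C \<inter> A = red N"
  proof (rule ccontr)
    assume "?C \<inter> A \<noteq> red N"
    then have "red N \<subset> ?C \<inter> A" using QC A(2) by auto
    then show False using N.chain_bottom[OF ch' red_sub[OF N]] A1 by blast
  qed
  \<comment> \<open>Likewise, if B were larger than the image of A, the chain could be prolonged
    upwards. So u(A) reaches all of u(N) modulo \<open>red K\<close>, that is, A and the kernel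
    together span N.\<close>
  have sum: "\<exists>a\<in>A. mod_cong N ?C y a" if y: "y \<in> carrier N" for y
  proof -
    note ri = red_image_sub[OF N K u A(1)]
    have "red_image u A K \<subseteq> B"
      unfolding red_image_def by (rule K.set_add_least[OF B(1)]) (use B N.sub_carrier[OF A(1)] in auto)
    moreover have "\<not> red_image u A K \<subset> B" using K.chain_top[OF ch B(1)] B(4) by blast
    ultimately have "u y \<in> red_image u A K" using B(2) y by auto
    then obtain a q where aq: "a \<in> A" "q \<in> red K" "u y = u a \<oplus>\<^bsub>K\<^esub> q"
      unfolding red_image_def K.set_add_mem by blast
    have ac: "a \<in> carrier N" using N.sub_carrier[OF A(1) aq(1)] .
    have "mod_cong K (red K) (u y) (u a)"
      by (rule K.congI_add[OF red_sub[OF K] mod_hom_closed[OF u ac] aq(2,3)])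
    then have "mod_cong N ?C y a"
      using y ac by (simp add: mod_cong_def mod_hom_minus[OF N K u])
    then show ?thesis using aq by blast
  qed
  have "A \<noteq> red N"
  proof
    assume "A = red N"
    then have "?C \<inter> A = A" using QC by auto
    then have "sub_chain R N A (Suc 0) A" using N.chain_less[OF ch'] r by auto
    then obtain H where H: "\<forall>i\<le>Suc 0. submodule (H i) R N \<and> A \<subseteq> H i \<and> H i \<subseteq> A"
      "\<forall>i<Suc 0. H i \<subset> H (Suc i)"
      unfolding sub_chain_def by (elim exE conjE)
    have "H 0 = A" "H (Suc 0) = A" using H(1) by auto
    then show False using H(2)[rule_format, of 0] by simp
  qed
  then have "A = carrier N \<and> ?C = red N"
    using red_indecomposable[OF L ind A sC QC sum] int by auto
  then show ?thesis by auto
qed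

text \<open>If h g f kept length r, then \<open>red_split\<close> for h g on N would show that after
  reduction f is onto and h g is injective, and \<open>red_split\<close> for h on N' that the image
  of g is everything. Then g would be bijective after reduction, hence an isomorphism by
  \<open>red_iso\<close>.\<close>

lemma harada_sai_step:
  assumes K: "liftable K" and N': "liftable N'" "indecomposable_module R N'"
    and N: "liftable N" "indecomposable_module R N" and L: "module R L"
    and f: "f \<in> mod_hom R L N" and g: "g \<in> mod_hom R N N'" and h: "h \<in> mod_hom R N' K"
    and g': "\<not> bij_betw g (carrier N) (carrier N')" and r: "r > 0"
    and fr: "\<not> sub_chain R N (red N) (Suc r) (red_image f (carrier L) N)"
    and hr: "\<not> sub_chain R K (red K) (Suc r) (red_image h (carrier N') K)"
  shows "\<not> sub_chain R K (red K) r (red_image (\<lambda>x. h (g (f x))) (carrier L) K)"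
proof
  assume ch: "sub_chain R K (red K) r (red_image (\<lambda>x. h (g (f x))) (carrier L) K)"
  have mN: "module R N" and mN': "module R N'" and mK: "module R K"
    using liftable_module N N' K by auto
  interpret L: rmodule R L using L by (rule rmoduleI)
  interpret N: rmodule R N using mN by (rule rmoduleI)
  interpret N': rmodule R N' using mN' by (rule rmoduleI)
  interpret K: rmodule R K using mK by (rule rmoduleI)
  note fc = mod_hom_closed[OF f] and gc = mod_hom_closed[OF g] and hc = mod_hom_closed[OF h]
  define A where "A = red_image f (carrier L) N"
  define A' where "A' = red_image g A N'"
  note sA = red_image_sub[OF L mN f L.carrier_is_submodule, folded A_def]
  note sA' = red_image_sub[OF mN mN' g sA(1), folded A'_def]
  note sB = red_image_sub[OF mN' mK h N'.carrier_is_submodule]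
  let ?u = "compose (carrier N) h g"
  have u: "?u \<in> mod_hom R N K" by (rule mod_hom_compose[OF mN g h])
  have "red_image (\<lambda>x. h (g (f x))) (carrier L) K \<subseteq> red_image ?u A K"
    unfolding red_image_def[of "\<lambda>x. h (g (f x))"]
  proof (rule K.set_add_least[OF red_image_sub(1)[OF mN mK u sA(1)] _ red_image_sub(2)[OF mN mK u sA(1)]])
    have "h (g (f x)) \<in> ?u ` A" if "x \<in> carrier L" for x
      using sA(3) that fc by (auto intro!: image_eqI[of _ _ "f x"] simp: compose_def)
    then show "(\<lambda>x. h (g (f x))) ` carrier L \<subseteq> red_image ?u A K"
      using red_image_sub(3)[OF mN mK u sA(1)] by auto
  qed
  then have chu: "sub_chain R K (red K) r (red_image ?u A K)" using K.chain_mono[OF ch] by blast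
  have uB: "?u ` carrier N \<subseteq> red_image h (carrier N') K"
    using sB(3) gc by (auto simp: compose_def)
  have 1: "A = carrier N \<and> (\<forall>x\<in>carrier N. ?u x \<in> red K \<longrightarrow> x \<in> red N)"
    by (rule red_split[OF N mK u sA(1,2) r chu fr[folded A_def] sB(1) uB sB(2) hr])
  have "red_image ?u A K \<subseteq> red_image h A' K"
    unfolding red_image_def[of ?u]
  proof (rule K.set_add_least[OF red_image_sub(1)[OF mN' mK h sA'(1)] _ red_image_sub(2)[OF mN' mK h sA'(1)]])
    have "?u x \<in> h ` A'" if "x \<in> A" for x
      using sA'(3) that N.sub_carrier[OF sA(1)] by (auto simp: compose_def)
    then show "?u ` A \<subseteq> red_image h A' K" using red_image_sub(3)[OF mN' mK h sA'(1)] by auto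
  qed
  then have chh: "sub_chain R K (red K) r (red_image h A' K)" using K.chain_mono[OF chu] by blast
  \<comment> \<open>A chain in the image of A under g pulls back to A with the same length, so A'
    inherits the bound assumed for f.\<close>
  have A'1: "\<not> sub_chain R N' (red N') (Suc r) A'"
  proof
    assume "sub_chain R N' (red N') (Suc r) A'"
    then have "sub_chain R N ({x \<in> carrier N. g x \<in> red N'} \<inter> A) (Suc r) A"
      unfolding A'_def by (rule red_image_chain[OF mN mN' g sA(1)])
    moreover have "red N \<subseteq> {x \<in> carrier N. g x \<in> red N'} \<inter> A"
      using red_hom[OF mN mN' g] sA(2) N.sub_carrier[OF sA(1)] by auto
    ultimately show False using N.chain_mono fr[folded A_def] by blast
  qed
  have hB: "h ` carrier N' \<subseteq> red_image h (carrier N') K" by (rule sB(3))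
  have 2: "A' = carrier N' \<and> (\<forall>x\<in>carrier N'. h x \<in> red K \<longrightarrow> x \<in> red N')"
    by (rule red_split[OF N' mK h sA'(1,2) r chh A'1 sB(1) hB sB(2) hr])
  have "bij_betw g (carrier N) (carrier N')"
  proof (rule red_iso[OF N(1) N'(1) g])
    fix y assume "y \<in> carrier N'"
    then have "y \<in> red_image g (carrier N) N'" using 1 2 A'_def by auto
    then obtain x q where "x \<in> carrier N" "q \<in> red N'" "y = g x \<oplus>\<^bsub>N'\<^esub> q"
      unfolding red_image_def N'.set_add_mem by blast
    then show "\<exists>x\<in>carrier N. mod_cong N' (red N') (g x) y"
      using N'.congI_add[OF red_sub[OF mN'] gc] N'.cong_sym[OF red_sub[OF mN']] by blast
  next
    fix x assume x: "x \<in> carrier N" "g x \<in> red N'"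
    then have "?u x \<in> red K" using red_hom[OF mN' mK h] by (simp add: compose_def)
    then show "x \<in> red N" using 1 x by blast
  qed
  then show False using g' by simp
qed

text \<open>Here \<open>f\<close> maps M j to M i and is a composite of n non-isomorphisms within
  the family. The recursion adds maps at the source; \<open>path_target\<close> adds one at the
  other end.\<close>

inductive path :: "('i \<Rightarrow> ('a, 'b) module) \<Rightarrow> 'i set \<Rightarrow> nat \<Rightarrow> 'i \<Rightarrow> 'i \<Rightarrow> ('b \<Rightarrow> 'b) \<Rightarrow> bool"
  for M I where
    path_0: "i \<in> I \<Longrightarrow> path M I 0 i i (\<lambda>x\<in>carrier (M i). x)"
  | path_Suc: "path M I n j i f \<Longrightarrow> k \<in> I \<Longrightarrow> g \<in> mod_hom R (M k) (M j) \<Longrightarrow>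
      \<not> bij_betw g (carrier (M k)) (carrier (M j)) \<Longrightarrow> path M I (Suc n) k i (compose (carrier (M k)) f g)"

lemma path_hom:
  assumes "path M I n j i f" "\<And>i. i \<in> I \<Longrightarrow> module R (M i)"
  shows "i \<in> I \<and> j \<in> I \<and> f \<in> mod_hom R (M j) (M i)"
  using assms(1)
proof induct
  case (path_0 i)
  then show ?case using mod_hom_id[OF assms(2)] by blast
next
  case (path_Suc n j i f k g)
  then show ?case using mod_hom_compose[OF assms(2)] by blast
qed

lemma path_split:
  assumes "path M I (a + b) k i f" "\<And>i. i \<in> I \<Longrightarrow> module R (M i)"
  shows "\<exists>j f1 f2. path M I a j i f1 \<and> path M I b k j f2 \<and> f = compose (carrier (M k)) f1 f2"
  using assms(1)
proof (induct b arbitrary: k f)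
  case 0
  then have p: "path M I a k i f" by simp
  note ph = path_hom[OF p assms(2)]
  have "f = compose (carrier (M k)) f (\<lambda>x\<in>carrier (M k). x)"
    using ph by (auto simp: mod_hom_def compose_def fun_eq_iff PiE_def extensional_def)
  then show ?case using p path_0[of k I M] ph by blast
next
  case (Suc b)
  then have "path M I (Suc (a + b)) k i f" by simp
  then obtain j f' g where *: "path M I (a + b) j i f'" "k \<in> I" "g \<in> mod_hom R (M k) (M j)"
    "\<not> bij_betw g (carrier (M k)) (carrier (M j))" "f = compose (carrier (M k)) f' g"
    by (auto elim: path.cases)
  obtain l f1 f2 where l: "path M I a l i f1" "path M I b j l f2" "f' = compose (carrier (M j)) f1 f2"
    using Suc(1)[OF *(1)] by blast
  have "f = compose (carrier (M k)) f1 (compose (carrier (M k)) f2 g)"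
    unfolding *(5) l(3) using mod_hom_closed[OF *(3)] by (auto simp: compose_def fun_eq_iff)
  then show ?case using l path_Suc[OF l(2) *(2-4)] by blast
qed

text \<open>Since 2^(n+1) - 1 = (2^n - 1) + 1 + (2^n - 1), the path consists of two shorter ones,
  whose images have length at most B - n by induction, around a middle non-isomorphism. By
  \<open>harada_sai_step\<close> the length of the image of the composite is smaller by one.\<close>

lemma harada_sai:
  assumes good: "\<And>i. i \<in> I \<Longrightarrow> liftable (M i) \<and> indecomposable_module R (M i)"
    and bound: "\<And>i. i \<in> I \<Longrightarrow> \<not> sub_chain R (M i) (red (M i)) (Suc B) (carrier (M i))"
    and "n \<le> B" "path M I (2 ^ n - 1) j i f"
  shows "\<not> sub_chain R (M i) (red (M i)) (Suc (B - n)) (red_image f (carrier (M j)) (M i))"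
  using assms(3,4)
proof (induct n arbitrary: i j f)
  have m: "module R (M i)" if "i \<in> I" for i using good[OF that] liftable_module by blast
  case 0
  have i: "i \<in> I" and j: "j \<in> I" and f: "f \<in> mod_hom R (M j) (M i)" using path_hom[OF 0(2) m] by auto
  interpret N: rmodule R "M i" by (rule rmoduleI[OF m[OF i]])
  interpret L: rmodule R "M j" by (rule rmoduleI[OF m[OF j]])
  have "red_image f (carrier (M j)) (M i) \<subseteq> carrier (M i)"
    using N.sub_carrier[OF red_image_sub(1)[OF m[OF j] m[OF i] f L.carrier_is_submodule]] by auto
  then show ?case using bound[OF i] N.chain_mono by auto
next
  have m: "module R (M i)" if "i \<in> I" for i using good[OF that] liftable_module by blast
  case (Suc n)
  have "(2::nat) ^ Suc n - 1 = Suc (2 ^ n - 1) + (2 ^ n - 1)" by (simp add: numeral_2_eq_2)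
  then have "path M I (Suc (2 ^ n - 1) + (2 ^ n - 1)) j i f" using Suc(3) by simp
  from path_split[OF this m] obtain k p f2 where p: "path M I (Suc (2 ^ n - 1)) k i p"
    "path M I (2 ^ n - 1) j k f2" "f = compose (carrier (M j)) p f2" by auto
  obtain l f1 g where l: "path M I (2 ^ n - 1) l i f1" "g \<in> mod_hom R (M k) (M l)"
    "\<not> bij_betw g (carrier (M k)) (carrier (M l))" "p = compose (carrier (M k)) f1 g"
    using p(1) by (auto elim: path.cases)
  have i: "i \<in> I" "l \<in> I" and f1: "f1 \<in> mod_hom R (M l) (M i)" using path_hom[OF l(1) m] by auto
  have k: "k \<in> I" "j \<in> I" and f2: "f2 \<in> mod_hom R (M j) (M k)" using path_hom[OF p(2) m] by auto
  have r: "0 < B - n" "Suc (B - Suc n) = B - n" "n \<le> B" using Suc(2) by auto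
  have "\<not> sub_chain R (M i) (red (M i)) (B - n) (red_image (\<lambda>x. f1 (g (f2 x))) (carrier (M j)) (M i))"
    by (rule harada_sai_step[OF _ _ _ _ _ _ f2 l(2) f1 l(3) r(1) Suc(1)[OF r(3) p(2)] Suc(1)[OF r(3) l(1)]])
      (use good i k m in auto)
  moreover have "(\<lambda>x. f1 (g (f2 x))) ` carrier (M j) = f ` carrier (M j)"
    unfolding p(3) l(4) using mod_hom_closed[OF f2] by (auto simp: compose_def)
  ultimately show ?case using r(2) by (simp add: red_image_def)
qed

text \<open>For n = B the image modulo \<open>red\<close> has length 0, so it lies in
  \<open>red\<close>, which is contained in \<mm> M.\<close>

lemma harada_sai_zero:
  assumes good: "\<And>i. i \<in> I \<Longrightarrow> liftable (M i) \<and> indecomposable_module R (M i)"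
    and bound: "\<And>i. i \<in> I \<Longrightarrow> \<not> sub_chain R (M i) (red (M i)) (Suc B) (carrier (M i))"
    and p: "path M I (2 ^ B - 1) j i f" and x: "x \<in> carrier (M j)"
  shows "f x \<in> filt (M i) 1"
proof -
  have m: "module R (M i)" if "i \<in> I" for i using good[OF that] liftable_module by blast
  have i: "i \<in> I" and j: "j \<in> I" and f: "f \<in> mod_hom R (M j) (M i)" using path_hom[OF p m] by auto
  interpret N: rmodule R "M i" by (rule rmoduleI[OF m[OF i]])
  interpret L: rmodule R "M j" by (rule rmoduleI[OF m[OF j]])
  note ri = red_image_sub[OF m[OF j] m[OF i] f L.carrier_is_submodule]
  have "sub_chain R (M i) (red (M i)) (Suc 0) (red_image f (carrier (M j)) (M i))"
    if "red (M i) \<noteq> red_image f (carrier (M j)) (M i)"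
    by (rule N.chain_bottom[OF N.chain_0[OF ri(1) order_refl] red_sub[OF m[OF i]]]) (use ri(2) that in auto)
  then have "red (M i) = red_image f (carrier (M j)) (M i)"
    using harada_sai[OF good bound order_refl p] by auto
  then have "f x \<in> red (M i)" using ri(3) x by auto
  then show ?thesis using red_filt[OF m[OF i]] by auto
qed

end

subsection \<open>Systems of parameters\<close>

context noeth_local
begin

definition height_ge :: "nat \<Rightarrow> 'a set \<Rightarrow> bool" where
  "height_ge n P \<longleftrightarrow>
     (\<exists>C. (\<forall>i\<le>n. primeideal (C i) R) \<and> (\<forall>i<n. C i \<subset> C (Suc i)) \<and> C n = P)"

text \<open>Says that the list generates an \<mm>-primary ideal. The formulation by primes passes at
  once to powers of the members; powers of \<mm> are recovered in
  \<open>primary_list_mpow\<close>.\<close>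

definition primary_list :: "'a list \<Rightarrow> bool" where
  "primary_list zs \<longleftrightarrow> set zs \<subseteq> \<mm> \<and> (\<forall>P. primeideal P R \<longrightarrow> set zs \<subseteq> P \<longrightarrow> P = \<mm>)"

lemma height_ge_0: "primeideal P R \<Longrightarrow> height_ge 0 P"
  unfolding height_ge_def by auto

lemma height_ge_Suc:
  assumes "height_ge n Q" "Q \<subset> P" "primeideal P R"
  shows "height_ge (Suc n) P"
proof -
  obtain C where C: "\<forall>i\<le>n. primeideal (C i) R" "\<forall>i<n. C i \<subset> C (Suc i)" "C n = Q"
    using assms(1) unfolding height_ge_def by (elim exE conjE)
  define D where "D = (\<lambda>i. if i \<le> n then C i else P)"
  have "\<forall>i\<le>Suc n. primeideal (D i) R" using C assms by (auto simp: D_def)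
  moreover have "D i \<subset> D (Suc i)" if "i < Suc n" for i
    using C assms that by (cases "i = n") (auto simp: D_def)
  ultimately show ?thesis unfolding height_ge_def by (intro exI[of _ D]) (auto simp: D_def)
qed

lemma height_ge_less:
  assumes "height_ge n P" "m < n"
  obtains Q where "height_ge m Q" "Q \<subset> P"
proof -
  obtain C where C: "\<forall>i\<le>n. primeideal (C i) R" "\<forall>i<n. C i \<subset> C (Suc i)" "C n = P"
    using assms(1) unfolding height_ge_def by (elim exE conjE)
  have "C m \<subset> C (m + Suc k)" if "m + Suc k \<le> n" for k
    using that
  proof (induct k)
    case (Suc k)
    then show ?case using C(2)[rule_format, of "m + Suc k"] by auto
  qed (use C in simp)
  from this[of "n - Suc m"] have "C m \<subset> C n" using assms(2) by simp
  moreover have "height_ge m (C m)" unfolding height_ge_def by (intro exI[of _ C]) (use C assms(2) in auto)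
  ultimately show thesis using that C by auto
qed

lemma krull_dim_heights:
  "krull_dim R = Sup {enat n | n. \<exists>P. height_ge n P}"
  unfolding krull_dim_def height_ge_def by (rule arg_cong[of _ _ Sup]) blast

lemma height_le_dim: "krull_dim R = enat d \<Longrightarrow> height_ge n P \<Longrightarrow> n \<le> d"
  unfolding krull_dim_heights by (metis (mono_tags, lifting) Sup_upper enat_ord_simps(1) mem_Collect_eq)

text \<open>A finite supremum of a nonempty set in \<open>enat\<close> is attained.\<close>

lemma height_dim:
  assumes "krull_dim R = enat d"
  obtains P where "height_ge d P"
proof -
  let ?A = "{enat n | n. \<exists>P. height_ge n P}"
  have ne: "?A \<noteq> {}" using height_ge_0[OF m_prime] by blast
  have "Sup ?A = enat d" using assms by (simp add: krull_dim_heights)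
  then have "finite ?A" "Max ?A = enat d" using ne by (auto simp: Sup_enat_def split: if_splits)
  then have "enat d \<in> ?A" using Max_in[OF _ ne] by metis
  then show thesis using that by auto
qed

text \<open>The next element avoids, apart from \<mm>, the finitely many primes that cover the
  primes over the previous elements. A prime over the longer list then lies strictly above one of
  them, which raises the height by one.\<close>

lemma exists_parameters:
  assumes dim: "krull_dim R = enat d" and "k \<le> d"
  shows "\<exists>zs. length zs = k \<and> set zs \<subseteq> \<mm> \<and> (\<forall>P. primeideal P R \<longrightarrow> set zs \<subseteq> P \<longrightarrow> height_ge k P)"
  using assms(2)
proof (induct k)
  case 0
  then show ?case using height_ge_0 by (intro exI[of _ "[]"]) auto
next
  case (Suc k)
  then obtain zs where zs: "length zs = k" "set zs \<subseteq> \<mm>"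
    "\<And>P. primeideal P R \<Longrightarrow> set zs \<subseteq> P \<Longrightarrow> height_ge k P" by auto
  have zc: "set zs \<subseteq> carrier R" using zs m_carrier by auto
  obtain S where S: "finite S" "\<forall>P\<in>S. primeideal P R \<and> Idl (set zs) \<subseteq> P"
    "\<forall>P. primeideal P R \<longrightarrow> Idl (set zs) \<subseteq> P \<longrightarrow> (\<exists>Q\<in>S. Q \<subseteq> P)"
    using finite_minimal_primes[OF genideal_ideal[OF zc]] by (elim exE conjE)
  have "\<exists>x\<in>\<mm>. \<forall>P\<in>S - {\<mm>}. x \<notin> P"
  proof (rule prime_avoidance[OF _ _ m_ideal])
    fix P assume "P \<in> S - {\<mm>}"
    then show "primeideal P R \<and> \<not> \<mm> \<subseteq> P" using S(2) prime_subset_m[of P] by auto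
  qed (use S in simp)
  then obtain x where x: "x \<in> \<mm>" "\<forall>P\<in>S - {\<mm>}. x \<notin> P" by (elim bexE)
  have "height_ge (Suc k) P" if P: "primeideal P R" "set (x # zs) \<subseteq> P" for P
  proof -
    have "Idl (set zs) \<subseteq> P" using genideal_minimal[OF primeideal.axioms(1)[OF P(1)]] P(2) by auto
    then obtain Q where Q: "Q \<in> S" "Q \<subseteq> P" using S(3) P(1) by blast
    have Q': "primeideal Q R" "set zs \<subseteq> Q" using S(2) Q(1) genideal_self[OF zc] by auto
    show ?thesis
    proof (cases "Q = \<mm>")
      case True
      \<comment> \<open>\<mm> itself cannot be avoided, but its height is at least k + 1 because k <
        d.\<close>
      then have Pm: "P = \<mm>" using prime_subset_m[OF P(1)] Q by auto
      obtain P0 where P0: "height_ge d P0" by (rule height_dim[OF dim])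
      have p0: "primeideal P0 R" using P0 unfolding height_ge_def by auto
      have "k < d" using Suc(2) by simp
      with P0 obtain Q0 where "height_ge k Q0" "Q0 \<subset> P0" by (rule height_ge_less)
      then show ?thesis unfolding Pm using prime_subset_m[OF p0] m_prime height_ge_Suc by blast
    next
      case False
      then have "x \<notin> Q" using x(2) Q(1) by auto
      then have "Q \<subset> P" using Q(2) P(2) by auto
      then show ?thesis by (rule height_ge_Suc[OF zs(3)[OF Q'] _ P(1)])
    qed
  qed
  then show ?case using zs x by (intro exI[of _ "x # zs"]) auto
qed

text \<open>A prime over d such elements has height at least d; if it were not \<mm>, then \<mm>
  would have height at least d + 1.\<close>

lemma exists_primary_list:
  assumes "krull_dim R = enat d"
  obtains zs where "length zs = d" "primary_list zs"
proof -
  obtain zs where zs: "length zs = d" "set zs \<subseteq> \<mm>" "\<forall>P. primeideal P R \<longrightarrow> set zs \<subseteq> P \<longrightarrow> height_ge d P"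
    using exists_parameters[OF assms order_refl] by (elim exE conjE)
  have "P = \<mm>" if P: "primeideal P R" "set zs \<subseteq> P" for P
  proof (rule ccontr)
    assume "P \<noteq> \<mm>"
    then have "P \<subset> \<mm>" using prime_subset_m[OF P(1)] by auto
    then have "height_ge (Suc d) \<mm>" using zs(3) P height_ge_Suc m_prime by blast
    then show False using height_le_dim[OF assms] by fastforce
  qed
  then show thesis using that zs by (auto simp: primary_list_def)
qed

lemma primary_list_pow:
  assumes "primary_list zs" "n > 0"
  shows "primary_list (map (\<lambda>z. z [^] (n::nat)) zs)"
  unfolding primary_list_def
proof (intro conjI allI impI)
  have zm: "set zs \<subseteq> \<mm>" using assms by (simp add: primary_list_def)
  show "set (map (\<lambda>z. z [^] n) zs) \<subseteq> \<mm>"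
    using pow_mpow[of _ n] mpow_Suc_m[OF assms(2)] zm by auto
  fix P assume P: "primeideal P R" "set (map (\<lambda>z. z [^] n) zs) \<subseteq> P"
  have "set zs \<subseteq> P"
  proof
    fix z assume "z \<in> set zs"
    then show "z \<in> P" using P zm m_carrier prime_pow[OF P(1), of z n] by auto
  qed
  then show "P = \<mm>" using assms(1) P(1) by (simp add: primary_list_def)
qed

lemma primary_list_mpow:
  assumes "primary_list zs"
  shows "\<exists>k. mpow k \<subseteq> Idl (set zs)"
proof (rule prime_radical)
  have zc: "set zs \<subseteq> carrier R" using assms m_carrier by (auto simp: primary_list_def)
  show "ideal (Idl (set zs)) R" by (rule genideal_ideal[OF zc])
  fix P assume "primeideal P R" "Idl (set zs) \<subseteq> P"
  then show "P = \<mm>" using assms genideal_self[OF zc] unfolding primary_list_def by blast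
qed

lemma primary_list_sop:
  assumes "primary_list zs" "krull_dim R = enat (length zs)"
  shows "system_of_parameters R \<mm> zs"
proof -
  obtain k where "mpow k \<subseteq> Idl (set zs)" using primary_list_mpow[OF assms(1)] by (elim exE)
  then have "\<exists>n::nat. a [^] n \<in> Idl (set zs)" if "a \<in> \<mm>" for a using pow_mpow[OF that, of k] by blast
  then show ?thesis using assms by (simp add: system_of_parameters_def primary_list_def)
qed

end

subsection \<open>Transport of modules along injections\<close>

text \<open>Projectivity and approximations are tested only on modules with elements of type
  \<open>'a elt\<close>. A finitely generated module on another type is brought there by an
  injection on its carrier.\<close>

definition transport :: "('a, 'b) module \<Rightarrow> ('b \<Rightarrow> 'c) \<Rightarrow> ('a, 'c) module" where
  "transport M \<iota> =
     \<lparr>carrier = \<iota> ` carrier M, monoid.mult = undefined, one = undefined, ring.zero = \<iota> \<zero>\<^bsub>M\<^esub>,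
      add = (\<lambda>x y. \<iota> (inv_into (carrier M) \<iota> x \<oplus>\<^bsub>M\<^esub> inv_into (carrier M) \<iota> y)),
      smult = (\<lambda>r x. \<iota> (r \<odot>\<^bsub>M\<^esub> inv_into (carrier M) \<iota> x))\<rparr>"

lemma transport_simps:
  assumes "inj_on \<iota> (carrier M)"
  shows "carrier (transport M \<iota>) = \<iota> ` carrier M" "\<zero>\<^bsub>transport M \<iota>\<^esub> = \<iota> \<zero>\<^bsub>M\<^esub>"
    "x \<in> carrier M \<Longrightarrow> y \<in> carrier M \<Longrightarrow> \<iota> x \<oplus>\<^bsub>transport M \<iota>\<^esub> \<iota> y = \<iota> (x \<oplus>\<^bsub>M\<^esub> y)"
    "x \<in> carrier M \<Longrightarrow> r \<odot>\<^bsub>transport M \<iota>\<^esub> \<iota> x = \<iota> (r \<odot>\<^bsub>M\<^esub> x)"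
  using assms by (simp_all add: transport_def inv_into_f_f)

lemma transport_module:
  assumes "module R M" and inj: "inj_on \<iota> (carrier M)"
  shows "module R (transport M \<iota>)"
proof -
  interpret M: module R M by fact
  note s = transport_simps[OF inj]
  have "abelian_group (transport M \<iota>)"
  proof (rule abelian_groupI)
    fix u assume "u \<in> carrier (transport M \<iota>)"
    then obtain x where x: "x \<in> carrier M" "u = \<iota> x" by (auto simp: s)
    then have "\<iota> (\<ominus>\<^bsub>M\<^esub> x) \<oplus>\<^bsub>transport M \<iota>\<^esub> u = \<zero>\<^bsub>transport M \<iota>\<^esub>" by (simp add: s M.M.l_neg)
    then show "\<exists>y\<in>carrier (transport M \<iota>). y \<oplus>\<^bsub>transport M \<iota>\<^esub> u = \<zero>\<^bsub>transport M \<iota>\<^esub>"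
      using x by (intro bexI[of _ "\<iota> (\<ominus>\<^bsub>M\<^esub> x)"]) (auto simp: s)
  qed (auto simp: s M.M.a_ac)
  then show ?thesis
    by (intro moduleI) (auto simp: s M.R.is_cring M.smult_l_distr M.smult_r_distr M.smult_assoc1)
qed

lemma transport_hom:
  assumes "module R M" and inj: "inj_on \<iota> (carrier M)"
  shows "restrict \<iota> (carrier M) \<in> mod_hom R M (transport M \<iota>)"
    and "bij_betw (restrict \<iota> (carrier M)) (carrier M) (carrier (transport M \<iota>))"
proof -
  show "restrict \<iota> (carrier M) \<in> mod_hom R M (transport M \<iota>)"
    by (rule mod_hom_restrictI[OF assms(1)]) (auto simp: transport_simps[OF inj])
  show "bij_betw (restrict \<iota> (carrier M)) (carrier M) (carrier (transport M \<iota>))"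
    using inj by (auto simp: bij_betw_def transport_simps[OF inj] inj_on_def)
qed

lemma iso_fin_gen:
  assumes M: "module R M" and N: "module R N" and f: "f \<in> mod_hom R M N"
    and surj: "f ` carrier M = carrier N" and fg: "fin_gen_module R M"
  shows "fin_gen_module R N"
proof -
  interpret M: rmodule R M using M by (rule rmoduleI)
  interpret N: rmodule R N using N by (rule rmoduleI)
  obtain S where S: "finite S" "S \<subseteq> carrier M" "mod_span R M S = carrier M"
    using fg unfolding fin_gen_module_def by (elim exE conjE)
  have fS: "f ` S \<subseteq> carrier N" using S mod_hom_closed[OF f] by auto
  have "mod_span R M S \<subseteq> {x \<in> carrier M. f x \<in> mod_span R N (f ` S)}"
    by (rule M.span_least[OF sub_vimage[OF M N f N.span_sub[OF fS]]]) (use S N.span_mem in auto)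
  then have "f ` carrier M \<subseteq> mod_span R N (f ` S)" using S by auto
  then have "carrier N \<subseteq> mod_span R N (f ` S)" using surj by simp
  then have "mod_span R N (f ` S) = carrier N" using N.sub_carrier[OF N.span_sub[OF fS]] by auto
  then show ?thesis unfolding fin_gen_module_def using S fS N by blast
qed

lemma iso_regular_sequence:
  assumes M: "module R M" and N: "module R N" and iso: "mod_iso R M N"
    and id: "\<And>S. S \<subseteq> carrier R \<Longrightarrow> Idl\<^bsub>R\<^esub> S \<subseteq> carrier R"
    and reg: "regular_sequence R M xs"
  shows "regular_sequence R N xs"
proof -
  obtain f where f: "f \<in> mod_hom R M N" "bij_betw f (carrier M) (carrier N)"
    using iso by (auto simp: mod_iso_def)
  obtain g where g: "g \<in> mod_hom R N M" "\<forall>x\<in>carrier M. g (f x) = x" "\<forall>y\<in>carrier N. f (g y) = y"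
    using iso_inverse[OF M N f] by (elim bexE conjE)
  note fc = mod_hom_closed[OF f(1)] and gc = mod_hom_closed[OF g(1)]
  have xsc: "set xs \<subseteq> carrier R" using reg by (simp add: regular_sequence_def)
  have ic: "Idl\<^bsub>R\<^esub> (set (take i xs)) \<subseteq> carrier R" for i
    by (rule id) (use xsc set_take_subset[of i xs] in blast)
  have gI: "g y \<in> ideal_times_module R (Idl\<^bsub>R\<^esub> (set (take i xs))) M"
    if "y \<in> ideal_times_module R (Idl\<^bsub>R\<^esub> (set (take i xs))) N" for i y
    using mod_hom_ideal_times[OF N M g(1) ic gc order_refl order_refl that[unfolded ideal_times_module_eq]]
    by (simp add: ideal_times_module_eq)
  have fI: "f y \<in> ideal_times_module R (Idl\<^bsub>R\<^esub> (set (take i xs))) N"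
    if "y \<in> ideal_times_module R (Idl\<^bsub>R\<^esub> (set (take i xs))) M" for i y
    using mod_hom_ideal_times[OF M N f(1) ic fc order_refl order_refl that[unfolded ideal_times_module_eq]]
    by (simp add: ideal_times_module_eq)
  have "y \<in> ideal_times_module R (Idl\<^bsub>R\<^esub> (set (take i xs))) N"
    if i: "i < length xs" and y: "y \<in> carrier N"
      and xy: "xs ! i \<odot>\<^bsub>N\<^esub> y \<in> ideal_times_module R (Idl\<^bsub>R\<^esub> (set (take i xs))) N" for i y
  proof -
    have "xs ! i \<in> carrier R" using xsc i by auto
    then have "xs ! i \<odot>\<^bsub>M\<^esub> g y \<in> ideal_times_module R (Idl\<^bsub>R\<^esub> (set (take i xs))) M"
      using gI[OF xy] mod_hom_smult[OF g(1) _ y] by simp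
    then have "g y \<in> ideal_times_module R (Idl\<^bsub>R\<^esub> (set (take i xs))) M"
      using reg i gc[OF y] unfolding regular_sequence_def by blast
    from fI[OF this] show ?thesis using g(3) y by simp
  qed
  moreover have "ideal_times_module R (Idl\<^bsub>R\<^esub> (set xs)) N \<noteq> carrier N"
  proof
    assume e: "ideal_times_module R (Idl\<^bsub>R\<^esub> (set xs)) N = carrier N"
    interpret M: rmodule R M using M by (rule rmoduleI)
    have "ideal_times_module R (Idl\<^bsub>R\<^esub> (set xs)) M \<subseteq> carrier M"
      unfolding ideal_times_module_eq using M.sub_carrier[OF M.times_sub[OF ic[of "length xs"] order_refl]] by auto
    moreover have "x \<in> ideal_times_module R (Idl\<^bsub>R\<^esub> (set xs)) M" if "x \<in> carrier M" for x
      using gI[of "f x" "length xs"] fc[OF that] g(2) that e by simp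
    ultimately show False using reg unfolding regular_sequence_def by blast
  qed
  ultimately show ?thesis using xsc unfolding regular_sequence_def by blast
qed

lemma iso_MCM:
  assumes R: "ring R" and M: "MCM R \<mm> M" and N: "module R N" and iso: "mod_iso R M N"
  shows "MCM R \<mm> N"
proof -
  have m: "module R M" using M by (simp add: MCM_def fin_gen_module_def)
  obtain f where f: "f \<in> mod_hom R M N" "bij_betw f (carrier M) (carrier N)"
    using iso by (auto simp: mod_iso_def)
  have "fin_gen_module R N"
    by (rule iso_fin_gen[OF m N f(1)]) (use f M in \<open>auto simp: bij_betw_def MCM_def\<close>)
  moreover have "is_zero_module N" if "is_zero_module M"
  proof -
    have "carrier N = f ` carrier M" using f by (simp add: bij_betw_def)
    also have "\<dots> = {\<zero>\<^bsub>N\<^esub>}" using that mod_hom_zero[OF m N f(1)] by (simp add: is_zero_module_def)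
    finally show ?thesis by (simp add: is_zero_module_def)
  qed
  moreover have "Idl\<^bsub>R\<^esub> S \<subseteq> carrier R" if "S \<subseteq> carrier R" for S
    using ring.genideal_ideal[OF R that] ideal.Icarr by fastforce
  ultimately show ?thesis
    using M iso_regular_sequence[OF m N iso] unfolding MCM_def by blast
qed

subsection \<open>Linear combinations and free modules\<close>

primrec lin_comb :: "('a, 'b) module \<Rightarrow> (nat \<Rightarrow> 'b) \<Rightarrow> nat \<Rightarrow> (nat \<Rightarrow> 'a) \<Rightarrow> 'b" where
  "lin_comb M g 0 c = \<zero>\<^bsub>M\<^esub>"
| "lin_comb M g (Suc n) c = c n \<odot>\<^bsub>M\<^esub> g n \<oplus>\<^bsub>M\<^esub> lin_comb M g n c"

lemma lin_comb_cong: "(\<And>i. i < n \<Longrightarrow> c i = c' i) \<Longrightarrow> lin_comb M g n c = lin_comb M g n c'"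
  by (induct n) auto

lemma lin_comb_cong_gen: "(\<And>i. i < n \<Longrightarrow> g i = g' i) \<Longrightarrow> lin_comb M g n c = lin_comb M g' n c"
  by (induct n) auto

context rmodule
begin

lemma lin_comb_closed:
  "(\<And>i. i < n \<Longrightarrow> g i \<in> carrier M) \<Longrightarrow> (\<And>i. i < n \<Longrightarrow> c i \<in> carrier R) \<Longrightarrow> lin_comb M g n c \<in> carrier M"
  by (induct n) auto

lemma lin_comb_add:
  assumes "\<And>i. i < n \<Longrightarrow> g i \<in> carrier M" "\<And>i. i < n \<Longrightarrow> c i \<in> carrier R" "\<And>i. i < n \<Longrightarrow> d i \<in> carrier R"
  shows "lin_comb M g n (\<lambda>i. c i \<oplus> d i) = lin_comb M g n c \<oplus>\<^bsub>M\<^esub> lin_comb M g n d"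
  using assms
proof (induct n)
  case (Suc n)
  have "lin_comb M g n c \<in> carrier M" "lin_comb M g n d \<in> carrier M"
    using Suc by (auto intro!: lin_comb_closed)
  then show ?case using Suc by (simp add: smult_l_distr M.a_ac)
qed simp

lemma lin_comb_smult:
  assumes "\<And>i. i < n \<Longrightarrow> g i \<in> carrier M" "\<And>i. i < n \<Longrightarrow> c i \<in> carrier R" "r \<in> carrier R"
  shows "lin_comb M g n (\<lambda>i. r \<otimes> c i) = r \<odot>\<^bsub>M\<^esub> lin_comb M g n c"
  using assms
proof (induct n)
  case (Suc n)
  have "lin_comb M g n c \<in> carrier M" using Suc by (auto intro!: lin_comb_closed)
  then show ?case using Suc by (simp add: smult_r_distr smult_assoc1)
qed simp

lemma span_lin_comb:
  assumes "\<And>i. i < n \<Longrightarrow> g i \<in> carrier M" "x \<in> mod_span R M (g ` {..<n})"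
  shows "\<exists>c. (\<forall>i. c i \<in> carrier R) \<and> x = lin_comb M g n c"
  using assms
proof (induct n arbitrary: x)
  case 0
  then show ?case using span_empty by (intro exI[of _ "\<lambda>_. \<zero>"]) auto
next
  case (Suc n)
  have s: "g ` {..<n} \<subseteq> carrier M" "g n \<in> carrier M" using Suc(2) by auto
  have "g ` {..<Suc n} = insert (g n) (g ` {..<n})" by (simp add: lessThan_Suc)
  then have "x \<in> mod_span R M (g ` {..<n}) <+>\<^bsub>M\<^esub> {r \<odot>\<^bsub>M\<^esub> g n | r. r \<in> carrier R}"
    using Suc(3) span_insert[OF s] by simp
  then obtain h r where hr: "h \<in> mod_span R M (g ` {..<n})" "r \<in> carrier R" "x = h \<oplus>\<^bsub>M\<^esub> r \<odot>\<^bsub>M\<^esub> g n"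
    unfolding adjoin_mem by blast
  obtain c where c: "\<forall>i. c i \<in> carrier R" "h = lin_comb M g n c" using Suc(1)[OF _ hr(1)] Suc(2) by auto
  have "lin_comb M g n (c(n := r)) = h" unfolding c(2) by (rule lin_comb_cong) simp
  moreover have "h \<in> carrier M" using sub_carrier[OF span_sub[OF s(1)] hr(1)] .
  ultimately have "x = lin_comb M g (Suc n) (c(n := r))" using hr s by (simp add: M.a_comm)
  moreover have "\<forall>i. (c(n := r)) i \<in> carrier R" using c(1) hr(2) by simp
  ultimately show ?case by blast
qed

lemma fin_gen_lin_comb:
  assumes "fin_gen_module R M"
  obtains n g where "\<And>i. g i \<in> carrier M"
    "\<And>x. x \<in> carrier M \<Longrightarrow> \<exists>c. (\<forall>i. c i \<in> carrier R) \<and> x = lin_comb M g n c"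
proof -
  obtain S where S: "finite S" "S \<subseteq> carrier M" "mod_span R M S = carrier M"
    using assms unfolding fin_gen_module_def by (elim exE conjE)
  obtain g0 and n :: nat where g0: "S = g0 ` {i. i < n}" using finite_imp_nat_seg_image_inj_on[OF S(1)] by blast
  define g where "g = (\<lambda>i. if i < n then g0 i else \<zero>\<^bsub>M\<^esub>)"
  have g: "S = g ` {..<n}" "\<And>i. g i \<in> carrier M" using g0 S(2) by (auto simp: g_def)
  show thesis
  proof (rule that[of g n])
    fix x assume "x \<in> carrier M"
    then show "\<exists>c. (\<forall>i. c i \<in> carrier R) \<and> x = lin_comb M g n c"
      using span_lin_comb[of n g x] g S(3) by simp
  qed (rule g(2))
qed

end

text \<open>An element \<open>x\<close> of a finitely generated module is encoded by the set of its coordinate vectors.\<close>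

lemma fin_gen_embedding:
  fixes R :: "('a, 'r) ring_scheme" and M :: "('a, 'b) module"
  assumes "fin_gen_module R M"
  obtains \<iota> :: "'b \<Rightarrow> 'a elt" where "inj_on \<iota> (carrier M)"
proof -
  interpret rmodule R M by (rule rmoduleI) (use assms in \<open>simp add: fin_gen_module_def\<close>)
  obtain n g where g: "\<And>i. g i \<in> carrier M"
    "\<And>x. x \<in> carrier M \<Longrightarrow> \<exists>c. (\<forall>i. c i \<in> carrier R) \<and> x = lin_comb M g n c"
    using fin_gen_lin_comb[OF assms] by metis
  have "inj_on (\<lambda>x. {c. x = lin_comb M g n c}) (carrier M)"
  proof (rule inj_onI)
    fix x y assume x: "x \<in> carrier M" and e: "{c. x = lin_comb M g n c} = {c. y = lin_comb M g n c}"
    obtain c where "x = lin_comb M g n c" using g(2)[OF x] by auto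
    then show "x = y" using e by auto
  qed
  then show thesis by (rule that)
qed

definition free_module :: "('a, 'r) ring_scheme \<Rightarrow> nat \<Rightarrow> ('a, nat \<Rightarrow> 'a) module" where
  "free_module R n =
     \<lparr>carrier = {..<n} \<rightarrow>\<^sub>E carrier R, monoid.mult = undefined, one = undefined,
      ring.zero = (\<lambda>i\<in>{..<n}. \<zero>\<^bsub>R\<^esub>), add = (\<lambda>c d. \<lambda>i\<in>{..<n}. c i \<oplus>\<^bsub>R\<^esub> d i),
      smult = (\<lambda>r c. \<lambda>i\<in>{..<n}. r \<otimes>\<^bsub>R\<^esub> c i)\<rparr>"

lemma free_module_eqI:
  assumes "c \<in> carrier (free_module R n)" "d \<in> carrier (free_module R n)" "\<And>i. i < n \<Longrightarrow> c i = d i"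
  shows "c = d"
proof (rule PiE_ext)
  show "c \<in> {..<n} \<rightarrow>\<^sub>E carrier R" "d \<in> {..<n} \<rightarrow>\<^sub>E carrier R"
    using assms(1,2) by (auto simp: free_module_def)
qed (use assms(3) in auto)

lemma free_module_simps:
  "c \<in> carrier (free_module R n) \<Longrightarrow> i < n \<Longrightarrow> c i \<in> carrier R"
  "i < n \<Longrightarrow> \<zero>\<^bsub>free_module R n\<^esub> i = \<zero>\<^bsub>R\<^esub>"
  "i < n \<Longrightarrow> (c \<oplus>\<^bsub>free_module R n\<^esub> d) i = c i \<oplus>\<^bsub>R\<^esub> d i"
  "i < n \<Longrightarrow> (r \<odot>\<^bsub>free_module R n\<^esub> c) i = r \<otimes>\<^bsub>R\<^esub> c i"
  by (auto simp: free_module_def)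

lemma free_module_module:
  assumes "cring R"
  shows "module R (free_module R n)"
proof -
  interpret cring R by fact
  let ?F = "free_module R n"
  note s = free_module_simps
  have add: "c \<oplus>\<^bsub>?F\<^esub> d \<in> carrier ?F" if "c \<in> carrier ?F" "d \<in> carrier ?F" for c d
    using that by (auto simp: free_module_def)
  have zero: "\<zero>\<^bsub>?F\<^esub> \<in> carrier ?F" by (simp add: free_module_def)
  have sm: "r \<odot>\<^bsub>?F\<^esub> c \<in> carrier ?F" if "r \<in> carrier R" "c \<in> carrier ?F" for r c
    using that by (auto simp: free_module_def)
  have neg: "\<exists>d\<in>carrier ?F. d \<oplus>\<^bsub>?F\<^esub> c = \<zero>\<^bsub>?F\<^esub>" if c: "c \<in> carrier ?F" for c
  proof (rule bexI)
    show m: "(\<lambda>i\<in>{..<n}. \<ominus>\<^bsub>R\<^esub> c i) \<in> carrier ?F" using c by (auto simp: free_module_def)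
    show "(\<lambda>i\<in>{..<n}. \<ominus>\<^bsub>R\<^esub> c i) \<oplus>\<^bsub>?F\<^esub> c = \<zero>\<^bsub>?F\<^esub>"
      by (rule free_module_eqI[OF add[OF m c] zero]) (simp add: s(2,3) s(1)[OF c] l_neg)
  qed
  have "abelian_group ?F"
  proof (rule abelian_groupI)
    fix c d e assume c: "c \<in> carrier ?F" and d: "d \<in> carrier ?F" and e: "e \<in> carrier ?F"
    show "c \<oplus>\<^bsub>?F\<^esub> d \<oplus>\<^bsub>?F\<^esub> e = c \<oplus>\<^bsub>?F\<^esub> (d \<oplus>\<^bsub>?F\<^esub> e)"
      by (rule free_module_eqI[OF add[OF add[OF c d] e] add[OF c add[OF d e]]])
        (simp add: s(3) s(1)[OF c] s(1)[OF d] s(1)[OF e] a_assoc)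
  next
    fix c d assume c: "c \<in> carrier ?F" and d: "d \<in> carrier ?F"
    show "c \<oplus>\<^bsub>?F\<^esub> d = d \<oplus>\<^bsub>?F\<^esub> c"
      by (rule free_module_eqI[OF add[OF c d] add[OF d c]])
        (simp add: s(3) s(1)[OF c] s(1)[OF d] a_comm)
  next
    fix c assume c: "c \<in> carrier ?F"
    show "\<zero>\<^bsub>?F\<^esub> \<oplus>\<^bsub>?F\<^esub> c = c"
      by (rule free_module_eqI[OF add[OF zero c] c]) (simp add: s(2,3) s(1)[OF c])
  qed (use add zero neg in blast)+
  then show ?thesis
  proof (rule moduleI[OF assms])
    fix r q c assume r: "r \<in> carrier R" and q: "q \<in> carrier R" and c: "c \<in> carrier ?F"
    show "(r \<oplus>\<^bsub>R\<^esub> q) \<odot>\<^bsub>?F\<^esub> c = r \<odot>\<^bsub>?F\<^esub> c \<oplus>\<^bsub>?F\<^esub> q \<odot>\<^bsub>?F\<^esub> c"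
      by (rule free_module_eqI[OF sm[OF _ c] add[OF sm[OF r c] sm[OF q c]]])
        (use r q in \<open>simp_all add: s(3,4) s(1)[OF c] l_distr\<close>)
    show "(r \<otimes>\<^bsub>R\<^esub> q) \<odot>\<^bsub>?F\<^esub> c = r \<odot>\<^bsub>?F\<^esub> (q \<odot>\<^bsub>?F\<^esub> c)"
      by (rule free_module_eqI[OF sm[OF _ c] sm[OF r sm[OF q c]]])
        (use r q in \<open>simp_all add: s(4) s(1)[OF c] m_assoc\<close>)
  next
    fix r c d assume r: "r \<in> carrier R" and c: "c \<in> carrier ?F" and d: "d \<in> carrier ?F"
    show "r \<odot>\<^bsub>?F\<^esub> (c \<oplus>\<^bsub>?F\<^esub> d) = r \<odot>\<^bsub>?F\<^esub> c \<oplus>\<^bsub>?F\<^esub> r \<odot>\<^bsub>?F\<^esub> d"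
      by (rule free_module_eqI[OF sm[OF r add[OF c d]] add[OF sm[OF r c] sm[OF r d]]])
        (use r in \<open>simp_all add: s(3,4) s(1)[OF c] s(1)[OF d] r_distr\<close>)
  next
    fix c assume c: "c \<in> carrier ?F"
    show "\<one>\<^bsub>R\<^esub> \<odot>\<^bsub>?F\<^esub> c = c"
      by (rule free_module_eqI[OF sm[OF _ c] c]) (simp_all add: s(4) s(1)[OF c])
  qed (rule sm)
qed

lemma lin_comb_hom:
  assumes "module R M" "\<And>i. i < n \<Longrightarrow> g i \<in> carrier M"
  shows "(\<lambda>c\<in>carrier (free_module R n). lin_comb M g n c) \<in> mod_hom R (free_module R n) M"
proof -
  interpret rmodule R M using assms(1) by (rule rmoduleI)
  show ?thesis
  proof (rule mod_hom_restrictI[OF free_module_module[OF R.is_cring]])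
    fix c d assume "c \<in> carrier (free_module R n)" "d \<in> carrier (free_module R n)"
    then have cd: "c i \<in> carrier R" "d i \<in> carrier R" if "i < n" for i using that by (auto simp: free_module_def)
    have "lin_comb M g n (c \<oplus>\<^bsub>free_module R n\<^esub> d) = lin_comb M g n (\<lambda>i. c i \<oplus>\<^bsub>R\<^esub> d i)"
      by (rule lin_comb_cong) (simp add: free_module_def)
    then show "lin_comb M g n (c \<oplus>\<^bsub>free_module R n\<^esub> d) = lin_comb M g n c \<oplus>\<^bsub>M\<^esub> lin_comb M g n d"
      using lin_comb_add[of n g c d] cd assms(2) by simp
  next
    fix r c assume r: "r \<in> carrier R" and "c \<in> carrier (free_module R n)"
    then have cd: "c i \<in> carrier R" if "i < n" for i using that by (auto simp: free_module_def)
    have "lin_comb M g n (r \<odot>\<^bsub>free_module R n\<^esub> c) = lin_comb M g n (\<lambda>i. r \<otimes>\<^bsub>R\<^esub> c i)"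
      by (rule lin_comb_cong) (simp add: free_module_def)
    then show "lin_comb M g n (r \<odot>\<^bsub>free_module R n\<^esub> c) = r \<odot>\<^bsub>M\<^esub> lin_comb M g n c"
      using lin_comb_smult[of n g c r] cd assms(2) r by simp
  next
    fix c assume "c \<in> carrier (free_module R n)"
    then show "lin_comb M g n c \<in> carrier M"
      using assms(2) by (intro lin_comb_closed) (auto simp: free_module_def)
  qed
qed

lemma free_module_hom_eq:
  assumes R: "cring R" and M: "module R M" and f: "f \<in> mod_hom R (free_module R n) M"
    and c: "c \<in> carrier (free_module R n)"
  shows "f c = lin_comb M (\<lambda>j. f (\<lambda>i\<in>{..<n}. if i = j then \<one>\<^bsub>R\<^esub> else \<zero>\<^bsub>R\<^esub>)) n c"
proof -
  interpret R: cring R by fact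
  interpret M: rmodule R M using M by (rule rmoduleI)
  let ?e = "\<lambda>j. \<lambda>i\<in>{..<n}. if i = j then \<one>\<^bsub>R\<^esub> else \<zero>\<^bsub>R\<^esub>"
  let ?F = "free_module R n"
  have cc: "c i \<in> carrier R" if "i < n" for i using that c by (auto simp: free_module_def)
  have eF: "?e j \<in> carrier ?F" for j by (auto simp: free_module_def)
  \<comment> \<open>Induction over the truncations of c to its first k coordinates.\<close>
  have "f (\<lambda>i\<in>{..<n}. if i < k then c i else \<zero>\<^bsub>R\<^esub>) = lin_comb M (\<lambda>j. f (?e j)) k c" if "k \<le> n" for k
    using that
  proof (induct k)
    case 0
    have "(\<lambda>i\<in>{..<n}. if i < 0 then c i else \<zero>\<^bsub>R\<^esub>) = \<zero>\<^bsub>?F\<^esub>" by (simp add: free_module_def)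
    then show ?case using mod_hom_zero[OF free_module_module[OF R] M f] by simp
  next
    case (Suc k)
    have t: "(\<lambda>i\<in>{..<n}. if i < k then c i else \<zero>\<^bsub>R\<^esub>) \<in> carrier ?F" using cc by (auto simp: free_module_def)
    have s: "c k \<odot>\<^bsub>?F\<^esub> ?e k \<in> carrier ?F" using cc Suc(2) by (auto simp: free_module_def)
    have "(\<lambda>i\<in>{..<n}. if i < Suc k then c i else \<zero>\<^bsub>R\<^esub>)
      = c k \<odot>\<^bsub>?F\<^esub> ?e k \<oplus>\<^bsub>?F\<^esub> (\<lambda>i\<in>{..<n}. if i < k then c i else \<zero>\<^bsub>R\<^esub>)"
      using cc Suc(2) by (auto simp: free_module_def fun_eq_iff less_Suc_eq)
    then have e: "f (\<lambda>i\<in>{..<n}. if i < Suc k then c i else \<zero>\<^bsub>R\<^esub>)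
      = c k \<odot>\<^bsub>M\<^esub> f (?e k) \<oplus>\<^bsub>M\<^esub> f (\<lambda>i\<in>{..<n}. if i < k then c i else \<zero>\<^bsub>R\<^esub>)"
      using mod_hom_add[OF f s t] mod_hom_smult[OF f _ eF] cc Suc(2) by simp
    have IH: "f (\<lambda>i\<in>{..<n}. if i < k then c i else \<zero>\<^bsub>R\<^esub>) = lin_comb M (\<lambda>j. f (?e j)) k c"
      by (rule Suc(1)) (use Suc(2) in simp)
    show ?case unfolding lin_comb.simps IH[symmetric] by (rule e)
  qed
  from this[of n] have "f (\<lambda>i\<in>{..<n}. if i < n then c i else \<zero>\<^bsub>R\<^esub>) = lin_comb M (\<lambda>j. f (?e j)) n c" by simp
  moreover have "(\<lambda>i\<in>{..<n}. if i < n then c i else \<zero>\<^bsub>R\<^esub>) = c"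
    using c by (auto simp: free_module_def fun_eq_iff PiE_def extensional_def)
  ultimately show ?thesis by simp
qed

subsection \<open>Homomorphisms factoring through projective modules\<close>

lemma hom_lin_comb:
  assumes "module R M" "module R N" "f \<in> mod_hom R M N" "\<And>i. i < n \<Longrightarrow> g i \<in> carrier M"
    "\<And>i. i < n \<Longrightarrow> c i \<in> carrier R"
  shows "f (lin_comb M g n c) = lin_comb N (\<lambda>i. f (g i)) n c"
proof -
  interpret M: rmodule R M using assms(1) by (rule rmoduleI)
  show ?thesis using assms(4,5)
  proof (induct n)
    case 0
    then show ?case using mod_hom_zero[OF assms(1-3)] by simp
  next
    case (Suc n)
    have "lin_comb M g n c \<in> carrier M" using Suc by (auto intro!: M.lin_comb_closed)
    then show ?case using Suc mod_hom_add[OF assms(3)] mod_hom_smult[OF assms(3)] by simp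
  qed
qed

lemma rank_homs_lin_comb:
  assumes M: "module R M" and N: "module R N" and f: "f \<in> rank_homs R M N"
  shows "\<exists>n g \<phi>. (\<forall>i. g i \<in> carrier N) \<and> (\<forall>i. \<phi> i \<in> mod_hom R M (self_module R)) \<and>
    (\<forall>x\<in>carrier M. f x = lin_comb N g n (\<lambda>i. \<phi> i x))"
  using f
proof induct
  interpret N: rmodule R N using N by (rule rmoduleI)
  case zero
  have "zero_hom M (self_module R) \<in> mod_hom R M (self_module R)"
    by (rule mod_hom_zero_hom[OF M self_module_module[OF N.R.is_cring]])
  moreover have "\<forall>x\<in>carrier M. zero_hom M N x = \<zero>\<^bsub>N\<^esub>" by (simp add: zero_hom_def)
  ultimately show ?case
    by (intro exI[of _ "0::nat"] exI[of _ "\<lambda>_. \<zero>\<^bsub>N\<^esub>"] exI[of _ "\<lambda>_. zero_hom M (self_module R)"]) simp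
next
  case (step f \<phi>0 m)
  obtain n g \<phi> where *: "\<forall>i. g i \<in> carrier N" "\<forall>i. \<phi> i \<in> mod_hom R M (self_module R)"
    "\<forall>x\<in>carrier M. f x = lin_comb N g n (\<lambda>i. \<phi> i x)" using step(2) by (elim exE conjE)
  have "lin_comb N (g(n := m)) n (\<lambda>i. (\<phi>(n := \<phi>0)) i x) = lin_comb N g n (\<lambda>i. \<phi> i x)" for x
    by (rule trans[OF lin_comb_cong lin_comb_cong_gen]) auto
  then have "(\<lambda>x\<in>carrier M. \<phi>0 x \<odot>\<^bsub>N\<^esub> m \<oplus>\<^bsub>N\<^esub> f x) x = lin_comb N (g(n := m)) (Suc n) (\<lambda>i. (\<phi>(n := \<phi>0)) i x)"
    if "x \<in> carrier M" for x using *(3) that by simp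
  moreover have "\<forall>i. (g(n := m)) i \<in> carrier N" "\<forall>i. (\<phi>(n := \<phi>0)) i \<in> mod_hom R M (self_module R)"
    using * step by auto
  ultimately show ?case by blast
qed

lemma lin_comb_rank_homs:
  assumes "module R M" "module R N" "\<And>i. g i \<in> carrier N" "\<And>i. i < n \<Longrightarrow> \<phi> i \<in> mod_hom R M (self_module R)"
  shows "(\<lambda>x\<in>carrier M. lin_comb N g n (\<lambda>i. \<phi> i x)) \<in> rank_homs R M N"
  using assms(4)
proof (induct n)
  case 0
  show ?case using rank_homs.zero[of M N R] by (simp only: zero_hom_def lin_comb.simps)
next
  case (Suc n)
  have 1: "(\<lambda>x\<in>carrier M. \<phi> n x \<odot>\<^bsub>N\<^esub> g n \<oplus>\<^bsub>N\<^esub> (\<lambda>x\<in>carrier M. lin_comb N g n (\<lambda>i. \<phi> i x)) x) \<in> rank_homs R M N"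
    by (rule rank_homs.step) (use Suc assms(3) in auto)
  have e: "(\<lambda>x\<in>carrier M. \<phi> n x \<odot>\<^bsub>N\<^esub> g n \<oplus>\<^bsub>N\<^esub> (\<lambda>x\<in>carrier M. lin_comb N g n (\<lambda>i. \<phi> i x)) x)
    = (\<lambda>x\<in>carrier M. lin_comb N g (Suc n) (\<lambda>i. \<phi> i x))" by (rule restrict_ext) simp
  show ?case using 1 unfolding e .
qed

text \<open>Singletons embed the coordinate vectors into \<open>'a elt\<close>, where projectivity
  is tested.\<close>

definition free_copy :: "('a, 'r) ring_scheme \<Rightarrow> nat \<Rightarrow> ('a, 'a elt) module" where
  "free_copy R n = transport (free_module R n) (\<lambda>c. {c})"

lemma free_copy:
  assumes R: "cring R"
  shows "module R (free_copy R n)"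
    and "\<exists>p\<in>mod_hom R (free_module R n) (free_copy R n). \<exists>q\<in>mod_hom R (free_copy R n) (free_module R n).
      (\<forall>c\<in>carrier (free_module R n). q (p c) = c) \<and> (\<forall>u\<in>carrier (free_copy R n). p (q u) = u)"
proof -
  have inj: "inj_on (\<lambda>c. {c}) (carrier (free_module R n))" by (simp add: inj_on_def)
  note F = free_module_module[OF R, of n]
  show m: "module R (free_copy R n)" unfolding free_copy_def by (rule transport_module[OF F inj])
  note h = transport_hom[OF F inj, folded free_copy_def]
  show "\<exists>p\<in>mod_hom R (free_module R n) (free_copy R n). \<exists>q\<in>mod_hom R (free_copy R n) (free_module R n).
      (\<forall>c\<in>carrier (free_module R n). q (p c) = c) \<and> (\<forall>u\<in>carrier (free_copy R n). p (q u) = u)"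
    by (rule bexI[OF _ h(1)]) (rule iso_inverse[OF F m h])
qed

lemma free_copy_projective:
  assumes R: "cring R"
  shows "projective_module R (free_copy R n)"
  unfolding projective_module_def
proof (intro conjI allI impI ballI)
  let ?F = "free_module R n"
  show FM: "module R (free_copy R n)" by (rule free_copy(1)[OF R])
  fix A B :: "('a, 'a elt) module" and s f
  assume A: "module R A" and B: "module R B" and s: "s \<in> mod_hom R A B" "s ` carrier A = carrier B"
    and f: "f \<in> mod_hom R (free_copy R n) B"
  note F = free_module_module[OF R, of n]
  obtain p q where pq: "p \<in> mod_hom R ?F (free_copy R n)" "q \<in> mod_hom R (free_copy R n) ?F"
    "\<forall>c\<in>carrier ?F. q (p c) = c" "\<forall>u\<in>carrier (free_copy R n). p (q u) = u"
    using free_copy(2)[OF R, of n] by (elim bexE conjE)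
  define f0 where "f0 = compose (carrier ?F) f p"
  have f0: "f0 \<in> mod_hom R ?F B" unfolding f0_def by (rule mod_hom_compose[OF F pq(1) f])
  let ?e = "\<lambda>j. \<lambda>i\<in>{..<n}. if i = j then \<one>\<^bsub>R\<^esub> else \<zero>\<^bsub>R\<^esub>"
  interpret R: cring R by fact
  define b where "b = (\<lambda>j. f0 (?e j))"
  have "b j \<in> s ` carrier A" for j
    unfolding s(2) b_def by (rule mod_hom_closed[OF f0]) (auto simp: free_module_def)
  then have "\<exists>a. a \<in> carrier A \<and> s a = b j" for j by (metis imageE)
  then obtain a where a: "\<And>j. a j \<in> carrier A" "\<And>j. s (a j) = b j" by metis
  define h where "h = compose (carrier (free_copy R n)) (\<lambda>c\<in>carrier ?F. lin_comb A a n c) q"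
  have h: "h \<in> mod_hom R (free_copy R n) A"
    unfolding h_def by (rule mod_hom_compose[OF FM pq(2) lin_comb_hom[OF A a(1)]])
  have "compose (carrier (free_copy R n)) s h = f"
  proof (rule mod_hom_eqI[OF mod_hom_compose[OF FM h s(1)] f])
    fix u assume u: "u \<in> carrier (free_copy R n)"
    have c: "q u \<in> carrier ?F" by (rule mod_hom_closed[OF pq(2) u])
    have "s (lin_comb A a n (q u)) = lin_comb B (\<lambda>i. s (a i)) n (q u)"
      by (rule hom_lin_comb[OF A B s(1) a(1)]) (use c in \<open>auto simp: free_module_def\<close>)
    also have "\<dots> = f0 (q u)" unfolding a(2) b_def by (rule free_module_hom_eq[OF R B f0 c, symmetric])
    also have "\<dots> = f u" using c pq(4) u by (simp add: f0_def compose_def)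
    finally show "compose (carrier (free_copy R n)) s h u = f u" using u c by (simp add: h_def compose_def)
  qed
  then show "\<exists>h\<in>mod_hom R (free_copy R n) A. compose (carrier (free_copy R n)) s h = f" using h by blast
qed

text \<open>The two factors are the coordinate map M \<rightarrow> R^n given by the functionals and
  the linear combination map R^n \<rightarrow> N.\<close>

lemma rank_homs_projective:
  assumes M: "module R M" and N: "module R N" and f: "f \<in> rank_homs R M N"
  shows "f \<in> projective_homs R M N"
proof -
  interpret N: rmodule R N using N by (rule rmoduleI)
  note R = N.R.is_cring
  obtain n g \<phi> where *: "\<forall>i. g i \<in> carrier N" "\<forall>i. \<phi> i \<in> mod_hom R M (self_module R)"
    "\<forall>x\<in>carrier M. f x = lin_comb N g n (\<lambda>i. \<phi> i x)"
    using rank_homs_lin_comb[OF M N f] by (elim exE conjE)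
  let ?F = "free_module R n"
  note F = free_module_module[OF R, of n]
  obtain p q where pq: "p \<in> mod_hom R ?F (free_copy R n)" "q \<in> mod_hom R (free_copy R n) ?F"
    "\<forall>c\<in>carrier ?F. q (p c) = c" "\<forall>u\<in>carrier (free_copy R n). p (q u) = u"
    using free_copy(2)[OF R, of n] by (elim bexE conjE)
  define \<Phi> where "\<Phi> = (\<lambda>x\<in>carrier M. \<lambda>i\<in>{..<n}. \<phi> i x)"
  note \<phi> = self_module_hom[OF *(2)[rule_format]]
  have \<Phi>: "\<Phi> \<in> mod_hom R M ?F"
    unfolding \<Phi>_def
  proof (rule mod_hom_restrictI[OF M])
    fix x assume "x \<in> carrier M"
    then show "(\<lambda>i\<in>{..<n}. \<phi> i x) \<in> carrier ?F" using \<phi>(1) by (auto simp: free_module_def)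
  next
    fix x y assume xy: "x \<in> carrier M" "y \<in> carrier M"
    then show "(\<lambda>i\<in>{..<n}. \<phi> i (x \<oplus>\<^bsub>M\<^esub> y)) = (\<lambda>i\<in>{..<n}. \<phi> i x) \<oplus>\<^bsub>?F\<^esub> (\<lambda>i\<in>{..<n}. \<phi> i y)"
      using \<phi>(2) by (auto simp: free_module_def fun_eq_iff)
  next
    fix r x assume "r \<in> carrier R" "x \<in> carrier M"
    then show "(\<lambda>i\<in>{..<n}. \<phi> i (r \<odot>\<^bsub>M\<^esub> x)) = r \<odot>\<^bsub>?F\<^esub> (\<lambda>i\<in>{..<n}. \<phi> i x)"
      using \<phi>(3) by (auto simp: free_module_def fun_eq_iff)
  qed
  let ?l = "\<lambda>c\<in>carrier ?F. lin_comb N g n c"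
  have l: "?l \<in> mod_hom R ?F N" by (rule lin_comb_hom[OF N]) (use * in auto)
  have 1: "compose (carrier M) p \<Phi> \<in> mod_hom R M (free_copy R n)" by (rule mod_hom_compose[OF M \<Phi> pq(1)])
  have 2: "compose (carrier (free_copy R n)) ?l q \<in> mod_hom R (free_copy R n) N"
    by (rule mod_hom_compose[OF free_copy(1)[OF R] pq(2) l])
  have fh: "f \<in> mod_hom R M N" by (rule rank_homs_hom[OF M N f])
  have "f = compose (carrier M) (compose (carrier (free_copy R n)) ?l q) (compose (carrier M) p \<Phi>)"
  proof (rule mod_hom_eqI[OF fh mod_hom_compose[OF M 1 2]])
    fix x assume x: "x \<in> carrier M"
    have c: "\<Phi> x \<in> carrier ?F" by (rule mod_hom_closed[OF \<Phi> x])
    have "f x = lin_comb N g n (\<lambda>i. \<phi> i x)" using *(3) x by blast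
    also have "\<dots> = lin_comb N g n (\<Phi> x)" by (rule lin_comb_cong) (simp add: \<Phi>_def x)
    finally show "f x = compose (carrier M) (compose (carrier (free_copy R n)) ?l q) (compose (carrier M) p \<Phi>) x"
      using x c pq(3) mod_hom_closed[OF pq(1) c] by (simp add: compose_def)
  qed
  then show ?thesis
    unfolding projective_homs_def using fh 1 2 free_copy_projective[OF R] by blast
qed

text \<open>A finite generating set gives a surjection R^n \<rightarrow> N, and projectivity lifts h
  : P \<rightarrow> N through it. So f factors through R^n even if P is large, and the coordinates
  are the functionals. The surjection has to end in a copy of N on \<open>'a elt\<close>.\<close>

lemma projective_rank_homs:
  fixes N :: "('a, 'c) module"
  assumes M: "module R M" and N: "module R N" and fg: "fin_gen_module R N" and f: "f \<in> projective_homs R M N"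
  shows "f \<in> rank_homs R M N"
proof -
  interpret N: rmodule R N using N by (rule rmoduleI)
  note R = N.R.is_cring
  obtain P g h where P: "projective_module R P" and g: "g \<in> mod_hom R M P" and h: "h \<in> mod_hom R P N"
    and f': "f = compose (carrier M) h g" and fh: "f \<in> mod_hom R M N"
    using f unfolding projective_homs_def by blast
  have PM: "module R P" using P by (simp add: projective_module_def)
  obtain n e where e: "\<And>i. e i \<in> carrier N"
    "\<And>x. x \<in> carrier N \<Longrightarrow> \<exists>c. (\<forall>i. c i \<in> carrier R) \<and> x = lin_comb N e n c"
    by (rule N.fin_gen_lin_comb[OF fg]) blast
  obtain \<iota> :: "'c \<Rightarrow> 'a elt" where \<iota>: "inj_on \<iota> (carrier N)" by (rule fin_gen_embedding[OF fg])
  let ?N = "transport N \<iota>"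
  note tN = transport_module[OF N \<iota>] and th = transport_hom[OF N \<iota>]
  let ?F = "free_module R n"
  note F = free_module_module[OF R, of n]
  obtain p q where pq: "p \<in> mod_hom R ?F (free_copy R n)" "q \<in> mod_hom R (free_copy R n) ?F"
    "\<forall>c\<in>carrier ?F. q (p c) = c" "\<forall>u\<in>carrier (free_copy R n). p (q u) = u"
    using free_copy(2)[OF R, of n] by (elim bexE conjE)
  let ?l = "\<lambda>c\<in>carrier ?F. lin_comb N e n c"
  have l: "?l \<in> mod_hom R ?F N" by (rule lin_comb_hom[OF N e(1)])
  define l' where "l' = compose (carrier (free_copy R n)) (restrict \<iota> (carrier N)) (compose (carrier (free_copy R n)) ?l q)"
  have l': "l' \<in> mod_hom R (free_copy R n) ?N" unfolding l'_def
    by (rule mod_hom_compose[OF free_copy(1)[OF R] mod_hom_compose[OF free_copy(1)[OF R] pq(2) l] th(1)])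
  have l'x: "l' u = \<iota> (lin_comb N e n (q u))" if "u \<in> carrier (free_copy R n)" for u
    using that mod_hom_closed[OF pq(2) that] mod_hom_closed[OF l, of "q u"] by (simp add: l'_def compose_def)
  have "l' ` carrier (free_copy R n) = carrier ?N"
  proof
    show "l' ` carrier (free_copy R n) \<subseteq> carrier ?N" using mod_hom_closed[OF l'] by auto
    show "carrier ?N \<subseteq> l' ` carrier (free_copy R n)"
    proof
      fix v assume "v \<in> carrier ?N"
      then obtain x where x: "x \<in> carrier N" "v = \<iota> x" by (auto simp: transport_simps[OF \<iota>])
      obtain c where c: "\<forall>i. c i \<in> carrier R" "x = lin_comb N e n c" using e(2)[OF x(1)] by (elim exE conjE)
      let ?c = "restrict c {..<n}"
      have cF: "?c \<in> carrier ?F" using c by (auto simp: free_module_def)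
      have "lin_comb N e n ?c = x" unfolding c(2) by (rule lin_comb_cong) simp
      then have "l' (p ?c) = v" using l'x[OF mod_hom_closed[OF pq(1) cF]] pq(3) cF x by simp
      then show "v \<in> l' ` carrier (free_copy R n)" using mod_hom_closed[OF pq(1) cF] by blast
    qed
  qed
  moreover have ih: "compose (carrier P) (restrict \<iota> (carrier N)) h \<in> mod_hom R P ?N"
    by (rule mod_hom_compose[OF PM h th(1)])
  ultimately obtain k where k: "k \<in> mod_hom R P (free_copy R n)"
    "compose (carrier P) l' k = compose (carrier P) (restrict \<iota> (carrier N)) h"
    using P l' free_copy(1)[OF R, of n] tN unfolding projective_module_def by blast
  have key: "h y = lin_comb N e n (q (k y))" if y: "y \<in> carrier P" for y
  proof -
    have ky: "k y \<in> carrier (free_copy R n)" by (rule mod_hom_closed[OF k(1) y])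
    have "compose (carrier P) l' k y = compose (carrier P) (restrict \<iota> (carrier N)) h y" using k(2) by simp
    then have "\<iota> (lin_comb N e n (q (k y))) = \<iota> (h y)"
      using y mod_hom_closed[OF h y] l'x[OF ky] by (simp add: compose_def)
    moreover have "lin_comb N e n (q (k y)) \<in> carrier N"
      using mod_hom_closed[OF l mod_hom_closed[OF pq(2) ky]] mod_hom_closed[OF pq(2) ky] by simp
    ultimately show ?thesis using inj_onD[OF \<iota>] mod_hom_closed[OF h y] by metis
  qed
  define \<phi> where "\<phi> = (\<lambda>i. \<lambda>x\<in>carrier M. q (k (g x)) i)"
  define t where "t = compose (carrier M) q (compose (carrier M) k g)"
  have t: "t \<in> mod_hom R M ?F" unfolding t_def
    by (rule mod_hom_compose[OF M mod_hom_compose[OF M g k(1)] pq(2)])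
  have tx: "t x = q (k (g x))" if "x \<in> carrier M" for x using that by (simp add: t_def compose_def)
  have \<phi>h: "\<phi> i \<in> mod_hom R M (self_module R)" if i: "i < n" for i
    unfolding \<phi>_def
  proof (rule mod_hom_restrictI[OF M])
    interpret M: rmodule R M using M by (rule rmoduleI)
    fix x assume x: "x \<in> carrier M"
    show "q (k (g x)) i \<in> carrier (self_module R)"
      using free_module_simps(1)[OF mod_hom_closed[OF t x] i] tx[OF x] by (simp add: self_module_def)
    fix y assume y: "y \<in> carrier M"
    have "t (x \<oplus>\<^bsub>M\<^esub> y) i = t x i \<oplus>\<^bsub>R\<^esub> t y i" using mod_hom_add[OF t x y] free_module_simps(3)[OF i] by simp
    then show "q (k (g (x \<oplus>\<^bsub>M\<^esub> y))) i = q (k (g x)) i \<oplus>\<^bsub>self_module R\<^esub> q (k (g y)) i"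
      using x y by (simp add: tx self_module_def)
  next
    interpret M: rmodule R M using M by (rule rmoduleI)
    fix r x assume r: "r \<in> carrier R" and x: "x \<in> carrier M"
    have "t (r \<odot>\<^bsub>M\<^esub> x) i = r \<otimes>\<^bsub>R\<^esub> t x i" using mod_hom_smult[OF t r x] free_module_simps(4)[OF i] by simp
    then show "q (k (g (r \<odot>\<^bsub>M\<^esub> x))) i = r \<odot>\<^bsub>self_module R\<^esub> q (k (g x)) i"
      using x r by (simp add: tx self_module_def)
  qed
  have rk: "(\<lambda>x\<in>carrier M. lin_comb N e n (\<lambda>i. \<phi> i x)) \<in> rank_homs R M N"
    by (rule lin_comb_rank_homs[OF M N e(1) \<phi>h])
  moreover have "f = (\<lambda>x\<in>carrier M. lin_comb N e n (\<lambda>i. \<phi> i x))"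
  proof (rule mod_hom_eqI[OF fh rank_homs_hom[OF M N rk]])
    fix x assume x: "x \<in> carrier M"
    have "f x = lin_comb N e n (q (k (g x)))" using f' x key[OF mod_hom_closed[OF g x]] by (simp add: compose_def)
    also have "\<dots> = lin_comb N e n (\<lambda>i. \<phi> i x)" by (rule lin_comb_cong) (simp add: \<phi>_def x)
    finally show "f x = (\<lambda>x\<in>carrier M. lin_comb N e n (\<lambda>i. \<phi> i x)) x" using x by simp
  qed
  ultimately show ?thesis by simp
qed

lemma projective_homs_eq:
  assumes "module R M" "fin_gen_module R N"
  shows "projective_homs R M N = rank_homs R M N"
proof -
  have "module R N" using assms(2) by (simp add: fin_gen_module_def)
  then show ?thesis
    using rank_homs_projective[OF assms(1)] projective_rank_homs[OF assms(1) _ assms(2)] by blast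
qed

section \<open>Homomorphisms of finite rank as a submodule of Hom\<close>

lemma rank_homs_add:
  assumes M: "module R M" and N: "module R N" and f: "f \<in> rank_homs R M N" and g: "g \<in> rank_homs R M N"
  shows "(\<lambda>x\<in>carrier M. f x \<oplus>\<^bsub>N\<^esub> g x) \<in> rank_homs R M N"
  using f
proof induct
  interpret N: rmodule R N using N by (rule rmoduleI)
  note gh = rank_homs_hom[OF M N g]
  case zero
  have "(\<lambda>x\<in>carrier M. zero_hom M N x \<oplus>\<^bsub>N\<^esub> g x) = g"
    by (rule mod_hom_eqI[OF mod_hom_lin[OF M N mod_hom_zero_hom[OF M N] gh] gh])
      (simp add: zero_hom_def mod_hom_closed[OF gh])
  then show ?case using g by simp
next
  interpret N: rmodule R N using N by (rule rmoduleI)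
  note gh = rank_homs_hom[OF M N g]
  case (step f \<phi> n)
  note fc = mod_hom_closed[OF rank_homs_hom[OF M N step(1)]]
  have e: "(\<lambda>x\<in>carrier M. (\<lambda>x\<in>carrier M. \<phi> x \<odot>\<^bsub>N\<^esub> n \<oplus>\<^bsub>N\<^esub> f x) x \<oplus>\<^bsub>N\<^esub> g x)
    = (\<lambda>x\<in>carrier M. \<phi> x \<odot>\<^bsub>N\<^esub> n \<oplus>\<^bsub>N\<^esub> (\<lambda>x\<in>carrier M. f x \<oplus>\<^bsub>N\<^esub> g x) x)"
    by (rule restrict_ext)
      (use fc mod_hom_closed[OF gh] self_module_hom(1)[OF step(3)] step(4) in \<open>simp add: N.M.a_assoc\<close>)
  show ?case unfolding e by (rule rank_homs.step[OF step(2-4)])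
qed

lemma rank_homs_smult:
  assumes M: "module R M" and N: "module R N" and f: "f \<in> rank_homs R M N" and r: "r \<in> carrier R"
  shows "(\<lambda>x\<in>carrier M. r \<odot>\<^bsub>N\<^esub> f x) \<in> rank_homs R M N"
  using f
proof induct
  interpret N: rmodule R N using N by (rule rmoduleI)
  case zero
  have "(\<lambda>x\<in>carrier M. r \<odot>\<^bsub>N\<^esub> zero_hom M N x) = zero_hom M N"
    using r by (auto simp: zero_hom_def fun_eq_iff)
  then show ?case using rank_homs.zero[of M N R] by simp
next
  interpret N: rmodule R N using N by (rule rmoduleI)
  case (step f \<phi> n)
  note fc = mod_hom_closed[OF rank_homs_hom[OF M N step(1)]]
  have e: "(\<lambda>x\<in>carrier M. r \<odot>\<^bsub>N\<^esub> (\<lambda>x\<in>carrier M. \<phi> x \<odot>\<^bsub>N\<^esub> n \<oplus>\<^bsub>N\<^esub> f x) x)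
    = (\<lambda>x\<in>carrier M. \<phi> x \<odot>\<^bsub>N\<^esub> (r \<odot>\<^bsub>N\<^esub> n) \<oplus>\<^bsub>N\<^esub> (\<lambda>x\<in>carrier M. r \<odot>\<^bsub>N\<^esub> f x) x)"
    by (rule restrict_ext)
      (use fc self_module_hom(1)[OF step(3)] step(4) r in
        \<open>simp add: N.smult_r_distr N.smult_assoc1[symmetric] N.R.m_comm\<close>)
  have "r \<odot>\<^bsub>N\<^esub> n \<in> carrier N" using step(4) r by simp
  then show ?case unfolding e by (rule rank_homs.step[OF step(2,3)])
qed

lemma rank_homs_compose:
  assumes M: "module R M" and N: "module R N" and L: "module R L" and h: "h \<in> mod_hom R N L"
    and f: "f \<in> rank_homs R M N"
  shows "compose (carrier M) h f \<in> rank_homs R M L"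
  using f
proof induct
  case zero
  have "compose (carrier M) h (zero_hom M N) = zero_hom M L"
    using mod_hom_zero[OF N L h] by (auto simp: zero_hom_def compose_def fun_eq_iff)
  then show ?case using rank_homs.zero[of M L R] by simp
next
  interpret N: rmodule R N using N by (rule rmoduleI)
  case (step f \<phi> n)
  note fc = mod_hom_closed[OF rank_homs_hom[OF M N step(1)]]
  have e: "compose (carrier M) h (\<lambda>x\<in>carrier M. \<phi> x \<odot>\<^bsub>N\<^esub> n \<oplus>\<^bsub>N\<^esub> f x)
    = (\<lambda>x\<in>carrier M. \<phi> x \<odot>\<^bsub>L\<^esub> h n \<oplus>\<^bsub>L\<^esub> compose (carrier M) h f x)"
    unfolding compose_def
    by (rule restrict_ext)
      (use fc self_module_hom(1)[OF step(3)] step(4) in \<open>simp add: mod_hom_add[OF h] mod_hom_smult[OF h]\<close>)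
  show ?case unfolding e by (rule rank_homs.step[OF step(2,3) mod_hom_closed[OF h step(4)]])
qed

lemma hom_module_simps [simp]:
  "carrier (hom_module R M N) = mod_hom R M N"
  "\<zero>\<^bsub>hom_module R M N\<^esub> = zero_hom M N"
  "f \<oplus>\<^bsub>hom_module R M N\<^esub> g = (\<lambda>x\<in>carrier M. f x \<oplus>\<^bsub>N\<^esub> g x)"
  "r \<odot>\<^bsub>hom_module R M N\<^esub> f = (\<lambda>x\<in>carrier M. r \<odot>\<^bsub>N\<^esub> f x)"
  by (simp_all add: hom_module_def)

lemma hom_module_module:
  assumes M: "module R M" and N: "module R N"
  shows "module R (hom_module R M N)"
proof -
  interpret M: rmodule R M using M by (rule rmoduleI)
  interpret N: rmodule R N using N by (rule rmoduleI)
  let ?H = "hom_module R M N"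
  note lin = mod_hom_lin[OF M N] and sc = mod_hom_scale[OF M N]
  have "abelian_group ?H"
  proof (rule abelian_groupI; unfold hom_module_simps)
    fix f assume f: "f \<in> mod_hom R M N"
    note fc = mod_hom_closed[OF f]
    show "(\<lambda>x\<in>carrier M. zero_hom M N x \<oplus>\<^bsub>N\<^esub> f x) = f"
      by (rule mod_hom_eqI[OF lin[OF mod_hom_zero_hom[OF M N] f] f]) (simp add: zero_hom_def fc)
    have m: "(\<lambda>x\<in>carrier M. (\<ominus>\<^bsub>R\<^esub> \<one>\<^bsub>R\<^esub>) \<odot>\<^bsub>N\<^esub> f x) \<in> mod_hom R M N" by (rule sc[OF f]) simp
    have "(\<lambda>x\<in>carrier M. (\<lambda>x\<in>carrier M. (\<ominus>\<^bsub>R\<^esub> \<one>\<^bsub>R\<^esub>) \<odot>\<^bsub>N\<^esub> f x) x \<oplus>\<^bsub>N\<^esub> f x) = zero_hom M N"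
      unfolding zero_hom_def by (rule restrict_ext) (simp add: fc N.smult_l_minus N.M.l_neg)
    then show "\<exists>g\<in>mod_hom R M N. (\<lambda>x\<in>carrier M. g x \<oplus>\<^bsub>N\<^esub> f x) = zero_hom M N" using m by (intro bexI)
  next
    fix f g assume f: "f \<in> mod_hom R M N" and g: "g \<in> mod_hom R M N"
    note fc = mod_hom_closed[OF f] mod_hom_closed[OF g]
    show "(\<lambda>x\<in>carrier M. f x \<oplus>\<^bsub>N\<^esub> g x) \<in> mod_hom R M N" by (rule lin[OF f g])
    show "(\<lambda>x\<in>carrier M. f x \<oplus>\<^bsub>N\<^esub> g x) = (\<lambda>x\<in>carrier M. g x \<oplus>\<^bsub>N\<^esub> f x)"
      by (rule restrict_ext) (simp add: fc N.M.a_comm)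
    fix h assume h: "h \<in> mod_hom R M N"
    show "(\<lambda>x\<in>carrier M. (\<lambda>x\<in>carrier M. f x \<oplus>\<^bsub>N\<^esub> g x) x \<oplus>\<^bsub>N\<^esub> h x) =
      (\<lambda>x\<in>carrier M. f x \<oplus>\<^bsub>N\<^esub> (\<lambda>x\<in>carrier M. g x \<oplus>\<^bsub>N\<^esub> h x) x)"
      by (rule restrict_ext) (simp add: fc mod_hom_closed[OF h] N.M.a_assoc)
  qed (rule mod_hom_zero_hom[OF M N])
  then show ?thesis
  proof (rule moduleI[OF M.R.is_cring]; unfold hom_module_simps)
    fix r f assume r: "r \<in> carrier R" and f: "f \<in> mod_hom R M N"
    note fc = mod_hom_closed[OF f]
    show "(\<lambda>x\<in>carrier M. r \<odot>\<^bsub>N\<^esub> f x) \<in> mod_hom R M N" by (rule sc[OF f r])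
    fix q assume q: "q \<in> carrier R"
    show "(\<lambda>x\<in>carrier M. (r \<oplus>\<^bsub>R\<^esub> q) \<odot>\<^bsub>N\<^esub> f x) =
      (\<lambda>x\<in>carrier M. (\<lambda>x\<in>carrier M. r \<odot>\<^bsub>N\<^esub> f x) x \<oplus>\<^bsub>N\<^esub> (\<lambda>x\<in>carrier M. q \<odot>\<^bsub>N\<^esub> f x) x)"
      by (rule restrict_ext) (simp add: fc r q N.smult_l_distr)
    show "(\<lambda>x\<in>carrier M. (r \<otimes>\<^bsub>R\<^esub> q) \<odot>\<^bsub>N\<^esub> f x) = (\<lambda>x\<in>carrier M. r \<odot>\<^bsub>N\<^esub> (\<lambda>x\<in>carrier M. q \<odot>\<^bsub>N\<^esub> f x) x)"
      by (rule restrict_ext) (simp add: fc r q N.smult_assoc1)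
  next
    fix r f g assume r: "r \<in> carrier R" and f: "f \<in> mod_hom R M N" and g: "g \<in> mod_hom R M N"
    note fc = mod_hom_closed[OF f] mod_hom_closed[OF g]
    show "(\<lambda>x\<in>carrier M. r \<odot>\<^bsub>N\<^esub> (\<lambda>x\<in>carrier M. f x \<oplus>\<^bsub>N\<^esub> g x) x) =
      (\<lambda>x\<in>carrier M. (\<lambda>x\<in>carrier M. r \<odot>\<^bsub>N\<^esub> f x) x \<oplus>\<^bsub>N\<^esub> (\<lambda>x\<in>carrier M. r \<odot>\<^bsub>N\<^esub> g x) x)"
      by (rule restrict_ext) (simp add: fc r N.smult_r_distr)
  next
    fix f assume f: "f \<in> mod_hom R M N"
    show "(\<lambda>x\<in>carrier M. \<one>\<^bsub>R\<^esub> \<odot>\<^bsub>N\<^esub> f x) = f"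
      by (rule mod_hom_eqI[OF sc[OF f] f]) (simp_all add: mod_hom_closed[OF f])
  qed
qed

lemma rank_homs_submodule:
  assumes M: "module R M" and N: "module R N"
  shows "submodule (rank_homs R M N) R (hom_module R M N)"
proof -
  interpret H: rmodule R "hom_module R M N" by (rule rmoduleI[OF hom_module_module[OF M N]])
  show ?thesis
    by (rule H.subI)
      (auto intro: rank_homs_hom[OF M N] rank_homs.zero rank_homs_add[OF M N] rank_homs_smult[OF M N] simp del: restrict_apply)
qed

section \<open>Direct sums\<close>

lemma direct_sum_simps [simp]:
  "carrier (direct_sum_module M N) = carrier M \<times> carrier N"
  "\<zero>\<^bsub>direct_sum_module M N\<^esub> = (\<zero>\<^bsub>M\<^esub>, \<zero>\<^bsub>N\<^esub>)"
  "(x, y) \<oplus>\<^bsub>direct_sum_module M N\<^esub> (x', y') = (x \<oplus>\<^bsub>M\<^esub> x', y \<oplus>\<^bsub>N\<^esub> y')"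
  "r \<odot>\<^bsub>direct_sum_module M N\<^esub> (x, y) = (r \<odot>\<^bsub>M\<^esub> x, r \<odot>\<^bsub>N\<^esub> y)"
  by (simp_all add: direct_sum_module_def)

lemma direct_sum_module_module:
  assumes M: "module R M" and N: "module R N"
  shows "module R (direct_sum_module M N)"
proof -
  interpret M: rmodule R M using M by (rule rmoduleI)
  interpret N: rmodule R N using N by (rule rmoduleI)
  have "abelian_group (direct_sum_module M N)"
  proof (rule abelian_groupI)
    fix x assume "x \<in> carrier (direct_sum_module M N)"
    then show "\<exists>y\<in>carrier (direct_sum_module M N). y \<oplus>\<^bsub>direct_sum_module M N\<^esub> x = \<zero>\<^bsub>direct_sum_module M N\<^esub>"
      by (intro bexI[of _ "(\<ominus>\<^bsub>M\<^esub> fst x, \<ominus>\<^bsub>N\<^esub> snd x)"]) (auto simp: M.M.l_neg N.M.l_neg)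
  qed (auto simp: M.M.a_assoc N.M.a_assoc, auto simp: M.M.a_comm N.M.a_comm)
  then show ?thesis
    by (rule moduleI[OF M.R.is_cring])
      (auto simp: M.smult_l_distr N.smult_l_distr M.smult_r_distr N.smult_r_distr M.smult_assoc1 N.smult_assoc1)
qed

lemma direct_sum_homs:
  assumes M: "module R M" and N: "module R N"
  shows "(\<lambda>x\<in>carrier M. (x, \<zero>\<^bsub>N\<^esub>)) \<in> mod_hom R M (direct_sum_module M N)"
    "(\<lambda>y\<in>carrier N. (\<zero>\<^bsub>M\<^esub>, y)) \<in> mod_hom R N (direct_sum_module M N)"
    "(\<lambda>z\<in>carrier (direct_sum_module M N). fst z) \<in> mod_hom R (direct_sum_module M N) M"
    "(\<lambda>z\<in>carrier (direct_sum_module M N). snd z) \<in> mod_hom R (direct_sum_module M N) N"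
proof -
  interpret M: rmodule R M using M by (rule rmoduleI)
  interpret N: rmodule R N using N by (rule rmoduleI)
  note D = direct_sum_module_module[OF M N]
  show "(\<lambda>x\<in>carrier M. (x, \<zero>\<^bsub>N\<^esub>)) \<in> mod_hom R M (direct_sum_module M N)"
    by (rule mod_hom_restrictI[OF M]) auto
  show "(\<lambda>y\<in>carrier N. (\<zero>\<^bsub>M\<^esub>, y)) \<in> mod_hom R N (direct_sum_module M N)"
    by (rule mod_hom_restrictI[OF N]) auto
  show "(\<lambda>z\<in>carrier (direct_sum_module M N). fst z) \<in> mod_hom R (direct_sum_module M N) M"
    by (rule mod_hom_restrictI[OF D]) auto
  show "(\<lambda>z\<in>carrier (direct_sum_module M N). snd z) \<in> mod_hom R (direct_sum_module M N) N"
    by (rule mod_hom_restrictI[OF D]) auto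
qed

lemma direct_sum_fin_gen:
  assumes "fin_gen_module R M" "fin_gen_module R N"
  shows "fin_gen_module R (direct_sum_module M N)"
proof -
  have M: "module R M" and N: "module R N" using assms by (auto simp: fin_gen_module_def)
  note D = direct_sum_module_module[OF M N] and h = direct_sum_homs[OF M N]
  interpret M: rmodule R M using M by (rule rmoduleI)
  interpret N: rmodule R N using N by (rule rmoduleI)
  interpret D: rmodule R "direct_sum_module M N" using D by (rule rmoduleI)
  obtain S where S: "finite S" "S \<subseteq> carrier M" "mod_span R M S = carrier M"
    using assms(1) unfolding fin_gen_module_def by (elim exE conjE)
  obtain T where T: "finite T" "T \<subseteq> carrier N" "mod_span R N T = carrier N"
    using assms(2) unfolding fin_gen_module_def by (elim exE conjE)
  let ?U = "(\<lambda>x. (x, \<zero>\<^bsub>N\<^esub>)) ` S \<union> (\<lambda>y. (\<zero>\<^bsub>M\<^esub>, y)) ` T"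
  have U: "?U \<subseteq> carrier (direct_sum_module M N)" using S T by auto
  note sU = D.span_sub[OF U]
  have "mod_span R M S \<subseteq> {x \<in> carrier M. (\<lambda>x\<in>carrier M. (x, \<zero>\<^bsub>N\<^esub>)) x \<in> mod_span R (direct_sum_module M N) ?U}"
    by (rule M.span_least[OF sub_vimage[OF M D h(1) sU]]) (use S in \<open>auto intro!: D.span_mem\<close>)
  moreover have "mod_span R N T \<subseteq> {y \<in> carrier N. (\<lambda>y\<in>carrier N. (\<zero>\<^bsub>M\<^esub>, y)) y \<in> mod_span R (direct_sum_module M N) ?U}"
    by (rule N.span_least[OF sub_vimage[OF N D h(2) sU]]) (use T in \<open>auto intro!: D.span_mem\<close>)
  ultimately have 1: "(x, \<zero>\<^bsub>N\<^esub>) \<in> mod_span R (direct_sum_module M N) ?U" "(\<zero>\<^bsub>M\<^esub>, y) \<in> mod_span R (direct_sum_module M N) ?U"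
    if "x \<in> carrier M" "y \<in> carrier N" for x y using S(3) T(3) that by auto
  have "(x, y) \<in> mod_span R (direct_sum_module M N) ?U" if "x \<in> carrier M" "y \<in> carrier N" for x y
    using D.sub_add[OF sU 1(1)[OF that] 1(2)[OF that]] that by simp
  then have "carrier (direct_sum_module M N) \<subseteq> mod_span R (direct_sum_module M N) ?U"
    unfolding direct_sum_simps by (intro subsetI) (elim SigmaE, hypsubst)
  then have "mod_span R (direct_sum_module M N) ?U = carrier (direct_sum_module M N)"
    using D.sub_carrier[OF sU] by (intro equalityI subsetI) auto
  then show ?thesis unfolding fin_gen_module_def
    using D U S(1) T(1) by (intro conjI exI[of _ ?U]) simp_all
qed

subsection \<open>Consequences of bounded stable length\<close>

context noeth_local
begin

text \<open>The submodules generated by \<open>\<mm>\<^sup>j\<close> times the class of the inclusion \<open>M \<rightarrow> M \<oplus> G\<close> decrease, so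
  two consecutive ones with \<open>j < b\<close> agree, and they vanish by Nakayama's lemma.\<close>

lemma stable_annihilator:
  assumes D: "fin_gen_module R M" "fin_gen_module R G" and h: "h_length R G M < enat b"
    and r: "r \<in> mpow b"
  shows "(\<lambda>y\<in>carrier M. r \<odot>\<^bsub>M\<^esub> y) \<in> rank_homs R M M"
proof -
  have M: "module R M" and G: "module R G" using D by (auto simp: fin_gen_module_def)
  interpret M: rmodule R M using M by (rule rmoduleI)
  let ?D = "direct_sum_module M G"
  have DM: "module R ?D" by (rule direct_sum_module_module[OF M G])
  let ?H = "hom_module R M ?D"
  interpret H: rmodule R ?H by (rule rmoduleI[OF hom_module_module[OF M DM]])
  interpret S: fg_local_module R \<mm> "self_module R" by (rule self_fg)
  define P where "P = rank_homs R M ?D"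
  have P: "submodule P R ?H" unfolding P_def by (rule rank_homs_submodule[OF M DM])
  define e where "e = (\<lambda>x\<in>carrier M. (x, \<zero>\<^bsub>G\<^esub>))"
  have e: "e \<in> carrier ?H" using direct_sum_homs(1)[OF M G] by (simp add: e_def)
  \<comment> \<open>The annihilator of the class of the inclusion \<open>e\<close> in the stable
    module.\<close>
  define T where "T = {r \<in> carrier R. r \<odot>\<^bsub>?H\<^esub> e \<in> P}"
  have T: "ideal T R"
  proof (rule idlI)
    show "\<zero> \<in> T" using H.smult_l_null[OF e] H.sub_zero[OF P] unfolding T_def by simp
    show "x \<oplus> y \<in> T" if "x \<in> T" "y \<in> T" for x y
      using that H.smult_l_distr[OF _ _ e, of x y] H.sub_add[OF P] unfolding T_def
      by (simp del: hom_module_simps)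
    show "q \<otimes> x \<in> T" if "q \<in> carrier R" "x \<in> T" for q x
      using that H.smult_assoc1[OF _ _ e, of q x] H.sub_smult[OF P] unfolding T_def
      by (simp del: hom_module_simps)
  qed (auto simp: T_def)
  define E where "E = (\<lambda>j. {r \<odot>\<^bsub>?H\<^esub> e | r. r \<in> mpow j})"
  have E: "submodule (E j) R ?H" for j
  proof (rule H.subI)
    show "E j \<subseteq> carrier ?H" using H.smult_closed[OF mpow_carrier e] by (auto simp: E_def simp del: hom_module_simps)
    show "\<zero>\<^bsub>?H\<^esub> \<in> E j" unfolding E_def using H.smult_l_null[OF e, symmetric] idl_zero[OF mpow_ideal] by blast
  next
    fix x y assume "x \<in> E j" "y \<in> E j"
    then obtain r s where rs: "r \<in> mpow j" "s \<in> mpow j" "x = r \<odot>\<^bsub>?H\<^esub> e" "y = s \<odot>\<^bsub>?H\<^esub> e" unfolding E_def by blast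
    then have "x \<oplus>\<^bsub>?H\<^esub> y = (r \<oplus> s) \<odot>\<^bsub>?H\<^esub> e" using H.smult_l_distr[OF _ _ e] mpow_carrier by (simp del: hom_module_simps)
    then show "x \<oplus>\<^bsub>?H\<^esub> y \<in> E j" unfolding E_def using idl_add[OF mpow_ideal rs(1,2)] by blast
  next
    fix q x assume q: "q \<in> carrier R" and "x \<in> E j"
    then obtain r where r: "r \<in> mpow j" "x = r \<odot>\<^bsub>?H\<^esub> e" unfolding E_def by blast
    then have "q \<odot>\<^bsub>?H\<^esub> x = (q \<otimes> r) \<odot>\<^bsub>?H\<^esub> e" using H.smult_assoc1[OF q _ e] mpow_carrier by (simp del: hom_module_simps)
    then show "q \<odot>\<^bsub>?H\<^esub> x \<in> E j" unfolding E_def using idl_mult[OF mpow_ideal r(1) q] by blast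
  qed
  define K where "K = (\<lambda>j. E j <+>\<^bsub>?H\<^esub> P)"
  have K: "submodule (K j) R ?H" "P \<subseteq> K j" for j
    unfolding K_def using H.sub_set_add[OF E P] H.set_add_upper[OF E P] by auto
  have Kmono: "K (Suc j) \<subseteq> K j" for j
  proof -
    have "E (Suc j) \<subseteq> E j" unfolding E_def using mpow_antimono[of j "Suc j"] by auto
    also have "\<dots> \<subseteq> K j" using H.set_add_upper(1)[OF E P] by (simp add: K_def)
    finally have "E (Suc j) <+>\<^bsub>?H\<^esub> P \<subseteq> K j" by (rule H.set_add_least[OF K(1) _ K(2)])
    then show ?thesis by (simp add: K_def)
  qed
  \<comment> \<open>Otherwise the K j, read backwards, would be a strict chain of length b above
    P.\<close>
  have "\<exists>j<b. K (Suc j) = K j"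
  proof (rule ccontr)
    assume "\<not> (\<exists>j<b. K (Suc j) = K j)"
    then have lt: "K (Suc j) \<subset> K j" if "j < b" for j using Kmono that by blast
    have "K (b - i) \<subset> K (b - Suc i)" if "i < b" for i
      using lt[of "b - Suc i"] that by (simp add: Suc_diff_Suc)
    then have "enat b \<le> module_length R (quot_module ?H P)"
      by (intro H.quot_chain[OF P, of b "\<lambda>i. K (b - i)"]) (use K in auto)
    then show False
      using h by (simp add: h_length_def stable_hom_def projective_homs_eq[OF M direct_sum_fin_gen[OF D]] P_def)
  qed
  then obtain j where j: "j < b" "K (Suc j) = K j" by auto
  \<comment> \<open>Every x \<in> \<mm>^j agrees with some y \<in> \<mm>^(j+1) up to an element of
    T. Nakayama's lemma is thus applied inside R, where finite generation is at hand, and not in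
    Hom.\<close>
  have "mpow j \<subseteq> ideal_times R \<mm> (self_module R) (mpow j) <+>\<^bsub>self_module R\<^esub> T"
  proof
    fix x assume x: "x \<in> mpow j"
    have "x \<odot>\<^bsub>?H\<^esub> e \<in> K (Suc j)"
      unfolding j(2) using H.set_add_upper(1)[OF E P, of j] x by (auto simp: K_def E_def)
    then obtain y p where yp: "y \<in> mpow (Suc j)" "p \<in> P" "x \<odot>\<^bsub>?H\<^esub> e = y \<odot>\<^bsub>?H\<^esub> e \<oplus>\<^bsub>?H\<^esub> p"
      unfolding K_def H.set_add_mem E_def by blast
    have c: "x \<in> carrier R" "y \<in> carrier R" using x yp mpow_carrier by auto
    have pc: "p \<in> carrier ?H" by (rule H.sub_carrier[OF P yp(2)])
    have yc: "y \<odot>\<^bsub>?H\<^esub> e \<in> carrier ?H" by (rule H.smult_closed[OF c(2) e])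
    have "(x \<ominus> y) \<odot>\<^bsub>?H\<^esub> e = x \<odot>\<^bsub>?H\<^esub> e \<oplus>\<^bsub>?H\<^esub> \<ominus>\<^bsub>?H\<^esub> (y \<odot>\<^bsub>?H\<^esub> e)"
      unfolding a_minus_def using c H.smult_l_distr[OF c(1) _ e, of "\<ominus> y"] H.smult_l_minus[OF c(2) e]
      by (simp del: hom_module_simps)
    also have "\<dots> = (p \<oplus>\<^bsub>?H\<^esub> y \<odot>\<^bsub>?H\<^esub> e) \<oplus>\<^bsub>?H\<^esub> \<ominus>\<^bsub>?H\<^esub> (y \<odot>\<^bsub>?H\<^esub> e)"
      unfolding yp(3) H.M.a_comm[OF yc pc] ..
    also have "\<dots> = p"
      unfolding H.M.a_assoc[OF pc yc H.M.a_inv_closed[OF yc]] H.M.r_neg[OF yc] by (rule H.M.r_zero[OF pc])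
    finally have t: "x \<ominus> y \<in> T" using c yp(2) by (simp add: T_def del: hom_module_simps)
    have "mpow (Suc 0 + j) \<subseteq> ideal_times R \<mm> (self_module R) (mpow j)"
    proof (rule mpow_least)
      show "ideal (ideal_times R \<mm> (self_module R) (mpow j)) R"
        using S.times_sub[of \<mm> "mpow j"] m_carrier mpow_carrier by (auto simp: self_submodule_iff)
      fix a c assume "a \<in> mpow (Suc 0)" "c \<in> mpow j"
      then show "a \<otimes> c \<in> ideal_times R \<mm> (self_module R) (mpow j)" using S.times_mem[of a \<mm> c "mpow j"] by (simp add: mpow_1)
    qed
    then have "y \<in> ideal_times R \<mm> (self_module R) (mpow j)" using yp(1) by auto
    from S.set_addI[OF this t]
    have "y \<oplus> (x \<ominus> y) \<in> ideal_times R \<mm> (self_module R) (mpow j) <+>\<^bsub>self_module R\<^esub> T" by simp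
    moreover have "y \<oplus> (x \<ominus> y) = x" using c by (simp add: a_minus_def a_comm[of x] r_neg1 r_neg2)
    ultimately show "x \<in> ideal_times R \<mm> (self_module R) (mpow j) <+>\<^bsub>self_module R\<^esub> T"
      by simp
  qed
  then have "mpow j \<subseteq> T" by (rule S.nakayama[OF self_submodule[OF mpow_ideal] self_submodule[OF T]])
  then have "r \<in> T" using r mpow_antimono[of j b] j(1) by auto
  then have rc: "r \<in> carrier R" and "r \<odot>\<^bsub>?H\<^esub> e \<in> rank_homs R M ?D" by (auto simp: T_def P_def)
  \<comment> \<open>Followed by the projection to M, r times the inclusion becomes multiplication by
    r on M.\<close>
  from rank_homs_compose[OF M DM M direct_sum_homs(3)[OF M G] this(2)]
  have 1: "compose (carrier M) (\<lambda>z\<in>carrier ?D. fst z) (r \<odot>\<^bsub>?H\<^esub> e) \<in> rank_homs R M M" .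
  interpret G: rmodule R G using G by (rule rmoduleI)
  have "compose (carrier M) (\<lambda>z\<in>carrier ?D. fst z) (r \<odot>\<^bsub>?H\<^esub> e) = (\<lambda>y\<in>carrier M. r \<odot>\<^bsub>M\<^esub> y)"
    unfolding compose_def by (rule restrict_ext) (simp add: e_def rc)
  then show ?thesis using 1 by simp
qed

lemma residue_hom_kills:
  assumes N: "local_module R \<mm> N" and f: "f \<in> mod_hom R N (residue_module R \<mm>)" and x: "x \<in> filt N 1"
  shows "f x = \<zero>\<^bsub>residue_module R \<mm>\<^esub>"
proof -
  interpret N: local_module R \<mm> N by fact
  interpret k: rmodule R "residue_module R \<mm>" by (rule rmoduleI[OF residue_module])
  have "filt N 1 \<subseteq> {x \<in> carrier N. f x \<in> {\<zero>\<^bsub>residue_module R \<mm>\<^esub>}}"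
  proof (rule N.filt_least[OF sub_vimage[OF N.module_axioms residue_module f k.sub_zero_module]])
    fix a y assume a: "a \<in> mpow 1" and y: "y \<in> carrier N"
    have "f (a \<odot>\<^bsub>N\<^esub> y) = a \<odot>\<^bsub>residue_module R \<mm>\<^esub> f y"
      by (rule mod_hom_smult[OF f mpow_carrier[OF a] y])
    also have "\<dots> = \<zero>\<^bsub>residue_module R \<mm>\<^esub>"
      by (rule residue_kill[OF _ mod_hom_closed[OF f y]]) (use a mpow_1 in simp)
    finally show "a \<odot>\<^bsub>N\<^esub> y \<in> {x \<in> carrier N. f x \<in> {\<zero>\<^bsub>residue_module R \<mm>\<^esub>}}"
      using y mpow_carrier[OF a] by simp
  qed
  then show ?thesis using x by auto
qed

text \<open>Every term \<phi>(x) n has its coefficient in \<mm>. The hypothesis on functionals says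
  that M has no direct summand isomorphic to R.\<close>

lemma rank_homs_filt:
  assumes M: "module R M" and N: "local_module R \<mm> N" and f: "f \<in> rank_homs R M N"
    and m: "\<And>\<phi> x. \<phi> \<in> mod_hom R M (self_module R) \<Longrightarrow> x \<in> carrier M \<Longrightarrow> \<phi> x \<in> \<mm>"
    and x: "x \<in> carrier M"
  shows "f x \<in> filt N 1"
  using f
proof induct
  interpret N: local_module R \<mm> N by fact
  case zero
  then show ?case using x N.sub_zero[OF N.filt_sub] by (simp add: zero_hom_def)
next
  interpret N: local_module R \<mm> N by fact
  case (step f \<phi> n)
  have "\<phi> x \<odot>\<^bsub>N\<^esub> n \<in> filt N 1" by (rule N.filt_mem[OF _ step(4)]) (use m[OF step(3) x] mpow_1 in simp)
  then show ?case using x step(2) N.sub_add[OF N.filt_sub] by simp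
qed

text \<open>Since \<open>M\<close> has no free summand, a homomorphism to \<open>G\<close> that factors through a projective module
  has image in \<open>\<mm> G\<close>. Hence the stable homomorphisms to \<open>G\<close> map onto \<open>Hom(M, k)\<close>, and a strict chain
  of submodules of \<open>M / \<mm> M\<close> yields one of annihilators in the stable module.\<close>

lemma generators_bound:
  assumes D: "fin_gen_module R M" "fin_gen_module R G" and h: "h_length R G M < enat b"
    and m: "\<And>\<phi> x. \<phi> \<in> mod_hom R M (self_module R) \<Longrightarrow> x \<in> carrier M \<Longrightarrow> \<phi> x \<in> \<mm>"
    and \<alpha>: "\<alpha> \<in> mod_hom R G (residue_module R \<mm>)"
    and lift: "\<And>\<beta>. \<beta> \<in> mod_hom R M (residue_module R \<mm>) \<Longrightarrow> \<exists>\<gamma>\<in>mod_hom R M G. compose (carrier M) \<alpha> \<gamma> = \<beta>"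
  shows "\<exists>T. finite T \<and> T \<subseteq> carrier M \<and> mod_span R M T = carrier M \<and> card T \<le> b"
proof (rule ccontr)
  assume no: "\<not> ?thesis"
  have M: "module R M" and G: "module R G" using D by (auto simp: fin_gen_module_def)
  interpret M: fg_local_module R \<mm> M
    by (intro fg_local_module.intro local_module.intro fg_local_module_axioms.intro rmoduleI M D noeth_local_axioms)
  interpret k: rmodule R "residue_module R \<mm>" by (rule rmoduleI[OF residue_module])
  let ?k = "residue_module R \<mm>"
  have lG: "local_module R \<mm> G" by (intro local_module.intro rmoduleI G noeth_local_axioms)
  interpret G: local_module R \<mm> G by (rule lG)
  let ?D = "direct_sum_module M G"
  have DM: "module R ?D" by (rule direct_sum_module_module[OF M G])
  let ?H = "hom_module R M ?D"
  interpret H: rmodule R ?H by (rule rmoduleI[OF hom_module_module[OF M DM]])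
  define gen where "gen = (\<lambda>T. filt M 1 <+>\<^bsub>M\<^esub> mod_span R M T)"
  have gen_sub: "submodule (gen T) R M" "filt M 1 \<subseteq> gen T" "mod_span R M T \<subseteq> gen T" if "T \<subseteq> carrier M" for T
    unfolding gen_def using M.sub_set_add[OF M.filt_sub M.span_sub[OF that]]
      M.set_add_upper[OF M.filt_sub M.span_sub[OF that]] by auto
  have ex: "\<exists>x. x \<in> carrier M \<and> x \<notin> gen T" if T: "finite T" "T \<subseteq> carrier M" "card T \<le> b" for T
  proof (rule ccontr)
    assume "\<nexists>x. x \<in> carrier M \<and> x \<notin> gen T"
    then have all: "\<And>x. x \<in> carrier M \<Longrightarrow> x \<in> gen T" by auto
    have "mod_span R M T = carrier M"
    proof (rule M.nakayama_carrier[OF M.span_sub[OF T(2)]])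
      fix x assume "x \<in> carrier M"
      then obtain a t where at: "a \<in> filt M 1" "t \<in> mod_span R M T" "x = a \<oplus>\<^bsub>M\<^esub> t"
        using all unfolding gen_def M.set_add_mem by blast
      have c: "a \<in> carrier M" "t \<in> carrier M"
        using M.filt_carrier[OF at(1)] M.sub_carrier[OF M.span_sub[OF T(2)] at(2)] by auto
      have "mod_cong M (filt M 1) x t"
        by (rule M.congI_add[OF M.filt_sub c(2) at(1)]) (use at c M.M.a_comm in simp)
      then show "\<exists>t\<in>mod_span R M T. mod_cong M (filt M 1) x t" using at by blast
    qed
    then show False using no T by blast
  qed
  \<comment> \<open>Greedy choice of elements independent modulo \<mm> M. It continues as long as at
    most b elements have been chosen, since these do not generate M.\<close>
  define nx where "nx = (\<lambda>T. SOME x. x \<in> carrier M \<and> x \<notin> gen T)"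
  have nx: "nx T \<in> carrier M" "nx T \<notin> gen T" if "finite T" "T \<subseteq> carrier M" "card T \<le> b" for T
    using someI_ex[OF ex[OF that]] by (auto simp: nx_def)
  define S where "S = rec_nat {} (\<lambda>_ T. insert (nx T) T)"
  have S0: "S 0 = {}" "\<And>n. S (Suc n) = insert (nx (S n)) (S n)" by (simp_all add: S_def)
  have S: "finite (S n) \<and> S n \<subseteq> carrier M \<and> card (S n) \<le> n" if "n \<le> b" for n
    using that
  proof (induct n)
    case (Suc n)
    then show ?case using nx(1)[of "S n"] by (auto simp: S0 card_insert_if)
  qed (simp add: S0)
  \<comment> \<open>Maps whose G-component, followed by \<alpha>, kills \<mm> M and the first n
    chosen elements. They contain the maps of finite rank and shrink strictly as n grows.\<close>
  define A where "A = (\<lambda>n. {h \<in> mod_hom R M ?D. \<forall>x\<in>gen (S n). \<alpha> (snd (h x)) = \<zero>\<^bsub>?k\<^esub>})"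
  have hG: "snd (h x) \<in> carrier G" if "h \<in> mod_hom R M ?D" "x \<in> carrier M" for h x
    using mod_hom_closed[OF that] by auto
  have gc: "x \<in> carrier M" if "n \<le> b" "x \<in> gen (S n)" for n x
    using M.sub_carrier[OF gen_sub(1)] S[OF that(1)] that(2) by blast
  have sA: "submodule (A n) R ?H" if n: "n \<le> b" for n
  proof (rule H.subI)
    show "A n \<subseteq> carrier ?H" by (auto simp: A_def)
    show "\<zero>\<^bsub>?H\<^esub> \<in> A n"
      using mod_hom_zero_hom[OF M DM] mod_hom_zero[OF G residue_module \<alpha>] gc[OF n]
      by (auto simp: A_def zero_hom_def)
  next
    fix f g assume f: "f \<in> A n" and g: "g \<in> A n"
    have h: "f \<in> mod_hom R M ?D" "g \<in> mod_hom R M ?D" using f g by (auto simp: A_def)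
    have "\<alpha> (snd (f x \<oplus>\<^bsub>?D\<^esub> g x)) = \<zero>\<^bsub>?k\<^esub>" if x: "x \<in> gen (S n)" for x
    proof -
      have "snd (f x \<oplus>\<^bsub>?D\<^esub> g x) = snd (f x) \<oplus>\<^bsub>G\<^esub> snd (g x)"
        by (cases "f x"; cases "g x") simp
      then show ?thesis
        using x f g hG[OF h(1) gc[OF n x]] hG[OF h(2) gc[OF n x]] by (simp add: A_def mod_hom_add[OF \<alpha>])
    qed
    then show "f \<oplus>\<^bsub>?H\<^esub> g \<in> A n" using mod_hom_lin[OF M DM h] gc[OF n] by (simp add: A_def)
  next
    fix r f assume r: "r \<in> carrier R" and f: "f \<in> A n"
    have h: "f \<in> mod_hom R M ?D" using f by (auto simp: A_def)
    have "\<alpha> (snd (r \<odot>\<^bsub>?D\<^esub> f x)) = \<zero>\<^bsub>?k\<^esub>" if x: "x \<in> gen (S n)" for x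
    proof -
      have "snd (r \<odot>\<^bsub>?D\<^esub> f x) = r \<odot>\<^bsub>G\<^esub> snd (f x)" by (cases "f x") simp
      then show ?thesis using x f r hG[OF h gc[OF n x]] by (simp add: A_def mod_hom_smult[OF \<alpha>])
    qed
    then show "r \<odot>\<^bsub>?H\<^esub> f \<in> A n" using mod_hom_scale[OF M DM h r] gc[OF n] by (simp add: A_def)
  qed
  have PA: "rank_homs R M ?D \<subseteq> A n" if n: "n \<le> b" for n
  proof
    fix f assume f: "f \<in> rank_homs R M ?D"
    have h: "f \<in> mod_hom R M ?D" by (rule rank_homs_hom[OF M DM f])
    let ?s = "compose (carrier M) (\<lambda>z\<in>carrier ?D. snd z) f"
    have s: "?s \<in> rank_homs R M G" by (rule rank_homs_compose[OF M DM G direct_sum_homs(4)[OF M G] f])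
    have "\<alpha> (snd (f x)) = \<zero>\<^bsub>?k\<^esub>" if x: "x \<in> carrier M" for x
    proof -
      have "?s x \<in> filt G 1" by (rule rank_homs_filt[OF M lG s _ x]) (use m in blast)
      moreover have "?s x = snd (f x)" using x mod_hom_closed[OF h x] by (simp add: compose_def)
      ultimately show ?thesis using residue_hom_kills[OF lG \<alpha>] by simp
    qed
    then show "f \<in> A n" using h gc[OF n] by (simp add: A_def)
  qed
  have AS: "A (Suc n) \<subset> A n" if n: "n < b" for n
  proof -
    have Sn: "finite (S n)" "S n \<subseteq> carrier M" "card (S n) \<le> b" using S[of n] n by auto
    have SSn: "S (Suc n) \<subseteq> carrier M" using S[of "Suc n"] n by auto
    have "mod_span R M (S n) \<subseteq> mod_span R M (S (Suc n))" by (rule M.span_mono) (use S0(2) in auto)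
    also have "\<dots> \<subseteq> gen (S (Suc n))" by (rule gen_sub(3)[OF SSn])
    finally have "filt M 1 <+>\<^bsub>M\<^esub> mod_span R M (S n) \<subseteq> gen (S (Suc n))"
      by (rule M.set_add_least[OF gen_sub(1,2)[OF SSn]])
    then have "gen (S n) \<subseteq> gen (S (Suc n))" by (simp add: gen_def)
    then have le: "A (Suc n) \<subseteq> A n" by (auto simp: A_def)
    let ?x = "nx (S n)"
    have x: "?x \<in> carrier M" "?x \<notin> gen (S n)" by (rule nx(1)[OF Sn], rule nx(2)[OF Sn])
    obtain \<beta> where \<beta>: "\<beta> \<in> mod_hom R M ?k" "\<And>t. t \<in> gen (S n) \<Longrightarrow> \<beta> t = \<zero>\<^bsub>?k\<^esub>" "\<beta> ?x \<noteq> \<zero>\<^bsub>?k\<^esub>"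
      using M.functional[OF gen_sub(1,2)[OF Sn(2)] x] by metis
    \<comment> \<open>A functional that separates the next element from the previous ones is lifted
      along \<alpha> and placed in the G-component. This is the role of the summand G in the stable
      Hom module.\<close>
    obtain \<gamma> where \<gamma>: "\<gamma> \<in> mod_hom R M G" "compose (carrier M) \<alpha> \<gamma> = \<beta>" using lift[OF \<beta>(1)] by (elim bexE)
    have \<gamma>\<beta>: "\<alpha> (\<gamma> y) = \<beta> y" if "y \<in> carrier M" for y using \<gamma>(2) that by (auto simp: compose_def)
    let ?h = "compose (carrier M) (\<lambda>y\<in>carrier G. (\<zero>\<^bsub>M\<^esub>, y)) \<gamma>"
    have h: "?h \<in> mod_hom R M ?D" by (rule mod_hom_compose[OF M \<gamma>(1) direct_sum_homs(2)[OF M G]])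
    have hx: "\<alpha> (snd (?h y)) = \<beta> y" if "y \<in> carrier M" for y
      using that mod_hom_closed[OF \<gamma>(1) that] \<gamma>\<beta>[OF that] by (simp add: compose_def)
    have "?h \<in> A n" using h hx \<beta>(2) gc[of n] n by (simp add: A_def)
    moreover have "?x \<in> gen (S (Suc n))" using gen_sub(3)[OF SSn] M.span_mem[of ?x "S (Suc n)"] S0(2) by auto
    then have "?h \<notin> A (Suc n)" using hx[OF x(1)] \<beta>(3) by (auto simp: A_def)
    ultimately show ?thesis using le by blast
  qed
  have "A (b - i) \<subset> A (b - Suc i)" if "i < b" for i
    using AS[of "b - Suc i"] that by (simp add: Suc_diff_Suc)
  then have "enat b \<le> module_length R (quot_module ?H (rank_homs R M ?D))"
    by (intro H.quot_chain[OF rank_homs_submodule[OF M DM], of b "\<lambda>i. A (b - i)"]) (use sA PA in auto)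
  then show False
    using h by (simp add: h_length_def stable_hom_def projective_homs_eq[OF M direct_sum_fin_gen[OF D]])
qed

text \<open>If \<phi> takes a unit value, some w has \<phi>(w) = 1, and M is the direct sum of R w
  and the kernel of \<phi>. The first summand is nonzero, so the kernel is zero.\<close>

lemma indecomposable_free:
  assumes ind: "indecomposable_module R M" and \<phi>: "\<phi> \<in> mod_hom R M (self_module R)"
    and x: "x \<in> carrier M" "\<phi> x \<notin> \<mm>"
  shows "mod_iso R M (self_module R)"
proof -
  have M: "module R M" using ind by (simp add: indecomposable_module_def)
  interpret M: rmodule R M using M by (rule rmoduleI)
  interpret S: rmodule R "self_module R" by (rule rmoduleI[OF self_module])
  note \<phi>s = self_module_hom[OF \<phi>]
  obtain u where u: "u \<in> carrier R" "u \<otimes> \<phi> x = \<one>" by (rule unit_of_notin_m[OF \<phi>s(1)[OF x(1)] x(2)])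
  define w where "w = u \<odot>\<^bsub>M\<^esub> x"
  have w: "w \<in> carrier M" "\<phi> w = \<one>" using u x \<phi>s(3) by (auto simp: w_def)
  let ?A = "{r \<odot>\<^bsub>M\<^esub> w | r. r \<in> carrier R}" and ?B = "{x \<in> carrier M. \<phi> x \<in> {\<zero>\<^bsub>self_module R\<^esub>}}"
  have A: "submodule ?A R M" by (rule M.cyclic_sub[OF w(1)])
  have B: "submodule ?B R M" by (rule sub_vimage[OF M self_module \<phi> S.sub_zero_module])
  have rw: "\<phi> (r \<odot>\<^bsub>M\<^esub> w) = r" if "r \<in> carrier R" for r using \<phi>s(3)[OF that w(1)] w that by simp
  have int: "?A \<inter> ?B = {\<zero>\<^bsub>M\<^esub>}"
  proof
    show "?A \<inter> ?B \<subseteq> {\<zero>\<^bsub>M\<^esub>}"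
    proof
      fix y assume "y \<in> ?A \<inter> ?B"
      then obtain r where "r \<in> carrier R" "y = r \<odot>\<^bsub>M\<^esub> w" "\<phi> y = \<zero>" by auto
      then show "y \<in> {\<zero>\<^bsub>M\<^esub>}" using rw w by auto
    qed
    show "{\<zero>\<^bsub>M\<^esub>} \<subseteq> ?A \<inter> ?B" using M.sub_zero[OF A] M.sub_zero[OF B] by blast
  qed
  have sum: "?A <+>\<^bsub>M\<^esub> ?B = carrier M"
  proof
    show "?A <+>\<^bsub>M\<^esub> ?B \<subseteq> carrier M" using M.sub_carrier[OF M.sub_set_add[OF A B]] by auto
    show "carrier M \<subseteq> ?A <+>\<^bsub>M\<^esub> ?B"
    proof
      fix y assume y: "y \<in> carrier M"
      have c: "\<phi> y \<odot>\<^bsub>M\<^esub> w \<in> carrier M" using \<phi>s(1)[OF y] w by simp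
      have "\<phi> (y \<ominus>\<^bsub>M\<^esub> \<phi> y \<odot>\<^bsub>M\<^esub> w) = \<zero>"
        unfolding mod_hom_minus[OF M self_module \<phi> y c]
        using rw[OF \<phi>s(1)[OF y]] \<phi>s(1)[OF y] by (simp add: a_minus_def r_neg)
      then have "y \<ominus>\<^bsub>M\<^esub> \<phi> y \<odot>\<^bsub>M\<^esub> w \<in> ?B" using y c by simp
      moreover have "\<phi> y \<odot>\<^bsub>M\<^esub> w \<in> ?A" using \<phi>s(1)[OF y] by blast
      moreover have "y = \<phi> y \<odot>\<^bsub>M\<^esub> w \<oplus>\<^bsub>M\<^esub> (y \<ominus>\<^bsub>M\<^esub> \<phi> y \<odot>\<^bsub>M\<^esub> w)"
        using y c by (simp add: a_minus_def M.M.a_comm[of y] M.M.r_neg1 M.M.r_neg2)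
      ultimately show "y \<in> ?A <+>\<^bsub>M\<^esub> ?B" unfolding M.set_add_mem by blast
    qed
  qed
  have "?A = {\<zero>\<^bsub>M\<^esub>} \<or> ?B = {\<zero>\<^bsub>M\<^esub>}" using ind A B int sum unfolding indecomposable_module_def by blast
  moreover have "?A \<noteq> {\<zero>\<^bsub>M\<^esub>}"
  proof
    assume a: "?A = {\<zero>\<^bsub>M\<^esub>}"
    have "\<one> \<odot>\<^bsub>M\<^esub> w \<in> ?A" by blast
    then have "w = \<zero>\<^bsub>M\<^esub>" using w a by simp
    then have "\<one> = \<zero>" using w mod_hom_zero[OF M self_module \<phi>] by simp
    then show False using one_notin_m idl_zero[OF m_ideal] by simp
  qed
  ultimately have B0: "?B = {\<zero>\<^bsub>M\<^esub>}" by blast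
  have "inj_on \<phi> (carrier M)"
  proof (rule inj_onI)
    fix y z assume yz: "y \<in> carrier M" "z \<in> carrier M" "\<phi> y = \<phi> z"
    have "\<phi> (y \<ominus>\<^bsub>M\<^esub> z) = \<zero>"
      unfolding mod_hom_minus[OF M self_module \<phi> yz(1,2)] using yz \<phi>s(1) by (simp add: a_minus_def r_neg)
    then have "y \<ominus>\<^bsub>M\<^esub> z \<in> ?B" using yz by simp
    then have "y \<ominus>\<^bsub>M\<^esub> z \<in> {\<zero>\<^bsub>M\<^esub>}" unfolding B0 .
    then have "mod_cong M {\<zero>\<^bsub>M\<^esub>} y z" using yz by (simp add: mod_cong_def)
    then show "y = z" using yz by (elim M.congE_add) simp
  qed
  moreover have "\<phi> ` carrier M = carrier R"
  proof
    show "\<phi> ` carrier M \<subseteq> carrier R" using \<phi>s(1) by auto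
    show "carrier R \<subseteq> \<phi> ` carrier M" using rw w(1) by (metis M.smult_closed imageI subsetI)
  qed
  ultimately show ?thesis using \<phi> unfolding mod_iso_def bij_betw_def by auto
qed

end

text \<open>Extends the lifting property to modules on other element types, by lifting on a
  transported copy of M.\<close>

lemma approximation_lift:
  fixes R :: "('a, 'r) ring_scheme" and M :: "('a, 'm) module"
  assumes R: "ring R" and ap: "right_minimal_MCM_approximation R \<mm> G N \<alpha>" and M: "MCM R \<mm> M"
    and \<beta>: "\<beta> \<in> mod_hom R M N"
  shows "\<exists>\<gamma>\<in>mod_hom R M G. compose (carrier M) \<alpha> \<gamma> = \<beta>"
proof -
  have fg: "fin_gen_module R M" and m: "module R M" using M by (auto simp: MCM_def fin_gen_module_def)
  obtain \<iota> :: "'m \<Rightarrow> 'a elt" where \<iota>: "inj_on \<iota> (carrier M)" by (rule fin_gen_embedding[OF fg])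
  let ?L = "transport M \<iota>"
  note tL = transport_module[OF m \<iota>] and th = transport_hom[OF m \<iota>]
  have L: "MCM R \<mm> ?L" by (rule iso_MCM[OF R M tL]) (use th in \<open>unfold mod_iso_def, blast\<close>)
  obtain g where g: "g \<in> mod_hom R ?L M" "\<forall>x\<in>carrier M. g (restrict \<iota> (carrier M) x) = x"
    using iso_inverse[OF m tL th] by (elim bexE conjE)
  have \<alpha>: "\<alpha> \<in> mod_hom R G N" using ap by (simp add: right_minimal_MCM_approximation_def)
  have \<beta>g: "compose (carrier ?L) \<beta> g \<in> mod_hom R ?L N" by (rule mod_hom_compose[OF tL g(1) \<beta>])
  obtain \<gamma> where \<gamma>: "\<gamma> \<in> mod_hom R ?L G" "compose (carrier ?L) \<alpha> \<gamma> = compose (carrier ?L) \<beta> g"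
    using ap L \<beta>g unfolding right_minimal_MCM_approximation_def by blast
  have c: "compose (carrier M) \<gamma> (restrict \<iota> (carrier M)) \<in> mod_hom R M G"
    by (rule mod_hom_compose[OF m th(1) \<gamma>(1)])
  have "compose (carrier M) \<alpha> (compose (carrier M) \<gamma> (restrict \<iota> (carrier M))) = \<beta>"
  proof (rule mod_hom_eqI[OF mod_hom_compose[OF m c \<alpha>] \<beta>])
    fix x assume x: "x \<in> carrier M"
    have ix: "\<iota> x \<in> carrier ?L" using x by (simp add: transport_simps[OF \<iota>])
    have "\<alpha> (\<gamma> (\<iota> x)) = \<beta> (g (\<iota> x))" using fun_cong[OF \<gamma>(2), of "\<iota> x"] ix by (simp add: compose_def)
    then show "compose (carrier M) \<alpha> (compose (carrier M) \<gamma> (restrict \<iota> (carrier M))) x = \<beta> x"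
      using x g(2) by (simp add: compose_def)
  qed
  then show ?thesis using c by (intro bexI)
qed

subsection \<open>Selecting the subfamily\<close>

text \<open>Paths grow at the source, but the selection in \<open>infinite_layer\<close> prolongs
  them at the target.\<close>

lemma (in reduction) path_target:
  assumes "path M I n k j p" "i \<in> I" "g \<in> mod_hom R (M j) (M i)"
    "\<not> bij_betw g (carrier (M j)) (carrier (M i))" "\<And>i. i \<in> I \<Longrightarrow> module R (M i)"
  shows "path M I (Suc n) k i (compose (carrier (M k)) g p)"
  using assms(1,3,4)
proof (induct n k j p)
  case (path_0 j)
  have "path M I (Suc 0) j i (compose (carrier (M j)) (\<lambda>x\<in>carrier (M i). x) g)"
    by (rule path_Suc[OF path.path_0[where M = M, OF assms(2)] path_0(1,2,3)])
  moreover have "compose (carrier (M j)) (\<lambda>x\<in>carrier (M i). x) g = compose (carrier (M j)) g (\<lambda>x\<in>carrier (M j). x)"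
    unfolding compose_def by (rule restrict_ext) (simp add: mod_hom_closed[OF path_0(2)])
  ultimately show ?case by (simp only:)
next
  case (path_Suc n l j p k h)
  have "path M I (Suc n) l i (compose (carrier (M l)) g p)" using path_Suc by blast
  from path.path_Suc[OF this path_Suc(3,4,5)]
  have "path M I (Suc (Suc n)) k i (compose (carrier (M k)) (compose (carrier (M l)) g p) h)" .
  moreover have "compose (carrier (M k)) (compose (carrier (M l)) g p) h
    = compose (carrier (M k)) g (compose (carrier (M k)) p h)"
    unfolding compose_def by (rule restrict_ext) (simp add: mod_hom_closed[OF path_Suc(4)])
  ultimately show ?case by (simp only:)
qed

text \<open>Peel off the indices that admit the required functional relative to the remaining ones.
  An index that survives \<open>n\<close> rounds is the target of a path of length \<open>n\<close> whose composite with some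
  functional does not vanish, so the number of rounds is bounded and one of the layers is infinite.\<close>

lemma (in reduction) infinite_layer:
  fixes M :: "'i \<Rightarrow> ('a, 'b) module"
  assumes m: "\<And>i. i \<in> I \<Longrightarrow> module R (M i)" and k: "module R K"
    and niso: "\<And>i j g. i \<in> I \<Longrightarrow> j \<in> I \<Longrightarrow> i \<noteq> j \<Longrightarrow> g \<in> mod_hom R (M j) (M i) \<Longrightarrow>
      \<not> bij_betw g (carrier (M j)) (carrier (M i))"
    and nz: "\<And>i. i \<in> I \<Longrightarrow> \<exists>f\<in>mod_hom R (M i) K. f \<noteq> zero_hom (M i) K"
    and bound: "\<And>i j f p. path M I N j i p \<Longrightarrow> f \<in> mod_hom R (M i) K \<Longrightarrow>
      compose (carrier (M j)) f p = zero_hom (M j) K"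
    and inf: "infinite I"
  shows "\<exists>I'\<subseteq>I. infinite I' \<and>
           (\<forall>i\<in>I'. \<exists>f\<in>mod_hom R (M i) K. f \<noteq> zero_hom (M i) K \<and>
              (\<forall>j\<in>I'. j \<noteq> i \<longrightarrow>
                 (\<forall>g\<in>mod_hom R (M j) (M i). compose (carrier (M j)) f g = zero_hom (M j) K)))"
proof -
  define good where "good = (\<lambda>J i. \<exists>f\<in>mod_hom R (M i) K. f \<noteq> zero_hom (M i) K \<and>
    (\<forall>j\<in>J. j \<noteq> i \<longrightarrow> (\<forall>g\<in>mod_hom R (M j) (M i). compose (carrier (M j)) f g = zero_hom (M j) K)))"
  define J where "J = rec_nat I (\<lambda>_ J. {i \<in> J. \<not> good J i})"
  have J0: "J 0 = I" "\<And>n. J (Suc n) = {i \<in> J n. \<not> good (J n) i}" by (simp_all add: J_def)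
  have JI: "J n \<subseteq> I" for n by (induct n) (auto simp: J0)
  \<comment> \<open>Stated for all non-zero functionals on M i at once, because the induction passes
    from f on M i to f g on some M j that survived one round less.\<close>
  have chain: "\<exists>j p. path M I n j i p \<and> compose (carrier (M j)) f p \<noteq> zero_hom (M j) K"
    if "i \<in> J n" "f \<in> mod_hom R (M i) K" "f \<noteq> zero_hom (M i) K" for n i f
    using that
  proof (induct n arbitrary: i f)
    case 0
    have i: "i \<in> I" using 0 by (simp add: J0)
    have "compose (carrier (M i)) f (\<lambda>x\<in>carrier (M i). x) = f"
      by (rule mod_hom_eqI[OF mod_hom_compose[OF m[OF i] mod_hom_id[OF m[OF i]] 0(2)] 0(2)]) (simp add: compose_def)
    then show ?case using path.path_0[OF i, of M] 0(3) by metis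
  next
    case (Suc n)
    have i: "i \<in> J n" "\<not> good (J n) i" "i \<in> I" using Suc(2) JI[of n] by (auto simp: J0)
    then obtain j g where j: "j \<in> J n" "j \<noteq> i" "g \<in> mod_hom R (M j) (M i)"
      "compose (carrier (M j)) f g \<noteq> zero_hom (M j) K"
      using Suc(3,4) unfolding good_def by blast
    have jI: "j \<in> I" using j JI by auto
    have fg: "compose (carrier (M j)) f g \<in> mod_hom R (M j) K" by (rule mod_hom_compose[OF m[OF jI] j(3) Suc(3)])
    obtain l p where p: "path M I n l j p" "compose (carrier (M l)) (compose (carrier (M j)) f g) p \<noteq> zero_hom (M l) K"
      using Suc(1)[OF j(1) fg j(4)] by (elim exE conjE)
    have ph: "p \<in> mod_hom R (M l) (M j)" using path_hom[OF p(1) m] by blast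
    have "path M I (Suc n) l i (compose (carrier (M l)) g p)"
      by (rule path_target[OF p(1) i(3) j(3) niso[OF i(3) jI j(2)[symmetric] j(3)] m])
    moreover have "compose (carrier (M l)) f (compose (carrier (M l)) g p)
      = compose (carrier (M l)) (compose (carrier (M j)) f g) p"
      unfolding compose_def by (rule restrict_ext) (simp add: mod_hom_closed[OF ph])
    ultimately show ?case using p(2) by metis
  qed
  have "J N = {}"
  proof (rule ccontr)
    assume "J N \<noteq> {}"
    then obtain i where i: "i \<in> J N" by auto
    then obtain f where f: "f \<in> mod_hom R (M i) K" "f \<noteq> zero_hom (M i) K" using nz JI by blast
    then show False using chain[OF i f] bound by blast
  qed
  \<comment> \<open>Every index either survives n rounds or belongs to the layer of the round that
    removed it.\<close>
  have "I \<subseteq> J n \<union> (\<Union>k<n. {i \<in> J k. good (J k) i})" for n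
  proof (induct n)
    case (Suc n)
    then show ?case by (auto simp: J0 lessThan_Suc)
  qed (simp add: J0)
  from this[of N] have "infinite (\<Union>k<N. {i \<in> J k. good (J k) i})"
    using inf \<open>J N = {}\<close> by (metis Un_empty_left finite_subset)
  then obtain k where k: "infinite {i \<in> J k. good (J k) i}" by auto
  let ?I = "{i \<in> J k. good (J k) i}"
  have "\<exists>f\<in>mod_hom R (M i) K. f \<noteq> zero_hom (M i) K \<and>
      (\<forall>j\<in>?I. j \<noteq> i \<longrightarrow> (\<forall>g\<in>mod_hom R (M j) (M i). compose (carrier (M j)) f g = zero_hom (M j) K))"
    if "i \<in> ?I" for i
    using that unfolding good_def by blast
  then show ?thesis using k JI[of k] by (intro exI[of _ ?I]) blast
qed

theorem theorem3p3:
  fixes R :: "('a, 'r) ring_scheme"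
    and \<mm> :: "'a set"
    and \<omega> :: "('a, 'w) module"
    and G :: "('a, 'g) module"
    and \<alpha> :: "'g \<Rightarrow> 'a set"
    and I :: "'i set"
    and M :: "'i \<Rightarrow> ('a, 'm) module"
  assumes "cohen_macaulay_local_ring R \<mm>"
    and "adic_complete R \<mm>"
    and "canonical_module R \<mm> \<omega>"
    and "right_minimal_MCM_approximation R \<mm> G (residue_module R \<mm>) \<alpha>"
    and "infinite I"
    and "\<And>i. i \<in> I \<Longrightarrow> MCM R \<mm> (M i)"
    and "\<And>i. i \<in> I \<Longrightarrow> indecomposable_module R (M i)"
    and "\<And>i j. i \<in> I \<Longrightarrow> j \<in> I \<Longrightarrow> i \<noteq> j \<Longrightarrow> \<not> mod_iso R (M i) (M j)"
    and "\<exists>b::nat. \<forall>i\<in>I. h_length R G (M i) < enat b"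
  shows "\<exists>I'\<subseteq>I. infinite I' \<and>
           (\<forall>i\<in>I'. \<exists>f\<in>mod_hom R (M i) (residue_module R \<mm>).
              f \<noteq> zero_hom (M i) (residue_module R \<mm>) \<and>
              (\<forall>j\<in>I'. j \<noteq> i \<longrightarrow>
                 (\<forall>g\<in>mod_hom R (M j) (M i).
                    compose (carrier (M j)) f g = zero_hom (M j) (residue_module R \<mm>))))"
proof -
  interpret noeth_local R \<mm>
    using assms(1) unfolding cohen_macaulay_local_ring_def local_ring_def
    by (intro noeth_local.intro noeth_local_axioms.intro) auto
  let ?k = "residue_module R \<mm>"
  note k = residue_module
  obtain b where b0: "\<forall>i\<in>I. h_length R G (M i) < enat b" using assms(9) by (elim exE)
  \<comment> \<open>The bound will serve as an exponent, which has to be positive.\<close>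
  have b: "h_length R G (M i) < enat (Suc b)" if "i \<in> I" for i
    using b0 that less_trans[of _ "enat b" "enat (Suc b)"] by auto
  have fg: "fin_gen_module R (M i)" if "i \<in> I" for i using assms(6)[OF that] by (simp add: MCM_def)
  have m: "module R (M i)" if "i \<in> I" for i using fg[OF that] by (simp add: fin_gen_module_def)
  have loc: "local_module R \<mm> (M i)" if "i \<in> I" for i
    by (intro local_module.intro rmoduleI m[OF that] noeth_local_axioms)
  have cm: "complete_module R \<mm> (M i)" if "i \<in> I" for i
    by (intro complete_module.intro fg_local_module.intro fg_local_module_axioms.intro
        complete_module_axioms.intro loc[OF that] fg[OF that] assms(2))
  have G: "fin_gen_module R G" "\<alpha> \<in> mod_hom R G ?k"
    using assms(4) by (auto simp: right_minimal_MCM_approximation_def MCM_def)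
  \<comment> \<open>On the remaining modules every functional to R has values in \<mm>, as
    \<open>generators_bound\<close> requires.\<close>
  define I0 where "I0 = {i \<in> I. \<not> mod_iso R (M i) (self_module R)}"
  have I0: "I0 \<subseteq> I" by (auto simp: I0_def)
  have "i = j" if i: "i \<in> I - I0" and j: "j \<in> I - I0" for i j
  proof (rule ccontr)
    assume ij: "i \<noteq> j"
    have "mod_iso R (M i) (self_module R)" "mod_iso R (M j) (self_module R)" using i j by (auto simp: I0_def)
    then have "mod_iso R (M i) (M j)"
      using mod_iso_trans[OF m] mod_iso_sym[OF m self_module] i j by blast
    then show False using assms(8) i j ij by blast
  qed
  then have "I - I0 = {} \<or> (\<exists>i. I - I0 = {i})" by blast
  then have "finite (I - I0)" by (metis finite.emptyI finite.insertI)
  then have inf: "infinite I0" using assms(5) by (metis finite_Diff2)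
  have gens: "\<exists>T. finite T \<and> T \<subseteq> carrier (M i) \<and> mod_span R (M i) T = carrier (M i) \<and> card T \<le> Suc b"
    if i: "i \<in> I0" for i
  proof (rule generators_bound[OF fg G(1) b _ G(2)])
    show iI: "i \<in> I" "i \<in> I" using i I0 by auto
    fix \<phi> x assume "\<phi> \<in> mod_hom R (M i) (self_module R)" "x \<in> carrier (M i)"
    then show "\<phi> x \<in> \<mm>" using indecomposable_free[OF assms(7)[OF iI(1)]] i by (auto simp: I0_def)
  next
    fix \<beta> assume "\<beta> \<in> mod_hom R (M i) ?k"
    then show "\<exists>\<gamma>\<in>mod_hom R (M i) G. compose (carrier (M i)) \<alpha> \<gamma> = \<beta>"
      using approximation_lift[OF ring_axioms assms(4) assms(6)] i I0 by blast
  qed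
  \<comment> \<open>The type of a canonical module is read off in degree dim R, so its existence
    includes finite Krull dimension.\<close>
  obtain d where d: "krull_dim R = enat d"
    using assms(3) unfolding canonical_module_def type_one_def by blast
  obtain zs where zs: "length zs = d" "primary_list zs" by (rule exists_primary_list[OF d])
  \<comment> \<open>These powers lie in \<mm>^(b+1), so by \<open>stable_annihilator\<close> they
    act on every M i by maps of finite rank, and they still generate an \<mm>-primary ideal.\<close>
  define xs where "xs = map (\<lambda>z. z [^]\<^bsub>R\<^esub> Suc b) zs"
  have xs_primary: "primary_list xs" unfolding xs_def by (rule primary_list_pow[OF zs(2)]) simp
  interpret reduction R \<mm> xs by unfold_locales (use xs_primary in \<open>simp add: primary_list_def\<close>)
  have sq_primary: "primary_list sq" unfolding sq_def by (rule primary_list_pow[OF xs_primary]) simp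
  have "length sq = length xs" by (simp add: sq_def)
  then have "krull_dim R = enat (length sq)" by (simp add: d zs(1) xs_def)
  with sq_primary have sop: "system_of_parameters R \<mm> sq"
    by (rule primary_list_sop)
  have good: "liftable (M i) \<and> indecomposable_module R (M i)" if i: "i \<in> I0" for i
  proof
    have iI: "i \<in> I" using i I0 by auto
    show ind: "indecomposable_module R (M i)" by (rule assms(7)[OF iI])
    have "regular_sequence R (M i) sq"
      using assms(6)[OF iI] ind sop by (auto simp: MCM_def indecomposable_module_def)
    moreover have "(\<lambda>y\<in>carrier (M i). x \<odot>\<^bsub>M i\<^esub> y) \<in> rank_homs R (M i) (M i)" if x: "x \<in> set xs" for x
    proof (rule stable_annihilator[OF fg[OF iI] G(1) b[OF iI]])
      obtain z where "z \<in> set zs" "x = z [^]\<^bsub>R\<^esub> Suc b" using x by (auto simp: xs_def)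
      then show "x \<in> mpow (Suc b)" using pow_mpow[of z "Suc b"] zs(2) by (auto simp: primary_list_def)
    qed
    ultimately show "liftable (M i)" using cm[OF iI] by (simp add: liftable_def)
  qed
  \<comment> \<open>Hence \<mm>^n M \<subseteq> red M for every M in the family, and the length of M
    / red M is at most that of M / \<mm>^n M, for which \<open>chain_bound\<close> gives the same
    bound B throughout.\<close>
  obtain n where n: "mpow n \<subseteq> Idl\<^bsub>R\<^esub> (set sq)" using primary_list_mpow[OF sq_primary] by (elim exE)
  have "\<exists>A. finite A \<and> A \<subseteq> carrier R \<and> mpow i = Idl\<^bsub>R\<^esub> A" for i
    using finetely_gen[OF mpow_ideal, of i] by blast
  then obtain A where A: "\<And>i. finite (A i) \<and> A i \<subseteq> carrier R \<and> mpow i = Idl\<^bsub>R\<^esub> (A i)" by metis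
  define B where "B = (\<Sum>i<n. card (A i) * Suc b)"
  have bound: "\<not> sub_chain R (M i) (red (M i)) (Suc B) (carrier (M i))" if i: "i \<in> I0" for i
  proof
    have iI: "i \<in> I" using i I0 by auto
    interpret N: local_module R \<mm> "M i" by (rule loc[OF iI])
    assume "sub_chain R (M i) (red (M i)) (Suc B) (carrier (M i))"
    moreover have "filt (M i) n \<subseteq> red (M i)"
      unfolding filt_def red_def by (rule N.times_mono[OF n order_refl])
    ultimately have ch: "sub_chain R (M i) (filt (M i) n) (Suc B) (carrier (M i))"
      by (rule N.chain_mono[OF _ _ order_refl])
    obtain T where T: "finite T" "T \<subseteq> carrier (M i)" "mod_span R (M i) T = carrier (M i)" "card T \<le> Suc b"
      using gens[OF i] by (elim exE conjE)
    have "Suc B \<le> B" unfolding B_def[symmetric] using N.chain_bound[OF T A ch] by (simp add: B_def)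
    then show False by simp
  qed
  have "\<exists>I'\<subseteq>I0. infinite I' \<and>
           (\<forall>i\<in>I'. \<exists>f\<in>mod_hom R (M i) ?k. f \<noteq> zero_hom (M i) ?k \<and>
              (\<forall>j\<in>I'. j \<noteq> i \<longrightarrow>
                 (\<forall>g\<in>mod_hom R (M j) (M i). compose (carrier (M j)) f g = zero_hom (M j) ?k)))"
  proof (rule infinite_layer[OF _ k _ _ _ inf])
    fix i assume i: "i \<in> I0"
    then have iI: "i \<in> I" using I0 by auto
    show "module R (M i)" by (rule m[OF iI])
    interpret N: complete_module R \<mm> "M i" by (rule cm[OF iI])
    \<comment> \<open>If M = \<mm> M, then M = 0 by Nakayama's lemma; so some x is nonzero modulo
      \<mm> M, and a functional to k detects it.\<close>
    have "\<exists>x. x \<in> carrier (M i) \<and> x \<notin> filt (M i) 1"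
    proof (rule ccontr)
      assume "\<nexists>x. x \<in> carrier (M i) \<and> x \<notin> filt (M i) 1"
      then have "{\<zero>\<^bsub>M i\<^esub>} = carrier (M i)"
        using N.cong_zero_iff[OF N.filt_sub] by (intro N.nakayama_carrier[OF N.sub_zero_module]) blast
      then show False using assms(7)[OF iI] by (simp add: indecomposable_module_def is_zero_module_def)
    qed
    then obtain x where x: "x \<in> carrier (M i)" "x \<notin> filt (M i) 1" by (elim exE conjE)
    obtain f where f: "f \<in> mod_hom R (M i) ?k" "f x \<noteq> \<zero>\<^bsub>?k\<^esub>"
      using N.functional[OF N.filt_sub order_refl x] by metis
    then have "f \<noteq> zero_hom (M i) ?k" using x by (auto simp: zero_hom_def)
    then show "\<exists>f\<in>mod_hom R (M i) ?k. f \<noteq> zero_hom (M i) ?k" using f by blast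
  next
    fix i j g assume "i \<in> I0" "j \<in> I0" "i \<noteq> j" "g \<in> mod_hom R (M j) (M i)"
    then show "\<not> bij_betw g (carrier (M j)) (carrier (M i))"
      using assms(8)[of j i] I0 by (auto simp: mod_iso_def)
  next
    fix i j f p assume p: "path M I0 (2 ^ B - 1) j i p" and f: "f \<in> mod_hom R (M i) ?k"
    have ij: "i \<in> I" "j \<in> I" and ph: "p \<in> mod_hom R (M j) (M i)"
      using path_hom[OF p m] I0 by auto
    show "compose (carrier (M j)) f p = zero_hom (M j) ?k"
    proof (rule mod_hom_eqI[OF mod_hom_compose[OF m[OF ij(2)] ph f] mod_hom_zero_hom[OF m[OF ij(2)] k]])
      fix x assume x: "x \<in> carrier (M j)"
      have "p x \<in> filt (M i) 1" by (rule harada_sai_zero[OF good bound p x])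
      then show "compose (carrier (M j)) f p x = zero_hom (M j) ?k x"
        using residue_hom_kills[OF loc[OF ij(1)] f] x by (simp add: compose_def zero_hom_def)
    qed
  qed
  then show ?thesis using I0 by (meson order_trans)
qed

end
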